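(* Let $\Omega\subset\mathbb{C}^n$ be a bounded domain and let $\psi\ge 0$ be a continuous function on $\overline{\Omega}$. Let $\Gamma$, $f$, $F$ be as in the context. Let $u\in USC(\Omega)$. Then $u$ is a viscosity subsolution of the equation $F(Hw)=\psi(z)$ in $\Omega$ if and only if $u$ is $\Gamma$-subharmonic in $\Omega$ and, for every $\epsilon>0$, $$F(H(u\ast\chi_{\epsilon}))\geq \psi\ast\chi_{\epsilon}\quad\text{in }\Omega_{\epsilon}=\{z\in\Omega: d(z,\partial\Omega)>\epsilon\}$$ in the classical (pointwise) sense, where $\ast$ denotes convolution.
   Context: Cone and operator. For $1\le k\le n$ let $\sigma_k(x)=\sum_{1\le j_1<\dots<j_k\le n}x_{j_1}\cdots x_{j_k}$ and $\Gamma_k=\{x\in\mathbb{R}^n:\sigma_1(x)>0,\dots,\sigma_k(x)>0\}$. $\Gamma\subsetneq\mathbb{R}^n$ is an open, convex, symmetric (permutation invariant) cone with vertex at the origin with $\Gamma_n\subseteq\Gamma\subseteq\Gamma_1$. $f:\overline{\Gamma}\to[0,\infty)$ is continuous, symmetric, concave, strictly increasing in each variable on $\Gamma$, with $f>0$ on $\Gamma$ and $f=0$ on $\partial\Gamma$. $\mathcal{H}^n$ is the set of $n\times n$ Hermitian matrices, $\lambda(H)\in\mathbb{R}^n$ denotes the eigenvalues of $H$, $M(\Gamma,n)=\{H\in\mathcal{H}^n:\lambda(H)\in\Gamma\}$, and $F:\mathcal{H}^n\to[-\infty,\infty)$ is $F(H)=f(\lambda(H))$ if $H\in\overline{M(\Gamma,n)}$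 and $F(H)=-\infty$ otherwise. $Hu=\left(\frac{\partial^2u}{\partial z_\alpha\partial\overline{z_\beta}}\right)$ is the complex Hessian. Viscosity subsolutions. $USC(\Omega)$ is the set of upper semicontinuous functions $\Omega\to[-\infty,\infty)$, not identically $-\infty$. An upper test function for $u$ at $z_0$ is a $C^2$ function $q$ near $z_0$ with $u(z_0)=q(z_0)$ and $u\le q$ near $z_0$ (there are none if $u(z_0)=-\infty$). $u\in USC(\Omega)$ is a viscosity subsolution of $F(Hw)=\psi(z)$ in $\Omega$ (also written $F(Hu)\ge\psi$ in the viscosity sense) if $F(Hq(z_0))\ge\psi(z_0)$ for every $z_0\in\Omega$ and every upper test function $q$ for $u$ at $z_0$. $\Gamma$-subharmonicity. $u\in USC(\Omega)$ is $\Gamma$-subharmonic if it satisfies the following two conditions, which are known to be equivalent: (i) $F(Hu)\ge 0$ in the viscosity sense in $\Omega$; (ii) for every open $U\Subset\Omega$ there is a decreasing sequence $\{u_j\}$ of smooth functions on $U$ with $Hu_j(z)\in M(\Gamma,n)$ for all $z\in U$, such that $u_j\to u$ on $U$. $\chi_\epsilon(z)=\epsilon^{-2n}\chi(z/\epsilon)$ is the standard mollifier, with $\chi\ge0$ smooth, radial, supported in the closed unit ball and of integral 1. *)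

theory Defs
  imports "HOL-Analysis.Analysis"
begin

section \<open>Differentiability and the complex Hessian\<close>

text \<open>
  Only used for open \<open>S\<close>, where the derivative within \<open>S\<close> is the ordinary derivative.
\<close>

fun Ck_on :: "nat \<Rightarrow> ('a::real_normed_vector \<Rightarrow> 'b::real_normed_vector) \<Rightarrow> 'a set \<Rightarrow> bool" where
  "Ck_on 0 g S \<longleftrightarrow> continuous_on S g"
| "Ck_on (Suc k) g S \<longleftrightarrow>
     g differentiable_on S \<and> (\<forall>v. Ck_on k (\<lambda>x. frechet_derivative g (at x) v) S)"

definition smooth_on :: "('a::real_normed_vector \<Rightarrow> 'b::real_normed_vector) \<Rightarrow> 'a set \<Rightarrow> bool" where
  "smooth_on g S \<longleftrightarrow> (\<forall>k. Ck_on k g S)"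

text \<open>
  Wirtinger operators \<open>\<partial>/\<partial>z\<^sub>\<alpha> = (\<partial>/\<partial>x\<^sub>\<alpha> - i \<partial>/\<partial>y\<^sub>\<alpha>) / 2\<close> and
  \<open>\<partial>/\<partial>zbar\<^sub>\<beta> = (\<partial>/\<partial>x\<^sub>\<beta> + i \<partial>/\<partial>y\<^sub>\<beta>) / 2\<close>.
\<close>

definition dz :: "'n::finite \<Rightarrow> (complex ^ 'n \<Rightarrow> complex) \<Rightarrow> complex ^ 'n \<Rightarrow> complex" where
  "dz \<alpha> g z = (frechet_derivative g (at z) (axis \<alpha> 1)
                 - \<i> * frechet_derivative g (at z) (axis \<alpha> \<i>)) / 2"

definition dzbar :: "'n::finite \<Rightarrow> (complex ^ 'n \<Rightarrow> complex) \<Rightarrow> complex ^ 'n \<Rightarrow> complex" where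
  "dzbar \<beta> g z = (frechet_derivative g (at z) (axis \<beta> 1)
                    + \<i> * frechet_derivative g (at z) (axis \<beta> \<i>)) / 2"

definition cHess :: "(complex ^ 'n::finite \<Rightarrow> real) \<Rightarrow> complex ^ 'n \<Rightarrow> complex ^ 'n ^ 'n" where
  "cHess u z = (\<chi> \<alpha> \<beta>. dz \<alpha> (dzbar \<beta> (\<lambda>w. complex_of_real (u w))) z)"

section \<open>Eigenvalues of Hermitian matrices\<close>

definition hermitian :: "complex ^ 'n::finite ^ 'n \<Rightarrow> bool" where
  "hermitian H \<longleftrightarrow> (\<forall>\<alpha> \<beta>. H $ \<alpha> $ \<beta> = cnj (H $ \<beta> $ \<alpha>))"

text \<open>
  The eigenvalues of a Hermitian matrix, listed with multiplicity. The vector is determined up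
  to a permutation of its entries, so the arbitrary choice is invisible to symmetric sets and
  symmetric functions.
\<close>

definition eigvals :: "complex ^ 'n::finite ^ 'n \<Rightarrow> real ^ 'n" where
  "eigvals H = (SOME l. \<forall>t. det (mat t - H) = (\<Prod>i\<in>UNIV. (t - complex_of_real (l $ i))))"

section \<open>The cone, the function and the operator\<close>

definition sigma :: "nat \<Rightarrow> real ^ 'n::finite \<Rightarrow> real" where
  "sigma k x = (\<Sum>J | J \<subseteq> UNIV \<and> card J = k. \<Prod>j\<in>J. x $ j)"

definition Garding_cone :: "nat \<Rightarrow> (real ^ 'n::finite) set" where
  "Garding_cone k = {x. \<forall>j\<in>{1..k}. sigma j x > 0}"

definition permute_vec :: "('n \<Rightarrow> 'n) \<Rightarrow> real ^ 'n::finite \<Rightarrow> real ^ 'n" where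
  "permute_vec p x = (\<chi> i. x $ p i)"

text \<open>
  The library predicate \<^const>\<open>cone\<close> forces a nonempty cone to contain its vertex, which an open
  proper cone does not; hence only positive dilations.
\<close>

definition admissible_cone :: "(real ^ 'n::finite) set \<Rightarrow> bool" where
  "admissible_cone \<Gamma> \<longleftrightarrow>
     open \<Gamma> \<and> convex \<Gamma> \<and> \<Gamma> \<noteq> UNIV \<and>
     (\<forall>x\<in>\<Gamma>. \<forall>t>0. t *\<^sub>R x \<in> \<Gamma>) \<and>
     (\<forall>p. bij p \<longrightarrow> (\<forall>x\<in>\<Gamma>. permute_vec p x \<in> \<Gamma>)) \<and>
     Garding_cone CARD('n) \<subseteq> \<Gamma> \<and> \<Gamma> \<subseteq> Garding_cone 1"

definition admissible_fun :: "(real ^ 'n::finite) set \<Rightarrow> (real ^ 'n \<Rightarrow> real) \<Rightarrow> bool" where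
  "admissible_fun \<Gamma> f \<longleftrightarrow>
     (\<forall>x\<in>closure \<Gamma>. f x \<ge> 0) \<and>
     continuous_on (closure \<Gamma>) f \<and>
     (\<forall>p. bij p \<longrightarrow> (\<forall>x\<in>closure \<Gamma>. f (permute_vec p x) = f x)) \<and>
     concave_on (closure \<Gamma>) f \<and>
     (\<forall>x\<in>\<Gamma>. \<forall>i. \<forall>t>0. x + t *\<^sub>R axis i 1 \<in> \<Gamma> \<longrightarrow> f x < f (x + t *\<^sub>R axis i 1)) \<and>
     (\<forall>x\<in>\<Gamma>. f x > 0) \<and>
     (\<forall>x\<in>frontier \<Gamma>. f x = 0)"

definition M_cone :: "(real ^ 'n::finite) set \<Rightarrow> (complex ^ 'n ^ 'n) set" where
  "M_cone \<Gamma> = {H. hermitian H \<and> eigvals H \<in> \<Gamma>}"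

text \<open>
  The closure is taken among all complex matrices; this is the closure in the (closed) subspace
  of Hermitian matrices.
\<close>

definition F_op ::
  "(real ^ 'n::finite) set \<Rightarrow> (real ^ 'n \<Rightarrow> real) \<Rightarrow> complex ^ 'n ^ 'n \<Rightarrow> ereal" where
  "F_op \<Gamma> f H = (if H \<in> closure (M_cone \<Gamma>) then ereal (f (eigvals H)) else -\<infinity>)"

section \<open>Viscosity subsolutions and subharmonicity\<close>

definition USC :: "('a::topological_space) set \<Rightarrow> ('a \<Rightarrow> ereal) set" where
  "USC \<Omega> = {u. (\<forall>z\<in>\<Omega>. u z \<noteq> \<infinity>) \<and> (\<exists>z\<in>\<Omega>. u z \<noteq> -\<infinity>) \<and>
               (\<forall>c. openin (top_of_set \<Omega>) {z\<in>\<Omega>. u z < c})}"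

definition upper_test ::
  "(complex ^ 'n::finite) set \<Rightarrow> (complex ^ 'n \<Rightarrow> ereal) \<Rightarrow> complex ^ 'n
     \<Rightarrow> (complex ^ 'n \<Rightarrow> real) \<Rightarrow> bool" where
  "upper_test \<Omega> u z0 q \<longleftrightarrow>
     (\<exists>U. open U \<and> z0 \<in> U \<and> U \<subseteq> \<Omega> \<and> Ck_on 2 q U \<and>
          u z0 = ereal (q z0) \<and> (\<forall>z\<in>U. u z \<le> ereal (q z)))"

definition viscosity_subsolution ::
  "(real ^ 'n::finite) set \<Rightarrow> (real ^ 'n \<Rightarrow> real) \<Rightarrow> (complex ^ 'n) set
     \<Rightarrow> (complex ^ 'n \<Rightarrow> real) \<Rightarrow> (complex ^ 'n \<Rightarrow> ereal) \<Rightarrow> bool" where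
  "viscosity_subsolution \<Gamma> f \<Omega> \<psi> u \<longleftrightarrow>
     u \<in> USC \<Omega> \<and>
     (\<forall>z0\<in>\<Omega>. \<forall>q. upper_test \<Omega> u z0 q \<longrightarrow> F_op \<Gamma> f (cHess q z0) \<ge> ereal (\<psi> z0))"

definition Gamma_approximable ::
  "(real ^ 'n::finite) set \<Rightarrow> (complex ^ 'n) set \<Rightarrow> (complex ^ 'n \<Rightarrow> ereal) \<Rightarrow> bool" where
  "Gamma_approximable \<Gamma> \<Omega> u \<longleftrightarrow>
     (\<forall>U. open U \<and> compact (closure U) \<and> closure U \<subseteq> \<Omega> \<longrightarrow>
        (\<exists>v :: nat \<Rightarrow> complex ^ 'n \<Rightarrow> real.
           (\<forall>j. smooth_on (v j) U) \<and>
           (\<forall>j. \<forall>z\<in>U. cHess (v j) z \<in> M_cone \<Gamma>) \<and>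
           (\<forall>j. \<forall>z\<in>U. v (Suc j) z \<le> v j z) \<and>
           (\<forall>z\<in>U. (\<lambda>j. ereal (v j z)) \<longlonglongrightarrow> u z)))"

text \<open>
  The viscosity condition and the approximation condition are known to be equivalent; the
  definition asks for both.
\<close>

definition Gamma_subharmonic ::
  "(real ^ 'n::finite) set \<Rightarrow> (real ^ 'n \<Rightarrow> real) \<Rightarrow> (complex ^ 'n) set
     \<Rightarrow> (complex ^ 'n \<Rightarrow> ereal) \<Rightarrow> bool" where
  "Gamma_subharmonic \<Gamma> f \<Omega> u \<longleftrightarrow>
     u \<in> USC \<Omega> \<and> viscosity_subsolution \<Gamma> f \<Omega> (\<lambda>z. 0) u \<and> Gamma_approximable \<Gamma> \<Omega> u"

section \<open>Mollification\<close>

definition mollifier :: "(complex ^ 'n::finite \<Rightarrow> real) \<Rightarrow> bool" where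
  "mollifier \<eta> \<longleftrightarrow>
     smooth_on \<eta> UNIV \<and> (\<forall>z. \<eta> z \<ge> 0) \<and>
     (\<forall>z w. norm z = norm w \<longrightarrow> \<eta> z = \<eta> w) \<and>
     (\<forall>z. norm z > 1 \<longrightarrow> \<eta> z = 0) \<and>
     (\<eta> has_integral 1) UNIV"

definition rescaled :: "(complex ^ 'n::finite \<Rightarrow> real) \<Rightarrow> real \<Rightarrow> complex ^ 'n \<Rightarrow> real" where
  "rescaled \<eta> \<epsilon> z = \<eta> ((1 / \<epsilon>) *\<^sub>R z) / \<epsilon> ^ (2 * CARD('n))"

text \<open>
  Convolution of a function living on \<open>\<Omega>\<close> with a kernel \<open>k\<close>; it is evaluated only at points \<open>z\<close>
  for which \<open>w \<mapsto> k (z - w)\<close> is supported in \<open>\<Omega>\<close>.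
\<close>

definition conv ::
  "(complex ^ 'n::finite) set \<Rightarrow> (complex ^ 'n \<Rightarrow> real) \<Rightarrow> (complex ^ 'n \<Rightarrow> real)
     \<Rightarrow> complex ^ 'n \<Rightarrow> real" where
  "conv \<Omega> g k z = (LINT w:\<Omega>|lborel. g w * k (z - w))"

text \<open>
  A subharmonic function on a domain that is not identically \<open>-\<infinity>\<close> is locally integrable, so
  its \<open>-\<infinity>\<close> set is null and the value that \<^const>\<open>real_of_ereal\<close> assigns there is irrelevant.
\<close>

definition conv_ereal ::
  "(complex ^ 'n::finite) set \<Rightarrow> (complex ^ 'n \<Rightarrow> ereal) \<Rightarrow> (complex ^ 'n \<Rightarrow> real)
     \<Rightarrow> complex ^ 'n \<Rightarrow> real" where
  "conv_ereal \<Omega> u k = conv \<Omega> (\<lambda>w. real_of_ereal (u w)) k"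

definition inner_domain :: "(complex ^ 'n::finite) set \<Rightarrow> real \<Rightarrow> (complex ^ 'n) set" where
  "inner_domain \<Omega> \<epsilon> = {z\<in>\<Omega>. infdist z (frontier \<Omega>) > \<epsilon>}"

definition classical_subsolution ::
  "(real ^ 'n::finite) set \<Rightarrow> (real ^ 'n \<Rightarrow> real) \<Rightarrow> (complex ^ 'n) set
     \<Rightarrow> (complex ^ 'n \<Rightarrow> real) \<Rightarrow> (complex ^ 'n \<Rightarrow> real) \<Rightarrow> bool" where
  "classical_subsolution \<Gamma> f W g v \<longleftrightarrow>
     Ck_on 2 v W \<and> (\<forall>z\<in>W. F_op \<Gamma> f (cHess v z) \<ge> ereal (g z))"

end

theory Submission
  imports Defs "HOL-Probability.Distributions" "HOL-Combinatorics.Permutations" "HOL-Computational_Algebra.Polynomial"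
begin

text \<open>
  The nonlinear inequality is a family of linear ones. A concave \<open>f\<close> is the infimum of its affine
  majorants \<open>x \<mapsto> a \<bullet> x + b\<close>, and since the closed cone contains the positive orthant and lies in a
  half-space on which the coordinate sum is nonnegative, majorants with all \<open>a\<^sub>i > 0\<close> suffice. For a
  Hermitian \<open>H\<close> the weighted diagonal sums \<open>\<Sum>\<^sub>i a\<^sub>i \<langle>H \<xi>\<^sub>i, \<xi>\<^sub>i\<rangle>\<close> over unitary frames \<open>\<xi>\<close> are smallest when
  \<open>\<xi>\<close> is a suitably ordered eigenframe, because the diagonal in any other frame is a doubly stochastic
  average of the eigenvalues. Hence \<open>F(H) \<ge> c\<close> says exactly that \<open>\<Sum>\<^sub>i a\<^sub>i \<langle>H \<xi>\<^sub>i, \<xi>\<^sub>i\<rangle> + b \<ge> c\<close> for every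
  majorant and every frame (\<open>F_op_ge_iff\<close>), and membership of \<open>H\<close> in the closed cone is part of this. For
  the complex Hessian of \<open>q\<close> the left side is \<open>L q + b\<close>, where \<open>L\<close> is an elliptic operator with constant
  coefficients, diagonal in a real orthonormal basis (\<open>frame_operator\<close>).

  A viscosity subsolution of a linear equation \<open>L u \<ge> m\<close> satisfies a submean inequality
  \<open>u \<le> k\<^sub>t * u - m t\<close> (\<open>gaussian_submean\<close>). Here \<open>k\<^sub>t\<close> is the Gaussian heat kernel of \<open>L\<close>, cut down to
  compact support by subtracting its value on a level set. The proof is a parabolic comparison: a
  Gaussian average of a continuous majorant of \<open>u\<close>, corrected by that level value, is a supersolution
  of the heat equation which lies above \<open>u\<close> at the initial time and on the lateral boundary of a
  cylinder, so that a positive maximum of the difference would produce an upper test function violating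
  the viscosity inequality (\<open>heat_comparison\<close>). On a connected domain the submean inequality makes \<open>u\<close>
  locally integrable. Integrated against a smooth kernel \<open>\<theta> \<ge> 0\<close> and divided by \<open>t\<close>, it gives
  \<open>L (u * \<theta>) \<ge> g * \<theta>\<close> whenever \<open>L u \<ge> g\<close> in the viscosity sense, since \<open>(k\<^sub>t * \<theta> - \<theta>) / t\<close> converges
  to \<open>L \<theta>\<close>. Taking all the linear inequalities together, \<open>F (H (u * \<theta>)) \<ge> \<psi> * \<theta>\<close> for every smooth kernel
  \<open>\<theta>\<close> of mass at most one (\<open>mollified_F_op_ge\<close>). For \<open>\<theta> = \<chi>\<^sub>\<epsilon>\<close> this is the classical inequality of the
  theorem.

  The decreasing smooth approximation comes from the same inequality with the kernel \<open>k\<^sub>t * \<chi>\<^sub>\<delta>\<close>: up to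
  small constants, \<open>u * k\<^sub>t * \<chi>\<^sub>\<delta>\<close> lies above \<open>u\<close> by the submean inequality and below any prescribed
  continuous strict majorant of \<open>u\<close>. Adding a small multiple of \<open>|z|\<^sup>2\<close> moves its Hessian into the open
  cone, and a decreasing sequence is built by putting each new function below the previous one
  (\<open>decreasing_approx_by_interlacing\<close>).

  Conversely, let \<open>q\<close> touch \<open>u\<close> from above at \<open>z\<^sub>0\<close> and suppose that one of the linear inequalities fails
  for \<open>q\<close> there. Put \<open>p = q + \<gamma> |z - z\<^sub>0|\<^sup>2\<close> with small \<open>\<gamma>\<close>. The mollifications \<open>u\<^sub>\<epsilon>\<close> satisfy \<open>L u\<^sub>\<epsilon> > L p\<close>
  near \<open>z\<^sub>0\<close>, so \<open>u\<^sub>\<epsilon> - p\<close> has no local maximum there, while on a small sphere it is at most some \<open>-\<nu> < 0\<close>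
  that does not depend on \<open>\<epsilon>\<close>. Hence \<open>u\<^sub>\<epsilon> \<le> p - \<nu>\<close> inside. As \<open>\<epsilon>\<close> tends to \<open>0\<close>, this bounds the Gaussian
  averages of \<open>u\<close> around \<open>z\<^sub>0\<close> by about \<open>p(z\<^sub>0) - \<nu> = u(z\<^sub>0) - \<nu>\<close>, which contradicts the submean inequality
  at \<open>z\<^sub>0\<close> (\<open>mollified_subsolution_imp_viscosity\<close>).
\<close>

section \<open>Calculus of functions of class \<open>C\<^sup>k\<close>\<close>

lemma frechet_derivative_cong_open:
  assumes "open S" "x \<in> S" "\<And>y. y \<in> S \<Longrightarrow> f y = g y"
  shows "frechet_derivative f (at x) = frechet_derivative g (at x)"
proof -
  have "(f has_derivative D) (at x) \<longleftrightarrow> (g has_derivative D) (at x)" for D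
    using assms has_derivative_transform_within_open by metis
  then show ?thesis by (simp add: frechet_derivative_def)
qed

lemma Ck_on_cong:
  assumes "open S" "\<And>y. y \<in> S \<Longrightarrow> f y = g y" "Ck_on k f S"
  shows "Ck_on k g S"
  using assms(2,3)
proof (induction k arbitrary: f g)
  case 0
  then show ?case using continuous_on_eq[of S f g] by simp
next
  case (Suc k)
  have "f differentiable at x" if "x \<in> S" for x
    using Suc.prems(2) that assms(1) by (simp add: differentiable_on_eq_differentiable_at)
  then have "g differentiable at x" if "x \<in> S" for x
    using has_derivative_transform_within_open[of f _ x UNIV S g, OF _ assms(1) that Suc.prems(1)] that
    unfolding differentiable_def by blast
  then have "g differentiable_on S"
    using assms(1) by (simp add: differentiable_on_eq_differentiable_at)
  moreover have "Ck_on k (\<lambda>x. frechet_derivative g (at x) v) S" for v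
    using Suc.IH[of "\<lambda>x. frechet_derivative f (at x) v" "\<lambda>x. frechet_derivative g (at x) v"] Suc.prems
      frechet_derivative_cong_open[OF assms(1), of _ f g] by simp
  ultimately show ?case by simp
qed

lemma Ck_on_subset: "Ck_on k f S \<Longrightarrow> T \<subseteq> S \<Longrightarrow> Ck_on k f T"
  by (induction k arbitrary: f) (auto intro: continuous_on_subset differentiable_on_subset)

text \<open>
  The recursive definition of \<open>C\<^sup>k\<close> functions asks about \<open>frechet_derivative\<close>; this rule lets the derivative
  be supplied explicitly instead.
\<close>

lemma Ck_on_SucI:
  assumes "open S" "\<And>x. x \<in> S \<Longrightarrow> (f has_derivative f' x) (at x)" "\<And>v. Ck_on k (\<lambda>x. f' x v) S"
  shows "Ck_on (Suc k) f S"
proof -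
  have "frechet_derivative f (at x) v = f' x v" if "x \<in> S" for x v
    using frechet_derivative_at[OF assms(2)[OF that]] by simp
  then have "Ck_on k (\<lambda>x. frechet_derivative f (at x) v) S" for v
    using Ck_on_cong[OF assms(1) _ assms(3)[of v]] by simp
  moreover have "f differentiable_on S"
    using assms(2) by (auto simp: differentiable_on_def differentiable_def intro: has_derivative_at_withinI)
  ultimately show ?thesis by simp
qed

lemma Ck_on_Suc_has_derivative:
  assumes "Ck_on (Suc k) f S" "open S" "x \<in> S"
  shows "(f has_derivative frechet_derivative f (at x)) (at x)"
  using assms by (simp add: differentiable_on_eq_differentiable_at frechet_derivative_works[symmetric])

lemma Ck_on_SucD: "Ck_on (Suc k) f S \<Longrightarrow> Ck_on k f S"
  by (induction k arbitrary: f) (auto intro: differentiable_imp_continuous_on)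

lemma Ck_on_le: "Ck_on m f S \<Longrightarrow> k \<le> m \<Longrightarrow> Ck_on k f S"
proof (induction m)
  case (Suc m)
  then show ?case using Ck_on_SucD le_Suc_eq by blast
qed simp

lemma Ck_on_continuous: "Ck_on k f S \<Longrightarrow> continuous_on S f"
  using Ck_on_le[of k f S 0] by simp

lemma Ck_on_const: "open S \<Longrightarrow> Ck_on k (\<lambda>x. c) S"
  by (induction k arbitrary: c) (auto simp: frechet_derivative_const)

lemma Ck_on_add:
  assumes "open S" "Ck_on k f S" "Ck_on k g S"
  shows "Ck_on k (\<lambda>x. f x + g x) S"
  using assms(2,3)
proof (induction k arbitrary: f g)
  case 0 then show ?case by (auto intro: continuous_intros)
next
  case (Suc k)
  show ?case
  proof (rule Ck_on_SucI[OF assms(1)])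
    show "((\<lambda>x. f x + g x) has_derivative
       (\<lambda>v. frechet_derivative f (at x) v + frechet_derivative g (at x) v)) (at x)" if "x \<in> S" for x
      by (intro has_derivative_add Ck_on_Suc_has_derivative[OF Suc.prems(1) assms(1) that]
          Ck_on_Suc_has_derivative[OF Suc.prems(2) assms(1) that])
    show "Ck_on k (\<lambda>x. frechet_derivative f (at x) v + frechet_derivative g (at x) v) S" for v
      using Suc by simp
  qed
qed

lemma Ck_on_bounded_linear:
  assumes "bounded_linear L" "open S" "Ck_on k f S"
  shows "Ck_on k (\<lambda>x. L (f x)) S"
  using assms(3)
proof (induction k arbitrary: f)
  case 0 then show ?case using assms bounded_linear.continuous_on by auto
next
  case (Suc k)
  show ?case
  proof (rule Ck_on_SucI[OF assms(2)])
    show "((\<lambda>x. L (f x)) has_derivative (\<lambda>v. L (frechet_derivative f (at x) v))) (at x)" if "x \<in> S" for x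
      by (rule bounded_linear.has_derivative[OF assms(1) Ck_on_Suc_has_derivative[OF Suc.prems assms(2) that]])
    show "Ck_on k (\<lambda>x. L (frechet_derivative f (at x) v)) S" for v
      using Suc by simp
  qed
qed

lemma Ck_on_linear_fun:
  assumes "bounded_linear f" "open S" shows "Ck_on k f S"
proof (cases k)
  case 0
  then show ?thesis using assms by (simp add: linear_continuous_on)
next
  case (Suc m)
  have "Ck_on (Suc m) f S"
    by (rule Ck_on_SucI[OF assms(2), where f' = "\<lambda>x. f"])
      (auto intro: bounded_linear_imp_has_derivative assms Ck_on_const)
  then show ?thesis using Suc by simp
qed

lemma Ck_on_norm_sq:
  assumes "open S" shows "Ck_on k (\<lambda>x::'a::real_inner. (norm (x - a))\<^sup>2) S"
proof -
  have "Ck_on (Suc m) (\<lambda>x::'a. (norm (x - a))\<^sup>2) S" for m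
  proof (rule Ck_on_SucI[OF assms, where f' = "\<lambda>x v. 2 * (v \<bullet> x) - 2 * (v \<bullet> a)"])
    show "((\<lambda>x. (norm (x - a))\<^sup>2) has_derivative (\<lambda>v. 2 * (v \<bullet> x) - 2 * (v \<bullet> a))) (at x)" for x
      unfolding power2_norm_eq_inner
      by (auto intro!: derivative_eq_intros simp: algebra_simps inner_commute)
    have "Ck_on m (\<lambda>x. (2 * (v \<bullet> x)) + (- 2 * (v \<bullet> a))) S" for v
      by (intro Ck_on_add Ck_on_const assms Ck_on_linear_fun)
        (auto intro!: bounded_linear_intros)
    then show "Ck_on m (\<lambda>x. 2 * (v \<bullet> x) - 2 * (v \<bullet> a)) S" for v by simp
  qed
  then show ?thesis using Ck_on_SucD by blast
qed

definition second_deriv :: "('a::real_normed_vector \<Rightarrow> 'b::real_normed_vector) \<Rightarrow> 'a \<Rightarrow> 'a \<Rightarrow> 'a \<Rightarrow> 'b" where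
  "second_deriv f z v w = frechet_derivative (\<lambda>x. frechet_derivative f (at x) v) (at z) w"

lemma second_deriv_cong_open:
  assumes "open S" "z \<in> S" "\<And>y. y \<in> S \<Longrightarrow> f y = g y"
  shows "second_deriv f z v w = second_deriv g z v w"
proof -
  have "frechet_derivative f (at x) v = frechet_derivative g (at x) v" if "x \<in> S" for x
    using frechet_derivative_cong_open[OF assms(1) that assms(3)] by simp
  from frechet_derivative_cong_open[OF assms(1,2) this]
  show ?thesis by (simp add: second_deriv_def)
qed

lemma C2_D1:
  assumes "Ck_on 2 f S" "open S" "x \<in> S"
  shows "(f has_derivative frechet_derivative f (at x)) (at x)"
  using Ck_on_Suc_has_derivative[of 1 f S x] assms by (simp add: numeral_2_eq_2)

lemma C2_D2:
  assumes "Ck_on 2 f S" "open S" "x \<in> S"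
  shows "((\<lambda>x. frechet_derivative f (at x) v) has_derivative second_deriv f x v) (at x)"
proof -
  have "Ck_on (Suc 0) (\<lambda>x. frechet_derivative f (at x) v) S"
    using assms(1) by (simp add: numeral_2_eq_2)
  from Ck_on_Suc_has_derivative[OF this assms(2,3)]
  show ?thesis unfolding second_deriv_def[abs_def] by simp
qed

lemma C2_continuous_second_deriv:
  assumes "Ck_on 2 f S" shows "continuous_on S (\<lambda>x. second_deriv f x v w)"
  using assms by (simp add: numeral_2_eq_2 second_deriv_def)

lemma second_deriv_eqI:
  assumes "open S" "z \<in> S" "\<And>x. x \<in> S \<Longrightarrow> (f has_derivative f' x) (at x)"
    "((\<lambda>x. f' x v) has_derivative f'') (at z)"
  shows "second_deriv f z v w = f'' w"
proof -
  have "frechet_derivative f (at x) v = f' x v" if "x \<in> S" for x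
    using frechet_derivative_at[OF assms(3)[OF that]] by simp
  from frechet_derivative_cong_open[OF assms(1,2) this]
  show ?thesis using frechet_derivative_at[OF assms(4)] by (simp add: second_deriv_def)
qed

lemma second_deriv_add:
  assumes "Ck_on 2 f S" "Ck_on 2 g S" "open S" "z \<in> S"
  shows "second_deriv (\<lambda>x. f x + g x) z v w = second_deriv f z v w + second_deriv g z v w"
  by (rule second_deriv_eqI[OF assms(3,4)
        has_derivative_add[OF C2_D1[OF assms(1,3)] C2_D1[OF assms(2,3)]]
        has_derivative_add[OF C2_D2[OF assms(1,3,4)] C2_D2[OF assms(2,3,4)]]])

lemma second_deriv_const: "second_deriv (\<lambda>x. c) z v w = 0"
  by (simp add: second_deriv_def frechet_derivative_const)

lemma second_deriv_linear1:
  assumes "Ck_on 2 f S" "open S" "z \<in> S"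
  shows "second_deriv f z (a *\<^sub>R v + b *\<^sub>R v') w = a *\<^sub>R second_deriv f z v w + b *\<^sub>R second_deriv f z v' w"
proof -
  have "((\<lambda>x. a *\<^sub>R frechet_derivative f (at x) v + b *\<^sub>R frechet_derivative f (at x) v')
      has_derivative (\<lambda>w. a *\<^sub>R second_deriv f z v w + b *\<^sub>R second_deriv f z v' w)) (at z)"
    by (intro has_derivative_add has_derivative_scaleR_right C2_D2[OF assms])
  moreover have "frechet_derivative f (at x) (a *\<^sub>R v + b *\<^sub>R v') =
      a *\<^sub>R frechet_derivative f (at x) v + b *\<^sub>R frechet_derivative f (at x) v'" if "x \<in> S" for x
    using has_derivative_linear[OF C2_D1[OF assms(1,2) that]] by (simp add: linear_add linear_scale)
  ultimately have "((\<lambda>x. frechet_derivative f (at x) (a *\<^sub>R v + b *\<^sub>R v'))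
      has_derivative (\<lambda>w. a *\<^sub>R second_deriv f z v w + b *\<^sub>R second_deriv f z v' w)) (at z)"
    using has_derivative_transform_within_open[OF _ assms(2,3)] by (metis (no_types, lifting))
  from frechet_derivative_at[OF this, symmetric] show ?thesis
    unfolding second_deriv_def by simp
qed

lemma second_deriv_linear2:
  assumes "Ck_on 2 f S" "open S" "z \<in> S"
  shows "linear (second_deriv f z v)"
  using has_derivative_linear[OF C2_D2[OF assms]] .

lemma second_deriv_bilinear:
  assumes "Ck_on 2 f S" "open S" "z \<in> S"
  shows "bilinear (second_deriv f z)"
  unfolding bilinear_def
proof (intro conjI allI)
  show "linear (second_deriv f z v)" for v using second_deriv_linear2[OF assms] .
  show "linear (\<lambda>v. second_deriv f z v w)" for w
    using second_deriv_linear1[OF assms, of 1 _ 1 _ w] second_deriv_linear1[OF assms, of _ _ 0 _ w]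
    by (intro linearI) auto
qed

lemma second_deriv_norm_sq:
  "second_deriv (\<lambda>x::'a::real_inner. (norm (x - a))\<^sup>2) z v w = 2 * (v \<bullet> w)"
proof (rule second_deriv_eqI[OF open_UNIV UNIV_I, where f' = "\<lambda>x v. 2 * (v \<bullet> x) - 2 * (v \<bullet> a)"])
  show "((\<lambda>x. (norm (x - a))\<^sup>2) has_derivative (\<lambda>v. 2 * (v \<bullet> x) - 2 * (v \<bullet> a))) (at x)" for x
    unfolding power2_norm_eq_inner
    by (auto intro!: derivative_eq_intros simp: algebra_simps inner_commute)
  show "((\<lambda>x. 2 * (v \<bullet> x) - 2 * (v \<bullet> a)) has_derivative (\<lambda>w. 2 * (v \<bullet> w))) (at z)"
    by (auto intro!: derivative_eq_intros)
qed

lemma second_deriv_scale: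
  fixes f :: "'a::real_normed_vector \<Rightarrow> real"
  assumes "Ck_on 2 f S" "open S" "z \<in> S"
  shows "second_deriv (\<lambda>x. c * f x) z v w = c * second_deriv f z v w"
  by (rule second_deriv_eqI[OF assms(2,3)
        has_derivative_mult_right[OF C2_D1[OF assms(1,2)]]
        has_derivative_mult_right[OF C2_D2[OF assms]]])

lemma line_deriv:
  fixes f :: "'a::real_normed_vector \<Rightarrow> real"
  assumes "(f has_derivative D) (at (z + t *\<^sub>R b))"
  shows "((\<lambda>t. f (z + t *\<^sub>R b)) has_real_derivative D b) (at t)"
proof -
  have "((\<lambda>t. z + t *\<^sub>R b) has_derivative (\<lambda>s. s *\<^sub>R b)) (at t)"
    by (auto intro!: derivative_eq_intros)
  from has_derivative_compose[OF this assms]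
  have "((\<lambda>t. f (z + t *\<^sub>R b)) has_derivative (\<lambda>s. D (s *\<^sub>R b))) (at t)" .
  moreover have "(\<lambda>s. D (s *\<^sub>R b)) = (\<lambda>s. D b * s)"
    using has_derivative_linear[OF assms] by (auto simp: linear_scale)
  ultimately show ?thesis by (simp add: has_field_derivative_def)
qed

text \<open>
  Restrict to the line through \<open>z\<close> in direction \<open>b\<close>: a positive second derivative would make the first
  derivative, which vanishes at the maximum, positive immediately afterwards.
\<close>

lemma second_deriv_local_max:
  fixes f :: "'a::real_normed_vector \<Rightarrow> real"
  assumes "Ck_on 2 f S" "open S" "z \<in> S" "\<And>x. x \<in> S \<Longrightarrow> f x \<le> f z"
  shows "second_deriv f z b b \<le> 0"
proof (rule ccontr)
  assume pos: "\<not> second_deriv f z b b \<le> 0"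
  define g where "g t = f (z + t *\<^sub>R b)" for t
  define h where "h t = frechet_derivative f (at (z + t *\<^sub>R b)) b" for t
  have "open ((\<lambda>t. z + t *\<^sub>R b) -` S)"
    by (rule open_vimage[OF assms(2)]) (intro continuous_intros)
  moreover have "0 \<in> (\<lambda>t. z + t *\<^sub>R b) -` S" using assms by simp
  ultimately obtain e where e: "e > 0" "\<And>t. \<bar>t\<bar> < e \<Longrightarrow> z + t *\<^sub>R b \<in> S"
    unfolding open_contains_ball
    by (metis (no_types, lifting) dist_real_def dist_commute diff_0_right mem_ball subset_iff vimage_eq)
  have g': "(g has_real_derivative h t) (at t)" if "\<bar>t\<bar> < e" for t
    unfolding g_def h_def by (rule line_deriv[OF C2_D1[OF assms(1,2) e(2)[OF that]]])
  have h': "(h has_real_derivative second_deriv f z b b) (at 0)"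
    unfolding h_def by (rule line_deriv) (use C2_D2[OF assms(1-3)] in simp)
  have "h 0 = 0"
  proof (rule DERIV_local_max[OF g'[of 0] e(1)])
    show "\<forall>y. \<bar>0 - y\<bar> < e \<longrightarrow> g y \<le> g 0" using e(2) assms(4) by (simp add: g_def)
  qed (use e in simp)
  obtain d where d: "d > 0" "\<And>s. 0 < s \<Longrightarrow> s < d \<Longrightarrow> h 0 < h s"
    using DERIV_pos_inc_right[OF h'] pos by auto
  define s where "s = min d e / 2"
  have s: "0 < s" "s < d" "s < e" using d e by (auto simp: s_def)
  have "g 0 < g s"
  proof (rule DERIV_pos_imp_increasing_open[OF s(1)])
    fix x assume x: "0 < x" "x < s"
    then show "\<exists>y. (g has_real_derivative y) (at x) \<and> y > 0"
      using g'[of x] d(2)[of x] s \<open>h 0 = 0\<close> by (intro exI[of _ "h x"]) auto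
  next
    show "continuous_on {0..s} g"
      by (intro DERIV_continuous_on[where D=h] DERIV_subset[OF g']) (use s in auto)
  qed
  moreover have "g s \<le> g 0" using assms(4)[OF e(2), of s] s by (simp add: g_def)
  ultimately show False by simp
qed

lemma second_deriv_symmetric:
  fixes f :: "'a::real_normed_vector \<Rightarrow> real"
  assumes "Ck_on 2 f S" "open S" "z \<in> S"
  shows "second_deriv f z v w = second_deriv f z w v"
proof -
  \<comment> \<open>The second difference over the parallelogram spanned by \<open>h v\<close> and \<open>h w\<close> does not distinguish
    \<open>v\<close> from \<open>w\<close>, and two mean value theorems turn it into a second derivative at a nearby point.\<close>
  have key: "\<exists>s t. \<bar>s\<bar> \<le> h \<and> \<bar>t\<bar> \<le> h \<and>
      f (z + h *\<^sub>R v + h *\<^sub>R w) - f (z + h *\<^sub>R v) - f (z + h *\<^sub>R w) + f z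
        = h\<^sup>2 * second_deriv f (z + s *\<^sub>R v + t *\<^sub>R w) v w"
    if h: "h > 0" and box: "\<And>s t. \<bar>s\<bar> \<le> h \<Longrightarrow> \<bar>t\<bar> \<le> h \<Longrightarrow> z + s *\<^sub>R v + t *\<^sub>R w \<in> S" for h v w
  proof -
    define G where "G s = f ((z + h *\<^sub>R w) + s *\<^sub>R v) - f (z + s *\<^sub>R v)" for s
    define G' where "G' s = frechet_derivative f (at ((z + h *\<^sub>R w) + s *\<^sub>R v)) v - frechet_derivative f (at (z + s *\<^sub>R v)) v" for s
    have "(G has_real_derivative G' s) (at s)" if "0 \<le> s" "s \<le> h" for s
      unfolding G_def G'_def
      by (intro DERIV_diff line_deriv C2_D1[OF assms(1,2)])
        (use box[of s h] box[of s 0] that h in \<open>auto simp: algebra_simps\<close>)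
    from MVT2[OF h this] obtain s where s: "0 < s" "s < h" "G h - G 0 = h * G' s" by auto
    define K where "K t = frechet_derivative f (at ((z + s *\<^sub>R v) + t *\<^sub>R w)) v" for t
    have "(K has_real_derivative second_deriv f ((z + s *\<^sub>R v) + t *\<^sub>R w) v w) (at t)" if "0 \<le> t" "t \<le> h" for t
      unfolding K_def
      by (intro line_deriv C2_D2[OF assms(1,2)]) (use box[of s t] that h s in \<open>auto simp: algebra_simps\<close>)
    from MVT2[OF h this] obtain t where t: "0 < t" "t < h"
      "K h - K 0 = h * second_deriv f ((z + s *\<^sub>R v) + t *\<^sub>R w) v w" by auto
    have "G' s = K h - K 0" by (simp add: G'_def K_def algebra_simps)
    then have "G h - G 0 = h\<^sup>2 * second_deriv f (z + s *\<^sub>R v + t *\<^sub>R w) v w"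
      using s t by (simp add: power2_eq_square)
    moreover have "G h - G 0 = f (z + h *\<^sub>R v + h *\<^sub>R w) - f (z + h *\<^sub>R v) - f (z + h *\<^sub>R w) + f z"
      by (simp add: G_def algebra_simps)
    ultimately show ?thesis using s t by (intro exI[of _ s] exI[of _ t]) auto
  qed
  have close: "\<bar>second_deriv f z v w - second_deriv f z w v\<bar> \<le> e" if "e > 0" for e
  proof -
    have lim: "((\<lambda>x. second_deriv f x a b) \<longlongrightarrow> second_deriv f z a b) (at z)" for a b
      using C2_continuous_second_deriv[OF assms(1), of a b] assms(2,3)
      by (simp add: continuous_on_eq_continuous_at isCont_def)
    have ev: "\<forall>\<^sub>F x in nhds z. \<bar>second_deriv f x a b - second_deriv f z a b\<bar> < e/2" for a b
      using lim[of a b] that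
      by (auto simp: eventually_nhds_conv_at dest!: tendstoD[of _ _ _ "e/2"] simp: dist_real_def)
    have "\<forall>\<^sub>F x in nhds z. \<bar>second_deriv f x v w - second_deriv f z v w\<bar> < e/2 \<and>
       \<bar>second_deriv f x w v - second_deriv f z w v\<bar> < e/2 \<and> x \<in> S"
      using ev[of v w] ev[of w v] eventually_nhds_in_open[OF assms(2,3)] by eventually_elim auto
    then obtain d where d: "d > 0" and dd: "\<And>x. dist x z < d \<Longrightarrow>
       \<bar>second_deriv f x v w - second_deriv f z v w\<bar> < e/2 \<and>
       \<bar>second_deriv f x w v - second_deriv f z w v\<bar> < e/2 \<and> x \<in> S"
      unfolding eventually_nhds_metric by auto
    define h where "h = d / (2 * (norm v + norm w + 1))"
    have h: "h > 0" using d by (auto simp: h_def intro!: divide_pos_pos add_nonneg_pos)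
    have near: "dist (z + s *\<^sub>R v + t *\<^sub>R w) z < d" "dist (z + t *\<^sub>R w + s *\<^sub>R v) z < d"
      if "\<bar>s\<bar> \<le> h" "\<bar>t\<bar> \<le> h" for s t
    proof -
      have "norm (s *\<^sub>R v + t *\<^sub>R w) \<le> h * norm v + h * norm w"
        using norm_triangle_ineq[of "s *\<^sub>R v" "t *\<^sub>R w"] mult_right_mono[OF that(1), of "norm v"]
          mult_right_mono[OF that(2), of "norm w"] by simp
      also have "\<dots> \<le> h * (norm v + norm w + 1)" using h by (simp add: algebra_simps)
      also have "\<dots> = d / 2"
      proof -
        have "norm v + norm w + 1 > 0" by (smt (verit) norm_ge_zero)
        then have "h * (norm v + norm w + 1) * 2 = d" unfolding h_def
          by (metis (no_types) mult.assoc mult.commute nonzero_eq_divide_eq less_irrefl mult_pos_pos zero_less_numeral)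
        then show ?thesis by simp
      qed
      also have "\<dots> < d" using d by simp
      finally show "dist (z + s *\<^sub>R v + t *\<^sub>R w) z < d" "dist (z + t *\<^sub>R w + s *\<^sub>R v) z < d"
        by (auto simp: dist_norm algebra_simps)
    qed
    obtain s t where 1: "\<bar>s\<bar> \<le> h" "\<bar>t\<bar> \<le> h"
      "f (z + h *\<^sub>R v + h *\<^sub>R w) - f (z + h *\<^sub>R v) - f (z + h *\<^sub>R w) + f z
        = h\<^sup>2 * second_deriv f (z + s *\<^sub>R v + t *\<^sub>R w) v w"
      using key[OF h, of v w] dd near by blast
    obtain s' t' where 2: "\<bar>s'\<bar> \<le> h" "\<bar>t'\<bar> \<le> h"
      "f (z + h *\<^sub>R w + h *\<^sub>R v) - f (z + h *\<^sub>R w) - f (z + h *\<^sub>R v) + f z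
        = h\<^sup>2 * second_deriv f (z + s' *\<^sub>R w + t' *\<^sub>R v) w v"
      using key[OF h, of w v] dd near by blast
    have "h\<^sup>2 * second_deriv f (z + s *\<^sub>R v + t *\<^sub>R w) v w = h\<^sup>2 * second_deriv f (z + s' *\<^sub>R w + t' *\<^sub>R v) w v"
      using 1(3) 2(3) unfolding add.assoc[of z] add.commute[of "h *\<^sub>R w" "h *\<^sub>R v"] by linarith
    then have eq: "second_deriv f (z + s *\<^sub>R v + t *\<^sub>R w) v w = second_deriv f (z + s' *\<^sub>R w + t' *\<^sub>R v) w v"
      using h by simp
    have "\<bar>second_deriv f (z + s *\<^sub>R v + t *\<^sub>R w) v w - second_deriv f z v w\<bar> < e/2"
      using dd near(1)[OF 1(1,2)] by blast
    moreover have "\<bar>second_deriv f (z + s' *\<^sub>R w + t' *\<^sub>R v) w v - second_deriv f z w v\<bar> < e/2"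
      using dd near(2)[OF 2(2,1)] by blast
    ultimately show ?thesis using eq by linarith
  qed
  then have "\<bar>second_deriv f z v w - second_deriv f z w v\<bar> \<le> 0"
    by (meson dense_ge)
  then show ?thesis by simp
qed

section \<open>Differentiation under the integral sign\<close>

text \<open>
  Only the points with \<open>g w \<noteq> 0\<close> matter, so the hypotheses on the kernel are restricted to them. This
  covers both a compactly supported \<open>g\<close> with an arbitrary smooth kernel and an integrable \<open>g\<close> with a
  compactly supported kernel.
\<close>

lemma has_derivative_integral_param:
  fixes k :: "'p::real_normed_vector \<Rightarrow> 'b \<Rightarrow> real"
  assumes g: "integrable M g" and r: "r > 0" and C: "C \<ge> 0"
    and kd: "\<And>p w. dist p p0 < r \<Longrightarrow> g w \<noteq> 0 \<Longrightarrow> ((\<lambda>p. k p w) has_derivative k' p w) (at p)"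
    and bd: "\<And>p w v. dist p p0 < r \<Longrightarrow> g w \<noteq> 0 \<Longrightarrow> \<bar>k' p w v\<bar> \<le> C * norm v"
    and bd0: "\<And>p w. dist p p0 < r \<Longrightarrow> g w \<noteq> 0 \<Longrightarrow> \<bar>k p w\<bar> \<le> C0"
    and meas: "\<And>p. (\<lambda>w. k p w) \<in> borel_measurable M"
      "\<And>v. (\<lambda>w. k' p0 w v) \<in> borel_measurable M"
  shows "((\<lambda>p. \<integral>w. g w * k p w \<partial>M) has_derivative (\<lambda>v. \<integral>w. g w * k' p0 w v \<partial>M)) (at p0)"
proof -
  note [measurable] = meas borel_measurable_integrable[OF g]
  have int0: "integrable M (\<lambda>w. g w * k p w)" if "dist p p0 < r" for p
  proof (rule Bochner_Integration.integrable_bound[of M "\<lambda>w. C0 * \<bar>g w\<bar>"])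
    show "AE w in M. norm (g w * k p w) \<le> norm (C0 * \<bar>g w\<bar>)"
    proof (rule AE_I2)
      fix w
      show "norm (g w * k p w) \<le> norm (C0 * \<bar>g w\<bar>)"
        using bd0[OF that, of w] mult_left_mono[of "\<bar>k p w\<bar>" "\<bar>C0\<bar>" "\<bar>g w\<bar>"]
        by (cases "g w = 0") (auto simp: abs_mult mult.commute)
    qed
  qed (use g in auto)
  have int1: "integrable M (\<lambda>w. g w * k' p0 w v)" for v
  proof (rule Bochner_Integration.integrable_bound[of M "\<lambda>w. (C * norm v) * \<bar>g w\<bar>"])
    show "AE w in M. norm (g w * k' p0 w v) \<le> norm ((C * norm v) * \<bar>g w\<bar>)"
    proof (rule AE_I2)
      fix w
      show "norm (g w * k' p0 w v) \<le> norm ((C * norm v) * \<bar>g w\<bar>)"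
      proof (cases "g w = 0")
        case False
        then have "\<bar>k' p0 w v\<bar> \<le> \<bar>C * norm v\<bar>" using bd[of p0 w v] r by (smt (verit) dist_self)
        from mult_right_mono[OF this, of "\<bar>g w\<bar>"] show ?thesis by (simp add: abs_mult mult.commute)
      qed simp
    qed
  qed (use g in auto)
  have lin: "linear (k' p0 w)" if "g w \<noteq> 0" for w
    using kd[of p0 w] that r by (auto dest: has_derivative_linear)
  have blin: "bounded_linear (\<lambda>v. \<integral>w. g w * k' p0 w v \<partial>M)"
  proof (rule bounded_linear_intro)
    fix x y
    have "(\<integral>w. g w * k' p0 w (x + y) \<partial>M) = (\<integral>w. g w * k' p0 w x + g w * k' p0 w y \<partial>M)"
    proof (intro Bochner_Integration.integral_cong refl)
      fix w show "g w * k' p0 w (x + y) = g w * k' p0 w x + g w * k' p0 w y"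
        using linear_add[OF lin, of w x y] by (cases "g w = 0") (auto simp: algebra_simps)
    qed
    then show "(\<integral>w. g w * k' p0 w (x + y) \<partial>M) = (\<integral>w. g w * k' p0 w x \<partial>M) + (\<integral>w. g w * k' p0 w y \<partial>M)"
      using int1 by simp
  next
    fix x and c :: real
    have "(\<integral>w. g w * k' p0 w (c *\<^sub>R x) \<partial>M) = (\<integral>w. c * (g w * k' p0 w x) \<partial>M)"
    proof (intro Bochner_Integration.integral_cong refl)
      fix w show "g w * k' p0 w (c *\<^sub>R x) = c * (g w * k' p0 w x)"
        using linear_scale[OF lin, of w c x] by (cases "g w = 0") (auto simp: algebra_simps)
    qed
    then show "(\<integral>w. g w * k' p0 w (c *\<^sub>R x) \<partial>M) = c *\<^sub>R (\<integral>w. g w * k' p0 w x \<partial>M)"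
      using int1 by simp
  next
    fix x
    have "norm (\<integral>w. g w * k' p0 w x \<partial>M) \<le> (\<integral>w. norm (g w * k' p0 w x) \<partial>M)"
      by (rule integral_norm_bound)
    also have "\<dots> \<le> (\<integral>w. \<bar>g w\<bar> * (C * norm x) \<partial>M)"
    proof (rule integral_mono)
      fix w show "norm (g w * k' p0 w x) \<le> \<bar>g w\<bar> * (C * norm x)"
        using bd[of p0 w x] r mult_left_mono[of "\<bar>k' p0 w x\<bar>" "C * norm x" "\<bar>g w\<bar>"]
        by (cases "g w = 0") (auto simp: abs_mult)
    qed (use int1 g in auto)
    also have "\<dots> = norm x * (C * (\<integral>w. \<bar>g w\<bar> \<partial>M))" by simp
    finally show "norm (\<integral>w. g w * k' p0 w x \<partial>M) \<le> norm x * (C * (\<integral>w. \<bar>g w\<bar> \<partial>M))" .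
  qed
  show ?thesis
    unfolding has_derivative_at2
  proof (intro conjI blin)
    let ?E = "\<lambda>p. (1 / norm (p - p0)) *\<^sub>R ((\<integral>w. g w * k p w \<partial>M) - ((\<integral>w. g w * k p0 w \<partial>M) + (\<integral>w. g w * k' p0 w (p - p0) \<partial>M)))"
    show "(?E \<longlongrightarrow> 0) (at p0)"
      unfolding tendsto_at_iff_sequentially
    proof (intro allI impI)
      fix X :: "nat \<Rightarrow> 'p" assume X0: "\<forall>i. X i \<in> UNIV - {p0}" and X: "X \<longlonglongrightarrow> p0"
      obtain N where N: "\<And>i. i \<ge> N \<Longrightarrow> dist (X i) p0 < r"
        using X r unfolding lim_sequentially by blast
      define Y where "Y i = X (i + N)" for i
      have Yr: "dist (Y i) p0 < r" "Y i \<noteq> p0" for i using N X0 by (auto simp: Y_def)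
      have Y: "Y \<longlonglongrightarrow> p0" unfolding Y_def by (rule LIMSEQ_ignore_initial_segment[OF X])
      let ?q = "\<lambda>i w. (1 / norm (Y i - p0)) * (k (Y i) w - (k p0 w + k' p0 w (Y i - p0)))"
      have eq: "?E (Y i) = (\<integral>w. g w * ?q i w \<partial>M)" for i
      proof -
        have "?E (Y i) = (1 / norm (Y i - p0)) * (\<integral>w. g w * k (Y i) w - (g w * k p0 w + g w * k' p0 w (Y i - p0)) \<partial>M)"
          using int0[OF Yr(1)[of i]] int0[of p0] int1 r by simp
        also have "\<dots> = (\<integral>w. (1 / norm (Y i - p0)) * (g w * k (Y i) w - (g w * k p0 w + g w * k' p0 w (Y i - p0))) \<partial>M)"
          by simp
        also have "\<dots> = (\<integral>w. g w * ?q i w \<partial>M)"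
          by (intro Bochner_Integration.integral_cong refl) (simp add: algebra_simps)
        finally show ?thesis .
      qed
      have "(\<lambda>i. \<integral>w. g w * ?q i w \<partial>M) \<longlonglongrightarrow> (\<integral>w. 0 \<partial>M)"
      proof (rule integral_dominated_convergence[where w = "\<lambda>w. \<bar>g w\<bar> * (2 * C)"])
        show "AE w in M. (\<lambda>i. g w * ?q i w) \<longlonglongrightarrow> 0"
        proof (rule AE_I2)
          fix w
          show "(\<lambda>i. g w * ?q i w) \<longlonglongrightarrow> 0"
          proof (cases "g w = 0")
            case False
            from kd[of p0 w] r False
            have "((\<lambda>p. (1 / norm (p - p0)) *\<^sub>R (k p w - (k p0 w + k' p0 w (p - p0)))) \<longlongrightarrow> 0) (at p0)"
              unfolding has_derivative_at2 by simp
            then have "(\<lambda>i. ?q i w) \<longlonglongrightarrow> 0"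
              using Y Yr(2) unfolding tendsto_at_iff_sequentially by (auto simp: o_def)
            from tendsto_mult_right_zero[OF this] show ?thesis by simp
          qed simp
        qed
        show "AE w in M. norm (g w * ?q i w) \<le> \<bar>g w\<bar> * (2 * C)" for i
        proof (rule AE_I2)
          fix w
          show "norm (g w * ?q i w) \<le> \<bar>g w\<bar> * (2 * C)"
          proof (cases "g w = 0")
            case False
            have on: "onorm (k' p w) \<le> C" if "p \<in> ball p0 r" for p
              by (rule onorm_bound[OF C]) (use bd[of p w] that False in \<open>auto simp: dist_commute\<close>)
            have "norm (k (Y i) w - k p0 w) \<le> C * norm (Y i - p0)"
              by (rule differentiable_bound[of "ball p0 r" "\<lambda>p. k p w" "\<lambda>p. k' p w"])
                (use kd False on Yr r in \<open>auto simp: dist_commute intro: has_derivative_at_withinI\<close>)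
            moreover have "\<bar>k' p0 w (Y i - p0)\<bar> \<le> C * norm (Y i - p0)" using bd[of p0 w] r False by auto
            ultimately have "\<bar>k (Y i) w - (k p0 w + k' p0 w (Y i - p0))\<bar> \<le> 2 * C * norm (Y i - p0)" by auto
            then have "\<bar>?q i w\<bar> \<le> 2 * C"
              using Yr(2)[of i] by (simp add: abs_mult divide_simps)
            then show ?thesis using mult_left_mono[of "\<bar>?q i w\<bar>" "2 * C" "\<bar>g w\<bar>"] by (simp add: abs_mult)
          qed simp
        qed
        show "(\<lambda>w. g w * ?q i w) \<in> borel_measurable M" for i by measurable
      qed (use g in auto)
      moreover have "(\<lambda>i. ?E (Y i)) = (\<lambda>i. \<integral>w. g w * ?q i w \<partial>M)" by (rule ext) (rule eq)
      ultimately have "(\<lambda>i. ?E (Y i)) \<longlonglongrightarrow> 0" by (simp only: Bochner_Integration.integral_zero)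
      then have "(\<lambda>i. ?E (X (i + N))) \<longlonglongrightarrow> 0" by (simp only: Y_def)
      then show "(?E \<circ> X) \<longlonglongrightarrow> 0" unfolding o_def by (rule LIMSEQ_offset)
    qed
  qed
qed

lemma continuous_integral_param:
  fixes k :: "'p::metric_space \<Rightarrow> 'b \<Rightarrow> real"
  assumes g: "integrable M g" and r: "r > 0"
    and kc: "\<And>w. g w \<noteq> 0 \<Longrightarrow> isCont (\<lambda>p. k p w) p0"
    and bd: "\<And>p w. dist p p0 < r \<Longrightarrow> g w \<noteq> 0 \<Longrightarrow> \<bar>k p w\<bar> \<le> C"
    and meas: "\<And>p. (\<lambda>w. k p w) \<in> borel_measurable M"
  shows "isCont (\<lambda>p. \<integral>w. g w * k p w \<partial>M) p0"
  unfolding continuous_at_sequentially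
proof (intro allI impI)
  fix X assume X: "X \<longlonglongrightarrow> p0"
  note [measurable] = meas borel_measurable_integrable[OF g]
  obtain N where N: "\<And>i. i \<ge> N \<Longrightarrow> dist (X i) p0 < r"
    using X r unfolding lim_sequentially by blast
  have XN: "(\<lambda>i. X (i + N)) \<longlonglongrightarrow> p0" by (rule LIMSEQ_ignore_initial_segment[OF X])
  have "(\<lambda>i. \<integral>w. g w * k (X (i + N)) w \<partial>M) \<longlonglongrightarrow> (\<integral>w. g w * k p0 w \<partial>M)"
  proof (rule integral_dominated_convergence[where w = "\<lambda>w. \<bar>g w\<bar> * C"])
    show "AE w in M. (\<lambda>i. g w * k (X (i + N)) w) \<longlonglongrightarrow> g w * k p0 w"
    proof (rule AE_I2)
      fix w show "(\<lambda>i. g w * k (X (i + N)) w) \<longlonglongrightarrow> g w * k p0 w"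
        using kc[of w] isCont_tendsto_compose[OF _ XN, of "\<lambda>p. k p w"]
        by (cases "g w = 0") (auto intro!: tendsto_mult_left)
    qed
    show "AE w in M. norm (g w * k (X (i + N)) w) \<le> \<bar>g w\<bar> * C" for i
    proof (rule AE_I2)
      fix w show "norm (g w * k (X (i + N)) w) \<le> \<bar>g w\<bar> * C"
        using bd[OF N, of "i + N" w] mult_left_mono[of "\<bar>k (X (i + N)) w\<bar>" C "\<bar>g w\<bar>"]
        by (cases "g w = 0") (auto simp: abs_mult)
    qed
  qed (use g in auto)
  then show "((\<lambda>p. \<integral>w. g w * k p w \<partial>M) \<circ> X) \<longlonglongrightarrow> (\<integral>w. g w * k p0 w \<partial>M)"
    unfolding o_def by (rule LIMSEQ_offset)
qed

section \<open>Convolution on Euclidean space\<close>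

definition convolve :: "('a::euclidean_space \<Rightarrow> real) \<Rightarrow> ('a \<Rightarrow> real) \<Rightarrow> 'a \<Rightarrow> real" where
  "convolve g k z = (\<integral>w. g w * k (z - w) \<partial>lborel)"

text \<open>
  Compact support of one of the two factors lets every continuous kernel be convolved, and the property
  passes from a kernel to its derivatives.
\<close>

definition convolvable :: "('a::euclidean_space \<Rightarrow> real) \<Rightarrow> ('a \<Rightarrow> real) \<Rightarrow> bool" where
  "convolvable g k \<longleftrightarrow> integrable lborel g \<and> (bounded {w. g w \<noteq> 0} \<or> bounded {x. k x \<noteq> 0})"

lemma continuous_compact_support_bounded:
  fixes k :: "'a::euclidean_space \<Rightarrow> real"
  assumes "continuous_on UNIV k" "bounded {x. k x \<noteq> 0}"
  obtains C where "C \<ge> 0" "\<And>x. \<bar>k x\<bar> \<le> C"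
proof -
  obtain r where r: "\<And>x. k x \<noteq> 0 \<Longrightarrow> norm x \<le> r"
    using assms(2) unfolding bounded_iff by auto
  have "compact (k ` cball 0 r)" by (intro compact_continuous_image continuous_on_subset[OF assms(1)]) auto
  then obtain C where C: "\<And>x. norm x \<le> r \<Longrightarrow> \<bar>k x\<bar> \<le> C"
    using compact_imp_bounded[THEN bounded_iff[THEN iffD1]] by (force simp: image_iff)
  have "\<bar>k x\<bar> \<le> \<bar>C\<bar>" for x using C[of x] r[of x] by (cases "k x = 0") auto
  then show ?thesis using that[of "\<bar>C\<bar>"] by auto
qed

lemma convolvable_bound:
  assumes "convolvable g k" "continuous_on UNIV k"
  obtains C where "C \<ge> 0" "\<And>z w. norm z \<le> R \<Longrightarrow> g w \<noteq> 0 \<Longrightarrow> \<bar>k (z - w)\<bar> \<le> C"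
  using assms(1)[unfolded convolvable_def, THEN conjunct2]
proof
  assume "bounded {x. k x \<noteq> 0}"
  then show ?thesis using that continuous_compact_support_bounded[OF assms(2)] by metis
next
  assume "bounded {w. g w \<noteq> 0}"
  then obtain r where r: "\<And>w. g w \<noteq> 0 \<Longrightarrow> norm w \<le> r" unfolding bounded_iff by auto
  have "compact (k ` cball 0 (R + r))" by (intro compact_continuous_image continuous_on_subset[OF assms(2)]) auto
  then obtain C where C: "\<And>x. norm x \<le> R + r \<Longrightarrow> \<bar>k x\<bar> \<le> C"
    using compact_imp_bounded[THEN bounded_iff[THEN iffD1]] by (force simp: image_iff)
  have "\<bar>k (z - w)\<bar> \<le> \<bar>C\<bar>" if "norm z \<le> R" "g w \<noteq> 0" for z w
    using C[of "z - w"] r[OF that(2)] that(1) norm_triangle_ineq4[of z w] by auto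
  then show ?thesis using that[of "\<bar>C\<bar>"] by auto
qed

lemma continuous_UNIV_measurable [measurable_dest]:
  "continuous_on UNIV k \<Longrightarrow> k \<in> borel_measurable borel"
  by (rule borel_measurable_continuous_onI)

lemma convolve_continuous:
  assumes "convolvable g k" "continuous_on UNIV k"
  shows "continuous_on UNIV (convolve g k)"
proof -
  have "isCont (convolve g k) z" for z
  proof -
    obtain C where C: "C \<ge> 0" "\<And>p w. norm p \<le> norm z + 1 \<Longrightarrow> g w \<noteq> 0 \<Longrightarrow> \<bar>k (p - w)\<bar> \<le> C"
      using convolvable_bound[OF assms] by metis
    have km[measurable]: "k \<in> borel_measurable borel" using assms(2) by measurable
    show ?thesis unfolding convolve_def[abs_def]
    proof (rule continuous_integral_param[where r=1 and C=C])
      show "isCont (\<lambda>p. k (p - w)) z" for w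
        using assms(2) by (intro continuous_within_compose3[where f="\<lambda>p. p - w" and g=k] continuous_intros)
          (auto simp: continuous_on_eq_continuous_at intro!: continuous_at_imp_continuous_within)
      show "\<bar>k (p - w)\<bar> \<le> C" if "dist p z < 1" "g w \<noteq> 0" for p w
      proof -
        have "norm p \<le> norm z + 1" using that norm_triangle_ineq2[of p z] by (simp add: dist_norm)
        then show ?thesis using C that by blast
      qed
    qed (use assms in \<open>auto simp: convolvable_def\<close>)
  qed
  then show ?thesis by (simp add: continuous_on_eq_continuous_at)
qed

lemma convolve_integrand_integrable:
  assumes "convolvable g k" "continuous_on UNIV k"
  shows "integrable lborel (\<lambda>w. g w * k (x - w))"
proof -
  obtain C where C: "C \<ge> 0" "\<And>p w. norm p \<le> norm x \<Longrightarrow> g w \<noteq> 0 \<Longrightarrow> \<bar>k (p - w)\<bar> \<le> C"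
    using convolvable_bound[OF assms] by metis
  have g: "integrable lborel g" using assms(1) by (simp add: convolvable_def)
  have km[measurable]: "k \<in> borel_measurable borel" using assms(2) by measurable
  show ?thesis
  proof (rule Bochner_Integration.integrable_bound[OF integrable_mult_right[OF g, of C]])
    show "AE w in lborel. norm (g w * k (x - w)) \<le> norm (C * g w)"
    proof (rule AE_I2)
      fix w show "norm (g w * k (x - w)) \<le> norm (C * g w)"
        using C(2)[of x w] C(1) by (cases "g w = 0") (auto simp: abs_mult mult.commute intro: mult_right_mono)
    qed
  qed (use g in measurable)
qed

text \<open>
  The counterpart of the previous lemma for Gaussians, which are bounded but not of compact support.
\<close>

lemma bounded_kernel_integrable:
  fixes g k :: "'a::euclidean_space \<Rightarrow> real"
  assumes g: "integrable lborel g" and k[measurable]: "k \<in> borel_measurable borel" and C: "\<And>x. \<bar>k x\<bar> \<le> C"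
  shows "integrable lborel (\<lambda>w. g w * k (x - w))"
proof (rule Bochner_Integration.integrable_bound[OF integrable_mult_right[OF g, of C]])
  show "AE w in lborel. norm (g w * k (x - w)) \<le> norm (C * g w)"
  proof (rule AE_I2)
    fix w
    have "\<bar>k (x - w)\<bar> \<le> \<bar>C\<bar>" using C[of "x - w"] by linarith
    from mult_right_mono[OF this, of "\<bar>g w\<bar>"]
    show "norm (g w * k (x - w)) \<le> norm (C * g w)"
      by (simp only: real_norm_def abs_mult mult.commute)
  qed
qed (use g in measurable)

lemma convolvable_deriv:
  assumes "convolvable g k" shows "convolvable g (\<lambda>x. frechet_derivative k (at x) v)"
proof -
  have "{x. frechet_derivative k (at x) v \<noteq> 0} \<subseteq> closure {x. k x \<noteq> 0}"
  proof
    fix x assume x: "x \<in> {x. frechet_derivative k (at x) v \<noteq> 0}"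
    show "x \<in> closure {x. k x \<noteq> 0}"
    proof (rule ccontr)
      assume n: "x \<notin> closure {x. k x \<noteq> 0}"
      have "frechet_derivative k (at x) = frechet_derivative (\<lambda>x. 0) (at x)"
        by (rule frechet_derivative_cong_open[of "- closure {x. k x \<noteq> 0}"])
          (use n closure_subset[of "{x. k x \<noteq> 0}"] in auto)
      then show False using x by (simp add: frechet_derivative_const)
    qed
  qed
  then show ?thesis using assms bounded_subset[OF bounded_closure] unfolding convolvable_def by blast
qed

lemma convolve_has_derivative:
  assumes "convolvable g k" "Ck_on (Suc m) k UNIV"
  shows "(convolve g k has_derivative (\<lambda>v. convolve g (\<lambda>x. frechet_derivative k (at x) v) z)) (at z)"
proof -
  have D: "(k has_derivative frechet_derivative k (at x)) (at x)" for x
    using Ck_on_Suc_has_derivative[OF assms(2)] by simp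
  have Dc: "continuous_on UNIV (\<lambda>x. frechet_derivative k (at x) v)" for v
    using assms(2) Ck_on_continuous by auto
  have kc: "continuous_on UNIV k" using assms(2) Ck_on_continuous by blast
  have km[measurable]: "k \<in> borel_measurable borel" using kc by measurable
  have Dm[measurable]: "(\<lambda>x. frechet_derivative k (at x) v) \<in> borel_measurable borel" for v
    using Dc by measurable
  obtain C0 where C0: "C0 \<ge> 0" "\<And>p w. norm p \<le> norm z + 1 \<Longrightarrow> g w \<noteq> 0 \<Longrightarrow> \<bar>k (p - w)\<bar> \<le> C0"
    using convolvable_bound[OF assms(1) kc] by metis
  have "\<exists>C. C \<ge> 0 \<and> (\<forall>p w. norm p \<le> norm z + 1 \<longrightarrow> g w \<noteq> 0 \<longrightarrow> \<bar>frechet_derivative k (at (p - w)) b\<bar> \<le> C)" for b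
    using convolvable_bound[OF convolvable_deriv[OF assms(1)] Dc] by metis
  then obtain C where C: "\<And>b. C b \<ge> 0"
    "\<And>b p w. norm p \<le> norm z + 1 \<Longrightarrow> g w \<noteq> 0 \<Longrightarrow> \<bar>frechet_derivative k (at (p - w)) b\<bar> \<le> C b"
    by metis
  have np: "norm p \<le> norm z + 1" if "dist p z < 1" for p
    using that norm_triangle_ineq2[of p z] by (simp add: dist_norm)
  show ?thesis unfolding convolve_def[abs_def]
  proof (rule has_derivative_integral_param[where r=1 and C="\<Sum>b\<in>Basis. C b" and C0=C0])
    show "((\<lambda>p. k (p - w)) has_derivative frechet_derivative k (at (p - w))) (at p)" for p w
    proof -
      have "((\<lambda>p. p - w) has_derivative (\<lambda>v. v)) (at p)" by (auto intro!: derivative_eq_intros)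
      from has_derivative_compose[OF this D] show ?thesis .
    qed
    show "\<bar>frechet_derivative k (at (p - w)) v\<bar> \<le> (\<Sum>b\<in>Basis. C b) * norm v" if "dist p z < 1" "g w \<noteq> 0" for p w v
    proof -
      have lin: "linear (frechet_derivative k (at (p - w)))" using D has_derivative_linear by blast
      have "frechet_derivative k (at (p - w)) v = frechet_derivative k (at (p - w)) (\<Sum>b\<in>Basis. (v \<bullet> b) *\<^sub>R b)"
        by (simp add: euclidean_representation)
      also have "\<dots> = (\<Sum>b\<in>Basis. (v \<bullet> b) * frechet_derivative k (at (p - w)) b)"
        using lin by (simp add: linear_sum linear_scale)
      also have "\<bar>\<dots>\<bar> \<le> (\<Sum>b\<in>Basis. C b * norm v)"
      proof (rule order_trans[OF sum_abs sum_mono])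
        fix b :: 'a assume b: "b \<in> Basis"
        show "\<bar>(v \<bullet> b) * frechet_derivative k (at (p - w)) b\<bar> \<le> C b * norm v"
          using C(2)[OF np[OF that(1)] that(2), of b] Basis_le_norm[OF b, of v]
          by (simp add: abs_mult mult_mono mult.commute[of "C b"])
      qed
      finally show ?thesis by (simp add: sum_distrib_right)
    qed
    show "\<bar>k (p - w)\<bar> \<le> C0" if "dist p z < 1" "g w \<noteq> 0" for p w
      using C0(2)[OF np[OF that(1)] that(2)] .
  qed (use assms C(1) in \<open>auto simp: convolvable_def intro: sum_nonneg\<close>)
qed

lemma convolve_frechet_derivative:
  assumes "convolvable g k" "Ck_on (Suc m) k UNIV"
  shows "frechet_derivative (convolve g k) (at z) v = convolve g (\<lambda>x. frechet_derivative k (at x) v) z"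
  using frechet_derivative_at[OF convolve_has_derivative[OF assms], symmetric] by simp

lemma convolve_Ck_on:
  assumes "convolvable g k" "Ck_on m k UNIV"
  shows "Ck_on m (convolve g k) UNIV"
  using assms
proof (induction m arbitrary: k)
  case 0 then show ?case by (simp add: convolve_continuous)
next
  case (Suc m)
  show ?case
    by (rule Ck_on_SucI[OF open_UNIV convolve_has_derivative[OF Suc.prems]])
      (rule Suc.IH[OF convolvable_deriv[OF Suc.prems(1)]], use Suc.prems(2) in simp)
qed

lemma convolve_second_deriv:
  assumes "convolvable g k" "Ck_on 2 k UNIV"
  shows "second_deriv (convolve g k) z v w = convolve g (\<lambda>x. second_deriv k x v w) z"
proof -
  have 2: "Ck_on (Suc (Suc 0)) k UNIV" using assms(2) by (simp add: numeral_2_eq_2)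
  then have 1: "Ck_on (Suc 0) (\<lambda>x. frechet_derivative k (at x) v) UNIV" by simp
  show ?thesis
    using convolve_frechet_derivative[OF assms(1) 2] convolve_frechet_derivative[OF convolvable_deriv[OF assms(1)] 1]
    by (simp add: second_deriv_def)
qed

lemma lborel_distr_reflect: "distr lborel borel (\<lambda>x. z - x) = (lborel :: 'a::euclidean_space measure)"
  using lborel_affine[of "-1" z] by (simp add: density_1)

lemma lborel_integral_reflect:
  fixes f :: "'a::euclidean_space \<Rightarrow> real"
  assumes "f \<in> borel_measurable borel"
  shows "(\<integral>w. f (z - w) \<partial>lborel) = (\<integral>w. f w \<partial>lborel)"
proof -
  have "(\<integral>w. f w \<partial>lborel) = (\<integral>w. f w \<partial>(distr lborel borel (\<lambda>x. z - x)))" by (simp add: lborel_distr_reflect)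
  also have "\<dots> = (\<integral>w. f (z - w) \<partial>lborel)" by (rule integral_distr) (use assms in auto)
  finally show ?thesis by simp
qed

lemma lborel_integrable_reflect:
  fixes f :: "'a::euclidean_space \<Rightarrow> real"
  assumes "integrable lborel f"
  shows "integrable lborel (\<lambda>w. f (z - w))"
proof -
  have "integrable (distr lborel borel (\<lambda>x. z - x)) f" using assms by (simp add: lborel_distr_reflect)
  then show ?thesis by (subst (asm) integrable_distr_eq) (use assms in auto)
qed

lemma lborel_integral_translate:
  fixes f :: "'a::euclidean_space \<Rightarrow> real"
  assumes "f \<in> borel_measurable borel"
  shows "(\<integral>w. f (w - z) \<partial>lborel) = (\<integral>w. f w \<partial>lborel)"
  using lborel_integral_reflect[of "\<lambda>w. f (- w)" z] lborel_integral_reflect[of f 0] assms by simp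

lemma convolve_commute:
  assumes "g \<in> borel_measurable borel" "k \<in> borel_measurable borel"
  shows "convolve g k z = convolve k g z"
proof -
  have "convolve g k z = (\<integral>w. (\<lambda>w. g (z - w) * k w) (z - w) \<partial>lborel)" by (simp add: convolve_def)
  also have "\<dots> = (\<integral>w. g (z - w) * k w \<partial>lborel)"
    by (rule lborel_integral_reflect) (use assms in measurable)
  finally show ?thesis by (simp add: convolve_def mult.commute)
qed

lemma kernel_Fubini:
  fixes g \<theta> :: "'a::euclidean_space \<Rightarrow> real" and K :: "'a \<Rightarrow> 'a \<Rightarrow> real"
  assumes g: "integrable lborel g" and t: "integrable lborel \<theta>"
    and K[measurable]: "(\<lambda>(x, w). K x w) \<in> borel_measurable (borel \<Otimes>\<^sub>M borel)" and C: "\<And>x w. \<bar>K x w\<bar> \<le> C"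
  shows "(\<integral>x. \<theta> x * (\<integral>w. g w * K x w \<partial>lborel) \<partial>lborel) = (\<integral>w. g w * (\<integral>x. \<theta> x * K x w \<partial>lborel) \<partial>lborel)"
proof -
  have [measurable]: "g \<in> borel_measurable borel" "\<theta> \<in> borel_measurable borel" using g t by auto
  have int1: "integrable (lborel \<Otimes>\<^sub>M lborel) (\<lambda>(x, w). \<theta> x * g w)"
  proof (rule lborel_pair.Fubini_integrable)
    show "integrable lborel (\<lambda>x. \<integral>w. norm (case (x, w) of (x, w) \<Rightarrow> \<theta> x * g w) \<partial>lborel)"
      using t g by (simp add: abs_mult)
    show "AE x in lborel. integrable lborel (\<lambda>w. case (x, w) of (x, w) \<Rightarrow> \<theta> x * g w)"
      using g by simp
  qed measurable
  have "integrable (lborel \<Otimes>\<^sub>M lborel) (\<lambda>(x, w). \<theta> x * g w * K x w)"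
  proof (rule Bochner_Integration.integrable_bound[where f="\<lambda>p. C * (case p of (x, w) \<Rightarrow> \<theta> x * g w)"])
    show "integrable (lborel \<Otimes>\<^sub>M lborel) (\<lambda>p. C * (case p of (x, w) \<Rightarrow> \<theta> x * g w))" using int1 by simp
    show "AE p in lborel \<Otimes>\<^sub>M lborel. norm (case p of (x, w) \<Rightarrow> \<theta> x * g w * K x w) \<le> norm (C * (case p of (x, w) \<Rightarrow> \<theta> x * g w))"
    proof (rule AE_I2)
      fix p :: "'a \<times> 'a"
      obtain x w where p: "p = (x, w)" by (cases p)
      have "\<bar>K x w\<bar> \<le> \<bar>C\<bar>" using C[of x w] by simp
      from mult_left_mono[OF this, of "\<bar>\<theta> x * g w\<bar>"]
      show "norm (case p of (x, w) \<Rightarrow> \<theta> x * g w * K x w) \<le> norm (C * (case p of (x, w) \<Rightarrow> \<theta> x * g w))"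
        unfolding p by (simp add: abs_mult mult_ac)
    qed
  qed measurable
  from lborel_pair.Fubini_integral[OF this]
  have "(\<integral>w. (\<integral>x. \<theta> x * g w * K x w \<partial>lborel) \<partial>lborel) = (\<integral>x. (\<integral>w. \<theta> x * g w * K x w \<partial>lborel) \<partial>lborel)" .
  moreover have "(\<integral>x. \<theta> x * g w * K x w \<partial>lborel) = g w * (\<integral>x. \<theta> x * K x w \<partial>lborel)" for w
    by (subst integral_mult_right_zero[symmetric]) (simp add: mult_ac)
  moreover have "(\<integral>w. \<theta> x * g w * K x w \<partial>lborel) = \<theta> x * (\<integral>w. g w * K x w \<partial>lborel)" for x
    by (subst integral_mult_right_zero[symmetric]) (simp add: mult_ac)
  ultimately show ?thesis by simp
qed

lemma convolve_assoc:
  assumes g: "integrable lborel g" and h: "integrable lborel h"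
    and k: "continuous_on UNIV k" and C: "\<And>x. \<bar>k x\<bar> \<le> C"
  shows "convolve (convolve g k) h z = convolve g (convolve k h) z"
proof -
  have km[measurable]: "k \<in> borel_measurable borel" using k by measurable
  have hm[measurable]: "h \<in> borel_measurable borel" using h by auto
  have "convolve (convolve g k) h z = (\<integral>x. h (z - x) * (\<integral>w. g w * k (x - w) \<partial>lborel) \<partial>lborel)"
    by (simp add: convolve_def mult.commute)
  also have "\<dots> = (\<integral>w. g w * (\<integral>x. h (z - x) * k (x - w) \<partial>lborel) \<partial>lborel)"
    by (rule kernel_Fubini[OF g lborel_integrable_reflect[OF h], where C=C]) (measurable, rule C)
  also have "\<dots> = (\<integral>w. g w * convolve k h (z - w) \<partial>lborel)"
  proof -
    have "(\<integral>x. h (z - x) * k (x - w) \<partial>lborel) = convolve k h (z - w)" for w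
      using lborel_integral_translate[of "\<lambda>y. k y * h (z - w - y)" w]
      by (simp add: convolve_def mult.commute)
    then show ?thesis by simp
  qed
  finally show ?thesis by (simp add: convolve_def)
qed

text \<open>
  Uniform continuity in which only one of the two points has to lie in the compact set: finitely many
  balls cover \<open>K\<close> such that \<open>h\<close> varies by less than \<open>e / 2\<close> from the centre on the ball of twice the radius.
\<close>

lemma compact_uniform_nbhd:
  fixes h :: "'a::heine_borel \<Rightarrow> 'b::metric_space"
  assumes "compact K" "open W" "K \<subseteq> W" "continuous_on W h" "e > 0"
  obtains d where "d > 0" "\<And>z w. z \<in> K \<Longrightarrow> dist z w \<le> d \<Longrightarrow> w \<in> W \<and> dist (h w) (h z) < e"
proof -
  obtain r where r: "r > 0" "(\<Union>x\<in>K. cball x r) \<subseteq> W"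
    using compact_subset_open_imp_cball_epsilon_subset[OF assms(1-3)] by metis
  let ?K = "\<Union>x\<in>K. cball x r"
  have "\<exists>d>0. \<forall>w. dist z w < d \<longrightarrow> w \<in> W \<and> dist (h w) (h z) < e/2" if "z \<in> K" for z
  proof -
    have "isCont h z" using assms that by (auto simp: continuous_on_eq_continuous_at)
    then obtain d where d: "d > 0" "\<And>w. dist w z < d \<Longrightarrow> dist (h w) (h z) < e/2"
      using assms(5) unfolding continuous_at_eps_delta by (meson half_gt_zero)
    moreover have "w \<in> W" if "dist z w < r" for w
      using r(2) \<open>z \<in> K\<close> that by (auto simp: subset_iff intro: less_imp_le)
    ultimately show ?thesis using r(1)
      by (intro exI[of _ "min d r"]) (auto simp: dist_commute)
  qed
  then obtain d where d: "\<And>z. z \<in> K \<Longrightarrow> d z > 0"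
    "\<And>z w. z \<in> K \<Longrightarrow> dist z w < d z \<Longrightarrow> w \<in> W \<and> dist (h w) (h z) < e/2" by metis
  obtain D where D: "D \<subseteq> K" "finite D" "K \<subseteq> (\<Union>z\<in>D. ball z (d z / 2))"
    using compactE_image[OF assms(1), of K "\<lambda>z. ball z (d z / 2)"] d(1) by force
  define \<delta> where "\<delta> = Min (insert 1 ((\<lambda>z. d z / 4) ` D))"
  have \<delta>: "\<delta> > 0" "\<And>z. z \<in> D \<Longrightarrow> \<delta> < d z / 2"
  proof -
    show "\<delta> > 0" unfolding \<delta>_def using D d(1) by (subst Min_gr_iff) auto
    fix z assume z: "z \<in> D"
    then have "\<delta> \<le> d z / 4" unfolding \<delta>_def using D by (intro Min_le) auto
    then show "\<delta> < d z / 2" using d(1)[of z] z D by (auto simp: subset_iff)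
  qed
  show ?thesis
  proof (rule that[OF \<delta>(1)])
    fix z w assume z: "z \<in> K" and w: "dist z w \<le> \<delta>"
    obtain y where y: "y \<in> D" "dist y z < d y / 2" using D(3) z by auto
    have "dist y w < d y" using dist_triangle[of y w z] w \<delta>(2)[OF y(1)] y(2) by linarith
    then have "w \<in> W" "dist (h w) (h y) < e/2" using d(2) y D by blast+
    moreover have "dist (h z) (h y) < e/2" using d(2)[of y z] y D d(1)[of y] by force
    ultimately show "w \<in> W \<and> dist (h w) (h z) < e"
      using dist_triangle[of "h w" "h z" "h y"] by (auto simp: dist_commute)
  qed
qed

section \<open>Gaussian kernels of constant-coefficient elliptic operators\<close>

lemma lborel_integral_scale:
  fixes f :: "'a::euclidean_space \<Rightarrow> real"
  assumes "f \<in> borel_measurable borel" "c > 0"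
  shows "(\<integral>x. f x \<partial>lborel) = c ^ DIM('a) * (\<integral>x. f (c *\<^sub>R x) \<partial>lborel)"
proof -
  have "(\<integral>x. f x \<partial>lborel) = (\<integral>x. f x \<partial>(density (distr lborel borel (\<lambda>x. 0 + c *\<^sub>R x)) (\<lambda>_. \<bar>c\<bar>^DIM('a))))"
    using lborel_affine[of c "0::'a"] assms by simp
  also have "\<dots> = (\<integral>x. (c ^ DIM('a)) *\<^sub>R f x \<partial>(distr lborel borel (\<lambda>x. 0 + c *\<^sub>R x)))"
    using assms by (subst integral_density[symmetric]) (auto simp: ennreal_power)
  also have "\<dots> = c ^ DIM('a) * (\<integral>x. f x \<partial>(distr lborel borel (\<lambda>x. 0 + c *\<^sub>R x)))" by simp
  also have "(\<integral>x. f x \<partial>(distr lborel borel (\<lambda>x. 0 + c *\<^sub>R x))) = (\<integral>x. f (0 + c *\<^sub>R x) \<partial>lborel)"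
    by (rule integral_distr) (use assms in auto)
  finally show ?thesis by simp
qed

lemma gaussian_integrable:
  assumes "c > 0" shows "integrable lborel (\<lambda>x::'a::euclidean_space. exp (- c * (norm x)\<^sup>2))"
proof -
  have 1: "integrable lborel (\<lambda>x::real. exp (- c * x\<^sup>2))"
  proof -
    have "integrable lborel (normal_density 0 (sqrt (1 / (2 * c))))"
      using assms by (intro integrable_normal_density) simp
    then have "integrable lborel (\<lambda>x. sqrt (2 * pi * (sqrt (1/(2*c)))\<^sup>2) * normal_density 0 (sqrt (1 / (2 * c))) x)"
      by simp
    moreover have "sqrt (2 * pi * (sqrt (1/(2*c)))\<^sup>2) * normal_density 0 (sqrt (1 / (2 * c))) x = exp (- c * x\<^sup>2)" for x
      using assms by (simp add: normal_density_def field_simps)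
    ultimately show ?thesis by simp
  qed
  have eq: "exp (- c * (norm x)\<^sup>2) = (\<Prod>b\<in>Basis. exp (- c * (x \<bullet> b)\<^sup>2))" for x :: 'a
    unfolding power2_norm_eq_inner euclidean_inner[of x x]
    by (simp add: exp_sum[symmetric] sum_distrib_left power2_eq_square sum_negf)
  have "(\<integral>\<^sup>+x. ennreal (exp (- c * (norm (x::'a))\<^sup>2)) \<partial>lborel) =
        (\<integral>\<^sup>+x. (\<Prod>b\<in>Basis. ennreal (exp (- c * (x \<bullet> b)\<^sup>2))) \<partial>(lborel::'a measure))"
    unfolding eq by (simp add: prod_ennreal)
  also have "\<dots> = (\<Prod>b\<in>(Basis::'a set). (\<integral>\<^sup>+x. ennreal (exp (- c * x\<^sup>2)) \<partial>lborel))"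
    by (rule nn_integral_lborel_prod[where f="\<lambda>b x. ennreal (exp (- c * x\<^sup>2))"]) auto
  also have "\<dots> < \<infinity>"
    using nn_integral_eq_integral[OF 1] by (simp add: power_less_top_ennreal)
  finally show ?thesis
    by (intro integrableI_nonneg) auto
qed

lemma gaussian_moment_integrable:
  assumes "c > 0" shows "integrable lborel (\<lambda>x::'a::euclidean_space. (norm x)\<^sup>2 * exp (- c * (norm x)\<^sup>2))"
proof (rule Bochner_Integration.integrable_bound)
  show "integrable lborel (\<lambda>x::'a. (2/c) * exp (- (c/2) * (norm x)\<^sup>2))"
    by (rule integrable_mult_right) (use gaussian_integrable[of "c/2"] assms in simp)
  have "(norm x)\<^sup>2 * exp (- c * (norm x)\<^sup>2) \<le> (2/c) * exp (- (c/2) * (norm x)\<^sup>2)" for x :: 'a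
  proof -
    let ?s = "(c/2) * (norm x)\<^sup>2"
    have "?s \<le> exp ?s" using exp_ge_add_one_self[of ?s] by linarith
    then have "?s * exp (- c * (norm x)\<^sup>2) \<le> exp ?s * exp (- c * (norm x)\<^sup>2)" by (intro mult_right_mono) auto
    also have "\<dots> = exp (- (c/2) * (norm x)\<^sup>2)" by (simp add: exp_add[symmetric] algebra_simps)
    finally show ?thesis using assms by (simp add: field_simps)
  qed
  then show "AE x in lborel. norm ((norm x)\<^sup>2 * exp (- c * (norm (x::'a))\<^sup>2)) \<le> norm ((2/c) * exp (- (c/2) * (norm x)\<^sup>2))"
    using assms by auto
qed measurable

text \<open>
  Up to normalization, the value at time \<open>t\<close> of an \<open>n\<close>-dimensional Gaussian heat kernel on the set where
  its quadratic form equals \<open>q\<close>.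
\<close>

definition heat_level :: "nat \<Rightarrow> real \<Rightarrow> real \<Rightarrow> real" where
  "heat_level n q t = t powr (- (real n / 2)) * exp (- q / (4 * t))"

lemma heat_level_pos: "t > 0 \<Longrightarrow> heat_level n q t > 0"
  by (simp add: heat_level_def)

lemma heat_level_antimono: "t > 0 \<Longrightarrow> q \<le> q' \<Longrightarrow> heat_level n q' t \<le> heat_level n q t"
  unfolding heat_level_def by (intro mult_left_mono) (auto simp: divide_right_mono)

lemma heat_level_deriv:
  assumes "t > 0"
  shows "((\<lambda>t. heat_level n q t) has_real_derivative (q / (4 * t\<^sup>2) - n / (2 * t)) * heat_level n q t) (at t)"
proof -
  have "((\<lambda>t. heat_level n q t) has_real_derivative
     (- (real n / 2)) * t powr (- (real n / 2) - 1) * exp (- q / (4 * t)) + t powr (- (real n / 2)) * (exp (- q / (4 * t)) * (q / (4 * t\<^sup>2)))) (at t)"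
    unfolding heat_level_def using assms
    by (auto intro!: derivative_eq_intros simp: power2_eq_square field_simps)
  moreover have "t powr (- (real n / 2) - 1) = t powr (- (real n / 2)) / t"
    using assms by (simp add: powr_diff)
  ultimately show ?thesis by (simp add: heat_level_def algebra_simps)
qed

lemma heat_level_tendsto: "q > 0 \<Longrightarrow> ((\<lambda>t. heat_level n q t / t) \<longlongrightarrow> 0) (at_right 0)"
  unfolding heat_level_def by real_asymp

text \<open>
  An orthonormal basis with positive weights encodes the elliptic operator \<open>L = \<Sum>\<^sub>b a\<^sub>b \<partial>\<^sub>b\<^sup>2\<close>. Its heat kernel
  is the Gaussian of the dual quadratic form \<open>Q x = \<Sum>\<^sub>b (x \<bullet> b)\<^sup>2 / a\<^sub>b\<close>.
\<close>

locale weighted_frame =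
  fixes B :: "'a::euclidean_space set" and a :: "'a \<Rightarrow> real"
  assumes finite_B: "finite B" and card_B: "card B = DIM('a)"
    and orthonormal: "\<And>b c. b \<in> B \<Longrightarrow> c \<in> B \<Longrightarrow> b \<bullet> c = (if b = c then 1 else 0)"
    and a_pos: "\<And>b. b \<in> B \<Longrightarrow> a b > 0"
begin

lemma B_repr: "(\<Sum>b\<in>B. (x \<bullet> b) *\<^sub>R b) = x"
proof (rule orthonormal_basis_expand)
  show po: "pairwise orthogonal B" using orthonormal by (auto simp: pairwise_def orthogonal_def)
  show "norm i = 1" if "i \<in> B" for i using orthonormal[OF that that] by (simp add: norm_eq_sqrt_inner)
  have "0 \<notin> B" using orthonormal[of 0 0] by auto
  then have "independent B" using po pairwise_orthogonal_independent by blast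
  then have "UNIV \<subseteq> span B" by (intro card_ge_dim_independent) (auto simp: card_B dim_UNIV)
  then show "x \<in> span B" by auto
  show "finite B" by (rule finite_B)
qed

lemma B_norm: "(\<Sum>b\<in>B. (x \<bullet> b)\<^sup>2) = (norm x)\<^sup>2"
proof -
  have "(norm x)\<^sup>2 = x \<bullet> (\<Sum>b\<in>B. (x \<bullet> b) *\<^sub>R b)" by (simp add: B_repr power2_norm_eq_inner)
  also have "\<dots> = (\<Sum>b\<in>B. (x \<bullet> b)\<^sup>2)" by (simp add: inner_sum_right power2_eq_square)
  finally show ?thesis by simp
qed

definition Q :: "'a \<Rightarrow> real" where "Q x = (\<Sum>b\<in>B. (x \<bullet> b)\<^sup>2 / a b)"

definition polar :: "'a \<Rightarrow> 'a \<Rightarrow> real" where "polar x v = (\<Sum>b\<in>B. (x \<bullet> b) * (v \<bullet> b) / a b)"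

definition elliptic :: "('a \<Rightarrow> real) \<Rightarrow> 'a \<Rightarrow> real" where
  "elliptic q z = (\<Sum>b\<in>B. a b * second_deriv q z b b)"

lemma B_nonempty: "B \<noteq> {}" using card_B by auto

definition c0 :: real where "c0 = Min ((\<lambda>b. 1 / a b) ` B)"
definition C0 :: real where "C0 = Max ((\<lambda>b. 1 / a b) ` B)"

lemma c0_pos: "c0 > 0" unfolding c0_def using finite_B B_nonempty a_pos by (subst Min_gr_iff) auto
lemma C0_pos: "C0 > 0" unfolding C0_def using finite_B B_nonempty a_pos by (subst Max_gr_iff) auto

lemma Q_lower: "c0 * (norm x)\<^sup>2 \<le> Q x"
proof -
  have "c0 * (norm x)\<^sup>2 = (\<Sum>b\<in>B. (x \<bullet> b)\<^sup>2 * c0)" by (simp add: B_norm[symmetric] sum_distrib_left mult.commute)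
  also have "\<dots> \<le> (\<Sum>b\<in>B. (x \<bullet> b)\<^sup>2 * (1 / a b))"
    unfolding c0_def using finite_B by (intro sum_mono mult_left_mono Min_le) auto
  finally show ?thesis by (simp add: Q_def)
qed

lemma Q_upper: "Q x \<le> C0 * (norm x)\<^sup>2"
proof -
  have "(\<Sum>b\<in>B. (x \<bullet> b)\<^sup>2 * (1 / a b)) \<le> (\<Sum>b\<in>B. (x \<bullet> b)\<^sup>2 * C0)"
    unfolding C0_def using finite_B by (intro sum_mono mult_left_mono Max_ge) auto
  also have "\<dots> = C0 * (norm x)\<^sup>2" by (simp add: B_norm[symmetric] sum_distrib_left mult.commute)
  finally show ?thesis by (simp add: Q_def)
qed

lemma Q_scale: "Q (c *\<^sub>R x) = c\<^sup>2 * Q x"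
  by (simp add: Q_def sum_distrib_left power_mult_distrib)

lemma Q_nonneg: "Q x \<ge> 0" using Q_lower[of x] c0_pos by (smt (verit) mult_nonneg_nonneg zero_le_power2)

lemma Q_continuous [continuous_intros]: "continuous_on S g \<Longrightarrow> continuous_on S (\<lambda>x. Q (g x))"
  unfolding Q_def using a_pos by (intro continuous_intros) (auto simp: less_imp_neq[symmetric])

lemma Q_measurable [measurable]: "Q \<in> borel_measurable borel"
  using Q_continuous[OF continuous_on_id, of UNIV] by (auto dest: borel_measurable_continuous_onI)

lemma a_nonzero: "b \<in> B \<Longrightarrow> a b \<noteq> 0" using a_pos by force

lemma Q_deriv: "(Q has_derivative (\<lambda>v. 2 * polar x v)) (at x)"
  unfolding Q_def[abs_def] polar_def
  by (auto intro!: derivative_eq_intros sum.cong simp: sum_distrib_left power2_eq_square a_nonzero)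

lemma polar_linear: "bounded_linear (\<lambda>x. polar x v)"
proof -
  have "polar x v = x \<bullet> (\<Sum>b\<in>B. ((v \<bullet> b) / a b) *\<^sub>R b)" for x
    unfolding polar_def by (simp add: inner_sum_right mult.commute)
  then show ?thesis by (simp add: bounded_linear_inner_left)
qed

lemma polar_deriv: "((\<lambda>x. polar x v) has_derivative (\<lambda>w. polar w v)) (at x)"
  by (rule bounded_linear_imp_has_derivative[OF polar_linear])

lemma polar_continuous [continuous_intros]: "continuous_on S g \<Longrightarrow> continuous_on S (\<lambda>x. polar (g x) v)"
  by (rule bounded_linear.continuous_on[OF polar_linear])

lemma polar_frame: "b \<in> B \<Longrightarrow> polar x b = (x \<bullet> b) / a b"
proof -
  assume b: "b \<in> B"
  have "polar x b = (\<Sum>c\<in>B. if c = b then (x \<bullet> b) / a b else 0)"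
    unfolding polar_def by (intro sum.cong refl) (use orthonormal b in auto)
  then show ?thesis using b finite_B by simp
qed

definition Z :: real where "Z = (\<integral>x. exp (- Q x / 4) \<partial>lborel)"

lemma exp_Q_le: "exp (- Q x / 4) \<le> exp (- (c0/4) * (norm x)\<^sup>2)"
  using Q_lower[of x] by simp

lemma exp_Q_integrable: "integrable lborel (\<lambda>x. exp (- Q x / 4))"
  by (rule Bochner_Integration.integrable_bound[OF gaussian_integrable[of "c0/4"]])
    (use c0_pos exp_Q_le in auto)

lemma exp_Q_moment_integrable: "integrable lborel (\<lambda>x. (norm x)\<^sup>2 * exp (- Q x / 4))"
  by (rule Bochner_Integration.integrable_bound[OF gaussian_moment_integrable[of "c0/4"]])
    (use c0_pos exp_Q_le in \<open>auto simp: abs_mult intro!: mult_left_mono\<close>)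

lemma Z_pos: "Z > 0"
proof -
  have "Z \<ge> 0" unfolding Z_def by simp
  moreover have "Z \<noteq> 0"
  proof
    assume "Z = 0"
    then have "AE x in lborel. exp (- Q x / 4) = 0"
      unfolding Z_def using exp_Q_integrable by (subst (asm) integral_nonneg_eq_0_iff_AE) auto
    then have "AE x in (lborel::'a measure). False" by simp
    then have "ae_filter (lborel::'a measure) = bot" by (simp only: eventually_False)
    then show False by (simp add: ae_filter_eq_bot_iff)
  qed
  ultimately show ?thesis by simp
qed

abbreviation heat_at :: "real \<Rightarrow> real \<Rightarrow> real" where "heat_at q t \<equiv> heat_level DIM('a) q t / Z"

definition gauss :: "real \<Rightarrow> 'a \<Rightarrow> real" where "gauss t x = heat_at (Q x) t"

lemma heat_at_pos: "t > 0 \<Longrightarrow> heat_at q t > 0" using heat_level_pos Z_pos by simp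

lemma heat_at_antimono: "t > 0 \<Longrightarrow> q \<le> q' \<Longrightarrow> heat_at q' t \<le> heat_at q t"
  using heat_level_antimono Z_pos by (simp add: divide_right_mono)

lemma heat_at_tendsto: "q > 0 \<Longrightarrow> ((\<lambda>t. heat_at q t / t) \<longlongrightarrow> 0) (at_right 0)"
  using tendsto_divide_zero[OF heat_level_tendsto[where n="DIM('a)"], where c=Z] by (simp add: mult.commute)

lemma heat_at_deriv:
  "t > 0 \<Longrightarrow> ((\<lambda>t. heat_at q t) has_real_derivative (q / (4 * t\<^sup>2) - DIM('a) / (2 * t)) * heat_at q t) (at t)"
  using DERIV_cdivide[OF heat_level_deriv[where n="DIM('a)" and q=q], where c=Z] by simp

lemma gauss_pos: "t > 0 \<Longrightarrow> gauss t x > 0" unfolding gauss_def by (rule heat_at_pos)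

lemma gauss_continuous: "continuous_on UNIV (gauss t)"
  unfolding gauss_def[abs_def] heat_level_def divide_inverse by (intro continuous_intros)

lemma gauss_measurable [measurable]: "gauss t \<in> borel_measurable borel"
  using gauss_continuous by measurable

text \<open>
  Parabolic scaling: at the scale \<open>\<surd>t\<close> every Gaussian looks like the one at time \<open>1\<close>. All mass and
  concentration statements are reduced to that one.
\<close>

lemma gauss_scale: assumes "t > 0" shows "gauss t (sqrt t *\<^sub>R y) * sqrt t ^ DIM('a) = exp (- Q y / 4) / Z"
proof -
  have "sqrt t ^ DIM('a) = t powr (real DIM('a) / 2)"
    using assms by (simp add: powr_half_sqrt[symmetric] powr_powr[symmetric] powr_realpow[symmetric] mult.commute powr_powr)
  then have "t powr (- (real DIM('a) / 2)) * sqrt t ^ DIM('a) = 1" using assms by (simp add: powr_add[symmetric])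
  then show ?thesis using assms by (simp add: gauss_def heat_level_def Q_scale field_simps)
qed

lemma convolve_gauss_scaled:
  assumes "t > 0" "h \<in> borel_measurable borel"
  shows "convolve h (gauss t) x = (\<integral>y. h (x - sqrt t *\<^sub>R y) * (exp (- Q y / 4) / Z) \<partial>lborel)"
proof -
  have "convolve h (gauss t) x = (\<integral>w. gauss t w * h (x - w) \<partial>lborel)"
    using convolve_commute[OF assms(2) gauss_measurable] by (simp add: convolve_def)
  also have "\<dots> = sqrt t ^ DIM('a) * (\<integral>y. gauss t (sqrt t *\<^sub>R y) * h (x - sqrt t *\<^sub>R y) \<partial>lborel)"
    by (rule lborel_integral_scale) (use assms in auto)
  also have "\<dots> = (\<integral>y. sqrt t ^ DIM('a) * (gauss t (sqrt t *\<^sub>R y) * h (x - sqrt t *\<^sub>R y)) \<partial>lborel)" by simp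
  also have "\<dots> = (\<integral>y. h (x - sqrt t *\<^sub>R y) * (gauss t (sqrt t *\<^sub>R y) * sqrt t ^ DIM('a)) \<partial>lborel)"
    by (simp add: mult_ac)
  finally show ?thesis by (simp add: gauss_scale[OF assms(1)])
qed

lemma gauss_integral: "t > 0 \<Longrightarrow> (\<integral>x. gauss t x \<partial>lborel) = 1"
  using convolve_gauss_scaled[of t "\<lambda>x. 1" 0] lborel_integral_reflect[of "gauss t" 0] Z_pos by (simp add: convolve_def Z_def)

lemma gauss_integrable: "t > 0 \<Longrightarrow> integrable lborel (gauss t)"
  using gauss_integral not_integrable_integral_eq[of lborel "gauss t"] by fastforce

lemma continuous_compact_support_uniform:
  fixes h :: "'a \<Rightarrow> real"
  assumes "continuous_on UNIV h" "bounded {x. h x \<noteq> 0}" "e > 0"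
  obtains d where "d > 0" "\<And>x y. dist x y \<le> d \<Longrightarrow> \<bar>h y - h x\<bar> < e"
proof -
  obtain r where r: "\<And>x. h x \<noteq> 0 \<Longrightarrow> norm x \<le> r" using assms(2) unfolding bounded_iff by auto
  obtain d where d: "d > 0" "\<And>z w. z \<in> cball 0 (r + 1) \<Longrightarrow> dist z w \<le> d \<Longrightarrow> w \<in> UNIV \<and> dist (h w) (h z) < e"
    using compact_uniform_nbhd[OF compact_cball open_UNIV subset_UNIV assms(1,3), of 0 "r+1"] by metis
  show ?thesis
  proof (rule that[of "min d 1"])
    fix x y :: 'a assume xy: "dist x y \<le> min d 1"
    show "\<bar>h y - h x\<bar> < e"
    proof (cases "norm x \<le> r + 1")
      case True then show ?thesis using d(2)[of x y] xy by (auto simp: dist_real_def)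
    next
      case False
      then have "norm y > r" using norm_triangle_ineq2[of x y] xy by (simp add: dist_norm)
      then have "h x = 0" "h y = 0" using False r by force+
      then show ?thesis using assms(3) by simp
    qed
  qed (use d in auto)
qed

lemma continuous_compact_support_integrable:
  fixes h :: "'a \<Rightarrow> real"
  assumes "continuous_on UNIV h" "bounded {x. h x \<noteq> 0}"
  shows "integrable lborel h"
proof -
  obtain r where r: "\<And>x. h x \<noteq> 0 \<Longrightarrow> norm x \<le> r" using assms(2) unfolding bounded_iff by auto
  have "integrable lborel (\<lambda>x. indicator (cball 0 r) x *\<^sub>R h x)"
    by (rule borel_integrable_compact) (auto intro: continuous_on_subset[OF assms(1)])
  moreover have "(\<lambda>x. indicator (cball 0 r) x *\<^sub>R h x) = h"
    using r by (auto simp: fun_eq_iff indicator_def)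
  ultimately show ?thesis by simp
qed

text \<open>
  After parabolic scaling the error is an average of \<open>h (x - \<surd>t y) - h x\<close> against a fixed Gaussian. It is
  small for \<open>\<surd>t |y| \<le> d\<close> by uniform continuity, and elsewhere it is dominated by a multiple of
  \<open>t |y|\<^sup>2 / d\<^sup>2\<close>, whose average is a second moment.
\<close>

lemma approx_identity:
  fixes h :: "'a \<Rightarrow> real"
  assumes h: "continuous_on UNIV h" "bounded {x. h x \<noteq> 0}" and e: "e > 0"
  obtains t0 where "t0 > 0" "\<And>t x. 0 < t \<Longrightarrow> t < t0 \<Longrightarrow> \<bar>convolve h (gauss t) x - h x\<bar> \<le> e"
proof -
  obtain d where d: "d > 0" "\<And>x y. dist x y \<le> d \<Longrightarrow> \<bar>h y - h x\<bar> < e/2"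
    using continuous_compact_support_uniform[OF h, of "e/2"] e by (metis half_gt_zero)
  obtain C where C: "C \<ge> 0" "\<And>x. \<bar>h x\<bar> \<le> C" using continuous_compact_support_bounded[OF h] by metis
  have hm[measurable]: "h \<in> borel_measurable borel" using h(1) by measurable
  define M2 where "M2 = (\<integral>y. (norm y)\<^sup>2 * (exp (- Q y / 4) / Z) \<partial>lborel)"
  have M2: "M2 \<ge> 0" unfolding M2_def using Z_pos by (intro integral_nonneg_AE) auto
  have intE: "integrable lborel (\<lambda>y. exp (- Q y / 4) / Z)" using exp_Q_integrable by simp
  have intM: "integrable lborel (\<lambda>y. (norm y)\<^sup>2 * (exp (- Q y / 4) / Z))"
    using integrable_divide[OF exp_Q_moment_integrable, of Z] by simp
  have one: "(\<integral>y. exp (- Q y / 4) / Z \<partial>lborel) = 1" using Z_pos by (simp add: Z_def)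
  define t0 where "t0 = e * d\<^sup>2 / (4 * (C + 1) * (M2 + 1))"
  have t0: "t0 > 0" unfolding t0_def using e d C M2 by (intro divide_pos_pos mult_pos_pos) auto
  show ?thesis
  proof (rule that[OF t0])
    fix t x assume t: "0 < t" "t < t0"
    let ?E = "\<lambda>y. exp (- Q y / 4) / Z"
    have Enn: "?E y \<ge> 0" for y using Z_pos by simp
    have bnd: "\<bar>h (x - sqrt t *\<^sub>R y) - h x\<bar> \<le> e/2 + (2 * C * t / d\<^sup>2) * (norm y)\<^sup>2" for y
    proof (cases "norm (sqrt t *\<^sub>R y) \<le> d")
      case True
      then have "dist x (x - sqrt t *\<^sub>R y) \<le> d" by (simp add: dist_norm)
      from d(2)[OF this] show ?thesis using C t
        by (smt (verit) divide_nonneg_nonneg mult_nonneg_nonneg zero_le_power2)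
    next
      case False
      then have "d\<^sup>2 \<le> (norm (sqrt t *\<^sub>R y))\<^sup>2" using d by (intro power_mono) auto
      also have "\<dots> = t * (norm y)\<^sup>2" using t by (simp add: power_mult_distrib)
      finally have "1 \<le> t * (norm y)\<^sup>2 / d\<^sup>2" using d by simp
      then have "2 * C * 1 \<le> 2 * C * (t * (norm y)\<^sup>2 / d\<^sup>2)" using C by (intro mult_left_mono) auto
      moreover have "\<bar>h (x - sqrt t *\<^sub>R y) - h x\<bar> \<le> 2 * C"
        using C(2)[of x] C(2)[of "x - sqrt t *\<^sub>R y"] by linarith
      ultimately show ?thesis using e by (simp add: mult.assoc)
    qed
    have int1: "integrable lborel (\<lambda>y. h (x - sqrt t *\<^sub>R y) * ?E y)"
    proof (rule Bochner_Integration.integrable_bound)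
      show "integrable lborel (\<lambda>y. C * ?E y)" using intE by (rule integrable_mult_right)
      show "AE y in lborel. norm (h (x - sqrt t *\<^sub>R y) * ?E y) \<le> norm (C * ?E y)"
      proof (rule AE_I2)
        fix y show "norm (h (x - sqrt t *\<^sub>R y) * ?E y) \<le> norm (C * ?E y)"
          using mult_right_mono[OF C(2) Enn] C(1) Enn[of y] by (simp only: real_norm_def abs_mult abs_of_nonneg)
      qed
    qed measurable
    have "convolve h (gauss t) x - h x = (\<integral>y. h (x - sqrt t *\<^sub>R y) * ?E y \<partial>lborel) - h x * (\<integral>y. ?E y \<partial>lborel)"
      using one by (simp add: convolve_gauss_scaled[OF t(1) hm])
    also have "\<dots> = (\<integral>y. h (x - sqrt t *\<^sub>R y) * ?E y \<partial>lborel) - (\<integral>y. h x * ?E y \<partial>lborel)" by simp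
    also have "\<dots> = (\<integral>y. h (x - sqrt t *\<^sub>R y) * ?E y - h x * ?E y \<partial>lborel)"
      by (rule Bochner_Integration.integral_diff[symmetric, OF int1 integrable_mult_right[OF intE]])
    finally have eq: "convolve h (gauss t) x - h x = (\<integral>y. h (x - sqrt t *\<^sub>R y) * ?E y - h x * ?E y \<partial>lborel)" .
    have intD: "integrable lborel (\<lambda>y. h (x - sqrt t *\<^sub>R y) * ?E y - h x * ?E y)"
      by (rule Bochner_Integration.integrable_diff[OF int1 integrable_mult_right[OF intE]])
    have intB: "integrable lborel (\<lambda>y. (e/2) * ?E y + (2 * C * t / d\<^sup>2) * ((norm y)\<^sup>2 * ?E y))"
      by (rule Bochner_Integration.integrable_add[OF integrable_mult_right[OF intE] integrable_mult_right[OF intM]])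
    have "\<bar>convolve h (gauss t) x - h x\<bar> \<le> (\<integral>y. \<bar>h (x - sqrt t *\<^sub>R y) * ?E y - h x * ?E y\<bar> \<partial>lborel)"
      unfolding eq by (rule integral_abs_bound)
    also have "\<dots> \<le> (\<integral>y. (e/2) * ?E y + (2 * C * t / d\<^sup>2) * ((norm y)\<^sup>2 * ?E y) \<partial>lborel)"
    proof (rule integral_mono[OF integrable_abs[OF intD] intB])
      fix y
      have "\<bar>h (x - sqrt t *\<^sub>R y) * ?E y - h x * ?E y\<bar> = \<bar>h (x - sqrt t *\<^sub>R y) - h x\<bar> * ?E y"
        using Enn[of y] by (simp only: left_diff_distrib[symmetric] abs_mult abs_of_nonneg)
      also have "\<dots> \<le> (e/2 + (2 * C * t / d\<^sup>2) * (norm y)\<^sup>2) * ?E y"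
        using bnd[of y] Enn[of y] by (intro mult_right_mono)
      finally show "\<bar>h (x - sqrt t *\<^sub>R y) * ?E y - h x * ?E y\<bar> \<le> (e/2) * ?E y + (2 * C * t / d\<^sup>2) * ((norm y)\<^sup>2 * ?E y)"
        by (simp only: distrib_right mult.assoc)
    qed
    also have "\<dots> = (e/2) * (\<integral>y. ?E y \<partial>lborel) + (2 * C * t / d\<^sup>2) * M2"
      unfolding M2_def
      by (subst Bochner_Integration.integral_add[OF integrable_mult_right[OF intE] integrable_mult_right[OF intM]])
        (simp only: integral_mult_right_zero)
    also have "\<dots> = e/2 + (2 * C * t / d\<^sup>2) * M2" by (simp only: one mult_1_right)
    also have "(2 * C * t / d\<^sup>2) * M2 \<le> e / 2"
    proof -
      have "t * (4 * (C + 1) * (M2 + 1)) < e * d\<^sup>2"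
        using t(2) C M2 unfolding t0_def by (subst (asm) pos_less_divide_eq) auto
      moreover have "t * (4 * C * M2) \<le> t * (4 * (C + 1) * (M2 + 1))"
        using t C M2 by (intro mult_left_mono mult_mono) auto
      ultimately have "2 * C * t * M2 \<le> (e/2) * d\<^sup>2" by (simp add: algebra_simps)
      then show ?thesis using d by (simp add: pos_divide_le_eq mult.assoc)
    qed
    finally show "\<bar>convolve h (gauss t) x - h x\<bar> \<le> e" by simp
  qed
qed

lemma gauss_has_derivative: "(gauss t has_derivative (\<lambda>v. (- 1 / (2 * t)) * (polar x v * gauss t x))) (at x)"
proof -
  have "(gauss t has_derivative (\<lambda>v. (t powr (- (real DIM('a) / 2)) * (exp (- Q x / (4 * t)) * (- (2 * polar x v) / (4 * t)))) / Z)) (at x)"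
    unfolding gauss_def[abs_def] heat_level_def divide_inverse
    by (auto intro!: derivative_eq_intros Q_deriv)
  moreover have "(\<lambda>v. (t powr (- (real DIM('a) / 2)) * (exp (- Q x / (4 * t)) * (- (2 * polar x v) / (4 * t)))) / Z)
      = (\<lambda>v. (- 1 / (2 * t)) * (polar x v * gauss t x))"
    by (auto simp: fun_eq_iff gauss_def heat_level_def)
  ultimately show ?thesis by simp
qed

lemma gauss_has_derivative2:
  "((\<lambda>x. (- 1 / (2 * t)) * (polar x v * gauss t x)) has_derivative
     (\<lambda>w. (- 1 / (2 * t)) * (polar x v * ((- 1 / (2 * t)) * (polar x w * gauss t x)) + polar w v * gauss t x))) (at x)"
  by (intro has_derivative_mult_right has_derivative_mult polar_deriv gauss_has_derivative)

lemma gauss_C2: "Ck_on 2 (gauss t) UNIV"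
proof -
  have "Ck_on (Suc 0) (\<lambda>x. (- 1 / (2 * t)) * (polar x v * gauss t x)) UNIV" for v
  proof (rule Ck_on_SucI[OF open_UNIV gauss_has_derivative2])
    fix w
    show "Ck_on 0 (\<lambda>x. (- 1 / (2 * t)) * (polar x v * ((- 1 / (2 * t)) * (polar x w * gauss t x)) + polar w v * gauss t x)) UNIV"
      unfolding Ck_on.simps by (intro continuous_intros gauss_continuous)
  qed
  then have "Ck_on (Suc (Suc 0)) (gauss t) UNIV"
    by (rule Ck_on_SucI[OF open_UNIV gauss_has_derivative])
  then show ?thesis by (simp only: numeral_2_eq_2)
qed

lemma gauss_second_deriv:
  "second_deriv (gauss t) x v w = (polar x v * polar x w / (4 * t\<^sup>2) - polar v w / (2 * t)) * gauss t x"
proof -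
  have "polar w v = polar v w" by (simp add: polar_def mult_ac)
  then show ?thesis
    unfolding second_deriv_eqI[OF open_UNIV UNIV_I gauss_has_derivative gauss_has_derivative2]
    by (simp add: algebra_simps power2_eq_square)
qed

lemma elliptic_gauss: "elliptic (gauss t) x = (Q x / (4 * t\<^sup>2) - DIM('a) / (2 * t)) * gauss t x"
proof -
  have "elliptic (gauss t) x = (\<Sum>b\<in>B. ((x \<bullet> b)\<^sup>2 / a b / (4 * t\<^sup>2) - 1 / (2 * t)) * gauss t x)"
    unfolding elliptic_def
  proof (intro sum.cong refl)
    fix b assume b: "b \<in> B"
    have "a b * (polar x b * polar x b / (4 * t\<^sup>2) - polar b b / (2 * t)) = (x \<bullet> b)\<^sup>2 / a b / (4 * t\<^sup>2) - 1 / (2 * t)"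
      using a_nonzero[OF b] orthonormal[OF b b] by (simp add: polar_frame[OF b] field_simps power2_eq_square)
    then show "a b * second_deriv (gauss t) x b b = ((x \<bullet> b)\<^sup>2 / a b / (4 * t\<^sup>2) - 1 / (2 * t)) * gauss t x"
      by (simp add: gauss_second_deriv mult.assoc[symmetric])
  qed
  also have "\<dots> = ((\<Sum>b\<in>B. (x \<bullet> b)\<^sup>2 / a b) / (4 * t\<^sup>2) - card B / (2 * t)) * gauss t x"
    by (simp add: sum_distrib_right[symmetric] sum_subtractf sum_divide_distrib)
  finally show ?thesis by (simp add: Q_def card_B)
qed

lemma gauss_heat_equation: "t > 0 \<Longrightarrow> ((\<lambda>t. gauss t x) has_real_derivative elliptic (gauss t) x) (at t)"
  unfolding elliptic_gauss using heat_at_deriv[of t "Q x"] by (simp add: gauss_def)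

lemma elliptic_convolve:
  assumes "convolvable g k" "Ck_on 2 k UNIV"
  shows "elliptic (convolve g k) x = convolve g (elliptic k) x"
proof -
  have int: "integrable lborel (\<lambda>w. g w * second_deriv k (x - w) b b)" for b
  proof -
    have 2: "Ck_on (Suc (Suc 0)) k UNIV" using assms(2) by (simp add: numeral_2_eq_2)
    have c: "convolvable g (\<lambda>x. second_deriv k x b b)"
      unfolding second_deriv_def using convolvable_deriv[OF convolvable_deriv[OF assms(1)]] by simp
    have cont: "continuous_on UNIV (\<lambda>x. second_deriv k x b b)" using C2_continuous_second_deriv[OF assms(2)] .
    then have m: "(\<lambda>x. second_deriv k x b b) \<in> borel_measurable borel" by measurable
    obtain C where C: "C \<ge> 0" "\<And>p w. norm p \<le> norm x \<Longrightarrow> g w \<noteq> 0 \<Longrightarrow> \<bar>second_deriv k (p - w) b b\<bar> \<le> C"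
      using convolvable_bound[OF c cont] by metis
    have g: "integrable lborel g" using assms(1) by (simp add: convolvable_def)
    show ?thesis
    proof (rule Bochner_Integration.integrable_bound[OF integrable_mult_right[OF g, of C]])
      show "(\<lambda>w. g w * second_deriv k (x - w) b b) \<in> borel_measurable lborel"
        using g measurable_compose[OF _ m, of "\<lambda>w. x - w"] by measurable
      show "AE w in lborel. norm (g w * second_deriv k (x - w) b b) \<le> norm (C * g w)"
      proof (rule AE_I2)
        fix w show "norm (g w * second_deriv k (x - w) b b) \<le> norm (C * g w)"
          using C(2)[of x w] C(1) by (cases "g w = 0") (auto simp: abs_mult mult.commute intro: mult_right_mono)
      qed
    qed
  qed
  have "elliptic (convolve g k) x = (\<Sum>b\<in>B. \<integral>w. a b * (g w * second_deriv k (x - w) b b) \<partial>lborel)"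
    unfolding elliptic_def by (simp add: convolve_second_deriv[OF assms] convolve_def)
  also have "\<dots> = (\<integral>w. (\<Sum>b\<in>B. a b * (g w * second_deriv k (x - w) b b)) \<partial>lborel)"
    by (rule Bochner_Integration.integral_sum[symmetric]) (rule integrable_mult_right[OF int])
  also have "\<dots> = convolve g (elliptic k) x"
    unfolding convolve_def elliptic_def by (simp add: sum_distrib_left mult_ac)
  finally show ?thesis .
qed

lemma elliptic_continuous: "Ck_on 2 k S \<Longrightarrow> continuous_on S (elliptic k)"
  unfolding elliptic_def[abs_def] by (intro continuous_intros C2_continuous_second_deriv)

lemma gauss_joint_continuous: "continuous_on ({0<..} \<times> UNIV) (\<lambda>(t, x). gauss t x)"
  unfolding gauss_def[abs_def] heat_level_def case_prod_beta
  by (intro continuous_intros) (use Z_pos in auto)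

text \<open>
  The kernel solves the heat equation, and for \<open>\<tau>\<close> near \<open>t\<close> the time derivative of the kernel is bounded
  on the support of \<open>h\<close>, so the equation passes through the convolution integral.
\<close>

lemma heat_conv_time_deriv:
  assumes h: "continuous_on UNIV h" "bounded {x. h x \<noteq> 0}" and t: "t > 0"
  shows "((\<lambda>t. convolve h (gauss t) x) has_real_derivative elliptic (convolve h (gauss t)) x) (at t)"
proof -
  have hi: "integrable lborel h" by (rule continuous_compact_support_integrable[OF h])
  have cc: "convolvable h (gauss t)" for t using hi h(2) by (simp add: convolvable_def)
  obtain r where r: "\<And>w. h w \<noteq> 0 \<Longrightarrow> norm w \<le> r" using h(2) unfolding bounded_iff by auto
  let ?T = "{t/2..3*t/2} \<times> cball (0::'a) (norm x + r)"
  let ?G' = "\<lambda>(s, y). (Q y / (4 * s\<^sup>2) - DIM('a) / (2 * s)) * gauss s y"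
  have comp: "compact ?T" by (intro compact_Times) auto
  have Gc: "continuous_on ?T (\<lambda>(t, x). gauss t x)"
    by (rule continuous_on_subset[OF gauss_joint_continuous]) (use t in auto)
  then have G'c: "continuous_on ?T ?G'"
    unfolding case_prod_beta by (intro continuous_intros) (use t in auto)
  obtain C0 where C0: "\<And>s y. (s, y) \<in> ?T \<Longrightarrow> \<bar>gauss s y\<bar> \<le> C0"
    using compact_imp_bounded[OF compact_continuous_image[OF Gc comp]] unfolding bounded_iff by fastforce
  obtain C1 where C1: "\<And>s y. (s, y) \<in> ?T \<Longrightarrow> \<bar>?G' (s, y)\<bar> \<le> C1"
    using compact_imp_bounded[OF compact_continuous_image[OF G'c comp]] unfolding bounded_iff by fastforce
  have inT: "(s, x - w) \<in> ?T" if "dist s t < t/2" "h w \<noteq> 0" for s w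
    using that r[OF that(2)] norm_triangle_ineq4[of x w] by (auto simp: dist_real_def abs_if split: if_splits)
  have "((\<lambda>t. \<integral>w. h w * gauss t (x - w) \<partial>lborel) has_derivative
        (\<lambda>s. \<integral>w. h w * (s * ?G' (t, x - w)) \<partial>lborel)) (at t)"
  proof (rule has_derivative_integral_param[where r="t/2" and C="\<bar>C1\<bar>" and C0=C0 and k' = "\<lambda>p w s. s * ?G' (p, x - w)"])
    show "((\<lambda>t. gauss t (x - w)) has_derivative (\<lambda>s. s * ?G' (p, x - w))) (at p)" if "dist p t < t/2" for p w
    proof -
      have "p > 0" using that by (auto simp: dist_real_def abs_if split: if_splits)
      from gauss_heat_equation[OF this, of "x - w"] show ?thesis
        by (simp add: has_field_derivative_def elliptic_gauss mult_commute_abs)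
    qed
    show "\<bar>s * ?G' (p, x - w)\<bar> \<le> \<bar>C1\<bar> * norm s" if "dist p t < t/2" "h w \<noteq> 0" for p w s
      using C1[OF inT[OF that]] mult_right_mono[of "\<bar>?G' (p, x - w)\<bar>" "\<bar>C1\<bar>" "\<bar>s\<bar>"]
      by (simp add: abs_mult mult.commute)
    show "\<bar>gauss p (x - w)\<bar> \<le> C0" if "dist p t < t/2" "h w \<noteq> 0" for p w using C0[OF inT[OF that]] .
  qed (use t hi in auto)
  moreover have "(\<integral>w. h w * (s * ?G' (t, x - w)) \<partial>lborel) = s * elliptic (convolve h (gauss t)) x" for s
  proof -
    have "(\<integral>w. h w * (s * ?G' (t, x - w)) \<partial>lborel) = (\<integral>w. s * (h w * elliptic (gauss t) (x - w)) \<partial>lborel)"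
      by (simp add: elliptic_gauss mult_ac)
    also have "\<dots> = s * convolve h (elliptic (gauss t)) x" by (simp add: convolve_def)
    finally show ?thesis by (simp add: elliptic_convolve[OF cc gauss_C2])
  qed
  ultimately show ?thesis by (simp add: convolve_def[symmetric] has_field_derivative_def mult_commute_abs)
qed

lemma heat_conv_joint_continuous:
  assumes h: "continuous_on UNIV h" "bounded {x. h x \<noteq> 0}"
  shows "continuous_on ({0<..} \<times> UNIV) (\<lambda>(t, x). convolve h (gauss t) x)"
proof (rule continuous_at_imp_continuous_on, clarify)
  fix t :: real and x :: 'a assume t: "t > 0" 
  have hi: "integrable lborel h" by (rule continuous_compact_support_integrable[OF h])
  obtain r where r: "\<And>w. h w \<noteq> 0 \<Longrightarrow> norm w \<le> r" using h(2) unfolding bounded_iff by auto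
  let ?T = "{t/2..3*t/2} \<times> cball (0::'a) (norm x + t/2 + r)"
  have comp: "compact ?T" by (intro compact_Times) auto
  have Gc: "continuous_on ?T (\<lambda>(t, x). gauss t x)"
    by (rule continuous_on_subset[OF gauss_joint_continuous]) (use t in auto)
  obtain C0 where C0: "\<And>s y. (s, y) \<in> ?T \<Longrightarrow> \<bar>gauss s y\<bar> \<le> C0"
    using compact_imp_bounded[OF compact_continuous_image[OF Gc comp]] unfolding bounded_iff by fastforce
  have "isCont (\<lambda>p. \<integral>w. h w * gauss (fst p) (snd p - w) \<partial>lborel) (t, x)"
  proof (rule continuous_integral_param[where r="t/2" and C=C0, OF hi])
    show "isCont (\<lambda>p. gauss (fst p) (snd p - w)) (t, x)" for w
    proof -
      have o: "open ({0::real<..} \<times> (UNIV::'a set))" by (intro open_Times) auto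
      have "continuous_on ({0<..} \<times> UNIV) (\<lambda>p. (fst p, snd p - w))" by (intro continuous_intros)
      then have "continuous_on ({0<..} \<times> UNIV) ((\<lambda>(t, x). gauss t x) \<circ> (\<lambda>p. (fst p, snd p - w)))"
        by (rule continuous_on_compose) (auto intro: continuous_on_subset[OF gauss_joint_continuous])
      then show ?thesis using t o by (auto simp: continuous_on_eq_continuous_at o_def)
    qed
    show "\<bar>gauss (fst p) (snd p - w)\<bar> \<le> C0" if "dist p (t, x) < t/2" "h w \<noteq> 0" for p w
    proof (rule C0)
      have 1: "dist (fst p) t < t/2" "dist (snd p) x < t/2"
        using that(1) dist_fst_le[of p "(t, x)"] dist_snd_le[of p "(t, x)"] by auto
      have "norm (snd p - w) \<le> norm (snd p - x) + norm x + norm w"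
        using norm_triangle_ineq4[of "snd p" w] norm_triangle_sub[of "snd p" x] by linarith
      then show "(fst p, snd p - w) \<in> ?T"
        using 1 r[OF that(2)] by (auto simp: dist_real_def dist_norm abs_if norm_minus_commute[of w] split: if_splits)
    qed
  qed (use t in auto)
  then show "isCont (\<lambda>(t, x). convolve h (gauss t) x) (t, x)" by (simp add: convolve_def case_prod_unfold)
qed

section \<open>The truncated heat kernel\<close>

text \<open>
  Subtracting the value that the Gaussian takes on the level set \<open>Q = q\<close> leaves a kernel supported in a
  fixed ellipsoid. The loss \<open>heat_at q t\<close> is \<open>o(t)\<close> as \<open>t\<close> tends to \<open>0\<close>, so neither the total mass nor the
  infinitesimal generator changes in the limit.
\<close>

definition heat_trunc :: "real \<Rightarrow> real \<Rightarrow> 'a \<Rightarrow> real" where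
  "heat_trunc q t x = max 0 (gauss t x - heat_at q t)"

lemma heat_trunc_nonneg: "heat_trunc q t x \<ge> 0" by (simp add: heat_trunc_def)

lemma heat_trunc_le_gauss: "t > 0 \<Longrightarrow> heat_trunc q t x \<le> gauss t x"
  using heat_at_pos[of t q] gauss_pos[of t x] by (simp add: heat_trunc_def)

lemma heat_trunc_close: "t > 0 \<Longrightarrow> \<bar>heat_trunc q t x - gauss t x\<bar> \<le> heat_at q t"
  using heat_at_pos[of t q] gauss_pos[of t x] by (auto simp: heat_trunc_def max_def)

lemma heat_trunc_support: "t > 0 \<Longrightarrow> q \<le> Q x \<Longrightarrow> heat_trunc q t x = 0"
  using heat_at_antimono[of t q "Q x"] by (simp add: heat_trunc_def gauss_def)

lemma heat_trunc_continuous: "continuous_on UNIV (heat_trunc q t)"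
  unfolding heat_trunc_def[abs_def] by (intro continuous_intros gauss_continuous)

lemma heat_trunc_measurable [measurable]: "heat_trunc q t \<in> borel_measurable borel"
  using heat_trunc_continuous by measurable

lemma heat_trunc_support_ball: "t > 0 \<Longrightarrow> r > 0 \<Longrightarrow> norm x \<ge> r \<Longrightarrow> heat_trunc (c0 * r\<^sup>2) t x = 0"
proof (rule heat_trunc_support)
  assume "r > 0" "norm x \<ge> r"
  then have "c0 * r\<^sup>2 \<le> c0 * (norm x)\<^sup>2" using c0_pos by (intro mult_left_mono power_mono) auto
  then show "c0 * r\<^sup>2 \<le> Q x" using Q_lower[of x] by linarith
qed

lemma heat_trunc_bounded: "t > 0 \<Longrightarrow> \<bar>heat_trunc q t x\<bar> \<le> heat_at 0 t"
  using heat_trunc_le_gauss[of t q x] heat_trunc_nonneg[of q t x] heat_at_antimono[OF _ Q_nonneg, of t x]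
  unfolding gauss_def by linarith

lemma heat_trunc_integrable: "t > 0 \<Longrightarrow> integrable lborel (heat_trunc q t)"
  by (rule Bochner_Integration.integrable_bound[OF gauss_integrable])
    (auto simp: heat_trunc_nonneg intro!: order_trans[OF heat_trunc_le_gauss])

lemma heat_trunc_integral_le_1: "t > 0 \<Longrightarrow> (\<integral>x. heat_trunc q t x \<partial>lborel) \<le> 1"
  using integral_mono[OF heat_trunc_integrable gauss_integrable, of t t q] heat_trunc_le_gauss[of t q] gauss_integral[of t] by simp

lemma convolve_heat_trunc_close:
  assumes "t > 0" "integrable lborel h"
  shows "\<bar>convolve h (heat_trunc q t) x - convolve h (gauss t) x\<bar> \<le> heat_at q t * (\<integral>w. \<bar>h w\<bar> \<partial>lborel)"
proof -
  have "\<bar>gauss t y\<bar> \<le> heat_at 0 t" for y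
    using gauss_pos[OF assms(1), of y] heat_at_antimono[OF assms(1) Q_nonneg, of y] by (simp add: gauss_def)
  then have i1: "integrable lborel (\<lambda>w. h w * gauss t (x - w))"
    by (rule bounded_kernel_integrable[OF assms(2) gauss_measurable])
  have i2: "integrable lborel (\<lambda>w. h w * heat_trunc q t (x - w))"
    by (rule bounded_kernel_integrable[OF assms(2) heat_trunc_measurable heat_trunc_bounded[OF assms(1)]])
  have "\<bar>convolve h (heat_trunc q t) x - convolve h (gauss t) x\<bar> = \<bar>\<integral>w. h w * (heat_trunc q t (x - w) - gauss t (x - w)) \<partial>lborel\<bar>"
    unfolding convolve_def using i1 i2 by (simp add: right_diff_distrib)
  also have "\<dots> \<le> (\<integral>w. \<bar>h w * (heat_trunc q t (x - w) - gauss t (x - w))\<bar> \<partial>lborel)" by (rule integral_abs_bound)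
  also have "\<dots> \<le> (\<integral>w. heat_at q t * \<bar>h w\<bar> \<partial>lborel)"
  proof (rule integral_mono)
    show "integrable lborel (\<lambda>w. \<bar>h w * (heat_trunc q t (x - w) - gauss t (x - w))\<bar>)"
      using i1 i2 by (intro integrable_abs) (simp add: right_diff_distrib)
    show "integrable lborel (\<lambda>w. heat_at q t * \<bar>h w\<bar>)" using assms by auto
    fix w show "\<bar>h w * (heat_trunc q t (x - w) - gauss t (x - w))\<bar> \<le> heat_at q t * \<bar>h w\<bar>"
      using mult_left_mono[OF heat_trunc_close[OF assms(1)], of "\<bar>h w\<bar>" q "x - w"] by (simp add: abs_mult mult.commute)
  qed
  finally show ?thesis by simp
qed

text \<open>
  For the full Gaussian, \<open>d/ds (\<theta> * gauss s) = (L \<theta>) * gauss s\<close>, which is uniformly close to \<open>L \<theta>\<close> for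
  small \<open>s\<close>; the mean value theorem turns this into a statement on difference quotients. Truncation
  changes the quotient by a multiple of \<open>heat_at q t / t\<close>, which tends to \<open>0\<close>.
\<close>

lemma heat_trunc_generator:
  assumes th: "Ck_on 2 \<theta> UNIV" "bounded {x. \<theta> x \<noteq> 0}" and q: "q > 0" and e: "e > 0"
  obtains t0 where "t0 > 0"
    "\<And>t x. 0 < t \<Longrightarrow> t < t0 \<Longrightarrow> \<bar>(convolve \<theta> (heat_trunc q t) x - \<theta> x) / t - elliptic \<theta> x\<bar> \<le> e"
proof -
  have tc: "continuous_on UNIV \<theta>" using Ck_on_continuous[OF th(1)] .
  have ti: "integrable lborel \<theta>" by (rule continuous_compact_support_integrable[OF tc th(2)])
  have Lc: "continuous_on UNIV (elliptic \<theta>)" using elliptic_continuous[OF th(1)] .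
  have Ls: "bounded {x. elliptic \<theta> x \<noteq> 0}"
  proof (rule bounded_subset[OF bounded_closure[OF th(2)]], rule subsetI, rule ccontr)
    fix x assume x: "x \<in> {x. elliptic \<theta> x \<noteq> 0}" "x \<notin> closure {x. \<theta> x \<noteq> 0}"
    have "second_deriv \<theta> x b b = second_deriv (\<lambda>x. 0::real) x b b" for b
      by (rule second_deriv_cong_open[of "- closure {x. \<theta> x \<noteq> 0}"])
        (use x(2) closure_subset[of "{x. \<theta> x \<noteq> 0}"] in auto)
    then have "elliptic \<theta> x = 0" by (simp add: elliptic_def second_deriv_const)
    then show False using x by simp
  qed
  obtain t1 where t1: "t1 > 0" "\<And>t x. 0 < t \<Longrightarrow> t < t1 \<Longrightarrow> \<bar>convolve (elliptic \<theta>) (gauss t) x - elliptic \<theta> x\<bar> \<le> e/2"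
    using approx_identity[OF Lc Ls, of "e/2"] e by (metis half_gt_zero)
  have swap: "elliptic (convolve \<theta> (gauss t)) x = convolve (elliptic \<theta>) (gauss t) x" if "t > 0" for t x
  proof -
    have cc: "convolvable (gauss t) \<theta>" using gauss_integrable[OF that] th(2) by (simp add: convolvable_def)
    have tm: "\<theta> \<in> borel_measurable borel" using tc by measurable
    have Lm: "elliptic \<theta> \<in> borel_measurable borel" using Lc by measurable
    have "convolve \<theta> (gauss t) = convolve (gauss t) \<theta>" using convolve_commute[OF tm gauss_measurable] by auto
    then have "elliptic (convolve \<theta> (gauss t)) x = convolve (gauss t) (elliptic \<theta>) x" by (simp add: elliptic_convolve[OF cc th(1)])
    also have "\<dots> = convolve (elliptic \<theta>) (gauss t) x" by (rule convolve_commute[OF gauss_measurable Lm])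
    finally show ?thesis .
  qed
  have main: "\<bar>convolve \<theta> (gauss t) x - \<theta> x - t * elliptic \<theta> x\<bar> \<le> t * (e/2)" if t: "0 < t" "t < t1" for t x
  proof (rule field_le_epsilon)
    fix \<epsilon> :: real assume eps: "\<epsilon> > 0"
    obtain s1 where s1: "s1 > 0" "\<And>t x. 0 < t \<Longrightarrow> t < s1 \<Longrightarrow> \<bar>convolve \<theta> (gauss t) x - \<theta> x\<bar> \<le> \<epsilon>/2"
      using approx_identity[OF tc th(2), of "\<epsilon>/2"] eps by (metis half_gt_zero)
    define c where "c = \<bar>elliptic \<theta> x\<bar> + 1"
    have c: "c > 0" by (simp add: c_def)
    define s where "s = min (t/2) (min (s1/2) (\<epsilon>/2/c))"
    have s: "0 < s" "s < t" "s < s1" "s * c \<le> \<epsilon>/2"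
    proof -
      show "0 < s" "s < t" "s < s1" using t s1 eps c by (auto simp: s_def min_def)
      have "s \<le> \<epsilon>/2/c" by (simp add: s_def)
      then show "s * c \<le> \<epsilon>/2" using c by (simp add: pos_le_divide_eq)
    qed
    have "((\<lambda>t. convolve \<theta> (gauss t) x) has_real_derivative elliptic (convolve \<theta> (gauss \<tau>)) x) (at \<tau>)" if "s \<le> \<tau>" "\<tau> \<le> t" for \<tau>
      by (rule heat_conv_time_deriv[OF tc th(2)]) (use that s in auto)
    from MVT2[OF s(2) this] obtain \<tau> where \<tau>: "s < \<tau>" "\<tau> < t"
      "convolve \<theta> (gauss t) x - convolve \<theta> (gauss s) x = (t - s) * elliptic (convolve \<theta> (gauss \<tau>)) x" by auto
    have "\<bar>convolve (elliptic \<theta>) (gauss \<tau>) x - elliptic \<theta> x\<bar> \<le> e/2" using t1(2)[of \<tau> x] \<tau> s t by auto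
    then have "\<bar>(t - s) * (elliptic (convolve \<theta> (gauss \<tau>)) x - elliptic \<theta> x)\<bar> \<le> (t - s) * (e/2)"
      using s \<tau> swap[of \<tau> x] by (simp add: abs_mult mult_left_mono)
    then have 1: "\<bar>convolve \<theta> (gauss t) x - convolve \<theta> (gauss s) x - (t - s) * elliptic \<theta> x\<bar> \<le> (t - s) * (e/2)"
      using \<tau>(3) by (simp add: right_diff_distrib)
    have 2: "\<bar>convolve \<theta> (gauss s) x - \<theta> x\<bar> \<le> \<epsilon>/2" using s1(2) s by auto
    have "s * \<bar>elliptic \<theta> x\<bar> \<le> s * c" using s by (intro mult_left_mono) (auto simp: c_def)
    then have "s * \<bar>elliptic \<theta> x\<bar> \<le> \<epsilon>/2" using s(4) by (rule order_trans)
    then have 3: "\<bar>s * elliptic \<theta> x\<bar> \<le> \<epsilon>/2" using s(1) by (simp add: abs_mult)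
    have 4: "(t - s) * (e/2) \<le> t * (e/2)" using s e by (intro mult_right_mono) auto
    have "convolve \<theta> (gauss t) x - \<theta> x - t * elliptic \<theta> x = (convolve \<theta> (gauss t) x - convolve \<theta> (gauss s) x - (t - s) * elliptic \<theta> x)
       + (convolve \<theta> (gauss s) x - \<theta> x) - s * elliptic \<theta> x" by (simp add: algebra_simps)
    then show "\<bar>convolve \<theta> (gauss t) x - \<theta> x - t * elliptic \<theta> x\<bar> \<le> t * (e/2) + \<epsilon>"
      using 1 2 3 4 by linarith
  qed
  define I where "I = (\<integral>w. \<bar>\<theta> w\<bar> \<partial>lborel)"
  have I: "I \<ge> 0" by (simp add: I_def)
  have "\<forall>\<^sub>F t in at_right 0. heat_at q t / t < e / (2 * (I + 1))"
    using order_tendstoD(2)[OF heat_at_tendsto[OF q], of "e / (2 * (I + 1))"] e I by simp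
  then obtain t2 where t2: "t2 > 0" "\<And>t. 0 < t \<Longrightarrow> t < t2 \<Longrightarrow> heat_at q t / t < e / (2 * (I + 1))"
    unfolding eventually_at_right_field by auto
  show ?thesis
  proof (rule that[of "min t1 t2"])
    fix t x assume t: "0 < t" "t < min t1 t2"
    have a: "\<bar>convolve \<theta> (heat_trunc q t) x - convolve \<theta> (gauss t) x\<bar> \<le> heat_at q t * I"
      unfolding I_def by (rule convolve_heat_trunc_close[OF t(1) ti])
    have "heat_at q t / t * I \<le> e / (2 * (I + 1)) * I"
      using t2(2)[of t] t I by (intro mult_right_mono) auto
    also have "\<dots> \<le> e / 2" using I e by (simp add: field_simps)
    finally have "t * (heat_at q t / t * I) \<le> t * (e / 2)" using t(1) by (intro mult_left_mono) auto
    moreover have "t * (heat_at q t / t * I) = heat_at q t * I" using t(1) by simp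
    ultimately have "heat_at q t * I \<le> t * (e / 2)" by simp
    then have "\<bar>convolve \<theta> (heat_trunc q t) x - \<theta> x - t * elliptic \<theta> x\<bar> \<le> t * e"
    proof -
      have "\<bar>convolve \<theta> (gauss t) x - \<theta> x - t * elliptic \<theta> x\<bar> \<le> t * (e/2)" using main[of t x] t by simp
      moreover have "t * (e/2) + t * (e/2) = t * e" by simp
      ultimately show ?thesis using a \<open>heat_at q t * I \<le> t * (e / 2)\<close> by linarith
    qed
    then have "\<bar>convolve \<theta> (heat_trunc q t) x - \<theta> x - t * elliptic \<theta> x\<bar> / t \<le> e"
      using t(1) by (simp add: pos_divide_le_eq mult.commute)
    moreover have "(convolve \<theta> (heat_trunc q t) x - \<theta> x) / t - elliptic \<theta> x = (convolve \<theta> (heat_trunc q t) x - \<theta> x - t * elliptic \<theta> x) / t"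
      using t(1) by (simp add: field_simps)
    ultimately show "\<bar>(convolve \<theta> (heat_trunc q t) x - \<theta> x) / t - elliptic \<theta> x\<bar> \<le> e" using t(1) by simp
  qed (use t1 t2 in auto)
qed

text \<open>
  The mass is at least the convolution at \<open>0\<close> with a tent function of height \<open>1\<close>, which tends to \<open>1\<close>.
\<close>

lemma heat_trunc_mass:
  assumes q: "q > 0" and e: "e > 0"
  obtains t0 where "t0 > 0" "\<And>t. 0 < t \<Longrightarrow> t < t0 \<Longrightarrow> (\<integral>x. heat_trunc q t x \<partial>lborel) \<ge> 1 - e"
proof -
  define h where "h x = max 0 (1 - norm x)" for x :: 'a
  have hc: "continuous_on UNIV h" unfolding h_def by (intro continuous_intros)
  have hb: "bounded {x. h x \<noteq> 0}" unfolding h_def bounded_iff by (intro exI[of _ 1]) auto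
  have hi: "integrable lborel h" by (rule continuous_compact_support_integrable[OF hc hb])
  have h01: "0 \<le> h x" "h x \<le> 1" for x by (auto simp: h_def)
  obtain t1 where t1: "t1 > 0" "\<And>t x. 0 < t \<Longrightarrow> t < t1 \<Longrightarrow> \<bar>convolve h (gauss t) x - h x\<bar> \<le> e/2"
    using approx_identity[OF hc hb, of "e/2"] e by (metis half_gt_zero)
  define I where "I = (\<integral>w. \<bar>h w\<bar> \<partial>lborel)"
  have I: "I \<ge> 0" by (simp add: I_def)
  have "\<forall>\<^sub>F t in at_right 0. heat_at q t / t < e / (2 * (I + 1))"
    using order_tendstoD(2)[OF heat_at_tendsto[OF q], of "e / (2 * (I + 1))"] e I by simp
  then obtain t2 where t2: "t2 > 0" "\<And>t. 0 < t \<Longrightarrow> t < t2 \<Longrightarrow> heat_at q t / t < e / (2 * (I + 1))"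
    unfolding eventually_at_right_field by auto
  show ?thesis
  proof (rule that[of "min t1 (min t2 1)"])
    fix t :: real assume t: "0 < t" "t < min t1 (min t2 1)"
    have a: "\<bar>convolve h (heat_trunc q t) 0 - convolve h (gauss t) 0\<bar> \<le> heat_at q t * I"
      unfolding I_def by (rule convolve_heat_trunc_close[OF t(1) hi])
    have "heat_at q t * I \<le> heat_at q t / t * I"
    proof (rule mult_right_mono[OF _ I])
      have "heat_at q t * t \<le> heat_at q t * 1" using t heat_at_pos[OF t(1), of q] by (intro mult_left_mono) auto
      then show "heat_at q t \<le> heat_at q t / t" using t(1) by (subst pos_le_divide_eq) auto
    qed
    also have "\<dots> \<le> e / (2 * (I + 1)) * I"
      using t2(2)[of t] t I by (intro mult_right_mono) auto
    also have "\<dots> \<le> e / 2" using I e by (simp add: field_simps)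
    finally have "heat_at q t * I \<le> e / 2" .
    moreover have "\<bar>convolve h (gauss t) 0 - 1\<bar> \<le> e / 2" using t1(2)[of t 0] t by (simp add: h_def)
    ultimately have "convolve h (heat_trunc q t) 0 \<ge> 1 - e" using a by linarith
    moreover have "convolve h (heat_trunc q t) 0 \<le> (\<integral>w. heat_trunc q t w \<partial>lborel)"
    proof -
      have ki: "integrable lborel (\<lambda>w. heat_trunc q t (0 - w))"
        by (rule lborel_integrable_reflect[OF heat_trunc_integrable[OF t(1)]])
      have "convolve h (heat_trunc q t) 0 \<le> (\<integral>w. heat_trunc q t (0 - w) \<partial>lborel)"
        unfolding convolve_def
      proof (rule integral_mono[OF _ ki])
        show "integrable lborel (\<lambda>w. h w * heat_trunc q t (0 - w))"
        proof (rule Bochner_Integration.integrable_bound[OF ki])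
          show "AE w in lborel. norm (h w * heat_trunc q t (0 - w)) \<le> norm (heat_trunc q t (0 - w))"
            using h01 heat_trunc_nonneg by (auto simp: abs_mult intro!: mult_left_le_one_le)
        qed (use hi in measurable)
        show "h w * heat_trunc q t (0 - w) \<le> heat_trunc q t (0 - w)" for w
          using h01 heat_trunc_nonneg by (intro mult_left_le_one_le) auto
      qed
      also have "\<dots> = (\<integral>w. heat_trunc q t w \<partial>lborel)" by (rule lborel_integral_reflect) simp
      finally show ?thesis .
    qed
    ultimately show "(\<integral>w. heat_trunc q t w \<partial>lborel) \<ge> 1 - e" by linarith
  qed (use t1 t2 in auto)
qed

end

section \<open>Upper semicontinuous functions and decreasing approximation\<close>

lemma usc_attains_max:
  fixes h :: "'a::topological_space \<Rightarrow> 'b::linorder"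
  assumes K: "compact K" "K \<noteq> {}" and usc: "\<And>c. openin (top_of_set K) {x\<in>K. h x < c}"
  obtains m where "m \<in> K" "\<And>x. x \<in> K \<Longrightarrow> h x \<le> h m"
proof -
  have "\<exists>m\<in>K. \<forall>x\<in>K. h x \<le> h m"
  proof (rule ccontr)
    assume "\<not> ?thesis"
    then have *: "\<And>m. m \<in> K \<Longrightarrow> \<exists>x\<in>K. h m < h x" by (meson not_le)
    let ?C = "(\<lambda>x. {y\<in>K. h y < h x}) ` K"
    have "K \<subseteq> \<Union>?C" using * by blast
    moreover have "\<forall>c\<in>?C. openin (top_of_set K) c" using usc by auto
    ultimately have "\<exists>D\<subseteq>?C. finite D \<and> K \<subseteq> \<Union>D"
      using K(1)[unfolded compact_eq_openin_cover, rule_format, of ?C] by blast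
    then obtain D where D: "D \<subseteq> ?C" "finite D" "K \<subseteq> \<Union>D" by blast
    then obtain E where E: "E \<subseteq> K" "finite E" "D = (\<lambda>x. {y\<in>K. h y < h x}) ` E"
      by (meson finite_subset_image)
    have "E \<noteq> {}" using E(3) D(3) K(2) by auto
    then have "Max (h ` E) \<in> h ` E" using E(2) by (intro Max_in) auto
    then obtain e where e: "e \<in> E" "h e = Max (h ` E)" by auto
    then obtain x where "x \<in> E" "h e < h x" using E D(3) by blast
    moreover from this have "h x \<le> Max (h ` E)" using E(2) by (intro Max_ge) auto
    ultimately show False using e by simp
  qed
  then show ?thesis using that by blast
qed

text \<open>
  The approximations are the sup-convolutions \<open>\<phi>\<^sub>j x = sup\<^sub>y (max (h y) (- j) - j dist x y)\<close>. The cut-off at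
  \<open>- j\<close> keeps them finite, the penalty makes them \<open>j\<close>-Lipschitz, and for large \<open>j\<close> only points near \<open>x\<close>
  contribute, where \<open>h\<close> is not much larger than \<open>h x\<close>.
\<close>

lemma usc_decreasing_continuous_approx:
  fixes h :: "'a::metric_space \<Rightarrow> ereal"
  assumes usc: "\<And>c. open {x. h x < c}" and neg: "\<And>x. h x \<le> 0"
  obtains \<phi> :: "nat \<Rightarrow> 'a \<Rightarrow> real" where "\<And>j. continuous_on UNIV (\<phi> j)" "\<And>j x. \<phi> j x \<le> 0"
    "\<And>j x. h x \<le> ereal (\<phi> j x)" "\<And>j x. \<phi> (Suc j) x \<le> \<phi> j x"
    "\<And>x. (\<lambda>j. ereal (\<phi> j x)) \<longlonglongrightarrow> h x"
proof -
  define g where "g j y = real_of_ereal (max (h y) (- ereal (real j)))" for j y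
  have g: "ereal (g j y) = max (h y) (- ereal (real j))" for j y
  proof -
    have "max (h y) (- ereal (real j)) \<le> 0" using neg[of y] by (simp add: max_def)
    moreover have "max (h y) (- ereal (real j)) \<ge> ereal (- real j)" by simp
    ultimately have "\<bar>max (h y) (- ereal (real j))\<bar> \<noteq> \<infinity>"
      by (metis ereal_infty_less_eq2(1,2) PInfty_neq_ereal(1) MInfty_neq_ereal(1) abs_eq_infinity_cases zero_ereal_def)
    then show ?thesis unfolding g_def by (simp add: ereal_real)
  qed
  have gneg: "g j y \<le> 0" for j y
  proof -
    have "ereal (g j y) \<le> 0" unfolding g using neg[of y] by (simp add: max_def)
    then show ?thesis by simp
  qed
  have gdec: "g (Suc j) y \<le> g j y" for j y
  proof -
    have "ereal (g (Suc j) y) \<le> ereal (g j y)" unfolding g by (intro max.mono) auto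
    then show ?thesis by simp
  qed
  define \<phi> where "\<phi> j x = (SUP y. g j y - real j * dist x y)" for j x
  have term_neg: "g j y - real j * dist x y \<le> 0" for j x y
    using gneg[of j y] mult_nonneg_nonneg[OF of_nat_0_le_iff zero_le_dist, of j x y] by linarith
  have bdd: "bdd_above (range (\<lambda>y. g j y - real j * dist x y))" for j x
    using term_neg by (intro bdd_aboveI[of _ 0]) blast
  have ub: "g j y - real j * dist x y \<le> \<phi> j x" for j x y
    unfolding \<phi>_def by (rule cSUP_upper[OF _ bdd]) simp
  have least: "\<phi> j x \<le> c" if "\<And>y. g j y - real j * dist x y \<le> c" for j x c
    unfolding \<phi>_def using that by (intro cSUP_least) auto
  have neg': "\<phi> j x \<le> 0" for j x
    by (rule least) (rule term_neg)
  have lip: "\<phi> j x \<le> \<phi> j x' + real j * dist x x'" for j x x'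
  proof (rule least)
    fix y
    have "real j * dist x' y \<le> real j * (dist x x' + dist x y)"
      using dist_triangle[of x' y x] by (intro mult_left_mono) (auto simp: dist_commute)
    then show "g j y - real j * dist x y \<le> \<phi> j x' + real j * dist x x'"
      using ub[of j y x'] by (simp add: distrib_left)
  qed
  have lip2: "\<bar>\<phi> j x - \<phi> j x'\<bar> \<le> real j * dist x x'" for j x x'
    using lip[of j x x'] lip[of j x' x] by (auto simp: dist_commute abs_le_iff)
  have cont: "continuous_on UNIV (\<phi> j)" for j
  proof (rule continuous_at_imp_continuous_on, rule ballI)
    fix x
    show "isCont (\<phi> j) x" unfolding continuous_at_eps_delta
    proof (intro allI impI)
      fix e :: real assume e: "e > 0"
      show "\<exists>d>0. \<forall>x'. dist x' x < d \<longrightarrow> dist (\<phi> j x') (\<phi> j x) < e"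
      proof (intro exI[of _ "e / (real j + 1)"] conjI allI impI)
        fix x' assume d: "dist x' x < e / (real j + 1)"
        have "real j * dist x' x \<le> (real j + 1) * dist x' x" by (simp add: mult_right_mono)
        also have "\<dots> < e" using d by (simp add: pos_less_divide_eq mult.commute add_nonneg_pos)
        finally show "dist (\<phi> j x') (\<phi> j x) < e" using lip2[of j x' x] by (simp add: dist_real_def)
      qed (use e in \<open>simp add: add_nonneg_pos\<close>)
    qed
  qed
  have above: "h x \<le> ereal (\<phi> j x)" for j x
  proof -
    have "h x \<le> ereal (g j x)" unfolding g by simp
    also have "\<dots> \<le> ereal (\<phi> j x)" using ub[of j x x] by simp
    finally show ?thesis .
  qed
  have dec: "\<phi> (Suc j) x \<le> \<phi> j x" for j x
  proof (rule least)
    fix y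
    have "g (Suc j) y - real (Suc j) * dist x y \<le> g j y - real j * dist x y"
    proof -
      have "real (Suc j) * dist x y = real j * dist x y + dist x y" by (simp add: distrib_right)
      then show ?thesis using gdec[of j y] zero_le_dist[of x y] by linarith
    qed
    then show "g (Suc j) y - real (Suc j) * dist x y \<le> \<phi> j x" using ub[of j y x] by linarith
  qed
  have lim: "(\<lambda>j. ereal (\<phi> j x)) \<longlonglongrightarrow> h x" for x
  proof (rule order_tendstoI)
    fix a assume "a < h x"
    then show "\<forall>\<^sub>F j in sequentially. a < ereal (\<phi> j x)" using above less_le_trans by (intro always_eventually) blast
  next
    fix a assume "h x < a"
    then obtain c where c: "h x < ereal c" "ereal c < a" using ereal_dense2 by blast
    then obtain r where r: "r > 0" "\<And>y. dist x y < r \<Longrightarrow> h y < ereal c"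
      using usc[of "ereal c"] unfolding open_contains_ball by (auto simp: subset_iff)
    obtain n :: nat where n: "real n \<ge> \<bar>c\<bar> / r" "real n \<ge> \<bar>c\<bar>"
      using real_arch_simple[of "max (\<bar>c\<bar> / r) \<bar>c\<bar>"] by auto
    have "\<phi> j x \<le> c" if j: "j \<ge> n" for j
    proof (rule least)
      fix y
      show "g j y - real j * dist x y \<le> c"
      proof (cases "dist x y < r")
        case True
        have "- real j \<le> c" using n(2) j by linarith
        then have "ereal (g j y) \<le> ereal c" unfolding g using r(2)[OF True] by auto
        then have "g j y \<le> c" by simp
        moreover have "0 \<le> real j * dist x y" by simp
        ultimately show ?thesis by linarith
      next
        case False
        have "\<bar>c\<bar> \<le> real n * r" using n(1) r(1) by (simp add: pos_divide_le_eq)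
        also have "\<dots> \<le> real j * dist x y" using j False r(1) by (intro mult_mono) auto
        finally show ?thesis using gneg[of j y] by linarith
      qed
    qed
    then show "\<forall>\<^sub>F j in sequentially. ereal (\<phi> j x) < a"
      using c(2) unfolding eventually_sequentially by (meson ereal_less_eq(3) le_less_trans)
  qed
  show ?thesis using that[OF cont neg' above dec lim] .
qed

lemma usc_on_subset_shift:
  fixes u :: "'a::topological_space \<Rightarrow> ereal"
  assumes usc: "\<And>c. openin (top_of_set \<Omega>) {z\<in>\<Omega>. u z < c}" and "C \<subseteq> \<Omega>"
  shows "openin (top_of_set C) {z\<in>C. u z - ereal k < c}"
proof -
  obtain W where W: "open W" "{z\<in>\<Omega>. u z < c + ereal k} = \<Omega> \<inter> W"
    using usc[of "c + ereal k"] unfolding openin_open by auto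
  have "{z\<in>C. u z - ereal k < c} = C \<inter> W"
    using assms(2) W(2) by (auto simp: ereal_minus_less set_eq_iff)
  then show ?thesis using W(1) unfolding openin_open by auto
qed

lemma usc_extension_minus_infinity:
  fixes u :: "'a::t2_space \<Rightarrow> ereal"
  assumes K: "compact K" and usc: "\<And>c. openin (top_of_set K) {x\<in>K. u x < c}"
  shows "open {x. (if x \<in> K then u x else -\<infinity>) < c}"
proof (cases "c = -\<infinity>")
  case False
  obtain W where W: "open W" "{x\<in>K. u x < c} = K \<inter> W"
    using usc[of c] unfolding openin_open by auto
  have "{x. (if x \<in> K then u x else -\<infinity>) < c} = W \<union> (- K)"
  proof (intro set_eqI)
    fix y show "y \<in> {x. (if x \<in> K then u x else -\<infinity>) < c} \<longleftrightarrow> y \<in> W \<union> (- K)"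
      using W(2) False by (cases "y \<in> K") auto
  qed
  then show ?thesis using W(1) K compact_imp_closed by auto
qed auto

text \<open>
  Dini's argument: the sets on which the decreasing continuous approximations of \<open>h\<close> have dropped below
  \<open>v\<close> are open, increase, and cover the compact set.
\<close>

lemma continuous_between_usc_and_continuous:
  fixes h :: "'a::metric_space \<Rightarrow> ereal"
  assumes usc: "\<And>c. open {x. h x < c}" and neg: "\<And>x. h x \<le> 0"
    and K: "compact K" and v: "continuous_on K v" "\<And>x. x \<in> K \<Longrightarrow> h x < ereal (v x)"
  obtains \<phi> where "continuous_on UNIV \<phi>" "\<And>x. h x \<le> ereal (\<phi> x)" "\<And>x. x \<in> K \<Longrightarrow> \<phi> x < v x"
proof -
  obtain \<Phi> :: "nat \<Rightarrow> 'a \<Rightarrow> real" where \<Phi>: "\<And>j. continuous_on UNIV (\<Phi> j)"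
    "\<And>j x. h x \<le> ereal (\<Phi> j x)" "\<And>j x. \<Phi> (Suc j) x \<le> \<Phi> j x" "\<And>x. (\<lambda>j. ereal (\<Phi> j x)) \<longlonglongrightarrow> h x"
    using usc_decreasing_continuous_approx[of h, OF usc neg] by metis
  let ?S = "\<lambda>j. {x\<in>K. \<Phi> j x < v x}"
  have pt: "\<exists>j. \<Phi> j x < v x" if x: "x \<in> K" for x
  proof -
    from order_tendstoD(2)[OF \<Phi>(4) v(2)[OF x]] obtain j where "ereal (\<Phi> j x) < ereal (v x)"
      by (auto simp: eventually_sequentially)
    then show ?thesis by (intro exI[of _ j]) simp
  qed
  have "openin (top_of_set K) (?S j)" for j
  proof -
    have "openin (top_of_set K) (K \<inter> (\<lambda>x. v x - \<Phi> j x) -` {0<..})"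
      by (rule continuous_openin_preimage_gen) (auto intro!: continuous_intros v(1) continuous_on_subset[OF \<Phi>(1)])
    moreover have "K \<inter> (\<lambda>x. v x - \<Phi> j x) -` {0<..} = ?S j" by auto
    ultimately show ?thesis by simp
  qed
  then have "\<forall>c\<in>range ?S. openin (top_of_set K) c" by blast
  moreover have "K \<subseteq> \<Union> (range ?S)" using pt by blast
  ultimately obtain D where D: "D \<subseteq> range ?S" "finite D" "K \<subseteq> \<Union>D"
    using K[unfolded compact_eq_openin_cover, rule_format, of "range ?S"] by blast
  obtain J where J: "finite J" "D = ?S ` J" using finite_subset_image[OF D(2,1)] by blast
  define m where "m = Max (insert 0 J)"
  have "\<Phi> m x < v x" if x: "x \<in> K" for x
  proof -
    obtain i where i: "i \<in> J" "\<Phi> i x < v x" using D(3) J(2) x by blast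
    have "i \<le> m" unfolding m_def using J(1) i(1) by simp
    then have "\<Phi> m x \<le> \<Phi> i x" by (rule lift_Suc_antimono_le[of "\<lambda>j. \<Phi> j x", OF \<Phi>(3)])
    then show ?thesis using i(2) by simp
  qed
  then show ?thesis using that \<Phi>(1,2) by blast
qed

text \<open>
  It suffices to undercut one continuous strict majorant at a time by a member of the class \<open>P\<close>: starting
  from continuous strict majorants \<open>\<psi>\<^sub>j\<close> that decrease to \<open>u\<close>, choose \<open>w\<^sub>j\<^sub>+\<^sub>1\<close> strictly between \<open>u\<close> and the
  minimum of \<open>w\<^sub>j\<close> and \<open>\<psi>\<^sub>j\<^sub>+\<^sub>1\<close>.
\<close>

lemma decreasing_approx_by_interlacing:
  fixes u :: "'a::metric_space \<Rightarrow> ereal"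
  assumes K: "compact K" and usc: "\<And>c. openin (top_of_set K) {x\<in>K. u x < c}"
    and fin: "\<And>x. x \<in> K \<Longrightarrow> u x \<noteq> \<infinity>"
    and step: "\<And>v. continuous_on K v \<Longrightarrow> (\<And>x. x \<in> K \<Longrightarrow> u x < ereal (v x)) \<Longrightarrow>
       \<exists>w. P w \<and> continuous_on K w \<and> (\<forall>x\<in>K. u x < ereal (w x) \<and> w x < v x)"
  obtains w :: "nat \<Rightarrow> 'a \<Rightarrow> real" where "\<And>j. P (w j)" "\<And>j x. x \<in> K \<Longrightarrow> w (Suc j) x \<le> w j x"
    "\<And>x. x \<in> K \<Longrightarrow> (\<lambda>j. ereal (w j x)) \<longlonglongrightarrow> u x"
proof -
  obtain M where M: "\<And>x. x \<in> K \<Longrightarrow> u x \<le> ereal M"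
  proof (cases "K = {}")
    case False
    obtain m where m: "m \<in> K" "\<And>x. x \<in> K \<Longrightarrow> u x \<le> u m"
      using usc_attains_max[OF K False usc] by metis
    have "u m \<le> ereal (real_of_ereal (u m))" using fin[OF m(1)] by (cases "u m") auto
    then show ?thesis using that m(2) order_trans by blast
  qed (use that in auto)
  define h where "h x = (if x \<in> K then u x - ereal M else - \<infinity>)" for x
  have husc: "open {x. h x < c}" for c
    unfolding h_def by (rule usc_extension_minus_infinity[OF K usc_on_subset_shift[OF usc order_refl]])
  have hneg: "h x \<le> 0" for x using M[of x] by (auto simp: h_def ereal_minus_le zero_ereal_def[symmetric])
  obtain \<phi> :: "nat \<Rightarrow> 'a \<Rightarrow> real" where \<phi>: "\<And>j. continuous_on UNIV (\<phi> j)"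
    "\<And>j x. h x \<le> ereal (\<phi> j x)" "\<And>x. (\<lambda>j. ereal (\<phi> j x)) \<longlonglongrightarrow> h x"
    using usc_decreasing_continuous_approx[of h, OF husc hneg] by metis
  define \<psi> where "\<psi> j x = \<phi> j x + M + 1 / real (Suc j)" for j x
  have \<psi>c: "continuous_on K (\<psi> j)" for j unfolding \<psi>_def
    by (intro continuous_intros continuous_on_subset[OF \<phi>(1)]) auto
  have \<psi>u: "u x < ereal (\<psi> j x)" if "x \<in> K" for j x
  proof -
    have "u x - ereal M \<le> ereal (\<phi> j x)" using \<phi>(2)[of x j] that by (simp add: h_def)
    then have "u x \<le> ereal (\<phi> j x + M)" by (simp add: ereal_minus_le)
    also have "\<dots> < ereal (\<psi> j x)" by (simp add: \<psi>_def)
    finally show ?thesis .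
  qed
  have \<psi>lim: "(\<lambda>j. ereal (\<psi> j x)) \<longlonglongrightarrow> u x" if "x \<in> K" for x
  proof -
    have "(\<lambda>j. 1 / real (Suc j)) \<longlonglongrightarrow> 0" using LIMSEQ_inverse_real_of_nat by (simp add: inverse_eq_divide)
    then have "(\<lambda>j. M + 1 / real (Suc j)) \<longlonglongrightarrow> M + 0" by (intro tendsto_intros)
    then have "(\<lambda>j. ereal (M + 1 / real (Suc j))) \<longlonglongrightarrow> ereal M" by simp
    then have "(\<lambda>j. ereal (\<phi> j x) + ereal (M + 1 / real (Suc j))) \<longlonglongrightarrow> h x + ereal M"
      by (intro tendsto_add_ereal_general \<phi>(3)) auto
    moreover have "h x + ereal M = u x" using that fin[OF that] by (cases "u x") (auto simp: h_def)
    ultimately show ?thesis by (simp add: \<psi>_def add.assoc)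
  qed
  let ?R = "\<lambda>j w. P w \<and> continuous_on K w \<and> (\<forall>x\<in>K. u x < ereal (w x) \<and> w x < \<psi> j x)"
  have "\<exists>w. \<forall>j. ?R j (w j) \<and> (\<forall>x\<in>K. w (Suc j) x < w j x)"
  proof (rule dependent_nat_choice)
    show "\<exists>w. ?R 0 w" using step[OF \<psi>c \<psi>u] by blast
    fix w j assume w: "?R j w"
    have "\<exists>w'. P w' \<and> continuous_on K w' \<and> (\<forall>x\<in>K. u x < ereal (w' x) \<and> w' x < min (w x) (\<psi> (Suc j) x))"
    proof (rule step)
      show "continuous_on K (\<lambda>x. min (w x) (\<psi> (Suc j) x))" using w \<psi>c by (intro continuous_intros) auto
      show "u x < ereal (min (w x) (\<psi> (Suc j) x))" if "x \<in> K" for x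
        using w \<psi>u[OF that] that by (simp add: min_def)
    qed
    then show "\<exists>w'. ?R (Suc j) w' \<and> (\<forall>x\<in>K. w' x < w x)" by auto
  qed
  then obtain w where w: "\<And>j. ?R j (w j)" "\<And>j x. x \<in> K \<Longrightarrow> w (Suc j) x < w j x" by blast
  show ?thesis
  proof (rule that[of w])
    show "P (w j)" for j using w(1) by blast
    show "w (Suc j) x \<le> w j x" if "x \<in> K" for j x using w(2)[OF that] less_imp_le by blast
    show "(\<lambda>j. ereal (w j x)) \<longlonglongrightarrow> u x" if "x \<in> K" for x
      by (rule tendsto_sandwich[OF _ _ tendsto_const \<psi>lim[OF that]])
        (use w(1) that in \<open>auto intro!: always_eventually less_imp_le\<close>)
  qed
qed

section \<open>The Gaussian submean inequality for linear viscosity subsolutions\<close>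

text \<open>
  The relation \<^const>\<open>upper_test\<close> on an arbitrary normed space, as the linear theory lives on Euclidean
  spaces of any dimension.
\<close>

definition touches_above ::
  "('a::real_normed_vector) set \<Rightarrow> ('a \<Rightarrow> ereal) \<Rightarrow> 'a \<Rightarrow> ('a \<Rightarrow> real) \<Rightarrow> bool" where
  "touches_above \<Omega> u z0 q \<longleftrightarrow>
     (\<exists>U. open U \<and> z0 \<in> U \<and> U \<subseteq> \<Omega> \<and> Ck_on 2 q U \<and>
          u z0 = ereal (q z0) \<and> (\<forall>z\<in>U. u z \<le> ereal (q z)))"

lemma touches_above_mono: "touches_above S u z q \<Longrightarrow> S \<subseteq> T \<Longrightarrow> touches_above T u z q"
  unfolding touches_above_def by blast

lemma touches_above_shift:
  assumes "touches_above \<Omega> (\<lambda>z. u z - ereal c) z0 q"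
  shows "touches_above \<Omega> u z0 (\<lambda>z. q z + c)"
proof -
  obtain U where U: "open U" "z0 \<in> U" "U \<subseteq> \<Omega>" "Ck_on 2 q U"
    "u z0 - ereal c = ereal (q z0)" "\<And>z. z \<in> U \<Longrightarrow> u z - ereal c \<le> ereal (q z)"
    using assms unfolding touches_above_def by blast
  have "Ck_on 2 (\<lambda>z. q z + c) U" by (intro Ck_on_add Ck_on_const U)
  moreover have "u z0 = ereal (q z0 + c)" using U(5) by (cases "u z0") auto
  moreover have "u z \<le> ereal (q z + c)" if "z \<in> U" for z using U(6)[OF that] by (cases "u z") auto
  ultimately show ?thesis unfolding touches_above_def using U by blast
qed

context weighted_frame
begin

definition linear_visc_sub :: "'a set \<Rightarrow> ('a \<Rightarrow> ereal) \<Rightarrow> ('a \<Rightarrow> real) \<Rightarrow> bool" where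
  "linear_visc_sub \<Omega> u g \<longleftrightarrow> (\<forall>z\<in>\<Omega>. \<forall>q. touches_above \<Omega> u z q \<longrightarrow> g z \<le> elliptic q z)"

lemma elliptic_shift:
  assumes "Ck_on 2 q U" "open U" "z \<in> U"
  shows "elliptic (\<lambda>z. q z + c) z = elliptic q z"
  unfolding elliptic_def using second_deriv_add[OF assms(1) Ck_on_const[OF assms(2)] assms(2,3)]
  by (simp add: second_deriv_const)

text \<open>
  Parabolic comparison on the cylinder \<open>[s, t1] \<times> cball x0 R\<close>. The function
  \<open>v(t, x) = \<integral> \<phi> y (gauss t (x - y) - heat_at q t) dy - m t + \<eta> + \<eta> t\<close> is a strict supersolution of
  \<open>\<partial>\<^sub>t v = L v - m\<close> as long as \<open>heat_at q\<close> increases in time, which is the condition \<open>2 n T \<le> q\<close> for the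
  dimension \<open>n\<close>. The subtracted level makes the kernel nonpositive for \<open>x\<close> on the sphere of radius \<open>R\<close> and
  \<open>y\<close> in the support of \<open>\<phi> \<le> 0\<close>, so that \<open>v\<close> is at least \<open>-1\<close> on the lateral boundary and hence above \<open>u\<close>.
\<close>

lemma heat_comparison_eta:
  assumes usc: "\<And>c. openin (top_of_set (cball x0 R)) {z\<in>cball x0 R. u z < c}"
    and um1: "\<And>z. z \<in> cball x0 R \<Longrightarrow> u z \<le> -1"
    and visc: "\<And>x p. x \<in> ball x0 R \<Longrightarrow> touches_above (ball x0 R) u x p \<Longrightarrow> m \<le> elliptic p x"
    and \<phi>: "continuous_on UNIV \<phi>" "\<And>y. \<phi> y \<le> 0" "\<And>y. y \<notin> ball x0 \<rho> \<Longrightarrow> \<phi> y = 0"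
      "\<And>z. z \<in> cball x0 R \<Longrightarrow> u z \<le> ereal (\<phi> z)"
    and \<rho>: "0 < \<rho>" "\<rho> < R" and q: "q > 0" "q \<le> c0 * (R - \<rho>)\<^sup>2" "2 * real DIM('a) * T \<le> q" "\<bar>m\<bar> * T \<le> 1"
    and t1: "0 < t1" "t1 \<le> T" and eta: "\<eta> > 0" and x1: "x1 \<in> cball x0 R"
  shows "u x1 \<le> ereal (convolve \<phi> (gauss t1) x1 - heat_at q t1 * (\<integral>y. \<phi> y \<partial>lborel) - m * t1 + \<eta> + \<eta> * t1)"
proof (rule ccontr)
  define I where "I = (\<integral>y. \<phi> y \<partial>lborel)"
  define v where "v t x = convolve \<phi> (gauss t) x - heat_at q t * I - m * t + \<eta> + \<eta> * t" for t x
  assume "\<not> ?thesis"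
  then have bad: "ereal (v t1 x1) < u x1" by (simp add: v_def I_def)
  have \<phi>b: "bounded {x. \<phi> x \<noteq> 0}"
    using \<phi>(3) by (intro bounded_subset[OF bounded_ball[of x0 \<rho>]] subsetI) blast
  have \<phi>i: "integrable lborel \<phi>" by (rule continuous_compact_support_integrable[OF \<phi>(1) \<phi>b])
  have I0: "I \<le> 0"
  proof -
    have "0 \<le> (\<integral>y. - \<phi> y \<partial>lborel)" using \<phi>(2) by (intro integral_nonneg_AE AE_I2) simp
    then show ?thesis by (simp add: I_def)
  qed
  obtain s0 where s0: "s0 > 0" "\<And>t x. 0 < t \<Longrightarrow> t < s0 \<Longrightarrow> \<bar>convolve \<phi> (gauss t) x - \<phi> x\<bar> \<le> \<eta>/4"
    using approx_identity[OF \<phi>(1) \<phi>b, of "\<eta>/4"] eta by auto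
  define e1 where "e1 = \<eta> / (4 * (\<bar>m\<bar> + 1))"
  have e1: "e1 > 0" using eta by (simp add: e1_def)
  \<comment> \<open>at time \<open>s\<close> the Gaussian average is within \<open>\<eta> / 4\<close> of \<open>\<phi>\<close>, and \<open>m s\<close> is at most \<open>\<eta> / 4\<close>,
    so the term \<open>\<eta>\<close> keeps \<open>v\<close> above \<open>u\<close>\<close>
  define s where "s = min (t1/2) (min (s0/2) e1)"
  have s: "0 < s" "s < t1" "s < s0" "m * s \<le> \<eta>/4"
  proof -
    show s0': "0 < s" "s < t1" "s < s0" using t1 s0 e1 by (auto simp: s_def min_def)
    have "s \<le> \<eta> / (4 * (\<bar>m\<bar> + 1))" unfolding e1_def[symmetric] by (simp add: s_def)
    then have "s * (4 * (\<bar>m\<bar> + 1)) \<le> \<eta>" by (subst (asm) pos_le_divide_eq) auto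
    then have "4 * s + 4 * (\<bar>m\<bar> * s) \<le> \<eta>" by (simp add: algebra_simps)
    moreover have "m * s \<le> \<bar>m\<bar> * s" using s0' by (intro mult_right_mono) auto
    ultimately show "m * s \<le> \<eta>/4" using s0'(1) by linarith
  qed
  let ?K = "{s..t1} \<times> cball x0 R"
  have vc: "continuous_on ({0<..} \<times> UNIV) (\<lambda>p. v (fst p) (snd p))"
  proof -
    have k: "continuous_on ({0<..} \<times> (UNIV::'a set)) (\<lambda>p. heat_at q (fst p))"
      unfolding heat_level_def by (intro continuous_intros) (use Z_pos in auto)
    have j: "continuous_on ({0<..} \<times> UNIV) (\<lambda>p. convolve \<phi> (gauss (fst p)) (snd p))"
      using heat_conv_joint_continuous[OF \<phi>(1) \<phi>b] by (simp add: case_prod_unfold)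
    show ?thesis unfolding v_def
      by (intro continuous_on_add continuous_on_diff continuous_on_mult k j continuous_on_const
          continuous_on_fst continuous_on_id)
  qed
  have vcK: "continuous_on ?K (\<lambda>p. v (fst p) (snd p))"
    by (rule continuous_on_subset[OF vc]) (use s in auto)
  define h where "h p = u (snd p) - ereal (v (fst p) (snd p))" for p
  have hlt: "h p < c \<longleftrightarrow> u (snd p) < c + ereal (v (fst p) (snd p))" for p c
    by (simp add: h_def ereal_minus_less)
  have husc: "openin (top_of_set ?K) {p\<in>?K. h p < c}" for c
  proof (subst openin_subopen, rule ballI)
    fix pp assume pp: "pp \<in> {p\<in>?K. h p < c}"
    obtain t x where ppe: "pp = (t, x)" by (cases pp)
    have tx: "(t, x) \<in> ?K" "h (t, x) < c" using pp ppe by auto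
    then have "u x < c + ereal (v t x)" by (simp add: hlt)
    then obtain d where d: "u x < ereal d" "ereal d < c + ereal (v t x)" using ereal_dense2 by blast
    have dc: "ereal (d - v t x) < c" using d(2) by (cases c) auto
    then obtain c' where c': "ereal (d - v t x) < ereal c'" "ereal c' < c" using ereal_dense2 by blast
    have o1: "openin (top_of_set ?K) (?K \<inter> snd -` {z\<in>cball x0 R. u z < ereal d})"
      by (rule continuous_openin_preimage[OF _ _ usc[of "ereal d"]]) (auto intro!: continuous_intros)
    have o2: "openin (top_of_set ?K) (?K \<inter> (\<lambda>p. v (fst p) (snd p)) -` {d - c'<..})"
      by (rule continuous_openin_preimage_gen[OF vcK open_greaterThan])
    show "\<exists>T. openin (top_of_set ?K) T \<and> pp \<in> T \<and> T \<subseteq> {p\<in>?K. h p < c}"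
      unfolding ppe
    proof (intro exI conjI)
      show "openin (top_of_set ?K) ((?K \<inter> snd -` {z\<in>cball x0 R. u z < ereal d}) \<inter> (?K \<inter> (\<lambda>p. v (fst p) (snd p)) -` {d - c'<..}))"
        using o1 o2 by (rule openin_Int)
      show "(t, x) \<in> (?K \<inter> snd -` {z\<in>cball x0 R. u z < ereal d}) \<inter> (?K \<inter> (\<lambda>p. v (fst p) (snd p)) -` {d - c'<..})"
        using tx d c' by auto
      show "(?K \<inter> snd -` {z\<in>cball x0 R. u z < ereal d}) \<inter> (?K \<inter> (\<lambda>p. v (fst p) (snd p)) -` {d - c'<..}) \<subseteq> {p\<in>?K. h p < c}"
      proof
        fix p assume p: "p \<in> (?K \<inter> snd -` {z\<in>cball x0 R. u z < ereal d}) \<inter> (?K \<inter> (\<lambda>p. v (fst p) (snd p)) -` {d - c'<..})"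
        then have "u (snd p) < ereal d" "d < c' + v (fst p) (snd p)" by auto
        then have "u (snd p) < ereal c' + ereal (v (fst p) (snd p))" by (auto intro: less_trans)
        also have "\<dots> < c + ereal (v (fst p) (snd p))" using c'(2) by (cases c) auto
        finally show "p \<in> {p\<in>?K. h p < c}" using p by (simp add: hlt)
      qed
    qed
  qed
  have Kne: "?K \<noteq> {}" using x1 s \<rho> by auto
  have Kc: "compact ?K" by (intro compact_Times) auto
  \<comment> \<open>a maximum point \<open>(t, x)\<close> of \<open>u - v\<close> over the cylinder, with positive value if the claim fails\<close>
  obtain p where p: "p \<in> ?K" "\<And>p'. p' \<in> ?K \<Longrightarrow> h p' \<le> h p"
    using usc_attains_max[OF Kc Kne husc] by metis
  obtain t x where tx: "p = (t, x)" by (cases p)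
  have t: "s \<le> t" "t \<le> t1" "t > 0" and x: "x \<in> cball x0 R" using p(1) s tx by auto
  have hpos: "h p > 0"
  proof -
    have "0 < h (t1, x1)" unfolding h_def using bad by (cases "u x1") auto
    also have "\<dots> \<le> h p" using p(2)[of "(t1, x1)"] x1 s by auto
    finally show ?thesis .
  qed
  then have uv: "ereal (v t x) < u x" unfolding h_def tx by (cases "u x") auto
  have ufin: "\<exists>r. u x = ereal r" using uv um1[OF x] by (cases "u x") (auto simp: one_ereal_def)
  then obtain r where r: "u x = ereal r" by blast
  have ts: "t \<noteq> s"
  proof
    assume "t = s"
    have "v s x \<ge> \<phi> x" unfolding v_def
    proof -
      have "convolve \<phi> (gauss s) x \<ge> \<phi> x - \<eta>/4" using s0(2)[OF s(1,3), of x] by linarith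
      moreover have "heat_at q s * I \<le> 0" by (rule mult_nonneg_nonpos[OF less_imp_le[OF heat_at_pos[OF s(1)]] I0])
      moreover have "\<eta> * s \<ge> 0" using eta s by simp
      ultimately show "\<phi> x \<le> convolve \<phi> (gauss s) x - heat_at q s * I - m * s + \<eta> + \<eta> * s" using s(4) eta by linarith
    qed
    then have "u x \<le> ereal (v s x)" using \<phi>(4)[OF x] order_trans by fastforce
    then show False using uv \<open>t = s\<close> by simp
  qed
  have Gi: "integrable lborel (\<lambda>y. \<phi> y * gauss t (x - y))"
    by (rule convolve_integrand_integrable[OF _ gauss_continuous]) (simp add: convolvable_def \<phi>i \<phi>b)
  \<comment> \<open>on the sphere, \<open>gauss t - heat_at q t\<close> and \<open>\<phi>\<close> are both nonpositive on the support of \<open>\<phi>\<close>,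
    so \<open>v \<ge> - m t \<ge> -1 \<ge> u\<close>\<close>
  have xint: "x \<in> ball x0 R"
  proof (rule ccontr)
    assume "x \<notin> ball x0 R"
    then have dR: "dist x0 x = R" using x by auto
    have "convolve \<phi> (gauss t) x - heat_at q t * I = (\<integral>y. \<phi> y * gauss t (x - y) - heat_at q t * \<phi> y \<partial>lborel)"
      unfolding convolve_def I_def using Gi \<phi>i by simp
    also have "\<dots> \<ge> 0"
    proof (rule integral_nonneg_AE, rule AE_I2)
      fix y
      show "0 \<le> \<phi> y * gauss t (x - y) - heat_at q t * \<phi> y"
      proof (cases "y \<in> ball x0 \<rho>")
        case True
        then have "norm (x - y) \<ge> R - \<rho>"
          using dist_triangle[of x0 x y] dR by (auto simp: dist_norm norm_minus_commute)
        then have "(R - \<rho>)\<^sup>2 \<le> (norm (x - y))\<^sup>2" using \<rho> by (intro power_mono) auto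
        then have "c0 * (R - \<rho>)\<^sup>2 \<le> c0 * (norm (x - y))\<^sup>2" using c0_pos by (intro mult_left_mono) auto
        then have "q \<le> Q (x - y)" using q(2) Q_lower[of "x - y"] by linarith
        then have "gauss t (x - y) \<le> heat_at q t" unfolding gauss_def using heat_at_antimono[OF t(3)] by blast
        then have "0 \<le> (- \<phi> y) * (heat_at q t - gauss t (x - y))" using \<phi>(2)[of y] by (intro mult_nonneg_nonneg) auto
        then show ?thesis by (simp add: algebra_simps)
      next
        case False then show ?thesis using \<phi>(3) by simp
      qed
    qed
    finally have "convolve \<phi> (gauss t) x - heat_at q t * I \<ge> 0" .
    moreover have "m * t \<le> 1"
    proof -
      have "m * t \<le> \<bar>m\<bar> * T" using t t1 by (intro mult_mono) auto
      then show ?thesis using q(4) by linarith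
    qed
    moreover have "\<eta> * t > 0" using eta t by simp
    ultimately have "v t x \<ge> -1" unfolding v_def using eta by linarith
    then show False using uv um1[OF x] r by (auto simp: one_ereal_def)
  qed
  \<comment> \<open>raised by a constant, \<open>v t\<close> is an upper test function for \<open>u\<close> at \<open>x\<close>, which gives
    \<open>m \<le> L (v t) x\<close>\<close>
  define pt where "pt z = v t z + (r - v t x)" for z
  have cc: "convolvable \<phi> (gauss t)" for t using \<phi>i \<phi>b by (simp add: convolvable_def)
  have C2cv: "Ck_on 2 (convolve \<phi> (gauss t)) UNIV" by (rule convolve_Ck_on[OF cc gauss_C2])
  have pt_eq: "pt = (\<lambda>z. convolve \<phi> (gauss t) z + (- heat_at q t * I - m * t + \<eta> + \<eta> * t + (r - v t x)))"
    by (auto simp: pt_def v_def fun_eq_iff)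
  have "touches_above (ball x0 R) u x pt"
    unfolding touches_above_def
  proof (intro exI[of _ "ball x0 R"] conjI ballI)
    show "Ck_on 2 pt (ball x0 R)" unfolding pt_eq
      by (intro Ck_on_add Ck_on_const Ck_on_subset[OF C2cv]) auto
    show "u x = ereal (pt x)" by (simp add: r pt_def)
    show "u z \<le> ereal (pt z)" if "z \<in> ball x0 R" for z
    proof -
      have "h (t, z) \<le> h (t, x)" using p(2)[of "(t, z)"] that t tx by auto
      then have "u z - ereal (v t z) \<le> ereal (r - v t x)" by (simp add: h_def r)
      then show ?thesis by (cases "u z") (auto simp: pt_def)
    qed
  qed (use xint in auto)
  from visc[OF xint this] have "m \<le> elliptic pt x" .
  also have "elliptic pt x = elliptic (convolve \<phi> (gauss t)) x" unfolding pt_eq by (rule elliptic_shift[OF C2cv]) auto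
  finally have Lm: "m \<le> elliptic (convolve \<phi> (gauss t)) x" .
  \<comment> \<open>\<open>v\<close> increases strictly in time at \<open>(t, x)\<close>, so \<open>u - v\<close> is larger at a slightly earlier time\<close>
  let ?D = "elliptic (convolve \<phi> (gauss t)) x - (q / (4 * t\<^sup>2) - DIM('a) / (2 * t)) * heat_at q t * I - m + \<eta>"
  have vD: "((\<lambda>t. v t x) has_real_derivative ?D) (at t)"
    unfolding v_def
    by (rule derivative_eq_intros heat_conv_time_deriv[OF \<phi>(1) \<phi>b t(3)] heat_at_deriv[OF t(3)] refl)+ simp
  have "2 * real DIM('a) * t \<le> 2 * real DIM('a) * T" using t t1 by (intro mult_left_mono) auto
  then have "2 * real DIM('a) * t \<le> q" using q(3) by linarith
  then have "q / (4 * t\<^sup>2) - DIM('a) / (2 * t) \<ge> 0"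
    using t(3) by (simp add: field_simps power2_eq_square)
  then have "(q / (4 * t\<^sup>2) - DIM('a) / (2 * t)) * heat_at q t * I \<le> 0"
    by (intro mult_nonneg_nonpos mult_nonneg_nonneg less_imp_le[OF heat_at_pos[OF t(3)]] I0)
  then have Dpos: "?D > 0" using Lm eta by linarith
  obtain d where d: "d > 0" "\<And>h. 0 < h \<Longrightarrow> h < d \<Longrightarrow> v (t - h) x < v t x"
    using DERIV_pos_inc_left[OF vD Dpos] by auto
  define \<tau> where "\<tau> = min d (t - s) / 2"
  have "\<tau> \<le> (t - s) / 2" by (simp add: \<tau>_def)
  then have "t - \<tau> \<ge> s" using t(1) by argo
  then have \<tau>: "0 < \<tau>" "\<tau> < d" "t - \<tau> \<ge> s" using d(1) t ts by (auto simp: \<tau>_def)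
  have "h (t - \<tau>, x) \<le> h (t, x)" using p(2)[of "(t - \<tau>, x)"] \<tau> t x tx by auto
  then have "v t x \<le> v (t - \<tau>) x" by (simp add: h_def r)
  then show False using d(2)[OF \<tau>(1,2)] by simp
qed

lemma heat_comparison:
  assumes usc: "\<And>c. openin (top_of_set (cball x0 R)) {z\<in>cball x0 R. u z < c}"
    and um1: "\<And>z. z \<in> cball x0 R \<Longrightarrow> u z \<le> -1"
    and visc: "\<And>x p. x \<in> ball x0 R \<Longrightarrow> touches_above (ball x0 R) u x p \<Longrightarrow> m \<le> elliptic p x"
    and \<phi>: "continuous_on UNIV \<phi>" "\<And>y. \<phi> y \<le> 0" "\<And>y. y \<notin> ball x0 \<rho> \<Longrightarrow> \<phi> y = 0"
      "\<And>z. z \<in> cball x0 R \<Longrightarrow> u z \<le> ereal (\<phi> z)"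
    and \<rho>: "0 < \<rho>" "\<rho> < R" and q: "q > 0" "q \<le> c0 * (R - \<rho>)\<^sup>2" "2 * real DIM('a) * T \<le> q" "\<bar>m\<bar> * T \<le> 1"
    and t1: "0 < t1" "t1 \<le> T" and x1: "x1 \<in> cball x0 R"
  shows "u x1 \<le> ereal (convolve \<phi> (gauss t1) x1 - heat_at q t1 * (\<integral>y. \<phi> y \<partial>lborel) - m * t1)"
proof -
  let ?V = "convolve \<phi> (gauss t1) x1 - heat_at q t1 * (\<integral>y. \<phi> y \<partial>lborel) - m * t1"
  have A: "u x1 \<le> ereal ?V + ereal e" if "e > 0" for e
  proof -
    \<comment> \<open>so that the two error terms add up to \<open>e\<close>\<close>
    define \<eta> where "\<eta> = e / (1 + t1)"
    have "\<eta> > 0" using that t1 by (simp add: \<eta>_def)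
    moreover have "\<eta> + \<eta> * t1 = e"
    proof -
      have "\<eta> * (1 + t1) = e" using t1 by (simp add: \<eta>_def)
      then show ?thesis by (simp add: distrib_left)
    qed
    ultimately have "\<eta> > 0" "\<eta> + \<eta> * t1 = e" by blast+
    have "u x1 \<le> ereal (?V + \<eta> + \<eta> * t1)"
      by (rule heat_comparison_eta[where u=u and ?x0.0=x0 and R=R and m=m and \<phi>=\<phi> and \<rho>=\<rho> and q=q and T=T])
        (fact usc um1 visc \<phi> \<rho> q t1 \<open>\<eta> > 0\<close> x1)+
    also have "?V + \<eta> + \<eta> * t1 = ?V + e" using \<open>\<eta> + \<eta> * t1 = e\<close> by linarith
    finally show ?thesis by simp
  qed
  show ?thesis by (rule ereal_le_epsilon2) (rule A)
qed

text \<open>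
  The submean inequality on a ball of radius \<open>R\<close> averages over a smaller ball of radius
  \<open>r = inner_radius R\<close>. The form \<open>Q (x - y)\<close> is at least \<open>outer_level R\<close> for \<open>x\<close> on the outer sphere and
  \<open>y\<close> in the inner ball, and it must be smaller than that for two points of the inner ball, where it is
  at most \<open>C0 (2 r)\<^sup>2\<close>. The factor \<open>3\<close> achieves this: \<open>R - r = 3 (C0 / c0) r\<close> gives
  \<open>outer_level R = 9 (C0\<^sup>2 / c0) r\<^sup>2 \<ge> 9 C0 r\<^sup>2\<close>. Truncation at \<open>inner_level R\<close> confines the heat kernel
  to the inner ball.
\<close>

definition inner_radius :: "real \<Rightarrow> real" where "inner_radius R = R / (1 + 3 * (C0 / c0))"
definition outer_level :: "real \<Rightarrow> real" where "outer_level R = c0 * (R - inner_radius R)\<^sup>2"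
definition inner_level :: "real \<Rightarrow> real" where "inner_level R = c0 * (inner_radius R)\<^sup>2"

lemma c0_le_C0: "c0 \<le> C0"
proof -
  obtain b where b: "b \<in> B" using B_nonempty by auto
  have "norm b = 1" using orthonormal[OF b b] by (simp add: norm_eq_sqrt_inner)
  then show ?thesis using Q_lower[of b] Q_upper[of b] by simp
qed

lemma inner_radius_props:
  assumes "R > 0"
  shows "0 < inner_radius R" "inner_radius R < R" "C0 * (2 * inner_radius R)\<^sup>2 < outer_level R" "inner_level R \<le> outer_level R" "0 < inner_level R" "0 < outer_level R"
proof -
  define k where "k = C0 / c0"
  have k: "k \<ge> 1" using c0_le_C0 c0_pos by (simp add: k_def)
  have Ck: "C0 = k * c0" using c0_pos by (simp add: k_def)
  have Rr: "R = inner_radius R * (1 + 3 * k)" unfolding inner_radius_def k_def[symmetric] using k by simp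
  show r0: "0 < inner_radius R" unfolding inner_radius_def k_def[symmetric] using assms k by simp
  have dif: "R - inner_radius R = 3 * k * inner_radius R" using Rr by (simp add: algebra_simps)
  then show "inner_radius R < R" using r0 k by (smt (verit) mult_pos_pos)
  have k2: "k \<le> k\<^sup>2" using k by (simp add: power2_eq_square)
  have outer_level: "outer_level R = c0 * (9 * k\<^sup>2 * (inner_radius R)\<^sup>2)" unfolding outer_level_def dif by (simp add: power_mult_distrib)
  have p: "c0 * (inner_radius R)\<^sup>2 > 0" using c0_pos r0 by simp
  have "C0 * (2 * inner_radius R)\<^sup>2 = 4 * k * (c0 * (inner_radius R)\<^sup>2)" by (simp add: Ck power_mult_distrib)
  also have "\<dots> < 9 * k\<^sup>2 * (c0 * (inner_radius R)\<^sup>2)" using p k k2 by (intro mult_strict_right_mono) auto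
  finally show "C0 * (2 * inner_radius R)\<^sup>2 < outer_level R" by (simp add: outer_level mult_ac)
  have "1 * (c0 * (inner_radius R)\<^sup>2) \<le> 9 * k\<^sup>2 * (c0 * (inner_radius R)\<^sup>2)" using p k k2 by (intro mult_right_mono) auto
  then show "inner_level R \<le> outer_level R" by (simp add: inner_level_def outer_level mult_ac)
  then show "0 < inner_level R" "0 < outer_level R" using p by (auto simp: inner_level_def)
qed

lemma heat_trunc_inner_support: "t > 0 \<Longrightarrow> R > 0 \<Longrightarrow> heat_trunc (inner_level R) t x \<noteq> 0 \<Longrightarrow> norm x < inner_radius R"
  using heat_trunc_support_ball[of t "inner_radius R" x] inner_radius_props(1)[of R] unfolding inner_level_def by (meson not_le)

lemma heat_trunc_inner_bounded_support: "t > 0 \<Longrightarrow> R > 0 \<Longrightarrow> bounded {x. heat_trunc (inner_level R) t x \<noteq> 0}"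
  unfolding bounded_iff using heat_trunc_inner_support by (intro exI[of _ "inner_radius R"]) (auto intro: less_imp_le)

lemma Q_diff_ball:
  assumes "x \<in> ball x0 r" "y \<in> ball x0 r"
  shows "Q (x - y) \<le> C0 * (2 * r)\<^sup>2"
proof -
  have "norm (x - y) \<le> 2 * r"
    using dist_triangle[of x y x0] assms by (auto simp: dist_norm norm_minus_commute)
  then have "(norm (x - y))\<^sup>2 \<le> (2 * r)\<^sup>2" by (intro power_mono) auto
  then have "C0 * (norm (x - y))\<^sup>2 \<le> C0 * (2 * r)\<^sup>2" using C0_pos by (intro mult_left_mono) auto
  then show ?thesis using Q_upper[of "x - y"] by linarith
qed

lemma usc_ball_extension:
  assumes usc: "\<And>c. openin (top_of_set (cball x0 R)) {z\<in>cball x0 R. u z < c}"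
    and um1: "\<And>z. z \<in> cball x0 R \<Longrightarrow> u z \<le> (-1::ereal)" and \<rho>: "\<rho> \<le> R"
  shows "open {y. (if y \<in> ball x0 \<rho> then u y else 0) < c}"
proof (cases "c > 0")
  case True
  have "u y < c" if "y \<in> ball x0 \<rho>" for y
  proof -
    have "u y \<le> -1" using that \<rho> by (intro um1) auto
    also have "(-1::ereal) < 0" by simp
    finally show ?thesis using True by simp
  qed
  then have "{y. (if y \<in> ball x0 \<rho> then u y else 0) < c} = UNIV" using True by auto
  then show ?thesis by simp
next
  case False
  obtain W where W: "open W" "{z\<in>cball x0 R. u z < c} = cball x0 R \<inter> W"
    using usc[of c] unfolding openin_open by auto
  have "(if y \<in> ball x0 \<rho> then u y else 0) < c \<longleftrightarrow> y \<in> ball x0 \<rho> \<inter> W" for y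
  proof (cases "y \<in> ball x0 \<rho>")
    case True
    then have "y \<in> cball x0 R" using \<rho> by auto
    then have "u y < c \<longleftrightarrow> y \<in> W" using W(2) by blast
    then show ?thesis using True by simp
  next
    case F: False
    then show ?thesis using False by simp
  qed
  then have "{y. (if y \<in> ball x0 \<rho> then u y else 0) < c} = ball x0 \<rho> \<inter> W" by blast
  then show ?thesis using W(1) by auto
qed

text \<open>
  Apply the comparison to continuous functions decreasing to \<open>u\<close> on the inner ball and to \<open>0\<close> outside, and
  pass to the limit by Fatou's lemma. The integral is written for \<open>-u\<close> with values in \<open>[0, \<infinity>]\<close> since it is
  this very estimate that will show integrability.
\<close>

lemma gaussian_bound_nn:
  assumes R: "R > 0" and usc: "\<And>c. openin (top_of_set (cball x0 R)) {z\<in>cball x0 R. u z < c}"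
    and um1: "\<And>z. z \<in> cball x0 R \<Longrightarrow> u z \<le> -1"
    and visc: "\<And>x p. x \<in> ball x0 R \<Longrightarrow> touches_above (ball x0 R) u x p \<Longrightarrow> m \<le> elliptic p x"
    and T: "2 * real DIM('a) * T \<le> outer_level R" "\<bar>m\<bar> * T \<le> 1" and t: "0 < t" "t \<le> T"
    and x: "x \<in> ball x0 (inner_radius R)"
  shows "(\<integral>\<^sup>+y. e2ennreal (- u y) * ennreal (gauss t (x - y) - heat_at (outer_level R) t) * indicator (ball x0 (inner_radius R)) y \<partial>lborel)
     \<le> e2ennreal (- u x - ereal (m * t))"
proof -
  note r = inner_radius_props[OF R]
  let ?B = "ball x0 (inner_radius R)"
  define h where "h y = (if y \<in> ?B then u y else 0)" for y
  have husc: "open {y. h y < c}" for c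
    unfolding h_def by (rule usc_ball_extension[OF usc um1]) (use r in auto)
  have hneg: "h y \<le> 0" for y
  proof (cases "y \<in> ?B")
    case True
    then have "u y \<le> -1" using r by (intro um1) auto
    also have "(-1::ereal) \<le> 0" by simp
    finally show ?thesis using True by (simp add: h_def)
  qed (simp add: h_def)
  obtain \<phi> :: "nat \<Rightarrow> 'a \<Rightarrow> real" where \<phi>: "\<And>j. continuous_on UNIV (\<phi> j)" "\<And>j y. \<phi> j y \<le> 0"
    "\<And>j y. h y \<le> ereal (\<phi> j y)" "\<And>y. (\<lambda>j. ereal (\<phi> j y)) \<longlonglongrightarrow> h y"
    using usc_decreasing_continuous_approx[of h, OF husc hneg] by metis
  have \<phi>0: "\<phi> j y = 0" if "y \<notin> ?B" for j y
    using \<phi>(2)[of j y] \<phi>(3)[of y j] that by (simp add: h_def zero_ereal_def)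
  have \<phi>u: "u z \<le> ereal (\<phi> j z)" if "z \<in> cball x0 R" for j z
  proof (cases "z \<in> ?B")
    case True then show ?thesis using \<phi>(3)[of z j] by (simp add: h_def)
  next
    case False
    have "u z \<le> -1" using um1[OF that] .
    also have "\<dots> \<le> 0" by simp
    finally show ?thesis using \<phi>0[OF False, of j] by (simp add: zero_ereal_def)
  qed
  have \<phi>b: "bounded {x. \<phi> j x \<noteq> 0}" for j
    using \<phi>0 by (intro bounded_subset[OF bounded_ball[of x0 "inner_radius R"]] subsetI) blast
  have \<phi>i: "integrable lborel (\<phi> j)" for j by (rule continuous_compact_support_integrable[OF \<phi>(1) \<phi>b])
  have \<phi>m[measurable]: "\<phi> j \<in> borel_measurable borel" for j using \<phi>(1)[of j] by measurable
  let ?p = "\<lambda>y. gauss t (x - y) - heat_at (outer_level R) t"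
  \<comment> \<open>two points of the inner ball are closer, in the sense of \<open>Q\<close>, than \<open>outer_level R\<close>\<close>
  have p0: "?p y \<ge> 0" if "y \<in> ?B" for y
  proof -
    have "Q (x - y) \<le> outer_level R" using Q_diff_ball[OF x that] r(3) by linarith
    then show ?thesis unfolding gauss_def using heat_at_antimono[OF t(1)] by (simp add: diff_ge_0_iff_ge)
  qed
  have nonneg: "0 \<le> - \<phi> j y * ?p y" for j y
  proof (cases "y \<in> ?B")
    case True then show ?thesis using p0[of y] \<phi>(2)[of j y] by (intro mult_nonneg_nonneg) linarith+
  next
    case False then show ?thesis using \<phi>0 by simp
  qed
  have Gi: "integrable lborel (\<lambda>y. \<phi> j y * gauss t (x - y))" for j
    by (rule convolve_integrand_integrable[OF _ gauss_continuous]) (simp add: convolvable_def \<phi>i \<phi>b)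
  have Ai: "integrable lborel (\<lambda>y. - \<phi> j y * ?p y)" for j
    using Bochner_Integration.integrable_diff[OF integrable_mult_right[OF \<phi>i[of j], of "heat_at (outer_level R) t"] Gi[of j]]
    by (simp add: algebra_simps)
  have Aeq: "(\<integral>y. - \<phi> j y * ?p y \<partial>lborel) = - (convolve (\<phi> j) (gauss t) x - heat_at (outer_level R) t * (\<integral>y. \<phi> j y \<partial>lborel))" for j
  proof -
    have "(\<integral>y. - \<phi> j y * ?p y \<partial>lborel) = (\<integral>y. heat_at (outer_level R) t * \<phi> j y - \<phi> j y * gauss t (x - y) \<partial>lborel)"
      by (simp add: algebra_simps)
    also have "\<dots> = heat_at (outer_level R) t * (\<integral>y. \<phi> j y \<partial>lborel) - convolve (\<phi> j) (gauss t) x"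
      unfolding convolve_def using Gi[of j] \<phi>i[of j] by simp
    finally show ?thesis by simp
  qed
  have xR: "x \<in> cball x0 R" using x r by auto
  have bnd: "(\<integral>\<^sup>+y. ennreal (- \<phi> j y * ?p y) \<partial>lborel) \<le> e2ennreal (- u x - ereal (m * t))" for j
  proof -
    have "u x \<le> ereal (convolve (\<phi> j) (gauss t) x - heat_at (outer_level R) t * (\<integral>y. \<phi> j y \<partial>lborel) - m * t)"
      by (rule heat_comparison[where u=u and ?x0.0=x0 and R=R and m=m and \<phi>="\<phi> j" and \<rho>="inner_radius R" and q="outer_level R" and T=T])
        (fact usc um1 visc \<phi>(1) \<phi>(2) \<phi>0 \<phi>u r(1,2) r(6) outer_level_def[THEN eq_refl] T t xR)+
    then have "ereal (\<integral>y. - \<phi> j y * ?p y \<partial>lborel) \<le> - u x - ereal (m * t)"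
      unfolding Aeq by (cases "u x") auto
    then have "ennreal (\<integral>y. - \<phi> j y * ?p y \<partial>lborel) \<le> e2ennreal (- u x - ereal (m * t))"
      using e2ennreal_mono by fastforce
    moreover have "(\<integral>\<^sup>+y. ennreal (- \<phi> j y * ?p y) \<partial>lborel) = ennreal (\<integral>y. - \<phi> j y * ?p y \<partial>lborel)"
      by (rule nn_integral_eq_integral[OF Ai]) (use nonneg in auto)
    ultimately show ?thesis by simp
  qed
  have lim: "(\<lambda>j. ennreal (- \<phi> j y * ?p y)) \<longlonglongrightarrow> e2ennreal (- u y) * ennreal (?p y) * indicator ?B y" for y
  proof (cases "y \<in> ?B")
    case True
    have "(\<lambda>j. - ereal (\<phi> j y)) \<longlonglongrightarrow> - h y" by (intro tendsto_uminus_ereal \<phi>(4))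
    then have "(\<lambda>j. e2ennreal (- ereal (\<phi> j y))) \<longlonglongrightarrow> e2ennreal (- h y)" by (rule tendsto_e2ennrealI)
    then have "(\<lambda>j. ennreal (?p y) * ennreal (- \<phi> j y)) \<longlonglongrightarrow> ennreal (?p y) * e2ennreal (- h y)"
      by (intro ennreal_tendsto_cmult) (auto simp: ennreal.rep_eq e2ennreal_ereal)
    moreover have "ennreal (?p y) * ennreal (- \<phi> j y) = ennreal (- \<phi> j y * ?p y)" for j
      using p0[OF True] \<phi>(2)[of j y] by (simp add: ennreal_mult[symmetric] mult.commute)
    ultimately show ?thesis using True by (simp add: h_def mult.commute)
  next
    case False then show ?thesis using \<phi>0 by simp
  qed
  have "(\<integral>\<^sup>+y. e2ennreal (- u y) * ennreal (?p y) * indicator ?B y \<partial>lborel)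
      = (\<integral>\<^sup>+y. liminf (\<lambda>j. ennreal (- \<phi> j y * ?p y)) \<partial>lborel)"
    using lim_imp_Liminf[OF _ lim] by simp
  also have "\<dots> \<le> liminf (\<lambda>j. \<integral>\<^sup>+y. ennreal (- \<phi> j y * ?p y) \<partial>lborel)"
    by (rule nn_integral_liminf) measurable
  also have "\<dots> \<le> e2ennreal (- u x - ereal (m * t))"
    using bnd by (intro Liminf_le always_eventually) auto
  finally show ?thesis .
qed

lemma usc_ball_measurable:
  assumes usc: "\<And>c. openin (top_of_set (cball x0 R)) {z\<in>cball x0 R. u z < c}"
    and um1: "\<And>z. z \<in> cball x0 R \<Longrightarrow> u z \<le> (-1::ereal)" and \<rho>: "\<rho> \<le> R"
  shows "(\<lambda>y. if y \<in> ball x0 \<rho> then u y else 0) \<in> borel_measurable borel"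
proof (rule borel_measurableI_less)
  fix c
  have "open {y. (if y \<in> ball x0 \<rho> then u y else 0) < c}" by (rule usc_ball_extension[OF usc um1 \<rho>])
  then have "{y. (if y \<in> ball x0 \<rho> then u y else 0) < c} \<in> sets borel" by (rule borel_open)
  then show "{x \<in> space borel. (if x \<in> ball x0 \<rho> then u x else 0) < c} \<in> sets borel" by simp
qed

lemma neg_real_le_e2ennreal: "ennreal (- real_of_ereal e) \<le> e2ennreal (- e)"
  by (cases e) (auto simp: e2ennreal_ereal)

text \<open>
  On the inner ball the kernel in the preceding estimate is bounded below by a positive constant, so a
  single point of the ball with \<open>u x > -\<infinity>\<close> makes the integral of \<open>-u\<close> finite.
\<close>

lemma local_integrability:
  assumes R: "R > 0" and usc: "\<And>c. openin (top_of_set (cball x0 R)) {z\<in>cball x0 R. u z < c}"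
    and um1: "\<And>z. z \<in> cball x0 R \<Longrightarrow> u z \<le> -1"
    and visc: "\<And>x p. x \<in> ball x0 R \<Longrightarrow> touches_above (ball x0 R) u x p \<Longrightarrow> m \<le> elliptic p x"
    and x: "x \<in> ball x0 (inner_radius R)" "u x \<noteq> -\<infinity>"
  shows "integrable lborel (\<lambda>y. indicator (ball x0 (inner_radius R)) y * real_of_ereal (u y))"
    and "AE y in lborel. y \<in> ball x0 (inner_radius R) \<longrightarrow> u y \<noteq> -\<infinity>"
proof -
  note r = inner_radius_props[OF R]
  let ?B = "ball x0 (inner_radius R)"
  define t where "t = min (outer_level R / (2 * DIM('a))) (1 / (\<bar>m\<bar> + 1))"
  have t: "t > 0" using r(6) by (simp add: t_def)
  have T1: "2 * real DIM('a) * t \<le> outer_level R"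
  proof -
    have "t \<le> outer_level R / (2 * DIM('a))" by (simp add: t_def)
    then show ?thesis by (simp add: pos_le_divide_eq mult.commute)
  qed
  have T2: "\<bar>m\<bar> * t \<le> 1"
  proof -
    have "t \<le> 1 / (\<bar>m\<bar> + 1)" by (simp add: t_def)
    then have "t * (\<bar>m\<bar> + 1) \<le> 1" by (subst (asm) pos_le_divide_eq) auto
    then show ?thesis using t by (simp add: algebra_simps)
  qed
  define h where "h y = (if y \<in> ?B then u y else 0)" for y
  have hm[measurable]: "h \<in> borel_measurable borel"
    unfolding h_def by (rule usc_ball_measurable[OF usc um1]) (use r in auto)
  \<comment> \<open>a lower bound for the kernel on pairs of points of the inner ball\<close>
  define \<delta> where "\<delta> = heat_at (C0 * (2 * inner_radius R)\<^sup>2) t - heat_at (outer_level R) t"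
  have \<delta>: "\<delta> > 0"
  proof -
    have "heat_level DIM('a) (outer_level R) t < heat_level DIM('a) (C0 * (2 * inner_radius R)\<^sup>2) t"
      unfolding heat_level_def
    proof (intro mult_strict_left_mono)
      show "exp (- outer_level R / (4 * t)) < exp (- (C0 * (2 * inner_radius R)\<^sup>2) / (4 * t))"
        unfolding exp_less_cancel_iff by (intro divide_strict_right_mono) (use r(3) t in auto)
    qed (use t in auto)
    then show ?thesis unfolding \<delta>_def using Z_pos by (simp add: divide_strict_right_mono)
  qed
  have xR: "x \<in> cball x0 R" using x r by auto
  obtain rr where rr: "u x = ereal rr" using x(2) um1[OF xR] by (cases "u x") (auto simp: one_ereal_def)
  have "ennreal \<delta> * (\<integral>\<^sup>+y. e2ennreal (- h y) \<partial>lborel) = (\<integral>\<^sup>+y. ennreal \<delta> * e2ennreal (- h y) \<partial>lborel)"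
    by (rule nn_integral_cmult[symmetric]) measurable
  also have "\<dots> \<le> (\<integral>\<^sup>+y. e2ennreal (- u y) * ennreal (gauss t (x - y) - heat_at (outer_level R) t) * indicator ?B y \<partial>lborel)"
  proof (rule nn_integral_mono)
    fix y
    show "ennreal \<delta> * e2ennreal (- h y) \<le> e2ennreal (- u y) * ennreal (gauss t (x - y) - heat_at (outer_level R) t) * indicator ?B y"
    proof (cases "y \<in> ?B")
      case True
      have "Q (x - y) \<le> C0 * (2 * inner_radius R)\<^sup>2" by (rule Q_diff_ball[OF x(1) True])
      then have "\<delta> \<le> gauss t (x - y) - heat_at (outer_level R) t" unfolding gauss_def \<delta>_def using heat_at_antimono[OF t] by (simp add: diff_right_mono)
      then have "ennreal \<delta> \<le> ennreal (gauss t (x - y) - heat_at (outer_level R) t)" by (rule ennreal_leI)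
      from mult_left_mono[OF this, of "e2ennreal (- u y)"] show ?thesis
        using True by (simp add: h_def mult.commute)
    next
      case False then show ?thesis by (simp add: h_def e2ennreal_neg)
    qed
  qed
  also have "\<dots> \<le> e2ennreal (- u x - ereal (m * t))"
    by (rule gaussian_bound_nn[OF R usc um1 visc T1 T2 t order_refl x(1)])
  also have "\<dots> < \<infinity>" by (simp add: rr e2ennreal_ereal)
  finally have "ennreal \<delta> * (\<integral>\<^sup>+y. e2ennreal (- h y) \<partial>lborel) < \<infinity>" .
  then have fin: "(\<integral>\<^sup>+y. e2ennreal (- h y) \<partial>lborel) < \<infinity>"
    using \<delta> by (auto simp: ennreal_mult_less_top)
  have "AE y in lborel. e2ennreal (- h y) \<noteq> \<infinity>"
    by (rule nn_integral_noteq_infinite) (use fin in auto)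
  then show "AE y in lborel. y \<in> ?B \<longrightarrow> u y \<noteq> -\<infinity>"
    by eventually_elim (auto simp: h_def)
  have eq: "(\<lambda>y. indicator ?B y * real_of_ereal (u y)) = (\<lambda>y. real_of_ereal (h y))"
    by (auto simp: h_def fun_eq_iff)
  show "integrable lborel (\<lambda>y. indicator ?B y * real_of_ereal (u y))"
    unfolding eq
  proof (rule integrableI_bounded)
    have "(\<integral>\<^sup>+y. ennreal (norm (real_of_ereal (h y))) \<partial>lborel) \<le> (\<integral>\<^sup>+y. e2ennreal (- h y) \<partial>lborel)"
    proof (rule nn_integral_mono)
      fix y
      have "h y \<le> 0"
      proof (cases "y \<in> ?B")
        case True
        then have "u y \<le> -1" using r by (intro um1) auto
        also have "(-1::ereal) \<le> 0" by simp
        finally show ?thesis using True by (simp add: h_def)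
      qed (simp add: h_def)
      then have "norm (real_of_ereal (h y)) = - real_of_ereal (h y)" by (cases "h y") auto
      then show "ennreal (norm (real_of_ereal (h y))) \<le> e2ennreal (- h y)" using neg_real_le_e2ennreal by metis
    qed
    then show "(\<integral>\<^sup>+y. ennreal (norm (real_of_ereal (h y))) \<partial>lborel) < \<infinity>" using fin by (rule le_less_trans)
  qed measurable
qed

text \<open>
  The truncated kernel at \<open>inner_level R\<close> is below \<open>gauss t - heat_at (outer_level R) t\<close> and \<open>u\<close> is negative,
  so the estimate in terms of \<open>-u\<close> implies the one for the truncated kernel. The function \<open>g\<close> stands for any
  integrable extension of \<open>u\<close> from the inner ball.
\<close>

lemma gaussian_submean:
  assumes R: "R > 0" and usc: "\<And>c. openin (top_of_set (cball x0 R)) {z\<in>cball x0 R. u z < c}"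
    and um1: "\<And>z. z \<in> cball x0 R \<Longrightarrow> u z \<le> -1"
    and visc: "\<And>x p. x \<in> ball x0 R \<Longrightarrow> touches_above (ball x0 R) u x p \<Longrightarrow> m \<le> elliptic p x"
    and T: "2 * real DIM('a) * t \<le> outer_level R" "\<bar>m\<bar> * t \<le> 1" and t: "0 < t"
    and g: "integrable lborel g" "\<And>y. y \<in> ball x0 (inner_radius R) \<Longrightarrow> g y = real_of_ereal (u y)"
  shows "u x0 \<le> ereal (convolve g (heat_trunc (inner_level R) t) x0 - m * t)"
proof (cases "u x0 = -\<infinity>")
  case False
  note r = inner_radius_props[OF R]
  let ?B = "ball x0 (inner_radius R)"
  let ?k = "\<lambda>y. heat_trunc (inner_level R) t (x0 - y)"
  have gm[measurable]: "g \<in> borel_measurable borel" using g by auto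
  have "u x0 \<le> -1" using R by (intro um1) auto
  then obtain rr where rr: "u x0 = ereal rr" using False by (cases "u x0") (auto simp: one_ereal_def)
  have k0: "?k y = 0" if "y \<notin> ?B" for y
    unfolding inner_level_def by (rule heat_trunc_support_ball[OF t r(1)]) (use that in \<open>auto simp: dist_norm\<close>)
  have pw: "ennreal (- g y * ?k y) \<le> e2ennreal (- u y) * ennreal (gauss t (x0 - y) - heat_at (outer_level R) t) * indicator ?B y" for y
  proof (cases "y \<in> ?B")
    case True
    have "x0 \<in> ?B" using r(1) by simp
    then have "Q (x0 - y) \<le> outer_level R" using Q_diff_ball[OF _ True] r(3) by fastforce
    then have "0 \<le> gauss t (x0 - y) - heat_at (outer_level R) t" unfolding gauss_def using heat_at_antimono[OF t] by (simp add: diff_ge_0_iff_ge)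
    moreover have "heat_at (outer_level R) t \<le> heat_at (inner_level R) t" using heat_at_antimono[OF t r(4)] .
    ultimately have kk: "?k y \<le> gauss t (x0 - y) - heat_at (outer_level R) t" by (simp add: heat_trunc_def)
    have "u y \<le> -1" using True r by (intro um1) auto
    then have "real_of_ereal (u y) \<le> 0" by (cases "u y") (auto simp: one_ereal_def)
    then have g0: "- g y \<ge> 0" using g(2)[OF True] by simp
    then have "ennreal (- g y * ?k y) = ennreal (- g y) * ennreal (?k y)"
      by (intro ennreal_mult heat_trunc_nonneg)
    also have "\<dots> \<le> e2ennreal (- u y) * ennreal (gauss t (x0 - y) - heat_at (outer_level R) t)"
      using neg_real_le_e2ennreal[of "u y"] g(2)[OF True] kk by (intro mult_mono ennreal_leI) auto
    finally show ?thesis using True by simp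
  next
    case False then show ?thesis using k0 by simp
  qed
  have nn: "0 \<le> - g y * ?k y" for y
  proof (cases "y \<in> ?B")
    case True
    have "u y \<le> -1" using True r by (intro um1) auto
    then have "real_of_ereal (u y) \<le> 0" by (cases "u y") (auto simp: one_ereal_def)
    then show ?thesis using g(2)[OF True] heat_trunc_nonneg by (simp add: mult_nonpos_nonneg)
  qed (use k0 in simp)
  have gi: "integrable lborel (\<lambda>y. - g y * ?k y)"
    using bounded_kernel_integrable[OF g(1) heat_trunc_measurable heat_trunc_bounded[OF t]] by simp
  have "ennreal (\<integral>y. - g y * ?k y \<partial>lborel) = (\<integral>\<^sup>+y. ennreal (- g y * ?k y) \<partial>lborel)"
    by (rule nn_integral_eq_integral[symmetric, OF gi]) (use nn in auto)
  also have "\<dots> \<le> (\<integral>\<^sup>+y. e2ennreal (- u y) * ennreal (gauss t (x0 - y) - heat_at (outer_level R) t) * indicator ?B y \<partial>lborel)"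
    by (rule nn_integral_mono) (rule pw)
  also have "\<dots> \<le> e2ennreal (- u x0 - ereal (m * t))"
    by (rule gaussian_bound_nn[OF R usc um1 visc T t order_refl]) (use r in auto)
  also have "\<dots> = ennreal (- rr - m * t)" by (simp add: rr e2ennreal_ereal)
  finally have "ennreal (\<integral>y. - g y * ?k y \<partial>lborel) \<le> ennreal (- rr - m * t)" .
  moreover have "0 \<le> - rr - m * t"
  proof -
    have "rr \<le> -1" using \<open>u x0 \<le> -1\<close> by (simp add: rr one_ereal_def)
    moreover have "m * t \<le> \<bar>m\<bar> * t" using t by (intro mult_right_mono) auto
    ultimately show ?thesis using T(2) by linarith
  qed
  ultimately have "(\<integral>y. - g y * ?k y \<partial>lborel) \<le> - rr - m * t" by simp
  then show ?thesis by (simp add: rr convolve_def)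
qed simp

end

section \<open>Local integrability of linear viscosity subsolutions\<close>

lemma usc_bounded_above_compact:
  fixes u :: "'b::metric_space \<Rightarrow> ereal"
  assumes usc: "\<And>c. openin (top_of_set \<Omega>) {z\<in>\<Omega>. u z < c}" and fin: "\<And>z. z \<in> \<Omega> \<Longrightarrow> u z \<noteq> \<infinity>"
    and K: "compact K" "K \<subseteq> \<Omega>"
  obtains M where "\<And>z. z \<in> K \<Longrightarrow> u z \<le> ereal M"
proof (cases "K = {}")
  case False
  have "openin (top_of_set K) {z\<in>K. u z < c}" for c
  proof -
    obtain W where W: "open W" "{z\<in>\<Omega>. u z < c} = \<Omega> \<inter> W" using usc[of c] unfolding openin_open by auto
    have "{z\<in>K. u z < c} = K \<inter> W" using K(2) W(2) by auto
    then show ?thesis using W(1) unfolding openin_open by auto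
  qed
  then obtain m where m: "m \<in> K" "\<And>x. x \<in> K \<Longrightarrow> u x \<le> u m"
    using usc_attains_max[OF K(1) False, of u] by blast
  have "u m \<le> ereal (real_of_ereal (u m))" using fin[of m] m(1) K(2) by (cases "u m") auto
  then show ?thesis using that m(2) order_trans by blast
qed (use that in auto)

context weighted_frame
begin

lemma linear_visc_sub_ball_shift:
  assumes v: "linear_visc_sub \<Omega> u g" and B: "ball x0 R \<subseteq> \<Omega>" and m: "\<And>y. y \<in> ball x0 R \<Longrightarrow> m \<le> g y"
    and x: "x \<in> ball x0 R" and t: "touches_above (ball x0 R) (\<lambda>z. u z - ereal k) x p"
  shows "m \<le> elliptic p x"
proof -
  have "touches_above \<Omega> u x (\<lambda>z. p z + k)"
    by (rule touches_above_shift[OF touches_above_mono[OF t B]])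
  then have "g x \<le> elliptic (\<lambda>z. p z + k) x" using v x B unfolding linear_visc_sub_def by blast
  also have "\<dots> = elliptic p x" using t elliptic_shift unfolding touches_above_def by blast
  finally show ?thesis using m[OF x] by simp
qed

text \<open>
  The bound \<open>u \<le> -1\<close> is arranged by subtracting \<open>M + 1\<close>; the operator does not see constants.
\<close>

lemma submean_domain:
  assumes usc: "\<And>c. openin (top_of_set \<Omega>) {z\<in>\<Omega>. u z < c}" and v: "linear_visc_sub \<Omega> u g"
    and R: "R > 0" "cball x R \<subseteq> \<Omega>" and M: "\<And>z. z \<in> cball x R \<Longrightarrow> u z \<le> ereal M"
    and m: "\<And>y. y \<in> ball x R \<Longrightarrow> m \<le> g y"
    and T: "2 * real DIM('a) * t \<le> outer_level R" "\<bar>m\<bar> * t \<le> 1" "t > 0"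
    and h: "integrable lborel h" "\<And>y. y \<in> ball x (inner_radius R) \<Longrightarrow> h y = real_of_ereal (u y - ereal (M + 1))"
  shows "u x - ereal (M + 1) \<le> ereal (convolve h (heat_trunc (inner_level R) t) x - m * t)"
proof (rule gaussian_submean[where R=R and u="\<lambda>z. u z - ereal (M + 1)"])
  show "openin (top_of_set (cball x R)) {z\<in>cball x R. u z - ereal (M + 1) < c}" for c
    by (rule usc_on_subset_shift[OF usc R(2)])
  show "u z - ereal (M + 1) \<le> -1" if "z \<in> cball x R" for z
    using M[OF that] by (cases "u z") (auto simp: one_ereal_def)
  have "ball x R \<subseteq> \<Omega>" using R(2) ball_subset_cball by blast
  then show "m \<le> elliptic p y" if "y \<in> ball x R" "touches_above (ball x R) (\<lambda>z. u z - ereal (M + 1)) y p" for y p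
    using linear_visc_sub_ball_shift[OF v _ m that] by blast
qed (use assms in auto)

lemma local_dichotomy:
  assumes usc: "\<And>c. openin (top_of_set \<Omega>) {z\<in>\<Omega>. u z < c}" and fin: "\<And>z. z \<in> \<Omega> \<Longrightarrow> u z \<noteq> \<infinity>"
    and v: "linear_visc_sub \<Omega> u (\<lambda>_. m)" and R: "R > 0" "cball x0 R \<subseteq> \<Omega>"
    and x: "x \<in> ball x0 (inner_radius R)" "u x \<noteq> -\<infinity>"
  shows "set_integrable lborel (ball x0 (inner_radius R)) (\<lambda>y. real_of_ereal (u y))"
    and "AE y in lborel. y \<in> ball x0 (inner_radius R) \<longrightarrow> u y \<noteq> -\<infinity>"
proof -
  let ?B = "ball x0 (inner_radius R)"
  obtain M where M: "\<And>z. z \<in> cball x0 R \<Longrightarrow> u z \<le> ereal M"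
    using usc_bounded_above_compact[OF usc fin compact_cball R(2)] by blast
  let ?u = "\<lambda>z. u z - ereal (M + 1)"
  have 1: "openin (top_of_set (cball x0 R)) {z\<in>cball x0 R. ?u z < c}" for c
    by (rule usc_on_subset_shift[OF usc R(2)])
  have 2: "?u z \<le> -1" if "z \<in> cball x0 R" for z
    using M[OF that] by (cases "u z") (auto simp: one_ereal_def)
  have B: "ball x0 R \<subseteq> \<Omega>" using R(2) ball_subset_cball by blast
  have 3: "m \<le> elliptic p y" if "y \<in> ball x0 R" "touches_above (ball x0 R) ?u y p" for y p
    using linear_visc_sub_ball_shift[OF v B _ that] by blast
  have 4: "?u x \<noteq> -\<infinity>" using x(2) by (cases "u x") auto
  have i: "integrable lborel (\<lambda>y. indicator ?B y * real_of_ereal (?u y))"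
    by (rule local_integrability(1)[where u="?u" and R=R and m=m]) (fact R(1) 1 2 3 x(1) 4)+
  have a: "AE y in lborel. y \<in> ?B \<longrightarrow> ?u y \<noteq> -\<infinity>"
    by (rule local_integrability(2)[where u="?u" and R=R and m=m]) (fact R(1) 1 2 3 x(1) 4)+
  then show ae: "AE y in lborel. y \<in> ?B \<longrightarrow> u y \<noteq> -\<infinity>"
    by eventually_elim auto
  have sub: "?B \<subseteq> \<Omega>" using inner_radius_props(2)[OF R(1)] R(2) by (auto simp: subset_iff)
  have ic: "integrable lborel (\<lambda>y. (M + 1) * indicator ?B y)"
    by (intro integrable_mult_right integrable_real_indicator) (auto simp: emeasure_bounded_finite[OF bounded_ball, unfolded infinity_ennreal_def])
  have i2: "integrable lborel (\<lambda>y. indicator ?B y * real_of_ereal (?u y) + (M + 1) * indicator ?B y)"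
    using i ic by (rule Bochner_Integration.integrable_add)
  have r: "inner_radius R \<le> R" using inner_radius_props(2)[OF R(1)] by simp
  have hm: "(\<lambda>y. if y \<in> ?B then ?u y else 0) \<in> borel_measurable borel"
    by (rule usc_ball_measurable[where u="?u" and R=R]) (fact 1 2 r)+
  have um: "(\<lambda>y. indicator ?B y * real_of_ereal (u y)) \<in> borel_measurable borel"
  proof -
    have [measurable]: "?B \<in> sets borel" by simp
    have "(\<lambda>y. real_of_ereal ((if y \<in> ?B then ?u y else 0) + (if y \<in> ?B then ereal (M + 1) else 0))) \<in> borel_measurable borel"
      using hm by measurable
    moreover have "real_of_ereal ((if y \<in> ?B then ?u y else 0) + (if y \<in> ?B then ereal (M + 1) else 0)) = indicator ?B y * real_of_ereal (u y)" for y
      by (cases "u y") (auto simp: indicator_def)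
    ultimately show ?thesis by simp
  qed
  have "integrable lborel (\<lambda>y. indicator ?B y * real_of_ereal (u y))"
  proof (rule iffD1[OF integrable_cong_AE i2])
    show "AE y in lborel. indicator ?B y * real_of_ereal (?u y) + (M + 1) * indicator ?B y = indicator ?B y * real_of_ereal (u y)"
      using ae
    proof eventually_elim
      fix y assume y: "y \<in> ?B \<longrightarrow> u y \<noteq> -\<infinity>"
      show "indicator ?B y * real_of_ereal (?u y) + (M + 1) * indicator ?B y = indicator ?B y * real_of_ereal (u y)"
      proof (cases "y \<in> ?B")
        case True
        then obtain r where "u y = ereal r" using y fin[of y] sub by (cases "u y") auto
        then show ?thesis using True by simp
      qed simp
    qed
  qed (use um i2 in auto)
  then show "set_integrable lborel ?B (\<lambda>y. real_of_ereal (u y))" by (simp add: set_integrable_def)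
qed

text \<open>
  By the local alternative, the points near which \<open>u\<close> is identically \<open>-\<infinity>\<close> and the points near which it is
  integrable form two open sets covering the domain. They are disjoint, so connectedness leaves only the
  second one.
\<close>

theorem locally_integrable:
  assumes \<Omega>: "open \<Omega>" "connected \<Omega>" and usc: "\<And>c. openin (top_of_set \<Omega>) {z\<in>\<Omega>. u z < c}"
    and fin: "\<And>z. z \<in> \<Omega> \<Longrightarrow> u z \<noteq> \<infinity>" and nb: "\<exists>z\<in>\<Omega>. u z \<noteq> -\<infinity>"
    and v: "linear_visc_sub \<Omega> u (\<lambda>_. m)" and K: "compact K" "K \<subseteq> \<Omega>"
  shows "set_integrable lborel K (\<lambda>y. real_of_ereal (u y))"
    and "AE y in lborel. y \<in> K \<longrightarrow> u y \<noteq> -\<infinity>"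
proof -
  let ?f = "\<lambda>y. real_of_ereal (u y)"
  let ?good = "\<lambda>x r. r > 0 \<and> ball x r \<subseteq> \<Omega> \<and> set_integrable lborel (ball x r) ?f \<and>
      (AE y in lborel. y \<in> ball x r \<longrightarrow> u y \<noteq> -\<infinity>)"
  define E1 where "E1 = {x\<in>\<Omega>. \<exists>r>0. ball x r \<subseteq> \<Omega> \<and> (\<forall>y\<in>ball x r. u y = -\<infinity>)}"
  define E2 where "E2 = {x\<in>\<Omega>. \<exists>r. ?good x r}"
  have cover: "x \<in> E1 \<union> E2" if x: "x \<in> \<Omega>" for x
  proof -
    obtain R where R: "R > 0" "cball x R \<subseteq> \<Omega>" using \<Omega>(1) x open_contains_cball by blast
    note r = inner_radius_props[OF R(1)]
    have sub: "ball x (inner_radius R) \<subseteq> \<Omega>" using r(2) R(2) by (auto simp: subset_iff)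
    show ?thesis
    proof (cases "\<forall>y\<in>ball x (inner_radius R). u y = -\<infinity>")
      case True then show ?thesis using x r(1) sub unfolding E1_def by blast
    next
      case False
      then obtain y where "y \<in> ball x (inner_radius R)" "u y \<noteq> -\<infinity>" by blast
      from local_dichotomy[OF usc fin v R this] show ?thesis using x r(1) sub unfolding E2_def by blast
    qed
  qed
  have sub_good: "?good y (r - dist x y)" if "?good x r" "dist x y < r" for x y r
  proof -
    have sub: "ball y (r - dist x y) \<subseteq> ball x r"
    proof
      fix w assume "w \<in> ball y (r - dist x y)"
      then show "w \<in> ball x r" using dist_triangle[of x w y] by auto
    qed
    have "set_integrable lborel (ball y (r - dist x y)) ?f"
      by (rule set_integrable_subset[of _ "ball x r"]) (use that sub in auto)
    moreover have "AE w in lborel. w \<in> ball y (r - dist x y) \<longrightarrow> u w \<noteq> -\<infinity>"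
    proof -
      have "AE w in lborel. w \<in> ball x r \<longrightarrow> u w \<noteq> -\<infinity>" using that(1) by blast
      then show ?thesis by eventually_elim (use sub in auto)
    qed
    ultimately show ?thesis using that sub by auto
  qed
  have o2: "open E2"
  proof (subst open_subopen, rule ballI)
    fix x assume "x \<in> E2"
    then obtain r where r: "x \<in> \<Omega>" "?good x r" unfolding E2_def by blast
    have "ball x r \<subseteq> E2"
    proof
      fix y assume y: "y \<in> ball x r"
      then have "?good y (r - dist x y)" using sub_good[OF r(2)] by simp
      moreover have "y \<in> \<Omega>" using r y by blast
      ultimately show "y \<in> E2" unfolding E2_def by blast
    qed
    then show "\<exists>T. open T \<and> x \<in> T \<and> T \<subseteq> E2" using r(2) by (intro exI[of _ "ball x r"]) auto
  qed
  have o1: "open E1"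
  proof (subst open_subopen, rule ballI)
    fix x assume "x \<in> E1"
    then obtain r where r: "r > 0" "ball x r \<subseteq> \<Omega>" "\<forall>y\<in>ball x r. u y = -\<infinity>" unfolding E1_def by blast
    have "ball x r \<subseteq> E1"
    proof
      fix y assume y: "y \<in> ball x r"
      then obtain s where s: "s > 0" "ball y s \<subseteq> ball x r" using open_ball open_contains_ball by blast
      then show "y \<in> E1" unfolding E1_def using r y by blast
    qed
    then show "\<exists>T. open T \<and> x \<in> T \<and> T \<subseteq> E1" using r by (intro exI[of _ "ball x r"]) auto
  qed
  have disj: "E1 \<inter> E2 = {}"
  proof (rule ccontr)
    assume "E1 \<inter> E2 \<noteq> {}"
    then obtain x r s where x: "r > 0" "\<forall>y\<in>ball x r. u y = -\<infinity>" "?good x s"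
      unfolding E1_def E2_def by blast
    have "AE y in lborel. y \<notin> ball x (min r s)"
    proof -
      have "AE w in lborel. w \<in> ball x s \<longrightarrow> u w \<noteq> -\<infinity>" using x(3) by blast
      then show ?thesis by eventually_elim (use x(2) in auto)
    qed
    then have "emeasure lborel (ball x (min r s)) = 0"
      by (subst (asm) AE_iff_measurable[where N="ball x (min r s)"]) auto
    then have "ball x (min r s) \<in> null_sets lborel" by (intro null_setsI) auto
    then have "negligible (ball x (min r s))"
      by (simp add: negligible_iff_null_sets null_sets_completionI)
    moreover have "\<not> negligible (ball x (min r s))" using x(1,3) by (intro open_not_negligible) auto
    ultimately show False by blast
  qed
  have "E1 = {}"
  proof -
    have "E1 \<inter> \<Omega> = {} \<or> E2 \<inter> \<Omega> = {}"
      using connectedD[OF \<Omega>(2) o1 o2] disj cover by blast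
    moreover have "E1 \<subseteq> \<Omega>" "E2 \<subseteq> \<Omega>" by (auto simp: E1_def E2_def)
    moreover obtain z where "z \<in> \<Omega>" "u z \<noteq> -\<infinity>" using nb by blast
    moreover have "z \<notin> E1"
    proof
      assume "z \<in> E1"
      then obtain r where "r > 0" "\<forall>y\<in>ball z r. u y = -\<infinity>" unfolding E1_def by blast
      then show False using \<open>u z \<noteq> -\<infinity>\<close> by auto
    qed
    ultimately show ?thesis using cover by blast
  qed
  then have "\<forall>x\<in>K. \<exists>r. ?good x r" using cover K(2) unfolding E2_def by blast
  then obtain r where r: "\<And>x. x \<in> K \<Longrightarrow> ?good x (r x)" by metis
  obtain D where D: "D \<subseteq> K" "finite D" "K \<subseteq> (\<Union>x\<in>D. ball x (r x))"
    using compactE_image[OF K(1), of K "\<lambda>x. ball x (r x)"] r by (metis (no_types, lifting) UN_I centre_in_ball open_ball subsetI)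
  have "set_integrable lborel (\<Union>x\<in>D. ball x (r x)) ?f"
    by (rule set_integrable_UN) (use D r in auto)
  then show "set_integrable lborel K ?f"
    by (rule set_integrable_subset) (use D K in \<open>auto intro: borel_compact\<close>)
  have "AE y in lborel. \<forall>x\<in>D. y \<in> ball x (r x) \<longrightarrow> u y \<noteq> -\<infinity>"
    using D r by (intro AE_finite_allI) auto
  then show "AE y in lborel. y \<in> K \<longrightarrow> u y \<noteq> -\<infinity>"
    by eventually_elim (use D(3) in blast)
qed

end

section \<open>Mollification of linear viscosity subsolutions\<close>

lemma convolve_linear:
  assumes "convolvable g k" "convolvable h k" "continuous_on UNIV k"
  shows "convolve (\<lambda>w. g w + c * h w) k x = convolve g k x + c * convolve h k x"
proof -
  have "convolve (\<lambda>w. g w + c * h w) k x = (\<integral>w. g w * k (x - w) + c * (h w * k (x - w)) \<partial>lborel)"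
    by (simp add: convolve_def algebra_simps)
  also have "\<dots> = convolve g k x + c * convolve h k x" unfolding convolve_def
    using convolve_integrand_integrable[OF assms(1,3), of x] convolve_integrand_integrable[OF assms(2,3), of x] by simp
  finally show ?thesis .
qed

lemma convolve_indicator_locally_constant:
  assumes k: "continuous_on UNIV k" "\<And>x. k x \<noteq> 0 \<Longrightarrow> norm x \<le> r" and K: "cball z (r + d) \<subseteq> K" and w: "w \<in> ball z d"
  shows "convolve (indicator K) k w = (\<integral>x. k x \<partial>lborel)"
proof -
  have km: "k \<in> borel_measurable borel" using k(1) by measurable
  have "indicator K x * k (w - x) = k (w - x)" for x
  proof (cases "k (w - x) = 0")
    case False
    then have "norm (w - x) \<le> r" by (rule k(2))
    then have "dist z x \<le> r + d" using w dist_triangle[of z x w] by (simp add: dist_norm)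
    then show ?thesis using K by auto
  qed simp
  then have "convolve (indicator K) k w = (\<integral>x. k (w - x) \<partial>lborel)" by (simp only: convolve_def)
  also have "\<dots> = (\<integral>x. k x \<partial>lborel)" by (rule lborel_integral_reflect[OF km])
  finally show ?thesis .
qed

lemma shifted_integrable:
  fixes u :: "'a::euclidean_space \<Rightarrow> ereal"
  assumes usc: "\<And>c. openin (top_of_set \<Omega>) {z\<in>\<Omega>. u z < c}" and fin: "\<And>z. z \<in> \<Omega> \<Longrightarrow> u z \<noteq> \<infinity>"
    and K: "compact K" "K \<subseteq> \<Omega>"
    and ui: "set_integrable lborel K (\<lambda>y. real_of_ereal (u y))"
    and uae: "AE y in lborel. y \<in> K \<longrightarrow> u y \<noteq> -\<infinity>"
  shows "AE y in lborel. indicator K y * real_of_ereal (u y - ereal k)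
            = indicator K y * real_of_ereal (u y) + (- k) * indicator K y"
    and "integrable lborel (\<lambda>y. indicator K y * real_of_ereal (u y - ereal k))"
proof -
  have Kb: "K \<in> sets borel" by (rule borel_closed[OF compact_imp_closed[OF K(1)]])
  define U where "U y = indicator K y * real_of_ereal (u y - ereal k)" for y
  show AE: "AE y in lborel. indicator K y * real_of_ereal (u y - ereal k)
            = indicator K y * real_of_ereal (u y) + (- k) * indicator K y"
    using uae
  proof eventually_elim
    fix y assume y: "y \<in> K \<longrightarrow> u y \<noteq> -\<infinity>"
    show "indicator K y * real_of_ereal (u y - ereal k) = indicator K y * real_of_ereal (u y) + (- k) * indicator K y"
    proof (cases "y \<in> K")
      case True
      then obtain s where "u y = ereal s" using y fin[of y] K(2) by (cases "u y") auto
      then show ?thesis using True by simp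
    qed simp
  qed
  have ci: "integrable lborel (indicator K :: 'a \<Rightarrow> real)"
    using K(1) Kb by (intro integrable_real_indicator) (auto simp: emeasure_compact_finite[unfolded infinity_ennreal_def])
  have uKi: "integrable lborel (\<lambda>y. indicator K y * real_of_ereal (u y))" using ui by (simp add: set_integrable_def)
  have V: "integrable lborel (\<lambda>y. indicator K y * real_of_ereal (u y) + (- k) * indicator K y)"
    by (intro Bochner_Integration.integrable_add uKi integrable_mult_right ci)
  have "{y. (if y \<in> K then u y - ereal k else -\<infinity>) < c} \<in> sets borel" for c
  proof -
    obtain W where W: "open W" "{z\<in>K. u z - ereal k < c} = K \<inter> W"
      using usc_on_subset_shift[OF usc K(2), of k c] unfolding openin_open by auto
    have "{y. (if y \<in> K then u y - ereal k else -\<infinity>) < c} = (if c = -\<infinity> then {} else (K \<inter> W) \<union> (- K))"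
      unfolding W(2)[symmetric] by auto
    then show ?thesis using W(1) Kb by (auto intro: borel_open)
  qed
  then have [measurable]: "(\<lambda>y. if y \<in> K then u y - ereal k else -\<infinity>) \<in> borel_measurable borel"
    by (intro borel_measurableI_less) simp
  have "(\<lambda>y. real_of_ereal (if y \<in> K then u y - ereal k else -\<infinity>)) \<in> borel_measurable borel" by measurable
  moreover have "real_of_ereal (if y \<in> K then u y - ereal k else -\<infinity>) = U y" for y by (simp add: U_def)
  ultimately have "U \<in> borel_measurable borel" by simp
  then show "integrable lborel (\<lambda>y. indicator K y * real_of_ereal (u y - ereal k))"
    using integrable_cong_AE[OF _ _ AE] V unfolding U_def by auto
qed

lemma convolve_cong_AE:
  assumes "AE y in lborel. g y = h y" "g \<in> borel_measurable borel" "h \<in> borel_measurable borel" "k \<in> borel_measurable borel"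
  shows "convolve g k z = convolve h k z"
  unfolding convolve_def
proof (rule integral_cong_AE)
  show "AE y in lborel. g y * k (z - y) = h y * k (z - y)" using assms(1) by eventually_elim simp
qed (use assms in measurable)

context weighted_frame
begin

lemma elliptic_convolve_indicator:
  assumes k: "Ck_on 2 k UNIV" "\<And>x. k x \<noteq> 0 \<Longrightarrow> norm x \<le> r" and K: "cball z (r + d) \<subseteq> K" "d > 0"
  shows "elliptic (convolve (indicator K) k) z = 0"
proof -
  have "second_deriv (convolve (indicator K) k) z b b = second_deriv (\<lambda>_. \<integral>x. k x \<partial>lborel) z b b" for b
    by (rule second_deriv_cong_open[of "ball z d"])
      (use convolve_indicator_locally_constant[OF Ck_on_continuous[OF k(1)] k(2) K(1)] K(2) in auto)
  then show ?thesis by (simp add: elliptic_def second_deriv_const)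
qed

text \<open>
  Integrating \<open>u \<le> k\<^sub>t * u - (g - e) t\<close> against \<open>k (z - \<cdot>)\<close> and moving \<open>k\<^sub>t\<close> onto \<open>k\<close> bounds \<open>t (g * k)\<close>, up to
  \<open>e t\<close>, by \<open>u * (k\<^sub>t * k - k)\<close>. After division by \<open>t\<close> the right side tends to \<open>u * L k = L (u * k)\<close>.
\<close>

theorem elliptic_mollified_ge:
  assumes \<Omega>: "open \<Omega>" and usc: "\<And>c. openin (top_of_set \<Omega>) {z\<in>\<Omega>. u z < c}"
    and fin: "\<And>z. z \<in> \<Omega> \<Longrightarrow> u z \<noteq> \<infinity>" and v: "linear_visc_sub \<Omega> u g" and gc: "continuous_on \<Omega> g"
    and k: "Ck_on 2 k UNIV" "\<And>x. k x \<ge> 0" "\<And>x. k x \<noteq> 0 \<Longrightarrow> norm x \<le> r"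
    and K: "compact K" "K \<subseteq> \<Omega>" "cball z (r + d) \<subseteq> K" "d > 0" "r \<ge> 0"
    and ui: "set_integrable lborel K (\<lambda>y. real_of_ereal (u y))"
    and uae: "AE y in lborel. y \<in> K \<longrightarrow> u y \<noteq> -\<infinity>"
  shows "convolve (\<lambda>y. indicator K y * g y) k z \<le> elliptic (convolve (\<lambda>y. indicator K y * real_of_ereal (u y)) k) z"
proof -
  have kc: "continuous_on UNIV k" by (rule Ck_on_continuous[OF k(1)])
  have km[measurable]: "k \<in> borel_measurable borel" using kc by measurable
  have kb: "bounded {x. k x \<noteq> 0}" using k(3) by (auto simp: bounded_iff)
  have ki: "integrable lborel k" by (rule continuous_compact_support_integrable[OF kc kb])
  have Kb[measurable]: "K \<in> sets borel" using K(1) by (rule borel_compact)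
  obtain M where M: "\<And>z. z \<in> K \<Longrightarrow> u z \<le> ereal M"
    using usc_bounded_above_compact[OF usc fin K(1,2)] by blast
  define uK where "uK y = indicator K y * real_of_ereal (u y)" for y
  define gK where "gK y = indicator K y * g y" for y
  define U where "U y = indicator K y * real_of_ereal (u y - ereal (M + 1))" for y
  have uKi: "integrable lborel uK" using ui unfolding uK_def set_integrable_def by simp
  have ci: "integrable lborel (indicator K :: 'a \<Rightarrow> real)"
    using K(1) by (intro integrable_real_indicator) (auto simp: emeasure_compact_finite[unfolded infinity_ennreal_def])
  have V: "integrable lborel (\<lambda>y. uK y + (- (M + 1)) * indicator K y)"
    by (intro Bochner_Integration.integrable_add uKi integrable_mult_right ci)
  have UV: "AE y in lborel. U y = uK y + (- (M + 1)) * indicator K y"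
    unfolding U_def uK_def by (rule shifted_integrable(1)[OF usc fin K(1,2) ui uae])
  \<comment> \<open>\<open>W\<close> equals \<open>U\<close> almost everywhere; it is a combination of \<open>uK\<close> and an indicator, so that the shift
    by \<open>M + 1\<close> can be removed again by linearity at the end\<close>
  define W where "W y = uK y + (- (M + 1)) * indicator K y" for y
  have Wi: "integrable lborel W" unfolding W_def by (rule V)
  have WU: "AE y in lborel. y \<in> K \<longrightarrow> u y \<noteq> -\<infinity> \<and> W y = real_of_ereal (u y - ereal (M + 1))"
    using uae UV by eventually_elim (auto simp: W_def U_def)
  have Wm[measurable]: "W \<in> borel_measurable borel" using Wi by auto
  have gKi: "integrable lborel gK"
    using borel_integrable_compact[OF K(1) continuous_on_subset[OF gc K(2)]] by (simp add: gK_def[abs_def])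
  have bK: "bounded {w. f w \<noteq> 0}" if "\<And>w. w \<notin> K \<Longrightarrow> f w = 0" for f :: "'a \<Rightarrow> real"
    using that by (intro bounded_subset[OF compact_imp_bounded[OF K(1)]]) auto
  have Wb: "bounded {w. W w \<noteq> 0}" by (rule bK) (simp add: W_def uK_def)
  define I where "I = (\<integral>x. k x \<partial>lborel)"
  have I0: "I \<ge> 0" unfolding I_def using k(2) by simp
  define N1 where "N1 = (\<integral>w. \<bar>W w\<bar> \<partial>lborel)"
  have N10: "N1 \<ge> 0" by (simp add: N1_def)
  have ccW: "convolvable W k" using Wi kb by (simp add: convolvable_def)
  have ccg: "convolvable gK k" using gKi kb by (simp add: convolvable_def)
  let ?B = "cball z r"
  have BK: "?B \<subseteq> K" using K(3,4) by (auto simp: subset_iff)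
  have key: "convolve gK k z \<le> convolve W (elliptic k) z + e * (I + N1)" if e: "e > 0" for e
  proof -
    obtain d1 where d1: "d1 > 0" "\<And>x w. x \<in> ?B \<Longrightarrow> dist x w \<le> d1 \<Longrightarrow> w \<in> \<Omega> \<and> dist (g w) (g x) < e"
      using compact_uniform_nbhd[OF compact_cball \<Omega> order_trans[OF BK K(2)] gc e] by metis
    define R where "R = min d d1"
    have R: "R > 0" "R \<le> d" "R \<le> d1" using d1 K(4) by (auto simp: R_def)
    note rr = inner_radius_props[OF R(1)]
    have BR: "cball x R \<subseteq> K" if "x \<in> ?B" for x
    proof
      fix w assume "w \<in> cball x R"
      then have "w \<in> cball z (r + d)" using that R(2) dist_triangle[of z w x] by auto
      then show "w \<in> K" using K(3) by blast
    qed
    have "bounded (g ` K)"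
      by (rule compact_imp_bounded[OF compact_continuous_image[OF continuous_on_subset[OF gc K(2)] K(1)]])
    then obtain Mg where Mg: "\<And>x. x \<in> K \<Longrightarrow> \<bar>g x\<bar> \<le> Mg"
      unfolding bounded_iff by auto
    define Mg' where "Mg' = \<bar>Mg\<bar> + e + 1"
    have Mg': "Mg' > 0" using e by (simp add: Mg'_def)
    obtain t0 where t0: "t0 > 0" "\<And>t x. 0 < t \<Longrightarrow> t < t0 \<Longrightarrow> \<bar>(convolve k (heat_trunc (inner_level R) t) x - k x) / t - elliptic k x\<bar> \<le> e"
      using heat_trunc_generator[OF k(1) kb rr(5) e] by metis
    define t where "t = min (t0/2) (min (outer_level R / (2 * DIM('a))) (1 / Mg'))"
    have t: "t > 0" "t < t0" "t \<le> outer_level R / (2 * DIM('a))" "t \<le> 1 / Mg'"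
    proof -
      have p: "outer_level R / (2 * DIM('a)) > 0" using rr(6) by simp
      show "t > 0" unfolding t_def using p t0 Mg' by (simp add: min_less_iff_conj)
      show "t < t0" "t \<le> outer_level R / (2 * DIM('a))" "t \<le> 1 / Mg'" using t0 unfolding t_def by auto
    qed
    have T1: "2 * real DIM('a) * t \<le> outer_level R" using t(3) by (simp add: pos_le_divide_eq mult.commute)
    have T2: "t * Mg' \<le> 1" using t(4) Mg' by (simp add: pos_le_divide_eq)
    let ?k = "heat_trunc (inner_level R) t"
    note kk = heat_trunc_bounded[OF t(1), of "inner_level R"]
    have kb': "bounded {x. ?k x \<noteq> 0}" by (rule heat_trunc_inner_bounded_support[OF t(1) R(1)])
    have ccWk: "convolvable W ?k" using Wi kb' by (simp add: convolvable_def)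
    have cWk: "continuous_on UNIV (convolve W ?k)" by (rule convolve_continuous[OF ccWk heat_trunc_continuous])
    \<comment> \<open>the submean inequality at \<open>x\<close> with \<open>m = g x - e\<close>, a lower bound of \<open>g\<close> on the ball of radius \<open>R\<close>,
      multiplied by \<open>k (z - x)\<close>\<close>
    have pt: "AE x in lborel. W x * k (z - x) \<le> convolve W ?k x * k (z - x) - t * (gK x * k (z - x) - e * k (z - x))"
      using WU
    proof eventually_elim
      fix x assume wu: "x \<in> K \<longrightarrow> u x \<noteq> -\<infinity> \<and> W x = real_of_ereal (u x - ereal (M + 1))"
      show "W x * k (z - x) \<le> convolve W ?k x * k (z - x) - t * (gK x * k (z - x) - e * k (z - x))"
      proof (cases "k (z - x) = 0")
        case False
        then have xB: "x \<in> ?B" using k(3) by (auto simp: dist_norm)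
        then have xK: "x \<in> K" using BK by blast
        have "u x - ereal (M + 1) \<le> ereal (convolve W ?k x - (g x - e) * t)"
        proof -
          have hW: "AE y in lborel. W y = U y" using UV by eventually_elim (simp add: W_def)
          have Ui: "integrable lborel U"
            unfolding U_def by (rule shifted_integrable(2)[OF usc fin K(1,2) ui uae])
          have "convolve W ?k x = convolve U ?k x"
            by (rule convolve_cong_AE[OF hW]) (use Wi Ui in auto)
          moreover have "u x - ereal (M + 1) \<le> ereal (convolve U ?k x - (g x - e) * t)"
          proof (rule submean_domain[OF usc v R(1)])
            show "cball x R \<subseteq> \<Omega>" using BR[OF xB] K(2) by blast
            show "u z \<le> ereal M" if "z \<in> cball x R" for z using M BR[OF xB] that by blast
            show "g x - e \<le> g y" if "y \<in> ball x R" for y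
              using d1(2)[OF xB, of y] that R(3) by (auto simp: dist_real_def)
            show "\<bar>g x - e\<bar> * t \<le> 1"
            proof -
              have "\<bar>g x - e\<bar> \<le> Mg'" using Mg[OF xK] e unfolding Mg'_def by linarith
              then have "\<bar>g x - e\<bar> * t \<le> Mg' * t" using t(1) by (intro mult_right_mono) auto
              then show ?thesis using T2 by (simp add: mult.commute)
            qed
            show "U y = real_of_ereal (u y - ereal (M + 1))" if "y \<in> ball x (inner_radius R)" for y
            proof -
              have "y \<in> cball x R" using that rr(2) by auto
              then show ?thesis using BR[OF xB] by (auto simp: U_def)
            qed
          qed (fact T1 t(1) Ui)+
          ultimately show ?thesis by simp
        qed
        moreover have "u x - ereal (M + 1) = ereal (W x)"
          using wu xK fin[of x] K(2) by (cases "u x") auto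
        ultimately have "W x \<le> convolve W ?k x - (g x - e) * t" by simp
        then have "W x * k (z - x) \<le> (convolve W ?k x - (g x - e) * t) * k (z - x)" by (rule mult_right_mono) (rule k(2))
        then show ?thesis using xK by (simp add: gK_def algebra_simps)
      qed simp
    qed
    have i1: "integrable lborel (\<lambda>x. W x * k (z - x))" by (rule convolve_integrand_integrable[OF ccW kc])
    have i2: "integrable lborel (\<lambda>x. gK x * k (z - x))" by (rule convolve_integrand_integrable[OF ccg kc])
    have i3: "integrable lborel (\<lambda>x. k (z - x))" by (rule lborel_integrable_reflect[OF ki])
    have i4: "integrable lborel (\<lambda>x. convolve W ?k x * k (z - x))"
    proof (rule continuous_compact_support_integrable)
      have "continuous_on UNIV (\<lambda>x. k (z - x))"
        by (rule continuous_on_compose2[OF kc]) (auto intro!: continuous_intros)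
      then show "continuous_on UNIV (\<lambda>x. convolve W ?k x * k (z - x))" by (intro continuous_on_mult cWk)
      have "x \<in> ?B" if "convolve W ?k x * k (z - x) \<noteq> 0" for x
        using k(3)[of "z - x"] that by (auto simp: dist_norm)
      then show "bounded {x. convolve W ?k x * k (z - x) \<noteq> 0}" by (intro bounded_subset[OF bounded_cball]) blast
    qed
    \<comment> \<open>integrate and move the heat kernel from \<open>W\<close> to \<open>k\<close>\<close>
    have "convolve W k z \<le> (\<integral>x. convolve W ?k x * k (z - x) - t * (gK x * k (z - x) - e * k (z - x)) \<partial>lborel)"
      unfolding convolve_def[of W k] by (rule integral_mono_AE[OF i1 _ pt]) (use i2 i3 i4 in simp)
    also have "\<dots> = convolve (convolve W ?k) k z - t * (convolve gK k z - e * I)"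
      unfolding convolve_def[of "convolve W ?k" k] convolve_def[of gK k] I_def lborel_integral_reflect[OF km, of z, symmetric]
      using i2 i3 i4 by simp
    also have "convolve (convolve W ?k) k z = convolve W (convolve ?k k) z" by (rule convolve_assoc[OF Wi ki heat_trunc_continuous kk])
    also have "convolve ?k k = convolve k ?k" using convolve_commute[OF heat_trunc_measurable km] by auto
    finally have A: "t * (convolve gK k z - e * I) \<le> convolve W (convolve k ?k) z - convolve W k z" by simp
    have cckk: "convolvable k ?k" using ki kb by (simp add: convolvable_def)
    have ckk: "continuous_on UNIV (convolve k ?k)" by (rule convolve_continuous[OF cckk heat_trunc_continuous])
    have Lc: "continuous_on UNIV (elliptic k)" by (rule elliptic_continuous[OF k(1)])
    have cc': "convolvable W f" for f using Wi Wb by (simp add: convolvable_def)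
    have j1: "integrable lborel (\<lambda>w. W w * convolve k ?k (z - w))" by (rule convolve_integrand_integrable[OF cc' ckk])
    have j3: "integrable lborel (\<lambda>w. W w * elliptic k (z - w))" by (rule convolve_integrand_integrable[OF cc' Lc])
    have jN: "integrable lborel (\<lambda>w. \<bar>W w\<bar> * (t * e))" using Wi by simp
    \<comment> \<open>replace the difference quotient of the heat flow of \<open>k\<close> by \<open>L k\<close>\<close>
    have "convolve W (convolve k ?k) z - convolve W k z - t * convolve W (elliptic k) z
        = (\<integral>w. W w * convolve k ?k (z - w) - W w * k (z - w) - t * (W w * elliptic k (z - w)) \<partial>lborel)"
      unfolding convolve_def[of W "convolve k ?k"] convolve_def[of W k] convolve_def[of W "elliptic k"] using j1 i1 j3 by simp
    also have "\<dots> \<le> (\<integral>w. \<bar>W w\<bar> * (t * e) \<partial>lborel)"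
    proof (rule integral_mono[OF _ jN])
      show "integrable lborel (\<lambda>w. W w * convolve k ?k (z - w) - W w * k (z - w) - t * (W w * elliptic k (z - w)))"
        using j1 i1 j3 by simp
      fix w
      have "\<bar>(convolve k ?k (z - w) - k (z - w)) / t - elliptic k (z - w)\<bar> \<le> e" using t0(2)[OF t(1,2)] .
      then have "t * \<bar>(convolve k ?k (z - w) - k (z - w)) / t - elliptic k (z - w)\<bar> \<le> t * e" using t(1) by (intro mult_left_mono) auto
      moreover have "t * \<bar>(convolve k ?k (z - w) - k (z - w)) / t - elliptic k (z - w)\<bar> = \<bar>convolve k ?k (z - w) - k (z - w) - t * elliptic k (z - w)\<bar>"
      proof -
        have "convolve k ?k (z - w) - k (z - w) - t * elliptic k (z - w) = t * ((convolve k ?k (z - w) - k (z - w)) / t - elliptic k (z - w))"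
          using t(1) by (simp add: field_simps)
        then show ?thesis using t(1) by (simp add: abs_mult)
      qed
      ultimately have "\<bar>convolve k ?k (z - w) - k (z - w) - t * elliptic k (z - w)\<bar> \<le> t * e" by simp
      from mult_left_mono[OF this, of "\<bar>W w\<bar>"]
      have "\<bar>W w * (convolve k ?k (z - w) - k (z - w) - t * elliptic k (z - w))\<bar> \<le> \<bar>W w\<bar> * (t * e)" by (simp add: abs_mult)
      then have "W w * (convolve k ?k (z - w) - k (z - w) - t * elliptic k (z - w)) \<le> \<bar>W w\<bar> * (t * e)" by (rule abs_le_D1)
      then show "W w * convolve k ?k (z - w) - W w * k (z - w) - t * (W w * elliptic k (z - w)) \<le> \<bar>W w\<bar> * (t * e)"
        by (simp add: algebra_simps)
    qed
    also have "\<dots> = t * (e * N1)" by (simp add: N1_def mult_ac)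
    finally have "t * (convolve gK k z - e * I) \<le> t * (convolve W (elliptic k) z + e * N1)"
      using A by (simp add: distrib_left)
    then have "convolve gK k z - e * I \<le> convolve W (elliptic k) z + e * N1" using t(1) by simp
    then show ?thesis by (simp add: distrib_left)
  qed
  have "convolve gK k z \<le> convolve W (elliptic k) z"
  proof (rule field_le_epsilon)
    fix e :: real assume e: "e > 0"
    have p: "I + N1 + 1 > 0" using I0 N10 by simp
    have "e / (I + N1 + 1) * (I + N1) \<le> e"
    proof -
      have "e / (I + N1 + 1) * (I + N1) \<le> e / (I + N1 + 1) * (I + N1 + 1)"
        using e p by (intro mult_left_mono) auto
      then show ?thesis using p by simp
    qed
    moreover have "convolve gK k z \<le> convolve W (elliptic k) z + e / (I + N1 + 1) * (I + N1)"
      by (rule key) (use e p in simp)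
    ultimately show "convolve gK k z \<le> convolve W (elliptic k) z + e" by linarith
  qed
  \<comment> \<open>\<open>L\<close> annihilates the contribution of the constant shift\<close>
  also have "convolve W (elliptic k) z = convolve uK (elliptic k) z + (- (M + 1)) * convolve (indicator K) (elliptic k) z"
  proof -
    have "convolvable uK (elliptic k)" using uKi bK[of uK] by (simp add: convolvable_def uK_def)
    moreover have "convolvable (indicator K) (elliptic k)" using ci bK[of "indicator K"] by (simp add: convolvable_def)
    ultimately show ?thesis unfolding W_def by (rule convolve_linear[OF _ _ elliptic_continuous[OF k(1)]])
  qed
  also have "convolve (indicator K) (elliptic k) z = 0"
  proof -
    have "convolvable (indicator K) k" using ci kb by (simp add: convolvable_def)
    from elliptic_convolve[OF this k(1), of z] show ?thesis using elliptic_convolve_indicator[OF k(1) k(3) K(3,4)] by simp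
  qed
  also have "convolve uK (elliptic k) z = elliptic (convolve uK k) z"
  proof -
    have "convolvable uK k" using uKi kb by (simp add: convolvable_def)
    from elliptic_convolve[OF this k(1), of z] show ?thesis by simp
  qed
  finally show ?thesis by (simp add: gK_def[abs_def] uK_def[abs_def])
qed

end

section \<open>Hermitian matrices and unitary frames\<close>

definition cinner :: "complex ^ 'n::finite \<Rightarrow> complex ^ 'n \<Rightarrow> complex" where
  "cinner x y = (\<Sum>\<alpha>\<in>UNIV. x $ \<alpha> * cnj (y $ \<alpha>))"

lemma inner_eq_cinner: "x \<bullet> y = Re (cinner x y)"
  unfolding cinner_def inner_vec_def by (simp add: inner_complex_def)

lemma cinner_add_left: "cinner (x + y) z = cinner x z + cinner y z"
  by (simp add: cinner_def sum.distrib algebra_simps)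
lemma cinner_diff_left: "cinner (x - y) z = cinner x z - cinner y z"
  by (simp add: cinner_def sum_subtractf algebra_simps)
lemma cinner_scale_left: "cinner (c *s x) z = c * cinner x z"
  by (simp add: cinner_def sum_distrib_left mult_ac)
lemma cinner_scale_right: "cinner x (c *s z) = cnj c * cinner x z"
  by (simp add: cinner_def sum_distrib_left mult_ac)
lemma cinner_cnj: "cnj (cinner x y) = cinner y x"
  by (simp add: cinner_def mult.commute)
lemma cinner_zero_right [simp]: "cinner x 0 = 0"
  by (simp_all add: cinner_def)
lemma cinner_self: "cinner x x = complex_of_real ((norm x)\<^sup>2)"
proof -
  have "Im (cinner x x) = 0" using arg_cong[OF cinner_cnj[of x x], of Im] by simp
  then show ?thesis using inner_eq_cinner[of x x] by (simp add: complex_eq_iff power2_norm_eq_inner)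
qed

lemma scaleR_eq_smult: "r *\<^sub>R (x::complex^'n) = complex_of_real r *s x"
  unfolding vec_eq_iff vector_scaleR_component vector_smult_component by (simp add: scaleR_conv_of_real)

lemma cinner_scaleR_left: "cinner (r *\<^sub>R x) z = of_real r * cinner x z"
  by (simp add: scaleR_eq_smult cinner_scale_left)

lemma hermitian_adjoint:
  assumes "hermitian H" shows "cinner (H *v x) y = cinner x (H *v y)"
proof -
  have "cinner (H *v x) y = (\<Sum>\<alpha>\<in>UNIV. \<Sum>\<beta>\<in>UNIV. H $ \<alpha> $ \<beta> * x $ \<beta> * cnj (y $ \<alpha>))"
    by (simp add: cinner_def matrix_vector_mult_def sum_distrib_right)
  also have "\<dots> = (\<Sum>\<beta>\<in>UNIV. \<Sum>\<alpha>\<in>UNIV. H $ \<alpha> $ \<beta> * x $ \<beta> * cnj (y $ \<alpha>))" by (rule sum.swap)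
  also have "\<dots> = (\<Sum>\<beta>\<in>UNIV. \<Sum>\<alpha>\<in>UNIV. x $ \<beta> * (cnj (H $ \<beta> $ \<alpha>) * cnj (y $ \<alpha>)))"
  proof (intro sum.cong refl)
    fix \<alpha> \<beta>
    have "H $ \<alpha> $ \<beta> = cnj (H $ \<beta> $ \<alpha>)" using assms unfolding hermitian_def by blast
    then show "H $ \<alpha> $ \<beta> * x $ \<beta> * cnj (y $ \<alpha>) = x $ \<beta> * (cnj (H $ \<beta> $ \<alpha>) * cnj (y $ \<alpha>))" by (simp add: mult_ac)
  qed
  also have "\<dots> = cinner x (H *v y)"
    by (simp add: cinner_def matrix_vector_mult_def sum_distrib_left)
  finally show ?thesis .
qed

definition unitary_frame :: "('n::finite \<Rightarrow> complex ^ 'n) \<Rightarrow> bool" where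
  "unitary_frame \<xi> \<longleftrightarrow> (\<forall>i j. cinner (\<xi> i) (\<xi> j) = (if i = j then 1 else 0))"

lemma unitary_frame_complete:
  fixes \<xi> :: "'n::finite \<Rightarrow> complex ^ 'n"
  assumes "unitary_frame \<xi>"
  shows "(\<Sum>i\<in>UNIV. \<xi> i $ \<alpha> * cnj (\<xi> i $ \<beta>)) = (if \<alpha> = \<beta> then 1 else 0)"
proof -
  define A :: "complex^'n^'n" where "A = (\<chi> i \<alpha>. cnj (\<xi> i $ \<alpha>))"
  define B :: "complex^'n^'n" where "B = (\<chi> \<alpha> i. \<xi> i $ \<alpha>)"
  have "A ** B = mat 1"
  proof (simp add: vec_eq_iff matrix_matrix_mult_def mat_def, intro allI)
    fix i j
    have "(\<Sum>k\<in>UNIV. A $ i $ k * B $ k $ j) = cinner (\<xi> j) (\<xi> i)"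
      by (simp add: A_def B_def cinner_def mult.commute)
    also have "\<dots> = (if i = j then 1 else 0)" using assms unfolding unitary_frame_def by auto
    finally show "(i = j \<longrightarrow> (\<Sum>k\<in>UNIV. A $ j $ k * B $ k $ j) = 1) \<and> (i \<noteq> j \<longrightarrow> (\<Sum>k\<in>UNIV. A $ i $ k * B $ k $ j) = 0)"
      by (auto split: if_splits)
  qed
  then have "B ** A = mat 1" using matrix_left_right_inverse by blast
  then have "(B ** A) $ \<alpha> $ \<beta> = (if \<alpha> = \<beta> then 1 else 0)" by (simp add: mat_def)
  then show ?thesis by (simp add: matrix_matrix_mult_def A_def B_def)
qed

lemma unitary_frame_Parseval:
  assumes "unitary_frame \<xi>"
  shows "(\<Sum>i\<in>UNIV. cinner x (\<xi> i) * cnj (cinner y (\<xi> i))) = cinner x y"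
proof -
  have "(\<Sum>i\<in>UNIV. cinner x (\<xi> i) * cnj (cinner y (\<xi> i)))
     = (\<Sum>i\<in>UNIV. \<Sum>\<alpha>\<in>UNIV. \<Sum>\<beta>\<in>UNIV. x $ \<alpha> * cnj (y $ \<beta>) * (\<xi> i $ \<beta> * cnj (\<xi> i $ \<alpha>)))"
    by (simp add: cinner_def sum_product mult_ac)
  also have "\<dots> = (\<Sum>\<alpha>\<in>UNIV. \<Sum>\<beta>\<in>UNIV. \<Sum>i\<in>UNIV. x $ \<alpha> * cnj (y $ \<beta>) * (\<xi> i $ \<beta> * cnj (\<xi> i $ \<alpha>)))"
    by (subst sum.swap, rule sum.cong[OF refl], subst sum.swap, rule refl)
  also have "\<dots> = (\<Sum>\<alpha>\<in>UNIV. \<Sum>\<beta>\<in>UNIV. if \<beta> = \<alpha> then x $ \<alpha> * cnj (y $ \<beta>) else 0)"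
    by (simp add: sum_distrib_left[symmetric] unitary_frame_complete[OF assms] if_distrib cong: if_cong)
  also have "\<dots> = cinner x y" by (simp add: cinner_def)
  finally show ?thesis .
qed

definition frame_basis :: "'a set \<Rightarrow> ('a \<Rightarrow> complex ^ 'n::finite) \<Rightarrow> (complex ^ 'n) set" where
  "frame_basis I \<xi> = \<xi> ` I \<union> (\<lambda>i. \<i> *s \<xi> i) ` I"

lemma frame_basis_orthonormal:
  assumes on: "\<And>i j. i \<in> I \<Longrightarrow> j \<in> I \<Longrightarrow> cinner (\<xi> i) (\<xi> j) = (if i = j then 1 else 0)"
  shows "\<And>b c. b \<in> frame_basis I \<xi> \<Longrightarrow> c \<in> frame_basis I \<xi> \<Longrightarrow> b \<bullet> c = (if b = c then 1 else 0)"
    and "inj_on \<xi> I" "inj_on (\<lambda>i. \<i> *s \<xi> i) I" "\<xi> ` I \<inter> (\<lambda>i. \<i> *s \<xi> i) ` I = {}"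
proof -
  have 1: "\<xi> i \<bullet> \<xi> j = (if i = j then 1 else 0)" if "i \<in> I" "j \<in> I" for i j
    using on[OF that] by (simp add: inner_eq_cinner)
  have 2: "(\<i> *s \<xi> i) \<bullet> (\<i> *s \<xi> j) = (if i = j then 1 else 0)" if "i \<in> I" "j \<in> I" for i j
    using on[OF that] by (simp add: inner_eq_cinner cinner_scale_left cinner_scale_right)
  have 3: "\<xi> i \<bullet> (\<i> *s \<xi> j) = 0" if "i \<in> I" "j \<in> I" for i j
    using on[OF that] by (simp add: inner_eq_cinner cinner_scale_right)
  show inj: "inj_on \<xi> I" by (rule inj_onI) (metis 1 zero_neq_one)
  show inj2: "inj_on (\<lambda>i. \<i> *s \<xi> i) I" by (rule inj_onI) (metis 2 zero_neq_one)
  show disj: "\<xi> ` I \<inter> (\<lambda>i. \<i> *s \<xi> i) ` I = {}"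
  proof (rule ccontr)
    assume "\<xi> ` I \<inter> (\<lambda>i. \<i> *s \<xi> i) ` I \<noteq> {}"
    then obtain i j where "i \<in> I" "j \<in> I" "\<xi> i = \<i> *s \<xi> j" by auto
    then show False using 1[of i i] 3[of i j] by simp
  qed
  fix b c assume bc: "b \<in> frame_basis I \<xi>" "c \<in> frame_basis I \<xi>"
  have bb: "b \<bullet> b = 1" using bc(1) 1 2 by (auto simp: frame_basis_def)
  have "b \<bullet> c = 0" if "b \<noteq> c"
  proof -
    obtain i where i: "i \<in> I" "b = \<xi> i \<or> b = \<i> *s \<xi> i" using bc(1) by (auto simp: frame_basis_def)
    obtain j where j: "j \<in> I" "c = \<xi> j \<or> c = \<i> *s \<xi> j" using bc(2) by (auto simp: frame_basis_def)
    show ?thesis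
      using i(2) j(2) that 1[OF i(1) j(1)] 2[OF i(1) j(1)] 3[OF i(1) j(1)] 3[OF j(1) i(1)]
      by (auto simp: inner_commute split: if_splits)
  qed
  then show "b \<bullet> c = (if b = c then 1 else 0)" using bb by auto
qed

lemma frame_basis_card:
  assumes "finite I" "\<And>i j. i \<in> I \<Longrightarrow> j \<in> I \<Longrightarrow> cinner (\<xi> i) (\<xi> j) = (if i = j then 1 else 0)"
  shows "card (frame_basis I \<xi>) = 2 * card I"
  unfolding frame_basis_def
  using frame_basis_orthonormal(2-4)[OF assms(2)] assms(1)
  by (subst card_Un_disjoint) (auto simp: card_image)

lemma frame_basis_independent:
  assumes "\<And>i j. i \<in> I \<Longrightarrow> j \<in> I \<Longrightarrow> cinner (\<xi> i) (\<xi> j) = (if i = j then 1 else 0)"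
  shows "independent (frame_basis I \<xi>)"
proof (rule pairwise_orthogonal_independent)
  note on = frame_basis_orthonormal(1)[OF assms]
  show "pairwise orthogonal (frame_basis I \<xi>)" unfolding pairwise_def orthogonal_def using on by auto
  show "0 \<notin> frame_basis I \<xi>" using on[where b=0 and c=0] by auto
qed

text \<open>
  A maximum point \<open>x\<close> of the quadratic form on the unit sphere of the invariant subspace is an
  eigenvector: otherwise the residual \<open>w = H x - l x\<close>, which lies in the subspace, is a direction in which
  the Rayleigh quotient increases to first order, with derivative \<open>2 |w|\<^sup>2\<close>.
\<close>

lemma hermitian_eigenvector_in_subspace:
  fixes H :: "complex ^ 'n::finite ^ 'n"
  assumes H: "hermitian H" and S: "S = {y. \<forall>e\<in>E. cinner y e = 0}" and inv: "\<And>y. y \<in> S \<Longrightarrow> H *v y \<in> S"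
    and ne: "y0 \<in> S" "y0 \<noteq> 0"
  obtains x l where "x \<in> S" "norm x = 1" "H *v x = complex_of_real l *s x"
proof -
  have Sadd: "x + y \<in> S" "x - y \<in> S" if "x \<in> S" "y \<in> S" for x y
    using that by (auto simp: S cinner_add_left cinner_diff_left)
  have Ssc: "r *\<^sub>R x \<in> S" if "x \<in> S" for x and r :: real
    using that by (auto simp: S cinner_scaleR_left)
  have "closed S"
  proof -
    have "S = (\<Inter>e\<in>E. {y. cinner y e = 0})" by (auto simp: S)
    moreover have "closed {y. cinner y e = 0}" for e
      unfolding cinner_def by (intro closed_Collect_eq continuous_intros)
    ultimately show ?thesis by auto
  qed
  then have comp: "compact (S \<inter> sphere 0 1)" by (intro closed_Int_compact) auto
  have "(1 / norm y0) *\<^sub>R y0 \<in> S \<inter> sphere 0 1" using ne Ssc by simp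
  then have nonempty: "S \<inter> sphere 0 1 \<noteq> {}" by blast
  have "continuous_on (S \<inter> sphere 0 1) (\<lambda>x. x \<bullet> (H *v x))"
    by (intro continuous_intros)
  from continuous_attains_sup[OF comp nonempty this]
  obtain x where x: "x \<in> S" "norm x = 1" "\<And>y. y \<in> S \<Longrightarrow> norm y = 1 \<Longrightarrow> y \<bullet> (H *v y) \<le> x \<bullet> (H *v x)"
    by auto
  define l where "l = x \<bullet> (H *v x)"
  have bound: "y \<bullet> (H *v y) \<le> l * (y \<bullet> y)" if y: "y \<in> S" for y
  proof (cases "y = 0")
    case False
    let ?y = "(1 / norm y) *\<^sub>R y"
    have "?y \<bullet> (H *v ?y) \<le> l" unfolding l_def using x(3)[of ?y] y False Ssc by simp
    moreover have "H *v ?y = (1 / norm y) *\<^sub>R (H *v y)" by (simp add: scaleR_eq_smult vector_scalar_commute)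
    ultimately have "(y \<bullet> (H *v y)) / (norm y)\<^sup>2 \<le> l" by (simp add: power2_eq_square)
    then show ?thesis using False by (simp add: divide_le_eq power2_norm_eq_inner)
  qed simp
  define w where "w = H *v x - l *\<^sub>R x"
  have wS: "w \<in> S" unfolding w_def using x(1) inv Ssc Sadd by blast
  have symm: "x \<bullet> (H *v y) = y \<bullet> (H *v x)" for y
    using hermitian_adjoint[OF H, of y x] cinner_cnj[of x "H *v y"] by (simp add: inner_eq_cinner) (metis cnj.simps(1))
  have quad: "2 * t * (w \<bullet> w) + t\<^sup>2 * (w \<bullet> (H *v w) - l * (w \<bullet> w)) \<le> 0" for t
  proof -
    have "(x + t *\<^sub>R w) \<bullet> (H *v (x + t *\<^sub>R w)) \<le> l * ((x + t *\<^sub>R w) \<bullet> (x + t *\<^sub>R w))"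
      by (rule bound) (use x(1) wS Ssc Sadd in auto)
    moreover have "H *v (x + t *\<^sub>R w) = H *v x + t *\<^sub>R (H *v w)"
      by (simp add: matrix_vector_right_distrib scaleR_eq_smult vector_scalar_commute)
    moreover have "w \<bullet> (H *v x) - l * (w \<bullet> x) = w \<bullet> w" by (simp add: w_def inner_diff_right inner_diff_left)
    moreover have "x \<bullet> x = 1" using x(2) by (simp add: norm_eq_1)
    ultimately show ?thesis
      using symm[of w] l_def
      by (simp add: inner_add_left inner_add_right power2_eq_square algebra_simps inner_commute)
  qed
  have "w = 0"
  proof (rule ccontr)
    assume "w \<noteq> 0"
    then have pos: "w \<bullet> w > 0" by simp
    define c where "c = \<bar>w \<bullet> (H *v w) - l * (w \<bullet> w)\<bar> + 1"
    have c: "c > 0" by (simp add: c_def)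
    define t where "t = (w \<bullet> w) / c"
    have t: "t > 0" using pos c by (simp add: t_def)
    have "- c \<le> w \<bullet> (H *v w) - l * (w \<bullet> w)" by (simp add: c_def)
    then have "t\<^sup>2 * (- c) \<le> t\<^sup>2 * (w \<bullet> (H *v w) - l * (w \<bullet> w))" by (intro mult_left_mono) auto
    moreover have "t\<^sup>2 * c = t * (w \<bullet> w)" using c by (simp add: t_def power2_eq_square)
    ultimately have "t * (w \<bullet> w) \<le> 0" using quad[of t] by (simp add: algebra_simps)
    then show False using t pos by (simp add: mult_le_0_iff)
  qed
  then have "H *v x = complex_of_real l *s x" by (simp add: w_def scaleR_eq_smult)
  then show ?thesis using that x by blast
qed

text \<open>
  Take an orthonormal set of eigenvectors of maximal size. Its orthogonal complement is invariant, so if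
  it were not zero it would contain a further unit eigenvector.
\<close>

theorem hermitian_eigenframe:
  fixes H :: "complex ^ 'n::finite ^ 'n"
  assumes H: "hermitian H"
  obtains \<xi> :: "'n \<Rightarrow> complex ^ 'n" and l :: "'n \<Rightarrow> real"
  where "unitary_frame \<xi>" "\<And>i. H *v \<xi> i = complex_of_real (l i) *s \<xi> i"
proof -
  let ?P = "\<lambda>E. finite E \<and> (\<forall>x\<in>E. \<forall>y\<in>E. cinner x y = (if x = y then 1 else 0)) \<and>
      (\<forall>x\<in>E. \<exists>l. H *v x = complex_of_real l *s x)"
  have dim: "DIM(complex ^ 'n) = 2 * CARD('n)" by simp
  have bound: "card E \<le> CARD('n)" if "?P E" for E
  proof -
    have "card (frame_basis E (\<lambda>x. x)) \<le> DIM(complex ^ 'n)"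
      using frame_basis_independent[of E "\<lambda>x. x"] that independent_bound by blast
    then show ?thesis using frame_basis_card[of E "\<lambda>x. x"] that dim by simp
  qed
  define P where "P E \<longleftrightarrow> ?P E" for E
  have P0: "P {}" by (simp add: P_def)
  have Pb: "\<forall>E. P E \<longrightarrow> card E < Suc CARD('n)" using bound unfolding P_def less_Suc_eq_le by blast
  have "\<exists>E. P E \<and> (\<forall>E'. P E' \<longrightarrow> card E' \<le> card E)"
    by (rule ex_has_greatest_nat[OF P0 Pb])
  then obtain E where E': "P E" "\<And>E'. P E' \<Longrightarrow> card E' \<le> card E" by blast
  have E: "?P E" "\<And>E'. ?P E' \<Longrightarrow> card E' \<le> card E"
    using E' unfolding P_def by blast+
  have "card E = CARD('n)"
  proof (rule ccontr)
    assume "card E \<noteq> CARD('n)"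
    then have less: "card E < CARD('n)" using bound[OF E(1)] by simp
    let ?B = "frame_basis E (\<lambda>x. x)"
    have "card ?B < DIM(complex ^ 'n)" using frame_basis_card[of E "\<lambda>x. x"] E(1) less dim by simp
    moreover have finB: "finite ?B" using E(1) by (simp add: frame_basis_def)
    ultimately have "dim ?B < DIM(complex ^ 'n)" using dim_le_card'[of ?B] by linarith
    from orthogonal_to_subspace_exists[OF this]
    \<comment> \<open>a vector that is orthogonal, in the real sense, to all \<open>e\<close> and \<open>\<i> e\<close> is so in the complex sense\<close>
    obtain y0 where y0: "y0 \<noteq> 0" "\<And>y. y \<in> span ?B \<Longrightarrow> orthogonal y0 y" by blast
    define S where "S = {y. \<forall>e\<in>E. cinner y e = 0}"
    have y0S: "y0 \<in> S"
      unfolding S_def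
    proof (intro CollectI ballI)
      fix e assume e: "e \<in> E"
      have "orthogonal y0 e" "orthogonal y0 (\<i> *s e)"
        by (intro y0(2) span_base, use e in \<open>auto simp: frame_basis_def\<close>)+
      then have "Re (cinner y0 e) = 0" "Re (- \<i> * cinner y0 e) = 0"
        by (auto simp: orthogonal_def inner_eq_cinner cinner_scale_right)
      then show "cinner y0 e = 0" by (simp add: complex_eq_iff)
    qed
    have inv: "H *v y \<in> S" if "y \<in> S" for y
      unfolding S_def
    proof (intro CollectI ballI)
      fix e assume e: "e \<in> E"
      then obtain l where "H *v e = complex_of_real l *s e" using E(1) by blast
      then show "cinner (H *v y) e = 0"
        using that e by (simp add: hermitian_adjoint[OF H] cinner_scale_right S_def)
    qed
    obtain x l where x: "x \<in> S" "norm x = 1" "H *v x = complex_of_real l *s x"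
      using hermitian_eigenvector_in_subspace[OF H S_def inv y0S y0(1)] by blast
    have xx: "cinner x x = 1" using x(2) by (simp add: cinner_self)
    have xe: "cinner x e = 0" "cinner e x = 0" if "e \<in> E" for e
      using x(1) that cinner_cnj[of x e] by (auto simp: S_def)
    have "x \<notin> E" using xx xe by force
    moreover have "?P (insert x E)" using E(1) xx xe x(3) \<open>x \<notin> E\<close> by auto
    ultimately show False using E(2)[of "insert x E"] E(1) by simp
  qed
  then obtain \<xi> where \<xi>: "bij_betw \<xi> (UNIV::'n set) E"
    using E(1) by (metis finite_same_card_bij finite_class.finite_UNIV)
  then have \<xi>E: "\<xi> i \<in> E" for i by (auto simp: bij_betw_def)
  have "unitary_frame \<xi>" unfolding unitary_frame_def
  proof (intro allI)
    fix i j
    have "\<xi> i = \<xi> j \<longleftrightarrow> i = j" using \<xi> by (auto simp: bij_betw_def inj_on_def)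
    then show "cinner (\<xi> i) (\<xi> j) = (if i = j then 1 else 0)" using E(1) \<xi>E by auto
  qed
  moreover have "\<forall>i. \<exists>l. H *v \<xi> i = complex_of_real l *s \<xi> i" using E(1) \<xi>E by blast
  ultimately show ?thesis using that by metis
qed

lemma det_eigenframe:
  fixes H :: "complex ^ 'n::finite ^ 'n"
  assumes \<xi>: "unitary_frame \<xi>" and ev: "\<And>i. H *v \<xi> i = complex_of_real (l i) *s \<xi> i"
  shows "det (mat t - H) = (\<Prod>i\<in>UNIV. (t - complex_of_real (l i)))"
proof -
  define A :: "complex^'n^'n" where "A = (\<chi> i \<alpha>. cnj (\<xi> i $ \<alpha>))"
  define U :: "complex^'n^'n" where "U = (\<chi> \<alpha> i. \<xi> i $ \<alpha>)"
  define D :: "complex^'n^'n" where "D = (\<chi> i j. if i = j then t - complex_of_real (l i) else 0)"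
  have "U ** A = mat 1"
    unfolding vec_eq_iff matrix_matrix_mult_def mat_def A_def U_def
    using unitary_frame_complete[OF \<xi>] by simp
  then have "det U * det A = 1" by (metis det_mul det_I)
  then have dU: "det U \<noteq> 0" by auto
  have "(mat t - H) ** U = U ** D"
    unfolding vec_eq_iff
  proof (intro allI)
    fix \<alpha> i
    have "(H ** U) $ \<alpha> $ i = (H *v \<xi> i) $ \<alpha>" by (simp add: matrix_matrix_mult_def matrix_vector_mult_def U_def)
    also have "\<dots> = complex_of_real (l i) * \<xi> i $ \<alpha>" by (simp add: ev)
    finally have 1: "(H ** U) $ \<alpha> $ i = complex_of_real (l i) * \<xi> i $ \<alpha>" .
    have 2: "(mat t ** U) $ \<alpha> $ i = t * \<xi> i $ \<alpha>"
      by (simp add: matrix_matrix_mult_def mat_def U_def if_distrib[of "\<lambda>x. x * _"] cong: if_cong)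
    have "(U ** D) $ \<alpha> $ i = (t - complex_of_real (l i)) * \<xi> i $ \<alpha>"
      by (simp add: matrix_matrix_mult_def D_def U_def if_distrib[of "\<lambda>x. _ * x"] mult.commute cong: if_cong)
    moreover have "((mat t - H) ** U) $ \<alpha> $ i = (mat t ** U) $ \<alpha> $ i - (H ** U) $ \<alpha> $ i"
      by (simp add: matrix_matrix_mult_def left_diff_distrib sum_subtractf)
    ultimately show "((mat t - H) ** U) $ \<alpha> $ i = (U ** D) $ \<alpha> $ i"
      using 1 2 by (simp add: left_diff_distrib)
  qed
  then have "det (mat t - H) * det U = det U * det D" by (metis det_mul)
  then have "det (mat t - H) = det D" using dU by simp
  also have "\<dots> = (\<Prod>i\<in>UNIV. D $ i $ i)" by (rule det_diagonal) (simp add: D_def)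
  finally show ?thesis by (simp add: D_def)
qed

lemma linear_factors_permute:
  fixes l m :: "'n::finite \<Rightarrow> real"
  assumes "\<And>t::complex. (\<Prod>i\<in>UNIV. (t - complex_of_real (l i))) = (\<Prod>i\<in>UNIV. (t - complex_of_real (m i)))"
  obtains p where "bij p" "\<And>i. l i = m (p i)"
proof -
  have P: "proots (\<Prod>i\<in>UNIV. [:- complex_of_real (l i), 1:]) = image_mset (\<lambda>i. complex_of_real (l i)) (mset_set UNIV)" for l :: "'n \<Rightarrow> real"
    by (subst proots_prod) (auto simp: sum_unfold_sum_mset)
  have "(\<Prod>i\<in>UNIV. [:- complex_of_real (l i), 1:]) = (\<Prod>i\<in>UNIV. [:- complex_of_real (m i), 1:])"
    by (rule poly_eq_poly_eq_iff[THEN iffD1]) (use assms in \<open>auto simp: fun_eq_iff poly_prod\<close>)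
  then have "image_mset (\<lambda>i. complex_of_real (l i)) (mset_set UNIV) = image_mset (\<lambda>i. complex_of_real (m i)) (mset_set UNIV)"
    using P[of l] P[of m] by simp
  from image_mset_eq_implies_permutes[OF finite_class.finite_UNIV this]
  obtain p where "p permutes UNIV" "\<forall>x\<in>UNIV. complex_of_real (l x) = complex_of_real (m (p x))" by blast
  then show ?thesis using that permutes_bij by auto
qed

text \<open>
  The eigenvalue vector is specified only through the characteristic polynomial, whose roots determine it
  up to order.
\<close>

lemma eigvals_permute:
  fixes H :: "complex ^ 'n::finite ^ 'n"
  assumes \<xi>: "unitary_frame \<xi>" and ev: "\<And>i. H *v \<xi> i = complex_of_real (l i) *s \<xi> i"
  obtains p where "bij p" "eigvals H = permute_vec p (\<chi> i. l i)"
proof -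
  have "\<exists>v::real^'n. \<forall>t. det (mat t - H) = (\<Prod>i\<in>UNIV. (t - complex_of_real (v $ i)))"
    using det_eigenframe[OF \<xi> ev] by (intro exI[of _ "\<chi> i. l i"]) simp
  then have "\<forall>t. det (mat t - H) = (\<Prod>i\<in>UNIV. (t - complex_of_real (eigvals H $ i)))"
    unfolding eigvals_def by (rule someI_ex)
  then have "(\<Prod>i\<in>UNIV. (t - complex_of_real (eigvals H $ i))) = (\<Prod>i\<in>UNIV. (t - complex_of_real (l i)))" for t
    using det_eigenframe[OF \<xi> ev] by metis
  then obtain p where "bij p" "\<And>i. eigvals H $ i = l (p i)" using linear_factors_permute by metis
  then show ?thesis using that by (simp add: permute_vec_def vec_eq_iff)
qed

section \<open>Diagonals of Hermitian matrices and rearrangement\<close>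

text \<open>
  A comonotone pairing of \<open>c\<close> and \<open>\<mu>\<close> is the subgradient of a potential, in the discrete sense that
  \<open>\<phi> j - \<phi> i \<ge> c i (\<mu> j - \<mu> i)\<close>. The potential is extended by induction to an index at which both \<open>c\<close> and
  \<open>\<mu>\<close> are maximal; there the smallest value permitted by the earlier indices works.
\<close>

lemma comonotone_potential:
  fixes c \<mu> :: "'n \<Rightarrow> real"
  assumes "finite I" "\<And>i j. i \<in> I \<Longrightarrow> j \<in> I \<Longrightarrow> (c i - c j) * (\<mu> i - \<mu> j) \<ge> 0"
  shows "\<exists>\<phi>. \<forall>i\<in>I. \<forall>j\<in>I. c i * (\<mu> j - \<mu> i) \<le> \<phi> j - (\<phi> i::real)"
  using assms
proof (induction "card I" arbitrary: I)
  case 0 then show ?case by auto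
next
  case (Suc n)
  have ne: "I \<noteq> {}" using Suc.hyps(2) by auto
  obtain m where m: "m \<in> I" "\<And>i. i \<in> I \<Longrightarrow> \<mu> i \<le> \<mu> m" "\<And>i. i \<in> I \<Longrightarrow> c i \<le> c m"
  proof -
    define J where "J = {i\<in>I. \<mu> i = Max (\<mu> ` I)}"
    have fJ: "finite J" using Suc.prems(1) by (simp add: J_def)
    have "Max (\<mu> ` I) \<in> \<mu> ` I" using Suc.prems(1) ne by (intro Max_in) auto
    then have Jne: "J \<noteq> {}" by (auto simp: J_def)
    have "Max (c ` J) \<in> c ` J" using fJ Jne by (intro Max_in) auto
    then obtain m where m: "m \<in> J" "c m = Max (c ` J)" by auto
    have mI: "m \<in> I" using m by (simp add: J_def)
    have mu: "\<mu> i \<le> \<mu> m" if "i \<in> I" for i using m(1) that Suc.prems(1) by (auto simp: J_def)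
    have "c i \<le> c m" if i: "i \<in> I" for i
    proof (cases "\<mu> i = \<mu> m")
      case True
      then have "i \<in> J" using i m by (auto simp: J_def)
      then show ?thesis using m(2) fJ by simp
    next
      case False
      then have "\<mu> m - \<mu> i > 0" using mu[OF i] by simp
      moreover have "(c m - c i) * (\<mu> m - \<mu> i) \<ge> 0" using Suc.prems(2)[OF mI i] .
      ultimately show ?thesis by (simp add: zero_le_mult_iff)
    qed
    then show ?thesis using that mI mu by blast
  qed
  define I' where "I' = I - {m}"
  have "\<exists>\<phi>. \<forall>i\<in>I'. \<forall>j\<in>I'. c i * (\<mu> j - \<mu> i) \<le> \<phi> j - (\<phi> i::real)"
    by (rule Suc.hyps(1)) (use Suc.hyps(2) Suc.prems m(1) in \<open>auto simp: I'_def\<close>)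
  then obtain \<phi> where \<phi>: "\<And>i j. i \<in> I' \<Longrightarrow> j \<in> I' \<Longrightarrow> c i * (\<mu> j - \<mu> i) \<le> \<phi> j - \<phi> i" by blast
  show ?case
  proof (cases "I' = {}")
    case True
    then have "I = {m}" using m(1) by (auto simp: I'_def)
    then show ?thesis by auto
  next
    case False
    define v where "v = Max ((\<lambda>i. \<phi> i + c i * (\<mu> m - \<mu> i)) ` I')"
    have fI': "finite I'" using Suc.prems(1) by (simp add: I'_def)
    have v_ge: "\<phi> i + c i * (\<mu> m - \<mu> i) \<le> v" if "i \<in> I'" for i
      unfolding v_def using fI' that by (intro Max_ge) auto
    have "v \<in> (\<lambda>i. \<phi> i + c i * (\<mu> m - \<mu> i)) ` I'" unfolding v_def using fI' False by (intro Max_in) auto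
    then obtain k where k: "k \<in> I'" "v = \<phi> k + c k * (\<mu> m - \<mu> k)" by auto
    have v_le: "c m * (\<mu> j - \<mu> m) \<le> \<phi> j - v" if j: "j \<in> I'" for j
    proof -
      have "c k * (\<mu> j - \<mu> k) \<le> \<phi> j - \<phi> k" by (rule \<phi>[OF k(1) j])
      moreover have "c k * (\<mu> m - \<mu> j) \<le> c m * (\<mu> m - \<mu> j)"
        using m k(1) j by (intro mult_right_mono) (auto simp: I'_def)
      ultimately show ?thesis unfolding k(2) by (simp add: algebra_simps)
    qed
    show ?thesis
    proof (intro exI[of _ "\<phi>(m := v)"] ballI)
      fix i j assume ij: "i \<in> I" "j \<in> I"
      show "c i * (\<mu> j - \<mu> i) \<le> (\<phi>(m := v)) j - (\<phi>(m := v)) i"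
        using \<phi>[of i j] v_ge[of i] v_le[of j] ij by (auto simp: I'_def algebra_simps)
    qed
  qed
qed

text \<open>
  Choose \<open>p\<close> to minimize the left side. Comparison with transpositions shows that \<open>l \<circ> p\<close> is ordered
  oppositely to \<open>a\<close>, so \<open>- a\<close> and \<open>l \<circ> p\<close> have a potential. Summed against the weights, the differences
  of the potential cancel because the rows and columns of \<open>S\<close> have the same sum.
\<close>

lemma doubly_stochastic_rearrangement:
  fixes S :: "'n::finite \<Rightarrow> 'n \<Rightarrow> real" and a l :: "'n \<Rightarrow> real"
  assumes S0: "\<And>i j. S i j \<ge> 0" and rows: "\<And>i. (\<Sum>j\<in>UNIV. S i j) = 1" and cols: "\<And>j. (\<Sum>i\<in>UNIV. S i j) = 1"
  obtains p where "bij p" "(\<Sum>i\<in>UNIV. a i * l (p i)) \<le> (\<Sum>i\<in>UNIV. \<Sum>j\<in>UNIV. a i * S i j * l j)"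
proof -
  let ?v = "\<lambda>p. \<Sum>i\<in>UNIV. a i * l (p i)"
  have fin: "finite {p :: 'n \<Rightarrow> 'n. bij p}" by simp
  have ne: "{p :: 'n \<Rightarrow> 'n. bij p} \<noteq> {}" using bij_id by blast
  have "Min (?v ` {p. bij p}) \<in> ?v ` {p. bij p}" using fin ne by (intro Min_in) auto
  then obtain p where p: "bij p" "?v p = Min (?v ` {p. bij p})" by auto
  have pmin: "?v p \<le> ?v p'" if "bij p'" for p' unfolding p(2) using fin that by (intro Min_le) auto
  define \<mu> where "\<mu> i = l (p i)" for i
  have como: "(- a i - (- a j)) * (\<mu> i - \<mu> j) \<ge> 0" for i j
  proof (cases "i = j")
    case False
    define p' where "p' = p \<circ> Transposition.transpose i j"
    have "bij p'" unfolding p'_def using p(1) by (intro bij_comp) auto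
    from pmin[OF this] have "0 \<le> (\<Sum>k\<in>UNIV. a k * l (p' k) - a k * l (p k))"
      by (simp add: sum_subtractf)
    also have "\<dots> = (\<Sum>k\<in>{i, j}. a k * l (p' k) - a k * l (p k))"
      by (rule sum.mono_neutral_right) (auto simp: p'_def transpose_def)
    also have "\<dots> = (a j - a i) * (\<mu> i - \<mu> j)"
      using False by (simp add: p'_def \<mu>_def algebra_simps)
    finally show ?thesis by (simp add: algebra_simps)
  qed simp
  obtain \<phi> where \<phi>: "\<And>i j. - a i * (\<mu> j - \<mu> i) \<le> \<phi> j - \<phi> i"
    using comonotone_potential[of UNIV "\<lambda>i. - a i" \<mu>] como by auto
  define S' where "S' i j = S i (p j)" for i j
  have reindex: "(\<Sum>j\<in>UNIV. g (p j)) = (\<Sum>j\<in>UNIV. g j)" for g :: "'n \<Rightarrow> real"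
    using sum.reindex_bij_betw[of p UNIV UNIV g] p(1) by (simp add: bij_def bij_betw_def)
  have rows': "(\<Sum>j\<in>UNIV. S' i j) = 1" for i unfolding S'_def using reindex[of "S i"] rows by simp
  have cols': "(\<Sum>i\<in>UNIV. S' i j) = 1" for j unfolding S'_def by (rule cols)
  have "(\<Sum>i\<in>UNIV. \<Sum>j\<in>UNIV. S' i j * (- a i * (\<mu> j - \<mu> i))) \<le> (\<Sum>i\<in>UNIV. \<Sum>j\<in>UNIV. S' i j * (\<phi> j - \<phi> i))"
    using \<phi> S0 by (intro sum_mono mult_left_mono) (auto simp: S'_def)
  also have "\<dots> = (\<Sum>i\<in>UNIV. \<Sum>j\<in>UNIV. S' i j * \<phi> j) - (\<Sum>i\<in>UNIV. \<Sum>j\<in>UNIV. S' i j * \<phi> i)"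
    by (simp add: right_diff_distrib sum_subtractf)
  also have "(\<Sum>i\<in>UNIV. \<Sum>j\<in>UNIV. S' i j * \<phi> j) = (\<Sum>j\<in>UNIV. \<phi> j)"
    by (subst sum.swap) (simp add: sum_distrib_right[symmetric] cols')
  also have "(\<Sum>i\<in>UNIV. \<Sum>j\<in>UNIV. S' i j * \<phi> i) = (\<Sum>i\<in>UNIV. \<phi> i)"
    by (simp add: sum_distrib_right[symmetric] rows')
  finally have "(\<Sum>i\<in>UNIV. \<Sum>j\<in>UNIV. S' i j * (- a i * (\<mu> j - \<mu> i))) \<le> 0" by simp
  moreover have "(\<Sum>i\<in>UNIV. \<Sum>j\<in>UNIV. S' i j * (- a i * (\<mu> j - \<mu> i)))
     = (\<Sum>i\<in>UNIV. \<Sum>j\<in>UNIV. S' i j * (a i * \<mu> i)) - (\<Sum>i\<in>UNIV. \<Sum>j\<in>UNIV. a i * S' i j * \<mu> j)"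
    by (simp add: sum_subtractf[symmetric] algebra_simps)
  moreover have "(\<Sum>i\<in>UNIV. \<Sum>j\<in>UNIV. S' i j * (a i * \<mu> i)) = ?v p"
    by (simp add: sum_distrib_right[symmetric] rows' \<mu>_def)
  moreover have "(\<Sum>i\<in>UNIV. \<Sum>j\<in>UNIV. a i * S' i j * \<mu> j) = (\<Sum>i\<in>UNIV. \<Sum>j\<in>UNIV. a i * S i j * l j)"
    unfolding S'_def \<mu>_def by (rule sum.cong[OF refl]) (rule reindex)
  ultimately show ?thesis using that[OF p(1)] by linarith
qed

text \<open>
  Expanding \<open>\<xi>\<^sub>i\<close> in the eigenframe writes the diagonal entries as averages of the eigenvalues with
  weights \<open>|\<langle>\<xi>\<^sub>i, \<zeta>\<^sub>j\<rangle>|\<^sup>2\<close>, and these are doubly stochastic by Parseval's identity for both frames.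
\<close>

lemma frame_diagonal_majorized:
  fixes H :: "complex ^ 'n::finite ^ 'n"
  assumes \<zeta>: "unitary_frame \<zeta>" and ev: "\<And>i. H *v \<zeta> i = complex_of_real (l i) *s \<zeta> i"
    and \<xi>: "unitary_frame \<xi>" and H: "hermitian H"
  obtains p where "bij p" "(\<Sum>i\<in>UNIV. a i * l (p i)) \<le> (\<Sum>i\<in>UNIV. a i * Re (cinner (H *v \<xi> i) (\<xi> i)))"
proof -
  define S where "S i j = (cmod (cinner (\<xi> i) (\<zeta> j)))\<^sup>2" for i j
  have S: "complex_of_real (S i j) = cinner (\<xi> i) (\<zeta> j) * cnj (cinner (\<xi> i) (\<zeta> j))" for i j
    unfolding S_def by (rule complex_norm_square)
  have "(\<Sum>j\<in>UNIV. complex_of_real (S i j)) = cinner (\<xi> i) (\<xi> i)" for i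
    unfolding S by (rule unitary_frame_Parseval[OF \<zeta>])
  then have rows: "(\<Sum>j\<in>UNIV. S i j) = 1" for i
    using \<xi> unfolding unitary_frame_def by (metis of_real_sum of_real_eq_1_iff)
  have "(\<Sum>i\<in>UNIV. complex_of_real (S i j)) = cinner (\<zeta> j) (\<zeta> j)" for j
  proof -
    have "complex_of_real (S i j) = cinner (\<zeta> j) (\<xi> i) * cnj (cinner (\<zeta> j) (\<xi> i))" for i
      unfolding S cinner_cnj by (simp add: mult.commute)
    then show ?thesis using unitary_frame_Parseval[OF \<xi>] by simp
  qed
  then have cols: "(\<Sum>i\<in>UNIV. S i j) = 1" for j
    using \<zeta> unfolding unitary_frame_def by (metis of_real_sum of_real_eq_1_iff)
  have diag: "Re (cinner (H *v \<xi> i) (\<xi> i)) = (\<Sum>j\<in>UNIV. S i j * l j)" for i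
  proof -
    have "cinner (H *v \<xi> i) (\<xi> i) = (\<Sum>j\<in>UNIV. cinner (H *v \<xi> i) (\<zeta> j) * cnj (cinner (\<xi> i) (\<zeta> j)))"
      by (rule unitary_frame_Parseval[OF \<zeta>, symmetric])
    also have "\<dots> = (\<Sum>j\<in>UNIV. complex_of_real (S i j * l j))"
      by (intro sum.cong refl) (simp add: hermitian_adjoint[OF H] ev cinner_scale_right S mult_ac)
    finally show ?thesis by simp
  qed
  obtain p where "bij p" "(\<Sum>i\<in>UNIV. a i * l (p i)) \<le> (\<Sum>i\<in>UNIV. \<Sum>j\<in>UNIV. a i * S i j * l j)"
    by (rule doubly_stochastic_rearrangement[of S a l, OF _ rows cols]) (simp_all add: S_def)
  moreover have "(\<Sum>i\<in>UNIV. \<Sum>j\<in>UNIV. a i * S i j * l j) = (\<Sum>i\<in>UNIV. a i * Re (cinner (H *v \<xi> i) (\<xi> i)))"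
    by (simp add: diag sum_distrib_left mult.assoc)
  ultimately show ?thesis using that by simp
qed

section \<open>The operator as an infimum of linear ones\<close>

lemma sigma_pos:
  fixes y :: "real ^ 'n::finite"
  assumes "\<And>i. y $ i > 0" "j \<in> {1..CARD('n)}" shows "sigma j y > 0"
proof -
  have "\<exists>J. J \<subseteq> (UNIV::'n set) \<and> card J = j" using assms(2) by (meson atLeastAtMost_iff obtain_subset_with_card_n)
  then show ?thesis unfolding sigma_def using assms(1)
    by (intro sum_pos) (auto intro!: prod_pos)
qed

lemma sigma_1: fixes x :: "real ^ 'n::finite" shows "sigma 1 x = (\<Sum>i\<in>UNIV. x $ i)"
proof -
  have "{J :: 'n set. J \<subseteq> UNIV \<and> card J = 1} = range (\<lambda>i. {i})"
    by (auto simp: card_1_singleton_iff)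
  then have "sigma 1 x = (\<Sum>J\<in>range (\<lambda>i. {i}). \<Prod>j\<in>J. x $ j)" by (simp only: sigma_def)
  also have "\<dots> = (\<Sum>i\<in>UNIV. x $ i)" by (subst sum.reindex) (auto simp: inj_on_def)
  finally show ?thesis .
qed

lemma permute_vec_continuous: "continuous_on S (permute_vec p)"
  unfolding permute_vec_def[abs_def] by (intro continuous_intros)

text \<open>
  Positive coefficients make the associated second-order operators elliptic.
\<close>

definition affine_majorants ::
  "(real ^ 'n::finite) set \<Rightarrow> (real ^ 'n \<Rightarrow> real) \<Rightarrow> ((real ^ 'n) \<times> real) set" where
  "affine_majorants \<Gamma> f = {(a, b). (\<forall>i. a $ i > 0) \<and> (\<forall>x\<in>closure \<Gamma>. f x \<le> a \<bullet> x + b)}"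

definition frame_trace ::
  "real ^ 'n::finite \<Rightarrow> ('n \<Rightarrow> complex ^ 'n) \<Rightarrow> complex ^ 'n ^ 'n \<Rightarrow> real" where
  "frame_trace a \<xi> H = (\<Sum>i\<in>UNIV. a $ i * Re (cinner (H *v \<xi> i) (\<xi> i)))"

context
  fixes \<Gamma> :: "(real ^ 'n::finite) set"
  assumes \<Gamma>: "admissible_cone \<Gamma>"
begin

lemma cone_positive: "(\<And>i. y $ i > 0) \<Longrightarrow> y \<in> \<Gamma>"
proof -
  assume "\<And>i. y $ i > 0"
  then have "y \<in> Garding_cone CARD('n)" using sigma_pos[of y] unfolding Garding_cone_def by blast
  then show ?thesis using \<Gamma> unfolding admissible_cone_def by blast
qed

lemma cone_add: "x \<in> \<Gamma> \<Longrightarrow> y \<in> \<Gamma> \<Longrightarrow> x + y \<in> \<Gamma>"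
proof -
  assume xy: "x \<in> \<Gamma>" "y \<in> \<Gamma>"
  have "(1/2) *\<^sub>R x + (1/2) *\<^sub>R y \<in> \<Gamma>"
    using \<Gamma> xy unfolding admissible_cone_def by (auto intro!: convexD)
  then have "2 *\<^sub>R ((1/2) *\<^sub>R x + (1/2) *\<^sub>R y) \<in> \<Gamma>" using \<Gamma> unfolding admissible_cone_def by (meson zero_less_numeral)
  then show ?thesis by (simp add: scaleR_add_right)
qed

lemma closure_cone_add: "x \<in> closure \<Gamma> \<Longrightarrow> y \<in> \<Gamma> \<Longrightarrow> x + y \<in> \<Gamma>"
proof -
  assume x: "x \<in> closure \<Gamma>" and y: "y \<in> \<Gamma>"
  have "open \<Gamma>" using \<Gamma> by (simp add: admissible_cone_def)
  then obtain e where e: "e > 0" "ball y e \<subseteq> \<Gamma>" using y open_contains_ball by blast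
  obtain x' where x': "x' \<in> \<Gamma>" "dist x' x < e" using x e(1) by (auto simp: closure_approachable)
  have "y + (x - x') \<in> ball y e" using x'(2) by (simp add: dist_norm norm_minus_commute)
  then have "x' + (y + (x - x')) \<in> \<Gamma>" using cone_add[OF x'(1)] e(2) by blast
  then show ?thesis by (simp add: algebra_simps)
qed

lemma closure_cone_scale: "x \<in> closure \<Gamma> \<Longrightarrow> t > 0 \<Longrightarrow> t *\<^sub>R x \<in> closure \<Gamma>"
proof -
  assume x: "x \<in> closure \<Gamma>" and t: "t > 0"
  obtain X where X: "\<And>n. X n \<in> \<Gamma>" "X \<longlonglongrightarrow> x" using x by (auto simp: closure_sequential)
  have "(\<lambda>n. t *\<^sub>R X n) \<longlonglongrightarrow> t *\<^sub>R x" by (intro tendsto_intros X)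
  moreover have "t *\<^sub>R X n \<in> \<Gamma>" for n using \<Gamma> X(1) t unfolding admissible_cone_def by blast
  ultimately show ?thesis unfolding closure_sequential by (intro exI[of _ "\<lambda>n. t *\<^sub>R X n"]) simp
qed

lemma closure_cone_permute: "x \<in> closure \<Gamma> \<Longrightarrow> bij p \<Longrightarrow> permute_vec p x \<in> closure \<Gamma>"
proof -
  assume x: "x \<in> closure \<Gamma>" and p: "bij p"
  obtain X where X: "\<And>n. X n \<in> \<Gamma>" "X \<longlonglongrightarrow> x" using x by (auto simp: closure_sequential)
  have "(\<lambda>n. permute_vec p (X n)) \<longlonglongrightarrow> permute_vec p x"
    by (rule continuous_on_tendsto_compose[OF permute_vec_continuous[of UNIV] X(2)]) auto
  moreover have "permute_vec p (X n) \<in> \<Gamma>" for n using \<Gamma> X(1) p unfolding admissible_cone_def by blast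
  ultimately show ?thesis unfolding closure_sequential by (intro exI[of _ "\<lambda>n. permute_vec p (X n)"]) simp
qed

lemma closure_cone_sum_nonneg: "x \<in> closure \<Gamma> \<Longrightarrow> (\<Sum>i\<in>UNIV. x $ i) \<ge> 0"
proof -
  assume "x \<in> closure \<Gamma>"
  moreover have "\<Gamma> \<subseteq> {x. (\<Sum>i\<in>UNIV. x $ i) \<ge> 0}"
    using \<Gamma> unfolding admissible_cone_def Garding_cone_def by (auto simp: sigma_1[symmetric] intro: less_imp_le)
  moreover have "closed {x::real^'n. (\<Sum>i\<in>UNIV. x $ i) \<ge> 0}" by (intro closed_Collect_le continuous_intros)
  ultimately show ?thesis using closure_minimal by blast
qed

lemma zero_in_closure_cone: "0 \<in> closure \<Gamma>"
proof -
  have "(\<lambda>n. (1 / real (Suc n)) *\<^sub>R ((\<chi> i. 1) :: real^'n)) \<longlonglongrightarrow> 0 *\<^sub>R (\<chi> i. 1)"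
    by (intro tendsto_intros LIMSEQ_inverse_real_of_nat[unfolded inverse_eq_divide])
  moreover have "(1 / real (Suc n)) *\<^sub>R ((\<chi> i. 1) :: real^'n) \<in> \<Gamma>" for n by (rule cone_positive) simp
  ultimately show ?thesis unfolding closure_sequential
    by (intro exI[of _ "\<lambda>n. (1 / real (Suc n)) *\<^sub>R ((\<chi> i. 1) :: real^'n)"]) simp
qed

text \<open>
  The hypograph of \<open>f\<close> is closed and convex, so a hyperplane with normal \<open>(A, - s)\<close> strictly separates it
  from \<open>(x0, c)\<close>. The signs follow from the shape of the hypograph: it is unbounded below, whence \<open>s \<ge> 0\<close>;
  it contains \<open>(0, 0)\<close>, whence \<open>\<kappa> < 0\<close>; its base is a cone, whence \<open>A \<ge> 0\<close> on the cone; and the cone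
  contains the positive orthant, whence the entries of \<open>A\<close> are nonnegative.
\<close>

lemma hypograph_separation:
  assumes f: "admissible_fun \<Gamma> f" and x0: "x0 \<in> closure \<Gamma> \<Longrightarrow> f x0 < c"
  obtains A s \<kappa> where "A \<bullet> x0 - s * c < \<kappa>" "s \<ge> 0" "\<kappa> < 0" "\<And>i. A $ i \<ge> 0"
    "\<And>x. x \<in> closure \<Gamma> \<Longrightarrow> \<kappa> < A \<bullet> x - s * f x" "\<And>x. x \<in> closure \<Gamma> \<Longrightarrow> A \<bullet> x \<ge> 0"
proof -
  have f0: "\<And>x. x \<in> closure \<Gamma> \<Longrightarrow> f x \<ge> 0" and fc: "continuous_on (closure \<Gamma>) f" and conc: "concave_on (closure \<Gamma>) f"
    using f unfolding admissible_fun_def by auto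
  define hyp where "hyp = {(x, t). x \<in> closure \<Gamma> \<and> t \<le> f x}"
  have cvx: "convex hyp"
    unfolding convex_def
  proof (intro ballI allI impI)
    fix p p' u v assume p: "p \<in> hyp" "p' \<in> hyp" and uv: "(0::real) \<le> u" "0 \<le> v" "u + v = 1"
    obtain x t x' t' where pp: "p = (x, t)" "p' = (x', t')" by (cases p, cases p')
    have x: "x \<in> closure \<Gamma>" "x' \<in> closure \<Gamma>" "t \<le> f x" "t' \<le> f x'" using p pp by (auto simp: hyp_def)
    have "u *\<^sub>R x + v *\<^sub>R x' \<in> closure \<Gamma>"
      using convex_closure[of \<Gamma>] \<Gamma> x uv unfolding admissible_cone_def by (intro convexD) auto
    moreover have "u * f x + v * f x' \<le> f (u *\<^sub>R x + v *\<^sub>R x')"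
      using conc x uv unfolding concave_on_iff by blast
    moreover have "u * t + v * t' \<le> u * f x + v * f x'" using x uv by (intro add_mono mult_left_mono) auto
    ultimately show "u *\<^sub>R p + v *\<^sub>R p' \<in> hyp" by (auto simp: pp hyp_def)
  qed
  have cls: "closed hyp"
  proof -
    have "closed ((closure \<Gamma> \<times> UNIV) \<inter> (\<lambda>p. f (fst p) - snd p) -` {0..})"
    proof (rule continuous_closed_preimage)
      show "continuous_on (closure \<Gamma> \<times> UNIV) (\<lambda>p. f (fst p) - snd p)"
        by (intro continuous_intros continuous_on_compose2[OF fc]) auto
    qed (auto intro: closed_Times)
    moreover have "(closure \<Gamma> \<times> UNIV) \<inter> (\<lambda>p. f (fst p) - snd p) -` {0..} = hyp" by (auto simp: hyp_def)
    ultimately show ?thesis by simp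
  qed
  have notin: "(x0, c) \<notin> hyp" using x0 by (auto simp: hyp_def)
  obtain w \<kappa> where w: "inner w (x0, c) < \<kappa>" "\<And>p. p \<in> hyp \<Longrightarrow> inner w p > \<kappa>"
    using separating_hyperplane_closed_point[OF cvx cls notin] by blast
  obtain A \<sigma> where w': "w = (A, \<sigma>)" by (cases w)
  define s where "s = - \<sigma>"
  have ineq: "\<kappa> < A \<bullet> x - s * t" if "x \<in> closure \<Gamma>" "t \<le> f x" for x t
    using w(2)[of "(x, t)"] that by (simp add: hyp_def w' s_def)
  have k0: "\<kappa> < 0" using ineq[OF zero_in_closure_cone f0[OF zero_in_closure_cone]] by simp
  have s0: "s \<ge> 0"
  proof (rule ccontr)
    assume "\<not> s \<ge> 0"
    then have s: "s < 0" by simp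
    have "\<kappa> / (- s) < 0" using k0 s by (intro divide_neg_pos) auto
    then have "\<kappa> / (- s) \<le> f 0" using f0[OF zero_in_closure_cone] by linarith
    from ineq[OF zero_in_closure_cone this] show False using s by simp
  qed
  have Ax: "\<kappa> < A \<bullet> x" if "x \<in> closure \<Gamma>" for x using ineq[OF that f0[OF that]] by simp
  have Ann: "A \<bullet> x \<ge> 0" if "x \<in> closure \<Gamma>" for x
  proof (rule ccontr)
    assume n: "\<not> A \<bullet> x \<ge> 0"
    define t where "t = \<kappa> / (A \<bullet> x)"
    have "t > 0" using n k0 by (simp add: t_def divide_neg_neg)
    from Ax[OF closure_cone_scale[OF that this]] show False using n by (simp add: t_def)
  qed
  have Ai: "A $ i \<ge> 0" for i
  proof (rule ccontr)
    assume n: "\<not> A $ i \<ge> 0"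
    \<comment> \<open>large enough to make \<open>A\<close> negative at \<open>(1, \<dots>, 1) + \<tau> e\<^sub>i\<close>\<close>
    define \<tau> where "\<tau> = (\<bar>A \<bullet> (\<chi> i. 1)\<bar> + 1) / (- (A $ i))"
    have t: "\<tau> > 0" using n unfolding \<tau>_def by (intro divide_pos_pos) auto
    have "(\<chi> i. 1) + \<tau> *\<^sub>R axis i 1 \<in> \<Gamma>"
      by (rule cone_positive) (use t in \<open>auto simp: axis_def add_pos_nonneg\<close>)
    then have "A \<bullet> ((\<chi> i. 1) + \<tau> *\<^sub>R axis i 1) \<ge> 0" using Ann closure_subset by blast
    then have "A \<bullet> (\<chi> i. 1) + \<tau> * (A $ i) \<ge> 0" by (simp add: inner_add_right inner_axis)
    moreover have "\<tau> * (A $ i) = - (\<bar>A \<bullet> (\<chi> i. 1)\<bar> + 1)" using n by (simp add: \<tau>_def)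
    ultimately show False by linarith
  qed
  show ?thesis
    by (rule that[of A s \<kappa>]) (use w(1) w' s_def s0 k0 Ai ineq Ann in auto)
qed

text \<open>
  Division by \<open>s\<close> yields a majorant with nonnegative coefficients. Adding a small multiple of the coordinate
  sum, which is nonnegative on the cone, makes them positive and uses up only half of the slack at \<open>x0\<close>.
\<close>

lemma majorant_from_separation:
  assumes s: "s > 0" and lt: "A \<bullet> x0 - s * c < \<kappa>" and Ai: "\<And>i. A $ i \<ge> 0"
    and maj: "\<And>x. x \<in> closure \<Gamma> \<Longrightarrow> \<kappa> < A \<bullet> x - s * f x"
  obtains a b where "(a, b) \<in> affine_majorants \<Gamma> f" "a \<bullet> x0 + b < c"
proof -
  define a0 where "a0 = (1 / s) *\<^sub>R A"
  define b where "b = - \<kappa> / s"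
  have m0: "f x \<le> a0 \<bullet> x + b" if "x \<in> closure \<Gamma>" for x
    using maj[OF that] s by (simp add: a0_def b_def field_simps)
  have l0: "a0 \<bullet> x0 + b < c" using lt s by (simp add: a0_def b_def field_simps)
  define S0 where "S0 = (\<Sum>i\<in>UNIV. x0 $ i)"
  define \<delta> where "\<delta> = (c - (a0 \<bullet> x0 + b)) / (2 * (\<bar>S0\<bar> + 1))"
  have d: "\<delta> > 0" unfolding \<delta>_def using l0 by (intro divide_pos_pos) auto
  define a where "a = a0 + \<delta> *\<^sub>R (\<chi> i. 1)"
  have ax: "a \<bullet> x = a0 \<bullet> x + \<delta> * (\<Sum>i\<in>UNIV. x $ i)" for x
    by (simp add: a_def inner_vec_def algebra_simps sum.distrib sum_distrib_left)
  have "(a, b) \<in> affine_majorants \<Gamma> f"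
    unfolding affine_majorants_def
  proof (intro CollectI case_prodI conjI allI ballI)
    show "a $ i > 0" for i using Ai[of i] s d by (simp add: a_def a0_def add_nonneg_pos)
    show "f x \<le> a \<bullet> x + b" if "x \<in> closure \<Gamma>" for x
    proof -
      have "\<delta> * (\<Sum>i\<in>UNIV. x $ i) \<ge> 0" using d closure_cone_sum_nonneg[OF that] by simp
      then show ?thesis using m0[OF that] ax[of x] by linarith
    qed
  qed
  moreover have "a \<bullet> x0 + b < c"
  proof -
    have "\<delta> * S0 \<le> \<delta> * (\<bar>S0\<bar> + 1)" using d by (intro mult_left_mono) auto
    also have "\<dots> = (c - (a0 \<bullet> x0 + b)) / 2" unfolding \<delta>_def by (simp add: field_simps)
    finally have 1: "\<delta> * S0 \<le> (c - (a0 \<bullet> x0 + b)) / 2" .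
    have 2: "a \<bullet> x0 = a0 \<bullet> x0 + \<delta> * S0" unfolding S0_def by (rule ax)
    show ?thesis using 1 2 l0 by argo
  qed
  ultimately show ?thesis using that by blast
qed

text \<open>
  Above a point of the cone itself the separating hyperplane cannot be vertical.
\<close>

lemma affine_majorants_nonempty:
  assumes f: "admissible_fun \<Gamma> f" shows "affine_majorants \<Gamma> f \<noteq> {}"
proof -
  let ?x = "(\<chi> i. 1) :: real^'n"
  have x: "?x \<in> closure \<Gamma>" using cone_positive[of ?x] closure_subset by auto
  obtain A s \<kappa> where A: "A \<bullet> ?x - s * (f ?x + 1) < \<kappa>" "s \<ge> 0" "\<kappa> < 0" "\<And>i. A $ i \<ge> 0"
    "\<And>x. x \<in> closure \<Gamma> \<Longrightarrow> \<kappa> < A \<bullet> x - s * f x" "\<And>x. x \<in> closure \<Gamma> \<Longrightarrow> A \<bullet> x \<ge> 0"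
    using hypograph_separation[OF f, of ?x "f ?x + 1"] by auto
  have "s \<noteq> 0" using A(1,3) A(6)[OF x] by auto
  then have "s > 0" using A(2) by simp
  from majorant_from_separation[OF this A(1,4,5)] show ?thesis by blast
qed

text \<open>
  This contains two statements: inside the closed cone \<open>f\<close> is the infimum of its majorants, and outside
  the infimum of the majorants is \<open>-\<infinity>\<close>, matching the value of the operator there.
\<close>

lemma affine_majorant_below:
  assumes f: "admissible_fun \<Gamma> f" and x0: "x0 \<in> closure \<Gamma> \<Longrightarrow> f x0 < c"
  obtains a b where "(a, b) \<in> affine_majorants \<Gamma> f" "a \<bullet> x0 + b < c"
proof -
  obtain A s \<kappa> where A: "A \<bullet> x0 - s * c < \<kappa>" "s \<ge> 0" "\<kappa> < 0" "\<And>i. A $ i \<ge> 0"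
    "\<And>x. x \<in> closure \<Gamma> \<Longrightarrow> \<kappa> < A \<bullet> x - s * f x" "\<And>x. x \<in> closure \<Gamma> \<Longrightarrow> A \<bullet> x \<ge> 0"
    using hypograph_separation[OF f x0] by metis
  show ?thesis
  proof (cases "s = 0")
    case False
    then have "s > 0" using A(2) by simp
    from majorant_from_separation[OF this A(1,4,5)] show ?thesis using that by blast
  next
    \<comment> \<open>the hyperplane is vertical, and a large multiple of \<open>A\<close> pushes any majorant down at \<open>x0\<close>\<close>
    case True
    then have neg: "A \<bullet> x0 < 0" using A(1,3) by simp
    obtain a0 b0 where ab: "(a0, b0) \<in> affine_majorants \<Gamma> f" using affine_majorants_nonempty[OF f] by auto
    define N where "N = (\<bar>a0 \<bullet> x0 + b0 - c\<bar> + 1) / (- (A \<bullet> x0))"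
    have N: "N > 0" unfolding N_def using neg by (intro divide_pos_pos) auto
    have "(a0 + N *\<^sub>R A, b0) \<in> affine_majorants \<Gamma> f"
      unfolding affine_majorants_def
    proof (intro CollectI case_prodI conjI allI ballI)
      show "(a0 + N *\<^sub>R A) $ i > 0" for i using ab A(4)[of i] N by (simp add: affine_majorants_def add_pos_nonneg)
      show "f x \<le> (a0 + N *\<^sub>R A) \<bullet> x + b0" if "x \<in> closure \<Gamma>" for x
      proof -
        have "f x \<le> a0 \<bullet> x + b0" using ab that by (simp add: affine_majorants_def)
        moreover have "N * (A \<bullet> x) \<ge> 0" using N A(6)[OF that] by simp
        ultimately show ?thesis by (simp add: inner_add_left)
      qed
    qed
    moreover have "(a0 + N *\<^sub>R A) \<bullet> x0 + b0 < c"
    proof -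
      have "N * (A \<bullet> x0) = - (\<bar>a0 \<bullet> x0 + b0 - c\<bar> + 1)" using neg by (simp add: N_def)
      then show ?thesis by (simp add: inner_add_left)
    qed
    ultimately show ?thesis using that by blast
  qed
qed

lemma frame_trace_eigenframe:
  assumes "unitary_frame \<xi>" "\<And>i. H *v \<xi> i = complex_of_real (l i) *s \<xi> i"
  shows "frame_trace a \<xi> H = a \<bullet> (\<chi> i. l i)"
proof -
  have "Re (cinner (H *v \<xi> i) (\<xi> i)) = l i" for i
    using assms unfolding unitary_frame_def by (simp add: cinner_scale_left)
  then show ?thesis by (simp add: frame_trace_def inner_vec_def)
qed

lemma frame_trace_ge_eigvals:
  assumes H: "hermitian H" and \<xi>: "unitary_frame \<xi>"
  obtains p where "bij p" "a \<bullet> permute_vec p (eigvals H) \<le> frame_trace a \<xi> H"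
proof -
  obtain \<zeta> l where z: "unitary_frame \<zeta>" "\<And>i. H *v \<zeta> i = complex_of_real (l i) *s \<zeta> i"
    using hermitian_eigenframe[OF H] by blast
  obtain p where p: "bij p" "eigvals H = permute_vec p (\<chi> i. l i)" using eigvals_permute[OF z] by blast
  obtain p' where p': "bij p'" "(\<Sum>i\<in>UNIV. a $ i * l (p' i)) \<le> (\<Sum>i\<in>UNIV. a $ i * Re (cinner (H *v \<xi> i) (\<xi> i)))"
    using frame_diagonal_majorized[OF z \<xi> H, of "\<lambda>i. a $ i"] by blast
  let ?r = "inv p \<circ> p'"
  have "permute_vec ?r (eigvals H) = (\<chi> i. l (p' i))"
    using p by (simp add: permute_vec_def vec_eq_iff bij_is_surj surj_f_inv_f)
  then have "a \<bullet> permute_vec ?r (eigvals H) \<le> frame_trace a \<xi> H"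
    using p'(2) by (simp add: frame_trace_def inner_vec_def)
  moreover have "bij ?r" using p(1) p'(1) by (intro bij_comp bij_imp_bij_inv)
  ultimately show ?thesis using that by blast
qed

lemma eigvals_in_iff:
  assumes z: "unitary_frame \<zeta>" "\<And>i. H *v \<zeta> i = complex_of_real (l i) *s \<zeta> i"
  shows "eigvals H \<in> closure \<Gamma> \<longleftrightarrow> (\<chi> i. l i) \<in> closure \<Gamma>"
proof -
  obtain p where p: "bij p" "eigvals H = permute_vec p (\<chi> i. l i)" using eigvals_permute[OF z] by blast
  have "permute_vec (inv p) (eigvals H) = (\<chi> i. l i)"
    using p by (simp add: permute_vec_def vec_eq_iff bij_is_surj surj_f_inv_f)
  then show ?thesis using p closure_cone_permute bij_imp_bij_inv by metis
qed

text \<open>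
  A translate of the closed cone by a positive vector lies in the open cone.
\<close>

lemma M_cone_add_identity:
  assumes H: "hermitian H" and e: "eigvals H \<in> closure \<Gamma>" and d: "\<delta> > 0"
  shows "H + mat (complex_of_real \<delta>) \<in> M_cone \<Gamma>"
proof -
  obtain \<zeta> l where z: "unitary_frame \<zeta>" "\<And>i. H *v \<zeta> i = complex_of_real (l i) *s \<zeta> i"
    using hermitian_eigenframe[OF H] by blast
  have mv: "mat (complex_of_real \<delta>) *v x = complex_of_real \<delta> *s x" for x :: "complex^'n"
    by (simp add: vec_eq_iff matrix_vector_mult_def mat_def if_distrib[of "\<lambda>y. y * _"] cong: if_cong)
  have z': "(H + mat (complex_of_real \<delta>)) *v \<zeta> i = complex_of_real (l i + \<delta>) *s \<zeta> i" for i
    by (simp add: matrix_vector_mult_add_rdistrib mv z vector_sadd_rdistrib)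
  obtain p where p: "bij p" "eigvals (H + mat (complex_of_real \<delta>)) = permute_vec p (\<chi> i. l i + \<delta>)"
    using eigvals_permute[OF z(1) z'] by blast
  have "(\<chi> i. l i) + (\<chi> i. \<delta>) \<in> \<Gamma>"
    using closure_cone_add[OF _ cone_positive[of "\<chi> i. \<delta>"]] e d by (simp add: eigvals_in_iff[OF z])
  moreover have "(\<chi> i. l i) + (\<chi> i. \<delta>) = (\<chi> i. l i + \<delta>)" by (simp add: vec_eq_iff)
  ultimately have "(\<chi> i. l i + \<delta>) \<in> \<Gamma>" by simp
  then have "eigvals (H + mat (complex_of_real \<delta>)) \<in> \<Gamma>" using p \<Gamma> unfolding admissible_cone_def by metis
  moreover have "hermitian (H + mat (complex_of_real \<delta>))"
    unfolding hermitian_def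
  proof (intro allI)
    fix \<alpha> \<beta>
    have "H $ \<alpha> $ \<beta> = cnj (H $ \<beta> $ \<alpha>)" using H unfolding hermitian_def by blast
    then show "(H + mat (complex_of_real \<delta>)) $ \<alpha> $ \<beta> = cnj ((H + mat (complex_of_real \<delta>)) $ \<beta> $ \<alpha>)"
      by (simp add: mat_def)
  qed
  ultimately show ?thesis by (simp add: M_cone_def)
qed

lemma frame_trace_continuous: "continuous_on S (frame_trace a \<xi>)"
  unfolding frame_trace_def[abs_def] cinner_def matrix_vector_mult_def by (intro continuous_intros)

text \<open>
  For a limit of matrices in the cone the inequalities \<open>\<Sum>\<^sub>i a\<^sub>i \<langle>H \<zeta>\<^sub>i, \<zeta>\<^sub>i\<rangle> + b \<ge> 0\<close> persist, being linear in
  the matrix, and in an eigenframe of the limit one of them would fail if its eigenvalues were outside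
  the closed cone. Conversely, matrices with eigenvalues in the closed cone are approached by adding
  multiples of the identity.
\<close>

lemma closure_M_cone_iff:
  assumes f: "admissible_fun \<Gamma> f" and H: "hermitian H"
  shows "H \<in> closure (M_cone \<Gamma>) \<longleftrightarrow> eigvals H \<in> closure \<Gamma>"
proof
  assume e: "eigvals H \<in> closure \<Gamma>"
  have "(\<lambda>n. H + mat (complex_of_real (1 / real (Suc n)))) \<longlonglongrightarrow> H + mat (complex_of_real 0)"
  proof (intro tendsto_add tendsto_const)
    have "(\<lambda>n. complex_of_real (1 / real (Suc n))) \<longlonglongrightarrow> complex_of_real 0"
      by (intro tendsto_of_real LIMSEQ_inverse_real_of_nat[unfolded inverse_eq_divide])
    then show "(\<lambda>n. mat (complex_of_real (1 / real (Suc n))) :: complex^'n^'n) \<longlonglongrightarrow> mat (complex_of_real 0)"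
      unfolding mat_def by (intro tendsto_vec_lambda) (auto simp: tendsto_const)
  qed
  moreover have "mat (complex_of_real 0) = (0 :: complex^'n^'n)" by (simp add: mat_def vec_eq_iff)
  moreover have "H + mat (complex_of_real (1 / real (Suc n))) \<in> M_cone \<Gamma>" for n
    by (rule M_cone_add_identity[OF H e]) simp
  ultimately show "H \<in> closure (M_cone \<Gamma>)" unfolding closure_sequential
    by (intro exI[of _ "\<lambda>n. H + mat (complex_of_real (1 / real (Suc n)))"]) simp
next
  assume Hc: "H \<in> closure (M_cone \<Gamma>)"
  then obtain X where X: "\<And>n. X n \<in> M_cone \<Gamma>" "X \<longlonglongrightarrow> H" by (auto simp: closure_sequential)
  obtain \<zeta> l where z: "unitary_frame \<zeta>" "\<And>i. H *v \<zeta> i = complex_of_real (l i) *s \<zeta> i"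
    using hermitian_eigenframe[OF H] by blast
  have nn: "a \<bullet> (\<chi> i. l i) + b \<ge> 0" if ab: "(a, b) \<in> affine_majorants \<Gamma> f" for a b
  proof -
    have "(\<lambda>n. frame_trace a \<zeta> (X n) + b) \<longlonglongrightarrow> frame_trace a \<zeta> H + b"
      by (intro tendsto_add tendsto_const continuous_on_tendsto_compose[OF frame_trace_continuous[of UNIV] X(2)]) auto
    moreover have "frame_trace a \<zeta> (X n) + b \<ge> 0" for n
    proof -
      have hX: "hermitian (X n)" "eigvals (X n) \<in> \<Gamma>" using X(1)[of n] by (auto simp: M_cone_def)
      obtain p where p: "bij p" "a \<bullet> permute_vec p (eigvals (X n)) \<le> frame_trace a \<zeta> (X n)"
        using frame_trace_ge_eigvals[OF hX(1) z(1)] by blast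
      have pin: "permute_vec p (eigvals (X n)) \<in> closure \<Gamma>"
        using closure_cone_permute[OF _ p(1)] hX(2) closure_subset by blast
      then have "0 \<le> f (permute_vec p (eigvals (X n)))" using f unfolding admissible_fun_def by blast
      also have "\<dots> \<le> a \<bullet> permute_vec p (eigvals (X n)) + b" using ab pin by (simp add: affine_majorants_def)
      finally show ?thesis using p(2) by linarith
    qed
    ultimately have "frame_trace a \<zeta> H + b \<ge> 0" by (intro LIMSEQ_le_const) auto
    then show ?thesis using frame_trace_eigenframe[OF z] by simp
  qed
  have "(\<chi> i. l i) \<in> closure \<Gamma>"
  proof (rule ccontr)
    assume "(\<chi> i. l i) \<notin> closure \<Gamma>"
    then obtain a b where "(a, b) \<in> affine_majorants \<Gamma> f" "a \<bullet> (\<chi> i. l i) + b < 0"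
      using affine_majorant_below[OF f, of "\<chi> i. l i" 0] by blast
    then show False using nn[of a b] by simp
  qed
  then show "eigvals H \<in> closure \<Gamma>" using eigvals_in_iff[OF z] by simp
qed

text \<open>
  If \<open>F(H) \<ge> c\<close>, each majorant dominates \<open>f\<close> at every ordering of the eigenvalues, and the best ordering
  bounds the weighted diagonal in any frame from below. Conversely, the inequalities in an eigenframe
  alone force \<open>f \<ge> c\<close> at the eigenvalues and place them in the closed cone.
\<close>

theorem F_op_ge_iff:
  assumes f: "admissible_fun \<Gamma> f" and H: "hermitian H"
  shows "ereal c \<le> F_op \<Gamma> f H \<longleftrightarrow>
    (\<forall>(a, b)\<in>affine_majorants \<Gamma> f. \<forall>\<xi>. unitary_frame \<xi> \<longrightarrow> c \<le> frame_trace a \<xi> H + b)"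
proof
  assume F: "ereal c \<le> F_op \<Gamma> f H"
  then have Hc: "H \<in> closure (M_cone \<Gamma>)" by (auto simp: F_op_def split: if_splits)
  then have e: "eigvals H \<in> closure \<Gamma>" using closure_M_cone_iff[OF f H] by simp
  have fc: "c \<le> f (eigvals H)" using F Hc by (simp add: F_op_def)
  show "\<forall>(a, b)\<in>affine_majorants \<Gamma> f. \<forall>\<xi>. unitary_frame \<xi> \<longrightarrow> c \<le> frame_trace a \<xi> H + b"
  proof (clarify)
    fix a b and \<xi> :: "'n \<Rightarrow> complex ^ 'n"
    assume ab: "(a, b) \<in> affine_majorants \<Gamma> f" and \<xi>: "unitary_frame \<xi>"
    obtain p where p: "bij p" "a \<bullet> permute_vec p (eigvals H) \<le> frame_trace a \<xi> H"
      using frame_trace_ge_eigvals[OF H \<xi>] by blast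
    have "f (eigvals H) = f (permute_vec p (eigvals H))" using f e p(1) unfolding admissible_fun_def by auto
    also have "\<dots> \<le> a \<bullet> permute_vec p (eigvals H) + b"
      using ab closure_cone_permute[OF e p(1)] by (simp add: affine_majorants_def)
    finally show "c \<le> frame_trace a \<xi> H + b" using p(2) fc by linarith
  qed
next
  assume R: "\<forall>(a, b)\<in>affine_majorants \<Gamma> f. \<forall>\<xi>. unitary_frame \<xi> \<longrightarrow> c \<le> frame_trace a \<xi> H + b"
  obtain \<zeta> l where z: "unitary_frame \<zeta>" "\<And>i. H *v \<zeta> i = complex_of_real (l i) *s \<zeta> i"
    using hermitian_eigenframe[OF H] by blast
  let ?l = "\<chi> i. l i"
  have ab: "c \<le> a \<bullet> ?l + b" if "(a, b) \<in> affine_majorants \<Gamma> f" for a b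
    using R that z(1) frame_trace_eigenframe[OF z] by fastforce
  have l: "?l \<in> closure \<Gamma> \<and> c \<le> f ?l"
  proof (rule ccontr)
    assume "\<not> ?thesis"
    then have "?l \<in> closure \<Gamma> \<Longrightarrow> f ?l < c" by simp
    from affine_majorant_below[OF f this] obtain a b
      where "(a, b) \<in> affine_majorants \<Gamma> f" "a \<bullet> ?l + b < c" by blast
    then show False using ab[of a b] by simp
  qed
  obtain p where p: "bij p" "eigvals H = permute_vec p ?l" using eigvals_permute[OF z] by blast
  have "f (eigvals H) = f ?l" using f l p unfolding admissible_fun_def by auto
  moreover have "H \<in> closure (M_cone \<Gamma>)" using closure_M_cone_iff[OF f H] eigvals_in_iff[OF z] l by simp
  ultimately show "ereal c \<le> F_op \<Gamma> f H" using l by (simp add: F_op_def)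
qed

end

section \<open>The complex Hessian\<close>

lemma cHess_eq:
  fixes q :: "complex ^ 'n::finite \<Rightarrow> real"
  assumes q: "Ck_on 2 q S" "open S" "z \<in> S"
  shows "cHess q z $ \<alpha> $ \<beta> =
    (complex_of_real (second_deriv q z (axis \<beta> 1) (axis \<alpha> 1) + second_deriv q z (axis \<beta> \<i>) (axis \<alpha> \<i>))
     + \<i> * complex_of_real (second_deriv q z (axis \<beta> \<i>) (axis \<alpha> 1) - second_deriv q z (axis \<beta> 1) (axis \<alpha> \<i>))) / 4"
proof -
  let ?g = "\<lambda>w. complex_of_real (q w)"
  have D1: "frechet_derivative ?g (at x) = (\<lambda>v. complex_of_real (frechet_derivative q (at x) v))" if "x \<in> S" for x
    by (rule frechet_derivative_at[symmetric]) (rule has_derivative_of_real[OF C2_D1[OF q(1,2) that]])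
  let ?h = "\<lambda>x. (complex_of_real (frechet_derivative q (at x) (axis \<beta> 1))
                    + \<i> * complex_of_real (frechet_derivative q (at x) (axis \<beta> \<i>))) / 2"
  have h: "dzbar \<beta> ?g x = ?h x" if "x \<in> S" for x
    by (simp add: dzbar_def D1[OF that])
  have "(?h has_derivative (\<lambda>v. (complex_of_real (second_deriv q z (axis \<beta> 1) v)
            + \<i> * complex_of_real (second_deriv q z (axis \<beta> \<i>) v)) / 2)) (at z)"
    by (intro bounded_linear.has_derivative[OF bounded_linear_divide] has_derivative_add
        has_derivative_mult_right has_derivative_of_real C2_D2[OF q])
  then have "frechet_derivative ?h (at z) = (\<lambda>v. (complex_of_real (second_deriv q z (axis \<beta> 1) v)
            + \<i> * complex_of_real (second_deriv q z (axis \<beta> \<i>) v)) / 2)"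
    by (rule frechet_derivative_at[symmetric])
  moreover have "frechet_derivative (dzbar \<beta> ?g) (at z) = frechet_derivative ?h (at z)"
    by (rule frechet_derivative_cong_open[OF q(2,3) h])
  ultimately show ?thesis
    unfolding cHess_def by (simp add: dz_def field_simps)
qed

lemma cHess_hermitian:
  fixes q :: "complex ^ 'n::finite \<Rightarrow> real"
  assumes "Ck_on 2 q S" "open S" "z \<in> S"
  shows "hermitian (cHess q z)"
  unfolding hermitian_def
proof (intro allI)
  fix \<alpha> \<beta>
  have s: "second_deriv q z v w = second_deriv q z w v" for v w by (rule second_deriv_symmetric[OF assms])
  show "cHess q z $ \<alpha> $ \<beta> = cnj (cHess q z $ \<beta> $ \<alpha>)"
    unfolding cHess_eq[OF assms]
    using s[of "axis \<beta> 1" "axis \<alpha> 1"] s[of "axis \<beta> \<i>" "axis \<alpha> \<i>"] s[of "axis \<beta> \<i>" "axis \<alpha> 1"] s[of "axis \<beta> 1" "axis \<alpha> \<i>"]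
    by (simp add: complex_eq_iff)
qed

definition cnj_vec :: "complex ^ 'n::finite \<Rightarrow> complex ^ 'n" where "cnj_vec c = (\<chi> i. cnj (c $ i))"

lemma vec_axis_expansion:
  fixes c :: "complex ^ 'n::finite"
  shows "c = (\<Sum>\<alpha>\<in>UNIV. Re (c $ \<alpha>) *\<^sub>R axis \<alpha> 1 + Im (c $ \<alpha>) *\<^sub>R axis \<alpha> \<i>)"
  unfolding vec_eq_iff
proof (intro allI)
  fix i
  have "(\<Sum>\<alpha>\<in>UNIV. Re (c $ \<alpha>) *\<^sub>R axis \<alpha> 1 + Im (c $ \<alpha>) *\<^sub>R axis \<alpha> \<i>) $ i
     = (\<Sum>\<alpha>\<in>UNIV. if \<alpha> = i then c $ i else 0)"
    unfolding sum_component by (intro sum.cong refl) (auto simp: axis_def complex_eq_iff)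
  then show "c $ i = (\<Sum>\<alpha>\<in>UNIV. Re (c $ \<alpha>) *\<^sub>R axis \<alpha> 1 + Im (c $ \<alpha>) *\<^sub>R axis \<alpha> \<i>) $ i" by simp
qed

text \<open>
  The directions are conjugated because the matrix has \<open>\<partial>/\<partial>z\<^sub>\<alpha>\<close> in the row index and the pairing is
  conjugate linear in its second argument.
\<close>

lemma cHess_quadratic_form:
  fixes q :: "complex ^ 'n::finite \<Rightarrow> real"
  assumes q: "Ck_on 2 q S" "open S" "z \<in> S"
  shows "Re (cinner (cHess q z *v c) c) =
    (second_deriv q z (cnj_vec c) (cnj_vec c) + second_deriv q z (\<i> *s cnj_vec c) (\<i> *s cnj_vec c)) / 4"
proof -
  define B where "B = second_deriv q z"
  have bil: "bilinear B" unfolding B_def by (rule second_deriv_bilinear[OF q])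
  let ?e = "\<lambda>\<alpha>. axis \<alpha> 1 :: complex^'n" and ?f = "\<lambda>\<alpha>. axis \<alpha> \<i> :: complex^'n"
  have expand: "B x x = (\<Sum>\<beta>\<in>UNIV. \<Sum>\<alpha>\<in>UNIV.
      Re (x $ \<beta>) * Re (x $ \<alpha>) * B (?e \<beta>) (?e \<alpha>) + Re (x $ \<beta>) * Im (x $ \<alpha>) * B (?e \<beta>) (?f \<alpha>)
    + Im (x $ \<beta>) * Re (x $ \<alpha>) * B (?f \<beta>) (?e \<alpha>) + Im (x $ \<beta>) * Im (x $ \<alpha>) * B (?f \<beta>) (?f \<alpha>))" for x
  proof -
    have "B x x = B (\<Sum>\<beta>\<in>UNIV. Re (x $ \<beta>) *\<^sub>R ?e \<beta> + Im (x $ \<beta>) *\<^sub>R ?f \<beta>) (\<Sum>\<alpha>\<in>UNIV. Re (x $ \<alpha>) *\<^sub>R ?e \<alpha> + Im (x $ \<alpha>) *\<^sub>R ?f \<alpha>)"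
      using vec_axis_expansion[of x] by simp
    also have "\<dots> = (\<Sum>(\<beta>, \<alpha>)\<in>UNIV \<times> UNIV. B (Re (x $ \<beta>) *\<^sub>R ?e \<beta> + Im (x $ \<beta>) *\<^sub>R ?f \<beta>) (Re (x $ \<alpha>) *\<^sub>R ?e \<alpha> + Im (x $ \<alpha>) *\<^sub>R ?f \<alpha>))"
      by (rule bilinear_sum[OF bil])
    also have "\<dots> = (\<Sum>\<beta>\<in>UNIV. \<Sum>\<alpha>\<in>UNIV. B (Re (x $ \<beta>) *\<^sub>R ?e \<beta> + Im (x $ \<beta>) *\<^sub>R ?f \<beta>) (Re (x $ \<alpha>) *\<^sub>R ?e \<alpha> + Im (x $ \<alpha>) *\<^sub>R ?f \<alpha>))"
      by (rule sum.cartesian_product[symmetric])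
    finally show ?thesis
      by (simp add: bilinear_ladd[OF bil] bilinear_radd[OF bil] bilinear_lmul[OF bil] bilinear_rmul[OF bil] algebra_simps)
  qed
  have "Re (cinner (cHess q z *v c) c) = (\<Sum>\<alpha>\<in>UNIV. \<Sum>\<beta>\<in>UNIV. Re (cHess q z $ \<alpha> $ \<beta> * c $ \<beta> * cnj (c $ \<alpha>)))"
    by (simp only: cinner_def matrix_vector_mult_def vec_lambda_beta sum_distrib_right Re_sum)
  also have "\<dots> = (\<Sum>\<beta>\<in>UNIV. \<Sum>\<alpha>\<in>UNIV. Re (cHess q z $ \<alpha> $ \<beta> * c $ \<beta> * cnj (c $ \<alpha>)))" by (rule sum.swap)
  finally have 1: "Re (cinner (cHess q z *v c) c) = (\<Sum>\<beta>\<in>UNIV. \<Sum>\<alpha>\<in>UNIV. Re (cHess q z $ \<alpha> $ \<beta> * c $ \<beta> * cnj (c $ \<alpha>)))" .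
  have 2: "(B (cnj_vec c) (cnj_vec c) + B (\<i> *s cnj_vec c) (\<i> *s cnj_vec c)) / 4
     = (\<Sum>\<beta>\<in>UNIV. \<Sum>\<alpha>\<in>UNIV. Re (cHess q z $ \<alpha> $ \<beta> * c $ \<beta> * cnj (c $ \<alpha>)))"
    unfolding expand sum.distrib[symmetric] sum_divide_distrib
  proof (intro sum.cong refl)
    fix \<beta> \<alpha>
    show "(Re (cnj_vec c $ \<beta>) * Re (cnj_vec c $ \<alpha>) * B (?e \<beta>) (?e \<alpha>) + Re (cnj_vec c $ \<beta>) * Im (cnj_vec c $ \<alpha>) * B (?e \<beta>) (?f \<alpha>)
    + Im (cnj_vec c $ \<beta>) * Re (cnj_vec c $ \<alpha>) * B (?f \<beta>) (?e \<alpha>) + Im (cnj_vec c $ \<beta>) * Im (cnj_vec c $ \<alpha>) * B (?f \<beta>) (?f \<alpha>)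
    + (Re ((\<i> *s cnj_vec c) $ \<beta>) * Re ((\<i> *s cnj_vec c) $ \<alpha>) * B (?e \<beta>) (?e \<alpha>) + Re ((\<i> *s cnj_vec c) $ \<beta>) * Im ((\<i> *s cnj_vec c) $ \<alpha>) * B (?e \<beta>) (?f \<alpha>)
    + Im ((\<i> *s cnj_vec c) $ \<beta>) * Re ((\<i> *s cnj_vec c) $ \<alpha>) * B (?f \<beta>) (?e \<alpha>) + Im ((\<i> *s cnj_vec c) $ \<beta>) * Im ((\<i> *s cnj_vec c) $ \<alpha>) * B (?f \<beta>) (?f \<alpha>))) / 4
    = Re (cHess q z $ \<alpha> $ \<beta> * c $ \<beta> * cnj (c $ \<alpha>))"
      unfolding cHess_eq[OF q] B_def cnj_vec_def by (simp add: field_simps)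
  qed
  show ?thesis using 1 2 by (simp add: B_def)
qed

lemma cnj_vec_cinner: "cinner (cnj_vec x) (cnj_vec y) = cnj (cinner x y)"
  by (simp add: cinner_def cnj_vec_def)

text \<open>
  The diagonal entry of the complex Hessian along \<open>\<xi>\<^sub>i\<close> is a quarter of the sum of the second derivatives
  along the conjugate vector and \<open>\<i>\<close> times it. These \<open>2 n\<close> vectors form a real orthonormal basis, and the
  two in one complex line get the same weight.
\<close>

lemma frame_operator:
  fixes \<xi> :: "'n::finite \<Rightarrow> complex ^ 'n" and a :: "real ^ 'n"
  assumes \<xi>: "unitary_frame \<xi>" and a: "\<And>i. a $ i > 0"
  obtains B w where "weighted_frame B w"
    "\<And>q S z. Ck_on 2 q S \<Longrightarrow> open S \<Longrightarrow> z \<in> S \<Longrightarrow> weighted_frame.elliptic B w q z = frame_trace a \<xi> (cHess q z)"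
proof -
  define \<eta> where "\<eta> i = cnj_vec (\<xi> i)" for i
  have on: "cinner (\<eta> i) (\<eta> j) = (if i = j then 1 else 0)" for i j
    using \<xi> by (simp add: \<eta>_def cnj_vec_cinner unitary_frame_def)
  define B where "B = frame_basis UNIV \<eta>"
  \<comment> \<open>the factor \<open>1 / 4\<close> comes from the Wirtinger derivatives; the index \<open>i\<close> is recovered from the vector\<close>
  define w where "w b = a $ (SOME i. b = \<eta> i \<or> b = \<i> *s \<eta> i) / 4" for b
  note fb = frame_basis_orthonormal[of UNIV \<eta>, OF on]
  have wf: "weighted_frame B w"
  proof
    show "finite B" by (simp add: B_def frame_basis_def)
    show "card B = DIM(complex ^ 'n)" unfolding B_def using frame_basis_card[of UNIV \<eta>] on by simp
    show "b \<bullet> c = (if b = c then 1 else 0)" if "b \<in> B" "c \<in> B" for b c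
      using fb(1) that by (simp add: B_def)
    show "w b > 0" if "b \<in> B" for b using a by (simp add: w_def)
  qed
  have ne: "\<eta> i \<noteq> \<i> *s \<eta> j" for i j using fb(4) by auto
  have w1: "w (\<eta> i) = a $ i / 4" for i
  proof -
    have "(\<eta> i = \<eta> j \<or> \<eta> i = \<i> *s \<eta> j) \<longleftrightarrow> j = i" for j using fb(2) ne by (auto simp: inj_on_def)
    then show ?thesis by (simp add: w_def)
  qed
  have w2: "w (\<i> *s \<eta> i) = a $ i / 4" for i
  proof -
    have "(\<i> *s \<eta> i = \<eta> j \<or> \<i> *s \<eta> i = \<i> *s \<eta> j) \<longleftrightarrow> j = i" for j
      using fb(3) ne[of j i] by (auto simp: inj_on_def)
    then show ?thesis by (simp add: w_def)
  qed
  have "weighted_frame.elliptic B w q z = frame_trace a \<xi> (cHess q z)"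
    if q: "Ck_on 2 q S" "open S" "z \<in> S" for q S z
  proof -
    have "weighted_frame.elliptic B w q z = (\<Sum>b\<in>B. w b * second_deriv q z b b)"
      by (rule weighted_frame.elliptic_def[OF wf])
    also have "\<dots> = (\<Sum>b\<in>range \<eta>. w b * second_deriv q z b b) + (\<Sum>b\<in>range (\<lambda>i. \<i> *s \<eta> i). w b * second_deriv q z b b)"
      unfolding B_def frame_basis_def by (rule sum.union_disjoint) (use fb(4) in auto)
    also have "\<dots> = (\<Sum>i\<in>UNIV. w (\<eta> i) * second_deriv q z (\<eta> i) (\<eta> i)) + (\<Sum>i\<in>UNIV. w (\<i> *s \<eta> i) * second_deriv q z (\<i> *s \<eta> i) (\<i> *s \<eta> i))"
      using fb(2,3) by (simp add: sum.reindex)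
    also have "\<dots> = (\<Sum>i\<in>UNIV. a $ i * ((second_deriv q z (\<eta> i) (\<eta> i) + second_deriv q z (\<i> *s \<eta> i) (\<i> *s \<eta> i)) / 4))"
      unfolding w1 w2 sum.distrib[symmetric] by (intro sum.cong refl) (simp add: algebra_simps)
    also have "\<dots> = frame_trace a \<xi> (cHess q z)"
      unfolding frame_trace_def cHess_quadratic_form[OF q] \<eta>_def by (rule refl)
    finally show ?thesis .
  qed
  then show ?thesis using that wf by blast
qed

section \<open>Smooth kernels and convolution over a domain\<close>

lemma Ck_on_local:
  assumes "open S" "\<And>x. x \<in> S \<Longrightarrow> \<exists>V. open V \<and> x \<in> V \<and> Ck_on m f V"
  shows "Ck_on m f S"
  using assms(2)
proof (induction m arbitrary: f)
  case 0
  have "isCont f x" if "x \<in> S" for x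
    using 0[OF that] by (auto simp: continuous_on_eq_continuous_at)
  then show ?case by (simp add: continuous_at_imp_continuous_on)
next
  case (Suc m)
  have "f differentiable at x" if "x \<in> S" for x
    using Suc.prems[OF that] by (auto simp: differentiable_on_eq_differentiable_at)
  then have "f differentiable_on S" using assms(1) by (simp add: differentiable_on_eq_differentiable_at)
  moreover have "Ck_on m (\<lambda>x. frechet_derivative f (at x) v) S" for v
    by (rule Suc.IH) (use Suc.prems in fastforce)
  ultimately show ?case by simp
qed

lemma Ck_on_scale:
  fixes f :: "'a::real_normed_vector \<Rightarrow> 'b::real_normed_vector"
  assumes "Ck_on m f UNIV" shows "Ck_on m (\<lambda>z. f (c *\<^sub>R z)) UNIV"
  using assms
proof (induction m arbitrary: f)
  case 0 then show ?case by (auto intro!: continuous_on_compose2[of UNIV f] continuous_intros)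
next
  case (Suc m)
  show ?case
  proof (rule Ck_on_SucI[OF open_UNIV])
    fix x :: 'a
    have "((\<lambda>z. c *\<^sub>R z) has_derivative (\<lambda>v. c *\<^sub>R v)) (at x)" by (auto intro!: derivative_eq_intros)
    from has_derivative_compose[OF this Ck_on_Suc_has_derivative[OF Suc.prems open_UNIV UNIV_I]]
    show "((\<lambda>z. f (c *\<^sub>R z)) has_derivative (\<lambda>v. frechet_derivative f (at (c *\<^sub>R x)) (c *\<^sub>R v))) (at x)" .
    show "Ck_on m (\<lambda>x. frechet_derivative f (at (c *\<^sub>R x)) (c *\<^sub>R v)) UNIV" for v
      by (rule Suc.IH) (use Suc.prems in simp)
  qed
qed

definition smooth_kernel :: "('a::euclidean_space \<Rightarrow> real) \<Rightarrow> real \<Rightarrow> bool" where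
  "smooth_kernel k r \<longleftrightarrow> smooth_on k UNIV \<and> (\<forall>x. k x \<ge> 0) \<and> (\<forall>x. k x \<noteq> 0 \<longrightarrow> norm x \<le> r)"

lemma smooth_kernelD:
  assumes "smooth_kernel k r"
  shows "\<And>m. Ck_on m k UNIV" "\<And>x. k x \<ge> 0" "\<And>x. k x \<noteq> 0 \<Longrightarrow> norm x \<le> r" "continuous_on UNIV k"
    "bounded {x. k x \<noteq> 0}"
  using assms Ck_on_continuous unfolding smooth_kernel_def smooth_on_def
  by (auto simp: bounded_iff)

lemma smooth_kernel_integrable: "smooth_kernel k r \<Longrightarrow> integrable lborel k"
proof -
  assume k: "smooth_kernel k r"
  obtain R where R: "\<And>x. k x \<noteq> 0 \<Longrightarrow> norm x \<le> R" using smooth_kernelD(5)[OF k] unfolding bounded_iff by auto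
  have "integrable lborel (\<lambda>x. indicator (cball 0 R) x *\<^sub>R k x)"
    by (rule borel_integrable_compact) (auto intro: continuous_on_subset[OF smooth_kernelD(4)[OF k]])
  moreover have "(\<lambda>x. indicator (cball 0 R) x *\<^sub>R k x) = k"
    using R by (auto simp: fun_eq_iff indicator_def)
  ultimately show ?thesis by simp
qed

lemma mollifier_kernel:
  fixes \<eta> :: "complex ^ 'n::finite \<Rightarrow> real"
  assumes "mollifier \<eta>" "\<epsilon> > 0"
  shows "smooth_kernel (rescaled \<eta> \<epsilon>) \<epsilon>" "(\<integral>x. rescaled \<eta> \<epsilon> x \<partial>lborel) = 1"
proof -
  have \<eta>: "\<And>m. Ck_on m \<eta> UNIV" "\<And>z. \<eta> z \<ge> 0" "\<And>z. norm z > 1 \<Longrightarrow> \<eta> z = 0" "(\<eta> has_integral 1) UNIV"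
    using assms(1) unfolding mollifier_def smooth_on_def by blast+
  have sk1: "smooth_kernel \<eta> 1"
    unfolding smooth_kernel_def smooth_on_def using \<eta> by (meson not_le)
  have \<eta>i: "integrable lborel \<eta>" by (rule smooth_kernel_integrable[OF sk1])
  have one: "(\<integral>x. \<eta> x \<partial>lborel) = 1"
    using has_integral_integral_lborel[OF \<eta>i] \<eta>(4) has_integral_unique by blast
  have Ck: "Ck_on m (rescaled \<eta> \<epsilon>) UNIV" for m
    unfolding rescaled_def by (intro Ck_on_bounded_linear[OF bounded_linear_divide] Ck_on_scale \<eta>(1)) simp
  show sk: "smooth_kernel (rescaled \<eta> \<epsilon>) \<epsilon>"
    unfolding smooth_kernel_def smooth_on_def
  proof (intro conjI allI impI Ck)
    show "rescaled \<eta> \<epsilon> x \<ge> 0" for x using \<eta>(2) assms(2) by (simp add: rescaled_def)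
    fix x assume "rescaled \<eta> \<epsilon> x \<noteq> 0"
    then have "\<not> norm ((1 / \<epsilon>) *\<^sub>R x) > 1" using \<eta>(3) by (auto simp: rescaled_def)
    then show "norm x \<le> \<epsilon>" using assms(2) by (simp add: divide_simps split: if_splits)
  qed
  have "(\<integral>x. rescaled \<eta> \<epsilon> x \<partial>lborel) = \<epsilon> ^ DIM(complex ^ 'n) * (\<integral>x. rescaled \<eta> \<epsilon> (\<epsilon> *\<^sub>R x) \<partial>lborel)"
    by (rule lborel_integral_scale) (use smooth_kernel_integrable[OF sk] assms(2) in auto)
  also have "(\<lambda>x. rescaled \<eta> \<epsilon> (\<epsilon> *\<^sub>R x)) = (\<lambda>x. \<eta> x / \<epsilon> ^ (2 * CARD('n)))"
    using assms(2) by (auto simp: rescaled_def)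
  also have "\<epsilon> ^ DIM(complex ^ 'n) * (\<integral>x. \<eta> x / \<epsilon> ^ (2 * CARD('n)) \<partial>lborel) = 1"
    using one assms(2) by (simp add: mult.commute)
  finally show "(\<integral>x. rescaled \<eta> \<epsilon> x \<partial>lborel) = 1" .
qed

text \<open>
  Links convolution over the domain with convolution on the whole space: the integrand may be cut off
  outside any set containing the translated support of the kernel.
\<close>

lemma conv_eq_convolve:
  assumes "\<And>w. k (z - w) \<noteq> 0 \<Longrightarrow> w \<in> K" "K \<subseteq> \<Omega>"
  shows "conv \<Omega> g k z = convolve (\<lambda>y. indicator K y * g y) k z"
proof -
  have "indicator \<Omega> w *\<^sub>R (g w * k (z - w)) = indicator K w * g w * k (z - w)" for w
    using assms by (cases "k (z - w) = 0") (auto simp: indicator_def)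
  then show ?thesis by (simp only: conv_def set_lebesgue_integral_def convolve_def)
qed

lemma conv_eq_convolve_ball:
  assumes k: "smooth_kernel k r" and K: "cball z (r + d) \<subseteq> \<Omega>" and w: "w \<in> ball z d"
  shows "conv \<Omega> g k w = convolve (\<lambda>y. indicator (cball z (r + d)) y * g y) k w"
proof (rule conv_eq_convolve[OF _ K])
  fix x assume "k (w - x) \<noteq> 0"
  then have "norm (w - x) \<le> r" using smooth_kernelD(3)[OF k] by blast
  then show "x \<in> cball z (r + d)" using w dist_triangle[of z x w] by (simp add: dist_norm)
qed

lemma conv_smooth:
  assumes k: "smooth_kernel k r" and W: "open W" "\<And>z. z \<in> W \<Longrightarrow> \<exists>d>0. cball z (r + d) \<subseteq> \<Omega>"
    and g: "\<And>K. compact K \<Longrightarrow> K \<subseteq> \<Omega> \<Longrightarrow> set_integrable lborel K g"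
  shows "Ck_on m (conv \<Omega> g k) W"
proof (rule Ck_on_local[OF W(1)])
  fix z assume "z \<in> W"
  then obtain d where d: "d > 0" "cball z (r + d) \<subseteq> \<Omega>" using W(2) by blast
  let ?g = "\<lambda>y. indicator (cball z (r + d)) y * g y"
  have "integrable lborel ?g" using g[OF compact_cball d(2)] by (simp add: set_integrable_def)
  then have "convolvable ?g k" using smooth_kernelD(5)[OF k] by (simp add: convolvable_def)
  then have "Ck_on m (convolve ?g k) UNIV" using smooth_kernelD(1)[OF k] by (rule convolve_Ck_on)
  then have "Ck_on m (convolve ?g k) (ball z d)" by (rule Ck_on_subset) simp
  then have "Ck_on m (conv \<Omega> g k) (ball z d)"
    by (rule Ck_on_cong[OF open_ball, rotated]) (rule conv_eq_convolve_ball[OF k d(2), symmetric])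
  then show "\<exists>V. open V \<and> z \<in> V \<and> Ck_on m (conv \<Omega> g k) V" using d(1) by (intro exI[of _ "ball z d"]) auto
qed

section \<open>From viscosity subsolutions to classical ones\<close>

lemma unitary_frame_exists: "\<exists>\<xi> :: 'n::finite \<Rightarrow> complex ^ 'n. unitary_frame \<xi>"
  using hermitian_eigenframe[of "0 :: complex ^ 'n ^ 'n"] by (auto simp: hermitian_def)

text \<open>
  The vertex belongs to the closed cone, and \<open>b\<close> bounds the nonnegative value of \<open>f\<close> there. The sign lets
  \<open>b\<close> absorb a loss of mass of the kernel in mollification.
\<close>

lemma affine_majorant_const_nonneg:
  assumes "admissible_cone \<Gamma>" "admissible_fun \<Gamma> f" "(a, b) \<in> affine_majorants \<Gamma> f"
  shows "b \<ge> 0"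
proof -
  have z: "0 \<in> closure \<Gamma>" by (rule zero_in_closure_cone[OF assms(1)])
  then have "0 \<le> f 0" using assms(2) by (simp add: admissible_fun_def)
  moreover have "f 0 \<le> a \<bullet> 0 + b" using z assms(3) by (auto simp: affine_majorants_def)
  ultimately show ?thesis by simp
qed

context
  fixes \<Omega> :: "(complex ^ 'n::finite) set" and \<Gamma> f \<psi> u
  assumes \<Gamma>: "admissible_cone \<Gamma>" and f: "admissible_fun \<Gamma> f" and \<Omega>: "open \<Omega>" "connected \<Omega>"
    and visc: "viscosity_subsolution \<Gamma> f \<Omega> \<psi> u"
begin

lemma visc_usc: "\<And>c. openin (top_of_set \<Omega>) {z\<in>\<Omega>. u z < c}" "\<And>z. z \<in> \<Omega> \<Longrightarrow> u z \<noteq> \<infinity>" "\<exists>z\<in>\<Omega>. u z \<noteq> -\<infinity>"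
  using visc unfolding viscosity_subsolution_def USC_def by auto

lemma visc_linear:
  assumes ab: "(a, b) \<in> affine_majorants \<Gamma> f" and \<xi>: "unitary_frame \<xi>" and wf: "weighted_frame B w"
    and L: "\<And>q S z. Ck_on 2 q S \<Longrightarrow> open S \<Longrightarrow> z \<in> S \<Longrightarrow> weighted_frame.elliptic B w q z = frame_trace a \<xi> (cHess q z)"
  shows "weighted_frame.linear_visc_sub B w \<Omega> u (\<lambda>z. \<psi> z - b)"
  unfolding weighted_frame.linear_visc_sub_def[OF wf]
proof (intro ballI allI impI)
  fix z q assume z: "z \<in> \<Omega>" and t: "touches_above \<Omega> u z q"
  have "upper_test \<Omega> u z q" using t unfolding touches_above_def upper_test_def .
  then have F: "ereal (\<psi> z) \<le> F_op \<Gamma> f (cHess q z)" using visc z unfolding viscosity_subsolution_def by blast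
  obtain S where S: "Ck_on 2 q S" "open S" "z \<in> S" using t unfolding touches_above_def by blast
  have "\<psi> z \<le> frame_trace a \<xi> (cHess q z) + b"
    using F_op_ge_iff[OF \<Gamma> f cHess_hermitian[OF S], of "\<psi> z"] F ab \<xi> by blast
  then show "\<psi> z - b \<le> weighted_frame.elliptic B w q z" using L[OF S] by simp
qed

end

context
  fixes \<Omega> :: "(complex ^ 'n::finite) set" and \<Gamma> f u
  assumes \<Gamma>: "admissible_cone \<Gamma>" and f: "admissible_fun \<Gamma> f" and \<Omega>: "open \<Omega>" "connected \<Omega>"
    and visc0: "viscosity_subsolution \<Gamma> f \<Omega> (\<lambda>_. 0) u"
begin

text \<open>
  One linear inequality, from any majorant and any frame, is enough to apply the linear theory.
\<close>

lemma visc_locally_integrable: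
  assumes "compact K" "K \<subseteq> \<Omega>"
  shows "set_integrable lborel K (\<lambda>y. real_of_ereal (u y))" "AE y in lborel. y \<in> K \<longrightarrow> u y \<noteq> -\<infinity>"
proof -
  obtain a b where ab: "(a, b) \<in> affine_majorants \<Gamma> f" using affine_majorants_nonempty[OF \<Gamma> f] by auto
  have a: "a $ i > 0" for i using ab by (simp add: affine_majorants_def)
  obtain \<xi> :: "'n \<Rightarrow> complex ^ 'n" where \<xi>: "unitary_frame \<xi>" using unitary_frame_exists by blast
  obtain B w where wf: "weighted_frame B w"
    and L: "\<And>q S z. Ck_on 2 q S \<Longrightarrow> open S \<Longrightarrow> z \<in> S \<Longrightarrow> weighted_frame.elliptic B w q z = frame_trace a \<xi> (cHess q z)"
    using frame_operator[OF \<xi> a] by blast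
  have v: "weighted_frame.linear_visc_sub B w \<Omega> u (\<lambda>_. 0 - b)"
    by (rule visc_linear[OF \<Gamma> f \<Omega> visc0 ab \<xi> wf L])
  note us = visc_usc[OF \<Gamma> f \<Omega> visc0]
  show "set_integrable lborel K (\<lambda>y. real_of_ereal (u y))" "AE y in lborel. y \<in> K \<longrightarrow> u y \<noteq> -\<infinity>"
    using weighted_frame.locally_integrable[OF wf \<Omega> us v assms] by blast+
qed

text \<open>
  Each of the linear inequalities is stable under mollification, and together they are the nonlinear
  one. The constant \<open>b\<close> is multiplied by the mass of the kernel, which does not increase it, as \<open>b \<ge> 0\<close>.
\<close>

theorem mollified_F_op_ge:
  assumes visc: "viscosity_subsolution \<Gamma> f \<Omega> \<psi> u" and \<psi>: "continuous_on \<Omega> \<psi>"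
    and k: "smooth_kernel k r" "(\<integral>x. k x \<partial>lborel) \<le> 1" "r \<ge> 0"
    and z: "d > 0" "cball z (r + d) \<subseteq> \<Omega>"
  shows "ereal (conv \<Omega> \<psi> k z) \<le> F_op \<Gamma> f (cHess (conv_ereal \<Omega> u k) z)"
proof -
  let ?u = "\<lambda>y. real_of_ereal (u y)"
  let ?K = "cball z (r + d)"
  let ?v = "conv \<Omega> ?u k"
  let ?U = "\<lambda>y. indicator ?K y * ?u y"
  have ui: "set_integrable lborel ?K ?u" and uae: "AE y in lborel. y \<in> ?K \<longrightarrow> u y \<noteq> -\<infinity>"
    using visc_locally_integrable[OF compact_cball z(2)] by auto
  have "integrable lborel ?U" using ui by (simp add: set_integrable_def)
  then have cc: "convolvable ?U k" using smooth_kernelD(5)[OF k(1)] by (simp add: convolvable_def)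
  have C2: "Ck_on 2 (convolve ?U k) UNIV" by (rule convolve_Ck_on[OF cc smooth_kernelD(1)[OF k(1)]])
  have eq: "?v w = convolve ?U k w" if "w \<in> ball z d" for w by (rule conv_eq_convolve_ball[OF k(1) z(2) that])
  have C2v: "Ck_on 2 ?v (ball z d)"
    by (rule Ck_on_cong[OF open_ball eq[symmetric] Ck_on_subset[OF C2]]) auto
  have zin: "z \<in> ball z d" using z(1) by simp
  have herm: "hermitian (cHess ?v z)" by (rule cHess_hermitian[OF C2v open_ball zin])
  have "conv \<Omega> \<psi> k z \<le> frame_trace a \<xi> (cHess ?v z) + b"
    if ab: "(a, b) \<in> affine_majorants \<Gamma> f" and \<xi>: "unitary_frame \<xi>" for a b \<xi>
  proof -
    have a: "a $ i > 0" for i using ab by (simp add: affine_majorants_def)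
    obtain B w where wf: "weighted_frame B w"
      and L: "\<And>q S z. Ck_on 2 q S \<Longrightarrow> open S \<Longrightarrow> z \<in> S \<Longrightarrow> weighted_frame.elliptic B w q z = frame_trace a \<xi> (cHess q z)"
      using frame_operator[OF \<xi> a] by blast
    have v: "weighted_frame.linear_visc_sub B w \<Omega> u (\<lambda>y. \<psi> y - b)"
      by (rule visc_linear[OF \<Gamma> f \<Omega> visc ab \<xi> wf L])
    note us = visc_usc[OF \<Gamma> f \<Omega> visc0]
    have gc: "continuous_on \<Omega> (\<lambda>y. \<psi> y - b)" by (intro continuous_intros \<psi>)
    have "convolve (\<lambda>y. indicator ?K y * (\<psi> y - b)) k z \<le> weighted_frame.elliptic B w (convolve ?U k) z"
      by (rule weighted_frame.elliptic_mollified_ge[OF wf \<Omega>(1) us(1,2) v gc smooth_kernelD(1-3)[OF k(1)] compact_cball z(2) order_refl z(1) k(3) ui uae])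
    also have "weighted_frame.elliptic B w (convolve ?U k) z = weighted_frame.elliptic B w ?v z"
      unfolding weighted_frame.elliptic_def[OF wf]
      using second_deriv_cong_open[OF open_ball zin eq] by simp
    also have "\<dots> = frame_trace a \<xi> (cHess ?v z)" by (rule L[OF C2v open_ball zin])
    finally have 1: "convolve (\<lambda>y. indicator ?K y * (\<psi> y - b)) k z \<le> frame_trace a \<xi> (cHess ?v z)" .
    have ci: "convolvable (indicator ?K) k"
      using smooth_kernelD(5)[OF k(1)]
      by (auto simp: convolvable_def emeasure_compact_finite[unfolded infinity_ennreal_def] intro!: integrable_real_indicator)
    have pc: "convolvable (\<lambda>y. indicator ?K y * \<psi> y) k"
      using smooth_kernelD(5)[OF k(1)] borel_integrable_compact[OF compact_cball continuous_on_subset[OF \<psi> z(2)]]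
      by (simp add: convolvable_def)
    have "convolve (\<lambda>y. indicator ?K y * (\<psi> y - b)) k z = convolve (\<lambda>y. indicator ?K y * \<psi> y + (- b) * indicator ?K y) k z"
      by (simp add: algebra_simps)
    also have "\<dots> = convolve (\<lambda>y. indicator ?K y * \<psi> y) k z + (- b) * convolve (indicator ?K) k z"
      by (rule convolve_linear[OF pc ci smooth_kernelD(4)[OF k(1)]])
    also have "convolve (indicator ?K) k z = (\<integral>x. k x \<partial>lborel)"
      by (rule convolve_indicator_locally_constant[OF smooth_kernelD(4,3)[OF k(1)] order_refl zin])
    also have "convolve (\<lambda>y. indicator ?K y * \<psi> y) k z = conv \<Omega> \<psi> k z"
      by (rule conv_eq_convolve_ball[OF k(1) z(2) zin, symmetric])
    finally have 2: "convolve (\<lambda>y. indicator ?K y * (\<psi> y - b)) k z = conv \<Omega> \<psi> k z - b * (\<integral>x. k x \<partial>lborel)" by simp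
    have "b * (\<integral>x. k x \<partial>lborel) \<le> b * 1"
      by (rule mult_left_mono[OF k(2) affine_majorant_const_nonneg[OF \<Gamma> f ab]])
    then show ?thesis using 1 2 by simp
  qed
  then show ?thesis unfolding conv_ereal_def using F_op_ge_iff[OF \<Gamma> f herm] by blast
qed

end

lemma inner_domain_cball:
  assumes "open \<Omega>" "z \<in> inner_domain \<Omega> \<epsilon>" "\<epsilon> > 0"
  obtains d where "d > 0" "cball z (\<epsilon> + d) \<subseteq> \<Omega>"
proof -
  have z: "z \<in> \<Omega>" "infdist z (frontier \<Omega>) > \<epsilon>" using assms(2) by (auto simp: inner_domain_def)
  define d where "d = (infdist z (frontier \<Omega>) - \<epsilon>) / 2"
  have d: "d > 0" "\<epsilon> + d < infdist z (frontier \<Omega>)" using z by (auto simp: d_def field_simps)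
  have "cball z (\<epsilon> + d) \<subseteq> \<Omega>"
  proof (rule ccontr)
    assume "\<not> cball z (\<epsilon> + d) \<subseteq> \<Omega>"
    then have "cball z (\<epsilon> + d) - \<Omega> \<noteq> {}" by blast
    moreover have "z \<in> cball z (\<epsilon> + d) \<inter> \<Omega>" using z(1) d(1) assms(3) by simp
    then have "cball z (\<epsilon> + d) \<inter> \<Omega> \<noteq> {}" by blast
    ultimately have "cball z (\<epsilon> + d) \<inter> frontier \<Omega> \<noteq> {}"
      by (intro connected_Int_frontier[OF connected_cball])
    then obtain w where "w \<in> frontier \<Omega>" "dist z w \<le> \<epsilon> + d" by auto
    then show False using infdist_le[of w "frontier \<Omega>" z] d(2) by linarith
  qed
  then show ?thesis using that d(1) by blast
qed

lemma open_inner_domain: "open \<Omega> \<Longrightarrow> open (inner_domain \<Omega> \<epsilon>)"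
proof -
  assume "open \<Omega>"
  moreover have "open {z. \<epsilon> < infdist z (frontier \<Omega>)}" by (intro open_Collect_less continuous_intros)
  moreover have "inner_domain \<Omega> \<epsilon> = \<Omega> \<inter> {z. \<epsilon> < infdist z (frontier \<Omega>)}" by (auto simp: inner_domain_def)
  ultimately show ?thesis by auto
qed

lemma in_inner_domain:
  fixes \<Omega> :: "(complex ^ 'n::finite) set"
  assumes "open \<Omega>" "bounded \<Omega>" "cball z (2 * \<epsilon>) \<subseteq> \<Omega>" "\<epsilon> > 0"
  shows "z \<in> inner_domain \<Omega> \<epsilon>"
proof -
  have z: "z \<in> \<Omega>" using assms(3,4) by auto
  have "\<Omega> \<noteq> UNIV" using assms(2) not_bounded_UNIV by blast
  then have ne: "frontier \<Omega> \<noteq> {}" using z by (auto simp: frontier_eq_empty)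
  have "2 * \<epsilon> \<le> dist z w" if "w \<in> frontier \<Omega>" for w
  proof (rule ccontr)
    assume "\<not> 2 * \<epsilon> \<le> dist z w"
    then have "w \<in> \<Omega>" using assms(3) by (auto simp: subset_iff)
    then show False using that assms(1) by (simp add: frontier_def interior_open)
  qed
  then have "2 * \<epsilon> \<le> infdist z (frontier \<Omega>)" using ne by (simp add: infdist_def cINF_greatest)
  then show ?thesis using z assms(4) by (simp add: inner_domain_def)
qed

section \<open>Decreasing approximation by functions with Hessian in the cone\<close>

lemma convolve_le_const:
  assumes i: "integrable lborel (\<lambda>y. g y * k (x - y))" and k: "integrable lborel k" "\<And>y. k y \<ge> 0"
    and le: "AE y in lborel. k (x - y) \<noteq> 0 \<longrightarrow> g y \<le> c"
  shows "convolve g k x \<le> c * (\<integral>y. k y \<partial>lborel)"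
proof -
  have km: "k \<in> borel_measurable borel" using k(1) by auto
  have "convolve g k x \<le> (\<integral>y. c * k (x - y) \<partial>lborel)"
    unfolding convolve_def
  proof (rule integral_mono_AE[OF i integrable_mult_right[OF lborel_integrable_reflect[OF k(1)]]])
    show "AE y in lborel. g y * k (x - y) \<le> c * k (x - y)"
      using le
    proof eventually_elim
      fix y assume "k (x - y) \<noteq> 0 \<longrightarrow> g y \<le> c"
      then show "g y * k (x - y) \<le> c * k (x - y)"
        using k(2)[of "x - y"] by (cases "k (x - y) = 0") (auto intro: mult_right_mono)
    qed
  qed
  also have "\<dots> = c * (\<integral>y. k (x - y) \<partial>lborel)" by simp
  also have "(\<integral>y. k (x - y) \<partial>lborel) = (\<integral>y. k y \<partial>lborel)" by (rule lborel_integral_reflect[OF km])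
  finally show ?thesis .
qed

lemma convolve_ge_const:
  assumes i: "integrable lborel (\<lambda>y. g y * k (x - y))" and k: "integrable lborel k" "\<And>y. k y \<ge> 0"
    and ge: "AE y in lborel. k (x - y) \<noteq> 0 \<longrightarrow> c \<le> g y"
  shows "c * (\<integral>y. k y \<partial>lborel) \<le> convolve g k x"
proof -
  have "convolve (\<lambda>y. - g y) k x \<le> (- c) * (\<integral>y. k y \<partial>lborel)"
    by (rule convolve_le_const[OF _ k]) (use i ge in auto)
  moreover have "convolve (\<lambda>y. - g y) k x = - convolve g k x" by (simp add: convolve_def)
  ultimately show ?thesis by simp
qed

lemma convolve_continuous_close:
  assumes V: "continuous_on UNIV V" and k: "smooth_kernel k r" "(\<integral>y. k y \<partial>lborel) = 1"
    and close: "\<And>y. dist x y \<le> r \<Longrightarrow> \<bar>V y - V x\<bar> \<le> e"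
  shows "\<bar>convolve V k x - V x\<bar> \<le> e"
proof -
  have i: "integrable lborel (\<lambda>y. V y * k (x - y))"
  proof -
    have "integrable lborel (\<lambda>y. indicator (cball x r) y *\<^sub>R (V y * k (x - y)))"
      by (rule borel_integrable_compact) (auto intro!: continuous_intros continuous_on_subset[OF V]
          continuous_on_compose2[OF smooth_kernelD(4)[OF k(1)]])
    moreover have "(\<lambda>y. indicator (cball x r) y *\<^sub>R (V y * k (x - y))) = (\<lambda>y. V y * k (x - y))"
      using smooth_kernelD(3)[OF k(1)] by (auto simp: fun_eq_iff indicator_def dist_norm)
    ultimately show ?thesis by simp
  qed
  have b: "\<bar>V y - V x\<bar> \<le> e" if "k (x - y) \<noteq> 0" for y
    by (rule close) (use smooth_kernelD(3)[OF k(1) that] in \<open>simp add: dist_norm\<close>)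
  have b2: "V y \<le> V x + e" "V x - e \<le> V y" if "k (x - y) \<noteq> 0" for y using b[OF that] by linarith+
  have "convolve V k x \<le> (V x + e) * (\<integral>y. k y \<partial>lborel)"
    by (rule convolve_le_const[OF i smooth_kernel_integrable[OF k(1)] smooth_kernelD(2)[OF k(1)]]) (use b2 in auto)
  moreover have "(V x - e) * (\<integral>y. k y \<partial>lborel) \<le> convolve V k x"
    by (rule convolve_ge_const[OF i smooth_kernel_integrable[OF k(1)] smooth_kernelD(2)[OF k(1)]]) (use b2 in auto)
  ultimately show ?thesis using k(2) by (simp add: abs_le_iff)
qed

lemma cHess_add_norm_sq:
  fixes q :: "complex ^ 'n::finite \<Rightarrow> real"
  assumes q: "Ck_on 2 q S" "open S" "z \<in> S"
  shows "cHess (\<lambda>x. q x + (s + c * (norm x)\<^sup>2)) z = cHess q z + mat (complex_of_real c)"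
proof -
  let ?n = "\<lambda>x::complex^'n. (norm x)\<^sup>2"
  have n2: "Ck_on 2 ?n S" using Ck_on_norm_sq[OF q(2), of 2 0] by simp
  have cn2: "Ck_on 2 (\<lambda>x. c * ?n x) S" by (rule Ck_on_bounded_linear[OF bounded_linear_mult_right q(2) n2])
  have sn2: "Ck_on 2 (\<lambda>x. s + c * ?n x) S" by (rule Ck_on_add[OF q(2) Ck_on_const[OF q(2)] cn2])
  have sd: "second_deriv (\<lambda>x. q x + (s + c * ?n x)) z v w = second_deriv q z v w + c * (2 * (v \<bullet> w))" for v w
    using second_deriv_add[OF q(1) sn2 q(2,3)] second_deriv_add[OF Ck_on_const[OF q(2)] cn2 q(2,3)]
      second_deriv_scale[OF n2 q(2,3)] second_deriv_norm_sq[of 0 z v w]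
    by (simp add: second_deriv_const)
  have C2: "Ck_on 2 (\<lambda>x. q x + (s + c * ?n x)) S" by (rule Ck_on_add[OF q(2) q(1) sn2])
  show ?thesis
    unfolding vec_eq_iff
  proof (intro allI)
    fix \<alpha> \<beta>
    have "axis \<beta> x \<bullet> (axis \<alpha> y :: complex^'n) = (if \<alpha> = \<beta> then x \<bullet> y else 0)" for x y
      by (simp add: inner_axis_axis)
    then show "cHess (\<lambda>x. q x + (s + c * ?n x)) z $ \<alpha> $ \<beta> = (cHess q z + mat (complex_of_real c)) $ \<alpha> $ \<beta>"
      unfolding cHess_eq[OF C2 q(2,3)] vector_add_component cHess_eq[OF q] sd
      by (auto simp: mat_def field_simps)
  qed
qed

text \<open>
  The truncated heat kernel is only continuous; smoothing it gives a kernel to which the mollification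
  inequality applies.
\<close>

lemma (in weighted_frame) heat_trunc_mollified:
  assumes t: "t > 0" and R: "R > 0" and \<theta>: "smooth_kernel \<theta> \<delta>" "(\<integral>x. \<theta> x \<partial>lborel) = 1" "\<delta> \<ge> 0"
  shows "smooth_kernel (convolve (heat_trunc (inner_level R) t) \<theta>) (inner_radius R + \<delta>)"
    and "(\<integral>x. convolve (heat_trunc (inner_level R) t) \<theta> x \<partial>lborel) \<le> 1"
proof -
  let ?kt = "heat_trunc (inner_level R) t"
  let ?k = "convolve ?kt \<theta>"
  note r = inner_radius_props[OF R]
  have kti: "integrable lborel ?kt" by (rule heat_trunc_integrable[OF t])
  have cc: "convolvable ?kt \<theta>" using kti smooth_kernelD(5)[OF \<theta>(1)] by (simp add: convolvable_def)
  note supp = heat_trunc_inner_support[OF t R]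
  have "?k x \<ge> 0" for x unfolding convolve_def
    by (intro integral_nonneg_AE AE_I2 mult_nonneg_nonneg heat_trunc_nonneg smooth_kernelD(2)[OF \<theta>(1)])
  moreover have "norm x \<le> inner_radius R + \<delta>" if "?k x \<noteq> 0" for x
  proof (rule ccontr)
    assume n: "\<not> norm x \<le> inner_radius R + \<delta>"
    have z: "?kt w * \<theta> (x - w) = 0" for w
    proof (rule ccontr)
      assume "?kt w * \<theta> (x - w) \<noteq> 0"
      then have "norm w < inner_radius R" "norm (x - w) \<le> \<delta>" using supp smooth_kernelD(3)[OF \<theta>(1)] by auto
      then show False using n norm_triangle_sub[of x w] by linarith
    qed
    then have "?k x = 0" unfolding convolve_def by (simp only: z Bochner_Integration.integral_zero)
    then show False using that by simp
  qed
  ultimately show sk: "smooth_kernel ?k (inner_radius R + \<delta>)"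
    unfolding smooth_kernel_def smooth_on_def using convolve_Ck_on[OF cc smooth_kernelD(1)[OF \<theta>(1)]] by blast
  note kk = heat_trunc_bounded[OF t, of "inner_level R"]
  let ?B = "cball (0::'a) (inner_radius R + \<delta> + 1)"
  have iB: "integrable lborel (indicator ?B :: 'a \<Rightarrow> real)"
    by (intro integrable_real_indicator) (auto simp: emeasure_compact_finite[unfolded infinity_ennreal_def])
  have in01: "(0::'a) \<in> ball 0 1" by simp
  \<comment> \<open>the mass of a kernel is its convolution with the indicator of a large ball, evaluated at \<open>0\<close>\<close>
  have "(\<integral>x. ?k x \<partial>lborel) = convolve (indicator ?B) ?k 0"
    by (rule convolve_indicator_locally_constant[OF smooth_kernelD(4,3)[OF sk] order_refl in01, symmetric])
  also have "\<dots> = convolve (convolve (indicator ?B) ?kt) \<theta> 0"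
    by (rule convolve_assoc[OF iB smooth_kernel_integrable[OF \<theta>(1)] heat_trunc_continuous kk, symmetric])
  also have "\<dots> = (\<integral>y. (\<integral>x. ?kt x \<partial>lborel) * \<theta> (0 - y) \<partial>lborel)"
    unfolding convolve_def[of "convolve (indicator ?B) ?kt"]
  proof (rule Bochner_Integration.integral_cong[OF refl])
    fix y
    show "convolve (indicator ?B) ?kt y * \<theta> (0 - y) = (\<integral>x. ?kt x \<partial>lborel) * \<theta> (0 - y)"
    proof (cases "\<theta> (0 - y) = 0")
      case False
      then have "norm (0 - y) \<le> \<delta>" by (rule smooth_kernelD(3)[OF \<theta>(1)])
      then have "y \<in> ball 0 (\<delta> + 1)" by simp
      then have "convolve (indicator ?B) ?kt y = (\<integral>x. ?kt x \<partial>lborel)"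
        by (rule convolve_indicator_locally_constant[OF heat_trunc_continuous, of _ _ "inner_radius R", rotated 2])
          (use supp in \<open>auto intro: less_imp_le\<close>)
      then show ?thesis by simp
    qed simp
  qed
  also have "\<dots> = (\<integral>x. ?kt x \<partial>lborel) * (\<integral>y. \<theta> (0 - y) \<partial>lborel)" by simp
  also have "(\<integral>y. \<theta> (0 - y) \<partial>lborel) = (\<integral>y. \<theta> y \<partial>lborel)"
    by (rule lborel_integral_reflect) (use smooth_kernel_integrable[OF \<theta>(1)] in auto)
  finally show "(\<integral>x. ?k x \<partial>lborel) \<le> 1" using \<theta>(2) heat_trunc_integral_le_1[OF t, of "inner_level R"] by simp
qed

context
  fixes \<Omega> :: "(complex ^ 'n::finite) set" and \<Gamma> f u
  assumes \<Gamma>: "admissible_cone \<Gamma>" and f: "admissible_fun \<Gamma> f" and \<Omega>: "open \<Omega>" "connected \<Omega>"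
    and visc0: "viscosity_subsolution \<Gamma> f \<Omega> (\<lambda>_. 0) u"
begin

lemma convolve_shifted_eq_conv:
  assumes k: "smooth_kernel k r" and K: "compact K" "K \<subseteq> \<Omega>" "cball z (r + d) \<subseteq> K" and w: "w \<in> ball z d"
  shows "convolve (\<lambda>y. indicator K y * real_of_ereal (u y - ereal s)) k w
     = conv_ereal \<Omega> u k w - s * (\<integral>x. k x \<partial>lborel)"
proof -
  note us = visc_usc[OF \<Gamma> f \<Omega> visc0]
  note li = visc_locally_integrable[OF \<Gamma> f \<Omega> visc0 K(1,2)]
  note sh = shifted_integrable[OF us(1,2) K(1,2) li]
  have ci: "integrable lborel (indicator K :: complex ^ 'n \<Rightarrow> real)"
    using K(1) borel_closed[OF compact_imp_closed[OF K(1)]]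
    by (intro integrable_real_indicator) (auto simp: emeasure_compact_finite[unfolded infinity_ennreal_def])
  have ui: "integrable lborel (\<lambda>y. indicator K y * real_of_ereal (u y))" using li(1) by (simp add: set_integrable_def)
  have km: "k \<in> borel_measurable borel" using smooth_kernel_integrable[OF k] by auto
  have cc: "convolvable g k" if "integrable lborel g" for g
    using that smooth_kernelD(5)[OF k] by (simp add: convolvable_def)
  have "convolve (\<lambda>y. indicator K y * real_of_ereal (u y - ereal s)) k w
     = convolve (\<lambda>y. indicator K y * real_of_ereal (u y) + (- s) * indicator K y) k w"
    by (rule convolve_cong_AE[OF sh(1) _ _ km]) (use sh(2) ui ci in auto)
  also have "\<dots> = convolve (\<lambda>y. indicator K y * real_of_ereal (u y)) k w + (- s) * convolve (indicator K) k w"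
    by (rule convolve_linear[OF cc[OF ui] cc[OF ci] smooth_kernelD(4)[OF k]])
  also have "convolve (indicator K) k w = (\<integral>x. k x \<partial>lborel)"
    by (rule convolve_indicator_locally_constant[OF smooth_kernelD(4,3)[OF k] K(3) w])
  also have "convolve (\<lambda>y. indicator K y * real_of_ereal (u y)) k w = conv_ereal \<Omega> u k w"
    unfolding conv_ereal_def
  proof (rule conv_eq_convolve[OF _ K(2), symmetric])
    fix x assume "k (w - x) \<noteq> 0"
    then have "norm (w - x) \<le> r" using smooth_kernelD(3)[OF k] by blast
    then have "x \<in> cball z (r + d)" using w dist_triangle[of z x w] by (simp add: dist_norm)
    then show "x \<in> K" using K(3) by blast
  qed
  finally show ?thesis by simp
qed

text \<open>
  The approximant is \<open>u * k\<close> plus a constant and a small multiple of \<open>|z|\<^sup>2\<close>, for the kernel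
  \<open>k = k\<^sub>t * \<chi>\<^sub>\<delta>\<close>. It lies above \<open>u\<close> by the submean inequality and below \<open>v\<close> because \<open>u\<close> lies below a
  continuous \<open>\<phi> < v\<close> whose averages are close to \<open>\<phi>\<close>. The Hessian of \<open>u * k\<close> is in the closed cone, and the
  quadratic term moves it into the open one.
\<close>

lemma approximant_between:
  fixes \<eta> :: "complex ^ 'n \<Rightarrow> real"
  assumes \<eta>: "mollifier \<eta>" and U: "open U" "U \<subseteq> K" and K: "compact K" "K \<subseteq> \<Omega>"
    and v: "continuous_on K v" "\<And>x. x \<in> K \<Longrightarrow> u x < ereal (v x)"
  shows "\<exists>w. (smooth_on w U \<and> (\<forall>z\<in>U. cHess w z \<in> M_cone \<Gamma>)) \<and> continuous_on K w \<and>
      (\<forall>x\<in>K. u x < ereal (w x) \<and> w x < v x)"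
proof -
  note us = visc_usc[OF \<Gamma> f \<Omega> visc0]
  obtain a b where ab: "(a, b) \<in> affine_majorants \<Gamma> f" using affine_majorants_nonempty[OF \<Gamma> f] by auto
  have a: "a $ i > 0" for i using ab by (simp add: affine_majorants_def)
  have b: "b \<ge> 0" by (rule affine_majorant_const_nonneg[OF \<Gamma> f ab])
  obtain \<xi> :: "'n \<Rightarrow> complex ^ 'n" where \<xi>: "unitary_frame \<xi>" using unitary_frame_exists by blast
  obtain B wt where wf: "weighted_frame B wt"
    and L: "\<And>q S z. Ck_on 2 q S \<Longrightarrow> open S \<Longrightarrow> z \<in> S \<Longrightarrow> weighted_frame.elliptic B wt q z = frame_trace a \<xi> (cHess q z)"
    using frame_operator[OF \<xi> a] by blast
  interpret weighted_frame B wt by (rule wf)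
  have vs: "linear_visc_sub \<Omega> u (\<lambda>_. 0 - b)" by (rule visc_linear[OF \<Gamma> f \<Omega> visc0 ab \<xi> wf L])
  obtain rr where rr: "rr > 0" "(\<Union>x\<in>K. cball x rr) \<subseteq> \<Omega>"
    using compact_subset_open_imp_cball_epsilon_subset[OF K(1) \<Omega>(1) K(2)] by blast
  \<comment> \<open>a compact neighbourhood of \<open>K\<close> inside the domain, containing all balls that are averaged over\<close>
  define K2 where "K2 = {x + y | x y. x \<in> K \<and> y \<in> cball 0 rr}"
  have K2c: "compact K2" unfolding K2_def by (rule compact_sums[OF K(1) compact_cball])
  have cbK2: "cball x rr \<subseteq> K2" if "x \<in> K" for x
  proof
    fix y assume "y \<in> cball x rr"
    then have "y = x + (y - x)" "y - x \<in> cball 0 rr" by (auto simp: dist_norm norm_minus_commute)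
    then show "y \<in> K2" unfolding K2_def using that by blast
  qed
  have K2\<Omega>: "K2 \<subseteq> \<Omega>"
  proof
    fix y assume "y \<in> K2"
    then obtain x c where "x \<in> K" "norm c \<le> rr" "y = x + c" unfolding K2_def by auto
    then have "y \<in> cball x rr" by (simp add: dist_norm)
    then show "y \<in> \<Omega>" using rr(2) \<open>x \<in> K\<close> by blast
  qed
  have KK2: "K \<subseteq> K2" using cbK2 rr(1) by force
  obtain M where M: "\<And>z. z \<in> K2 \<Longrightarrow> u z \<le> ereal M"
    using usc_bounded_above_compact[OF us(1,2) K2c K2\<Omega>] by blast
  define M0 where "M0 = M + 1"
  define h where "h y = (if y \<in> K2 then u y - ereal M0 else -\<infinity>)" for y
  have husc: "open {y. h y < c}" for c
    unfolding h_def by (rule usc_extension_minus_infinity[OF K2c usc_on_subset_shift[OF us(1) K2\<Omega>]])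
  have hneg: "h y \<le> 0" for y
  proof (cases "y \<in> K2")
    case True
    then show ?thesis using M[OF True] by (cases "u y") (auto simp: h_def M0_def)
  qed (simp add: h_def)
  have hv: "h x < ereal (v x - M0)" if "x \<in> K" for x
    using v(2)[OF that] KK2 that by (cases "u x") (auto simp: h_def)
  have vM: "continuous_on K (\<lambda>x. v x - M0)" by (intro continuous_intros v(1))
  obtain \<phi> where \<phi>c: "continuous_on UNIV \<phi>" and \<phi>h: "\<And>x. h x \<le> ereal (\<phi> x)"
    and \<phi>v: "\<And>x. x \<in> K \<Longrightarrow> \<phi> x < v x - M0"
    using continuous_between_usc_and_continuous[of h, OF husc hneg K(1) vM hv] by blast
  \<comment> \<open>the errors will use up \<open>7 e\<close> of the gap: \<open>2 e\<close> for averaging \<open>\<phi>\<close>, \<open>e\<close> for mollification, \<open>3 e\<close>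
    for the constant that lifts the approximant above \<open>u\<close>, and \<open>e\<close> for the quadratic term\<close>
  obtain e where e: "e > 0" "\<And>x. x \<in> K \<Longrightarrow> \<phi> x + M0 + 8 * e \<le> v x"
  proof (cases "K = {}")
    case False
    have "continuous_on K (\<lambda>x. v x - \<phi> x)" by (intro continuous_intros v(1) continuous_on_subset[OF \<phi>c]) auto
    from continuous_attains_inf[OF K(1) False this] obtain m where m: "m \<in> K" "\<And>x. x \<in> K \<Longrightarrow> v m - \<phi> m \<le> v x - \<phi> x" by blast
    have "v m - \<phi> m - M0 > 0" using \<phi>v[OF m(1)] by simp
    moreover have "\<phi> x + M0 + 8 * ((v m - \<phi> m - M0) / 8) \<le> v x" if "x \<in> K" for x using m(2)[OF that] by argo
    ultimately show ?thesis by (intro that[of "(v m - \<phi> m - M0) / 8"]) auto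
  qed (use that[of 1] in auto)
  have "bounded (\<phi> ` K)" by (rule compact_imp_bounded[OF compact_continuous_image[OF continuous_on_subset[OF \<phi>c] K(1)]]) auto
  then obtain C' where C': "\<And>x. x \<in> K \<Longrightarrow> \<bar>\<phi> x\<bar> \<le> C'" unfolding bounded_iff by auto
  define C where "C = \<bar>C'\<bar> + 1"
  have C: "C > 0" "\<And>x. x \<in> K \<Longrightarrow> - \<phi> x \<le> C" using C' by (force simp: C_def)+
  obtain d1 where d1: "d1 > 0" "\<And>x y. x \<in> K \<Longrightarrow> dist x y \<le> d1 \<Longrightarrow> y \<in> UNIV \<and> dist (\<phi> y) (\<phi> x) < e"
    using compact_uniform_nbhd[OF K(1) open_UNIV subset_UNIV \<phi>c e(1)] by blast
  define R where "R = min d1 (rr / 4)"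
  have R: "R > 0" "R \<le> d1" "R \<le> rr / 4" using d1(1) rr(1) by (auto simp: R_def)
  note rp = inner_radius_props[OF R(1)]
  have cbR: "cball x R \<subseteq> K2" if "x \<in> K" for x
  proof -
    have "cball x R \<subseteq> cball x rr" using R rr(1) by (intro subset_cball) auto
    then show ?thesis using cbK2[OF that] by blast
  qed
  obtain t0 where t0: "t0 > 0" "\<And>t. 0 < t \<Longrightarrow> t < t0 \<Longrightarrow> (\<integral>x. heat_trunc (inner_level R) t x \<partial>lborel) \<ge> 1 - e / C"
    using heat_trunc_mass[OF rp(5), of "e / C"] e(1) C(1) by (metis divide_pos_pos)
  \<comment> \<open>the heat kernel then has almost full mass, the submean inequality applies, and its loss \<open>b t\<close> is at
    most \<open>e\<close>\<close>
  define t where "t = min (t0 / 2) (min (outer_level R / (2 * DIM(complex^'n))) (min 1 e / (b + 1)))"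
  have t: "t > 0" "t < t0" "t \<le> outer_level R / (2 * DIM(complex^'n))" "t \<le> min 1 e / (b + 1)"
  proof -
    have p: "outer_level R / (2 * DIM(complex^'n)) > 0" using rp(6) by simp
    have p2: "min 1 e / (b + 1) > 0" using e(1) b by simp
    show "t > 0" unfolding t_def using p p2 t0 by (simp only: min_less_iff_conj) simp
    show "t < t0" "t \<le> outer_level R / (2 * DIM(complex^'n))" "t \<le> min 1 e / (b + 1)" using t0 unfolding t_def by linarith+
  qed
  have T1: "2 * real DIM(complex^'n) * t \<le> outer_level R" using t(3) by (subst (asm) pos_le_divide_eq) (auto simp: mult.commute)
  have bt: "b * t \<le> 1" "b * t \<le> e"
  proof -
    have "t * (b + 1) \<le> min 1 e" using t(4) b by (subst (asm) pos_le_divide_eq) auto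
    then show "b * t \<le> 1" "b * t \<le> e" using t(1) by (auto simp: algebra_simps)
  qed
  let ?kt = "heat_trunc (inner_level R) t"
  define U' where "U' y = indicator K2 y * real_of_ereal (u y - ereal M0)" for y
  note li = visc_locally_integrable[OF \<Gamma> f \<Omega> visc0 K2c K2\<Omega>]
  have U'i: "integrable lborel U'" unfolding U'_def by (rule shifted_integrable(2)[OF us(1,2) K2c K2\<Omega> li])
  note kts = heat_trunc_inner_support[OF t(1) R(1)]
  note ktb = heat_trunc_inner_bounded_support[OF t(1) R(1)]
  have kti: "integrable lborel ?kt" by (rule heat_trunc_integrable[OF t(1)])
  note kk = heat_trunc_bounded[OF t(1), of "inner_level R"]
  define V where "V = convolve U' ?kt"
  have ccV: "convolvable U' ?kt" using U'i ktb by (simp add: convolvable_def)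
  have Vc: "continuous_on UNIV V" unfolding V_def by (rule convolve_continuous[OF ccV heat_trunc_continuous])
  \<comment> \<open>the submean inequality for the linear inequality \<open>L u \<ge> - b\<close>\<close>
  have lower: "u x - ereal M0 \<le> ereal (V x + e)" if x: "x \<in> K" for x
  proof -
    have "u x - ereal (M + 1) \<le> ereal (convolve U' ?kt x - (0 - b) * t)"
    proof (rule submean_domain[OF us(1) vs R(1)])
      show "cball x R \<subseteq> \<Omega>" using cbR[OF x] K2\<Omega> by blast
      show "u z \<le> ereal M" if "z \<in> cball x R" for z using M cbR[OF x] that by blast
      show "\<bar>0 - b\<bar> * t \<le> 1" using bt(1) b by simp
      show "U' y = real_of_ereal (u y - ereal (M + 1))" if "y \<in> ball x (inner_radius R)" for y
      proof -
        have "y \<in> cball x R" using that rp(2) by auto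
        then show ?thesis using cbR[OF x] by (auto simp: U'_def M0_def)
      qed
    qed (use T1 t(1) U'i in auto)
    also have "\<dots> \<le> ereal (V x + e)" using bt(2) by (simp add: V_def)
    finally show ?thesis by (simp add: M0_def)
  qed
  have upper: "V x \<le> \<phi> x + 2 * e" if x: "x \<in> K" for x
  proof -
    let ?m = "\<integral>y. ?kt y \<partial>lborel"
    have "V x \<le> (\<phi> x + e) * ?m"
      unfolding V_def
    proof (rule convolve_le_const[OF convolve_integrand_integrable[OF ccV heat_trunc_continuous] kti heat_trunc_nonneg])
      show "AE y in lborel. ?kt (x - y) \<noteq> 0 \<longrightarrow> U' y \<le> \<phi> x + e"
        using li(2)
      proof eventually_elim
        fix y assume y: "y \<in> K2 \<longrightarrow> u y \<noteq> -\<infinity>"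
        show "?kt (x - y) \<noteq> 0 \<longrightarrow> U' y \<le> \<phi> x + e"
        proof
          assume "?kt (x - y) \<noteq> 0"
          then have "dist x y \<le> R" using kts[of "x - y"] rp(2) by (simp add: dist_norm)
          then have yK: "y \<in> K2" and "\<phi> y \<le> \<phi> x + e"
            using cbR[OF x] d1(2)[OF x, of y] R(2) by (auto simp: dist_real_def)
          then obtain s where "u y = ereal s" using y us(2)[of y] K2\<Omega> by (cases "u y") auto
          then have "U' y \<le> \<phi> y" using \<phi>h[of y] yK by (simp add: U'_def h_def)
          then show "U' y \<le> \<phi> x + e" using \<open>\<phi> y \<le> \<phi> x + e\<close> by simp
        qed
      qed
    qed
    also have "\<dots> = \<phi> x * ?m + e * ?m" by (simp add: distrib_right)
    also have "\<dots> \<le> (\<phi> x + e) + e"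
    proof (rule add_mono)
      have m1: "1 - ?m \<le> e / C" "0 \<le> 1 - ?m" using t0(2)[OF t(1,2)] heat_trunc_integral_le_1[OF t(1), of "inner_level R"] by auto
      have "(- \<phi> x) * (1 - ?m) \<le> C * (e / C)"
        by (rule mult_mono[OF C(2)[OF x] m1(1)]) (use C(1) m1(2) in auto)
      then show "\<phi> x * ?m \<le> \<phi> x + e" using C(1) by (simp add: algebra_simps)
      show "e * ?m \<le> e" using e(1) heat_trunc_integral_le_1[OF t(1), of "inner_level R"] by (simp add: mult_left_le)
    qed
    finally show ?thesis by simp
  qed
  obtain d2 where d2: "d2 > 0" "\<And>x y. x \<in> K \<Longrightarrow> dist x y \<le> d2 \<Longrightarrow> y \<in> UNIV \<and> dist (V y) (V x) < e"
    using compact_uniform_nbhd[OF K(1) open_UNIV subset_UNIV Vc e(1)] by blast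
  define \<delta> where "\<delta> = min d2 (rr / 4)"
  have \<delta>: "\<delta> > 0" "\<delta> \<le> d2" "\<delta> \<le> rr / 4" using d2(1) rr(1) by (auto simp: \<delta>_def)
  let ?\<theta> = "rescaled \<eta> \<delta>"
  note \<theta> = mollifier_kernel[OF \<eta> \<delta>(1)]
  \<comment> \<open>mollifying the average \<open>V\<close> is the same as averaging with the smooth kernel \<open>k\<close>\<close>
  define k where "k = convolve ?kt ?\<theta>"
  have k: "smooth_kernel k (inner_radius R + \<delta>)" "(\<integral>x. k x \<partial>lborel) \<le> 1"
    unfolding k_def using heat_trunc_mollified[OF t(1) R(1) \<theta> less_imp_le[OF \<delta>(1)]] by auto
  define s where "s = inner_radius R + \<delta>"
  have s: "s \<ge> 0" "s + rr / 4 \<le> rr" using rp(1,2) R \<delta> by (auto simp: s_def)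
  have cbs: "cball x (s + rr / 4) \<subseteq> K2" if "x \<in> K" for x
  proof -
    have "cball x (s + rr / 4) \<subseteq> cball x rr" using s(2) by (intro subset_cball)
    then show ?thesis using cbK2[OF that] by blast
  qed
  have k': "smooth_kernel k s" using k(1) by (simp add: s_def)
  define mk where "mk = (\<integral>x. k x \<partial>lborel)"
  define g where "g = conv_ereal \<Omega> u k"
  have gU: "convolve U' k x = g x - M0 * mk" if x: "x \<in> K" for x
    unfolding U'_def g_def mk_def
    by (rule convolve_shifted_eq_conv[OF k' K2c K2\<Omega> cbs[OF x]]) (use rr(1) in simp)
  have gV: "g x = convolve V ?\<theta> x + M0 * mk" if x: "x \<in> K" for x
  proof -
    have "convolve U' k x = convolve V ?\<theta> x"
      unfolding k_def V_def by (rule convolve_assoc[OF U'i smooth_kernel_integrable[OF \<theta>(1)] heat_trunc_continuous kk, symmetric])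
    then show ?thesis using gU[OF x] by simp
  qed
  have close: "\<bar>convolve V ?\<theta> x - V x\<bar> \<le> e" if x: "x \<in> K" for x
  proof (rule convolve_continuous_close[OF Vc \<theta>])
    show "\<bar>V y - V x\<bar> \<le> e" if "dist x y \<le> \<delta>" for y
      using d2(2)[OF x, of y] that \<delta>(2) by (simp add: dist_real_def)
  qed
  have "bounded (norm ` K)" using compact_imp_bounded[OF K(1)] by (auto simp: bounded_iff)
  then obtain N' where N': "\<And>x. x \<in> K \<Longrightarrow> norm x \<le> N'" unfolding bounded_iff by auto
  define c where "c = e / (\<bar>N'\<bar> + 1)\<^sup>2"
  have c: "c > 0" using e(1) by (simp add: c_def)
  have cn: "c * (norm x)\<^sup>2 \<le> e" "0 \<le> c * (norm x)\<^sup>2" if "x \<in> K" for x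
  proof -
    have "(norm x)\<^sup>2 \<le> (\<bar>N'\<bar> + 1)\<^sup>2" using N'[OF that] by (intro power_mono) auto
    then have "c * (norm x)\<^sup>2 \<le> c * (\<bar>N'\<bar> + 1)\<^sup>2" using c by (intro mult_left_mono) auto
    then show "c * (norm x)\<^sup>2 \<le> e" by (simp add: c_def)
    show "0 \<le> c * (norm x)\<^sup>2" using c by simp
  qed
  \<comment> \<open>the last two terms undo the shift by \<open>M0\<close>, which the kernel of mass \<open>mk\<close> has scaled\<close>
  define s0 where "s0 = 3 * e + M0 - M0 * mk"
  define w where "w x = g x + (s0 + c * (norm x)\<^sup>2)" for x
  have w_eq: "w x = convolve V ?\<theta> x + 3 * e + M0 + c * (norm x)\<^sup>2" if "x \<in> K" for x
    using gV[OF that] by (simp add: w_def s0_def)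
  have ux: "u x < ereal (w x)" if x: "x \<in> K" for x
  proof -
    have "u x \<le> ereal (V x + e + M0)" using lower[OF x] by (cases "u x") auto
    also have "\<dots> < ereal (w x)" using close[OF x] cn(2)[OF x] e(1) by (simp add: w_eq[OF x])
    finally show ?thesis .
  qed
  have wv: "w x < v x" if x: "x \<in> K" for x
    using upper[OF x] close[OF x] cn(1)[OF x] e(2)[OF x] e(1) w_eq[OF x] by linarith
  have gs: "Ck_on m g U" for m
    unfolding g_def conv_ereal_def
  proof (rule conv_smooth[OF k' U(1)])
    show "\<exists>d>0. cball z (s + d) \<subseteq> \<Omega>" if "z \<in> U" for z
      using cbs[of z] that U(2) K2\<Omega> rr(1) by (intro exI[of _ "rr / 4"]) auto
    show "set_integrable lborel K' (\<lambda>w. real_of_ereal (u w))" if "compact K'" "K' \<subseteq> \<Omega>" for K'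
      using visc_locally_integrable(1)[OF \<Gamma> f \<Omega> visc0 that] .
  qed
  have sm: "smooth_on w U" unfolding smooth_on_def
  proof
    fix m
    have "Ck_on m (\<lambda>x::complex^'n. (norm x)\<^sup>2) U" using Ck_on_norm_sq[OF U(1), of m 0] by simp
    then have "Ck_on m (\<lambda>x::complex^'n. c * (norm x)\<^sup>2) U" by (rule Ck_on_bounded_linear[OF bounded_linear_mult_right U(1)])
    then show "Ck_on m w U" unfolding w_def by (intro Ck_on_add U(1) gs Ck_on_const)
  qed
  have hw: "cHess w z \<in> M_cone \<Gamma>" if z: "z \<in> U" for z
  proof -
    have zK: "z \<in> K" using z U(2) by blast
    have "ereal (conv \<Omega> (\<lambda>_. 0) k z) \<le> F_op \<Gamma> f (cHess (conv_ereal \<Omega> u k) z)"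
      by (rule mollified_F_op_ge[OF \<Gamma> f \<Omega> visc0 visc0 continuous_on_const k' k(2) s(1), where d = "rr/4"])
        (use rr(1) cbs[OF zK] K2\<Omega> in auto)
    then have F0: "ereal 0 \<le> F_op \<Gamma> f (cHess g z)" by (simp add: conv_def set_lebesgue_integral_def g_def)
    then have Hc: "cHess g z \<in> closure (M_cone \<Gamma>)" by (auto simp: F_op_def split: if_splits)
    have hg: "hermitian (cHess g z)" by (rule cHess_hermitian[OF gs U(1) z])
    have "eigvals (cHess g z) \<in> closure \<Gamma>" using closure_M_cone_iff[OF \<Gamma> f hg] Hc by simp
    from M_cone_add_identity[OF \<Gamma> hg this c]
    show ?thesis unfolding w_def[abs_def] cHess_add_norm_sq[OF gs U(1) z] .
  qed
  have wc: "continuous_on K w"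
  proof -
    have "continuous_on K g"
    proof -
      have cck: "convolvable U' k" using U'i smooth_kernelD(5)[OF k'] by (simp add: convolvable_def)
      have "continuous_on UNIV (convolve U' k)" by (rule convolve_continuous[OF cck smooth_kernelD(4)[OF k']])
      then have "continuous_on K (\<lambda>x. convolve U' k x + M0 * mk)" by (intro continuous_intros) (auto intro: continuous_on_subset)
      moreover have "convolve U' k x + M0 * mk = g x" if x: "x \<in> K" for x
        using gU[OF x] by simp
      ultimately show ?thesis by (simp cong: continuous_on_cong)
    qed
    then show ?thesis unfolding w_def by (intro continuous_intros)
  qed
  show ?thesis using sm hw wc ux wv by blast
qed

theorem visc_Gamma_approximable:
  fixes \<eta> :: "complex ^ 'n \<Rightarrow> real"
  assumes \<eta>: "mollifier \<eta>" shows "Gamma_approximable \<Gamma> \<Omega> u"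
  unfolding Gamma_approximable_def
proof (intro allI impI)
  fix U assume U: "open U \<and> compact (closure U) \<and> closure U \<subseteq> \<Omega>"
  note us = visc_usc[OF \<Gamma> f \<Omega> visc0]
  have K: "compact (closure U)" "closure U \<subseteq> \<Omega>" and oU: "open U" using U by auto
  have usK: "openin (top_of_set (closure U)) {x\<in>closure U. u x < c}" for c
  proof -
    obtain W where W: "open W" "{z\<in>\<Omega>. u z < c} = \<Omega> \<inter> W" using us(1)[of c] unfolding openin_open by auto
    have "{z\<in>closure U. u z < c} = closure U \<inter> W" using K(2) W(2) by auto
    then show ?thesis using W(1) unfolding openin_open by auto
  qed
  have fin: "u x \<noteq> \<infinity>" if "x \<in> closure U" for x using us(2) that K(2) by blast
  obtain w :: "nat \<Rightarrow> complex ^ 'n \<Rightarrow> real"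
    where w: "\<And>j. smooth_on (w j) U \<and> (\<forall>z\<in>U. cHess (w j) z \<in> M_cone \<Gamma>)"
      "\<And>j x. x \<in> closure U \<Longrightarrow> w (Suc j) x \<le> w j x" "\<And>x. x \<in> closure U \<Longrightarrow> (\<lambda>j. ereal (w j x)) \<longlonglongrightarrow> u x"
    using decreasing_approx_by_interlacing[OF K(1) usK fin approximant_between[OF \<eta> oU closure_subset K]] by blast
  show "\<exists>v::nat \<Rightarrow> complex ^ 'n \<Rightarrow> real. (\<forall>j. smooth_on (v j) U) \<and> (\<forall>j. \<forall>z\<in>U. cHess (v j) z \<in> M_cone \<Gamma>) \<and>
      (\<forall>j. \<forall>z\<in>U. v (Suc j) z \<le> v j z) \<and> (\<forall>z\<in>U. (\<lambda>j. ereal (v j z)) \<longlonglongrightarrow> u z)"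
    using w closure_subset[of U] by (intro exI[of _ w]) blast
qed

section \<open>From mollified inequalities back to viscosity subsolutions\<close>

text \<open>
  By \<open>F_op_ge_iff\<close> it suffices to contradict the failure of a single linear inequality for a test
  function \<open>q\<close> at \<open>z0\<close>. The perturbation \<open>p\<close> is strictly above \<open>u\<close> away from \<open>z0\<close> and still violates the
  inequality, so the maximum principle for the smooth functions \<open>u\<^sub>\<epsilon>\<close> on a small ball gives
  \<open>u\<^sub>\<epsilon> \<le> p - \<nu>\<close>. The submean inequality at \<open>z0\<close> transfers this gap to \<open>u z0 = p z0\<close>, a contradiction.
\<close>

theorem mollified_subsolution_imp_viscosity:
  fixes \<eta> :: "complex ^ 'n \<Rightarrow> real"
  assumes \<eta>: "mollifier \<eta>" and bdd: "bounded \<Omega>" and \<psi>: "continuous_on \<Omega> \<psi>"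
    and cl: "\<And>\<epsilon> z. \<epsilon> > 0 \<Longrightarrow> z \<in> inner_domain \<Omega> \<epsilon> \<Longrightarrow>
       ereal (conv \<Omega> \<psi> (rescaled \<eta> \<epsilon>) z) \<le> F_op \<Gamma> f (cHess (conv_ereal \<Omega> u (rescaled \<eta> \<epsilon>)) z)"
  shows "viscosity_subsolution \<Gamma> f \<Omega> \<psi> u"
  unfolding viscosity_subsolution_def
proof (intro conjI ballI allI impI)
  show "u \<in> USC \<Omega>" using visc0 by (simp add: viscosity_subsolution_def)
  note us = visc_usc[OF \<Gamma> f \<Omega> visc0]
  fix z0 q assume z0: "z0 \<in> \<Omega>" and t: "upper_test \<Omega> u z0 q"
  obtain U0 where U0: "open U0" "z0 \<in> U0" "U0 \<subseteq> \<Omega>" "Ck_on 2 q U0" "u z0 = ereal (q z0)"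
    "\<And>z. z \<in> U0 \<Longrightarrow> u z \<le> ereal (q z)" using t unfolding upper_test_def by blast
  have "\<psi> z0 \<le> frame_trace a \<xi> (cHess q z0) + b"
    if ab: "(a, b) \<in> affine_majorants \<Gamma> f" and \<xi>: "unitary_frame \<xi>" for a b and \<xi> :: "'n \<Rightarrow> complex ^ 'n"
  proof (rule ccontr)
    assume neg: "\<not> \<psi> z0 \<le> frame_trace a \<xi> (cHess q z0) + b"
    have a: "a $ i > 0" for i using ab by (simp add: affine_majorants_def)
    have b: "b \<ge> 0" by (rule affine_majorant_const_nonneg[OF \<Gamma> f ab])
    obtain B wt where wf: "weighted_frame B wt"
      and L: "\<And>q S z. Ck_on 2 q S \<Longrightarrow> open S \<Longrightarrow> z \<in> S \<Longrightarrow> weighted_frame.elliptic B wt q z = frame_trace a \<xi> (cHess q z)"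
      using frame_operator[OF \<xi> a] by blast
    interpret weighted_frame B wt by (rule wf)
    have vs: "linear_visc_sub \<Omega> u (\<lambda>_. 0 - b)" by (rule visc_linear[OF \<Gamma> f \<Omega> visc0 ab \<xi> wf L])
    \<comment> \<open>\<open>4 \<kappa>\<close> is the amount by which the linear inequality fails at \<open>z0\<close>\<close>
    define \<kappa> where "\<kappa> = (\<psi> z0 - b - elliptic q z0) / 4"
    have \<kappa>: "\<kappa> > 0" using neg L[OF U0(4,1,2)] by (simp add: \<kappa>_def)
    define Wt where "Wt = (\<Sum>c\<in>B. wt c)"
    have Wt: "Wt > 0" unfolding Wt_def using finite_B B_nonempty a_pos by (intro sum_pos) auto
    \<comment> \<open>the quadratic perturbation raises \<open>L q\<close> by exactly \<open>\<kappa>\<close>\<close>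
    define \<gamma> where "\<gamma> = \<kappa> / (2 * Wt)"
    have \<gamma>: "\<gamma> > 0" using \<kappa> Wt by (simp add: \<gamma>_def)
    define p where "p x = q x + \<gamma> * (norm (x - z0))\<^sup>2" for x
    have n2: "Ck_on 2 (\<lambda>x. \<gamma> * (norm (x - z0))\<^sup>2) S" if "open S" for S
      by (rule Ck_on_bounded_linear[OF bounded_linear_mult_right that Ck_on_norm_sq[OF that]])
    have pC2: "Ck_on 2 p U0" unfolding p_def by (rule Ck_on_add[OF U0(1,4) n2[OF U0(1)]])
    have Lp: "elliptic p x = elliptic q x + \<kappa>" if x: "x \<in> U0" for x
    proof -
      have "second_deriv p x c c = second_deriv q x c c + \<gamma> * 2" if c: "c \<in> B" for c
        unfolding p_def
        using second_deriv_add[OF U0(4) n2[OF U0(1)] U0(1) x] second_deriv_scale[OF Ck_on_norm_sq[OF U0(1)] U0(1) x]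
          second_deriv_norm_sq[of z0 x c c] orthonormal[OF c c] by simp
      then have "elliptic p x = (\<Sum>c\<in>B. wt c * second_deriv q x c c + wt c * (\<gamma> * 2))"
        unfolding elliptic_def by (intro sum.cong refl) (simp add: distrib_left)
      also have "\<dots> = elliptic q x + Wt * (\<gamma> * 2)"
        by (simp add: elliptic_def Wt_def sum.distrib sum_distrib_right)
      also have "Wt * (\<gamma> * 2) = \<kappa>" using Wt by (simp add: \<gamma>_def)
      finally show ?thesis .
    qed
    have gc: "continuous_on U0 (\<lambda>x. \<psi> x - b - elliptic q x)"
      by (intro continuous_intros continuous_on_subset[OF \<psi> U0(3)] elliptic_continuous[OF U0(4)])
    obtain \<rho>0 where \<rho>0: "\<rho>0 > 0" "\<And>w. dist z0 w \<le> \<rho>0 \<Longrightarrow> w \<in> U0 \<and>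
        dist (\<psi> w - b - elliptic q w) (\<psi> z0 - b - elliptic q z0) < \<kappa>"
      using compact_uniform_nbhd[OF compact_sing[of z0] U0(1) _ gc \<kappa>] U0(2) by (metis empty_subsetI insert_subset singletonI)
    define \<rho> where "\<rho> = \<rho>0 / 3"
    have \<rho>: "\<rho> > 0" "cball z0 (3 * \<rho>) \<subseteq> U0" using \<rho>0 by (auto simp: \<rho>_def)
    have c31: "cball z0 \<rho> \<subseteq> cball z0 (3 * \<rho>)" using \<rho>(1) by (intro subset_cball) simp
    have c1: "cball z0 \<rho> \<subseteq> U0" using \<rho>(2) c31 by blast
    have Lpb: "elliptic p x + b < \<psi> x - 2 * \<kappa> + \<kappa>" if x: "x \<in> cball z0 \<rho>" for x
    proof -
      have "dist z0 x \<le> \<rho>0" using x \<rho>(1) by (simp add: \<rho>_def)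
      from \<rho>0(2)[OF this] have xU: "x \<in> U0" and
        "\<bar>(\<psi> x - b - elliptic q x) - (\<psi> z0 - b - elliptic q z0)\<bar> < \<kappa>" by (auto simp: dist_real_def)
      then have "\<psi> x - b - elliptic q x > 3 * \<kappa>" unfolding \<kappa>_def by argo
      then show ?thesis using Lp[OF xU] \<kappa> by linarith
    qed
    \<comment> \<open>on the sphere of radius \<open>\<rho>\<close>, \<open>p\<close> exceeds \<open>q\<close> by \<open>\<gamma> \<rho>\<^sup>2\<close>, a quarter of which is lost to mollification\<close>
    define \<nu> where "\<nu> = 3 * (\<gamma> * \<rho>\<^sup>2) / 4"
    have \<nu>: "\<nu> > 0" using \<gamma> \<rho>(1) by (simp add: \<nu>_def)
    have qc: "continuous_on U0 q" by (rule Ck_on_continuous[OF U0(4)])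
    have mu: "\<gamma> * \<rho>\<^sup>2 / 4 > 0" using \<gamma> \<rho>(1) by simp
    obtain d1 where d1: "d1 > 0" "\<And>x y. x \<in> cball z0 \<rho> \<Longrightarrow> dist x y \<le> d1 \<Longrightarrow> y \<in> U0 \<and> dist (\<psi> y) (\<psi> x) < \<kappa> / 2"
      using compact_uniform_nbhd[OF compact_cball U0(1) c1 continuous_on_subset[OF \<psi> U0(3)], of "\<kappa>/2"] \<kappa> by (metis half_gt_zero)
    obtain d2 where d2: "d2 > 0" "\<And>x y. x \<in> cball z0 \<rho> \<Longrightarrow> dist x y \<le> d2 \<Longrightarrow> y \<in> U0 \<and> dist (q y) (q x) < \<gamma> * \<rho>\<^sup>2 / 4"
      using compact_uniform_nbhd[OF compact_cball U0(1) c1 qc mu] by blast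
    let ?K = "cball z0 (3 * \<rho>)"
    have K\<Omega>: "?K \<subseteq> \<Omega>" using \<rho>(2) U0(3) by blast
    note li = visc_locally_integrable[OF \<Gamma> f \<Omega> visc0 compact_cball K\<Omega>]
    have claim: "conv_ereal \<Omega> u (rescaled \<eta> \<epsilon>) x \<le> p x - \<nu>"
      if \<epsilon>: "0 < \<epsilon>" "\<epsilon> < d1" "\<epsilon> < d2" "\<epsilon> < \<rho>" and x: "x \<in> cball z0 \<rho>" for \<epsilon> x
    proof -
      let ?h = "rescaled \<eta> \<epsilon>"
      note h = mollifier_kernel[OF \<eta> \<epsilon>(1)]
      define v where "v = conv_ereal \<Omega> u ?h"
      have sub: "cball x (\<epsilon> + \<rho>) \<subseteq> ?K" if "x \<in> cball z0 \<rho>" for x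
      proof
        fix y assume "y \<in> cball x (\<epsilon> + \<rho>)"
        then show "y \<in> ?K" using that \<epsilon>(4) dist_triangle[of z0 y x] by auto
      qed
      have v_convolve: "v y = convolve (\<lambda>y. indicator ?K y * real_of_ereal (u y)) ?h y" if y: "y \<in> cball z0 \<rho>" for y
        unfolding v_def conv_ereal_def
      proof (rule conv_eq_convolve[OF _ K\<Omega>])
        fix w assume "?h (y - w) \<noteq> 0"
        then have "dist y w \<le> \<epsilon>" using smooth_kernelD(3)[OF h(1)] by (simp add: dist_norm)
        then have "w \<in> cball y (\<epsilon> + \<rho>)" using \<rho>(1) by simp
        then show "w \<in> ?K" using sub[OF y] by blast
      qed
      have uKi: "integrable lborel (\<lambda>y. indicator ?K y * real_of_ereal (u y))" using li(1) by (simp add: set_integrable_def)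
      have ccu: "convolvable (\<lambda>y. indicator ?K y * real_of_ereal (u y)) ?h"
        using uKi smooth_kernelD(5)[OF h(1)] by (simp add: convolvable_def)
      have vq: "v y \<le> q y + \<gamma> * \<rho>\<^sup>2 / 4" if y: "y \<in> cball z0 \<rho>" for y
      proof -
        have "v y \<le> (q y + \<gamma> * \<rho>\<^sup>2 / 4) * (\<integral>x. ?h x \<partial>lborel)"
          unfolding v_convolve[OF y]
        proof (rule convolve_le_const[OF convolve_integrand_integrable[OF ccu smooth_kernelD(4)[OF h(1)]] smooth_kernel_integrable[OF h(1)] smooth_kernelD(2)[OF h(1)]])
          show "AE w in lborel. ?h (y - w) \<noteq> 0 \<longrightarrow> indicator ?K w * real_of_ereal (u w) \<le> q y + \<gamma> * \<rho>\<^sup>2 / 4"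
            using li(2)
          proof eventually_elim
            fix w assume w: "w \<in> ?K \<longrightarrow> u w \<noteq> -\<infinity>"
            show "?h (y - w) \<noteq> 0 \<longrightarrow> indicator ?K w * real_of_ereal (u w) \<le> q y + \<gamma> * \<rho>\<^sup>2 / 4"
            proof
              assume "?h (y - w) \<noteq> 0"
              then have dw: "dist y w \<le> \<epsilon>" using smooth_kernelD(3)[OF h(1)] by (simp add: dist_norm)
              then have "w \<in> cball y (\<epsilon> + \<rho>)" using \<rho>(1) by simp
              then have wK: "w \<in> ?K" using sub[OF y] by blast
              have wU: "w \<in> U0" "q w \<le> q y + \<gamma> * \<rho>\<^sup>2 / 4" using d2(2)[OF y, of w] dw \<epsilon>(3) unfolding dist_real_def by linarith+
              obtain s where "u w = ereal s" using w wK us(2)[of w] K\<Omega> by (cases "u w") auto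
              then show "indicator ?K w * real_of_ereal (u w) \<le> q y + \<gamma> * \<rho>\<^sup>2 / 4"
                using U0(6)[OF wU(1)] wU(2) wK by simp
            qed
          qed
        qed
        then show ?thesis using h(2) by simp
      qed
      have vC2: "Ck_on 2 v (ball z0 \<rho>)"
        unfolding v_def conv_ereal_def
      proof (rule conv_smooth[OF h(1) open_ball])
        show "\<exists>d>0. cball z (\<epsilon> + d) \<subseteq> \<Omega>" if "z \<in> ball z0 \<rho>" for z
          using sub[of z] that K\<Omega> \<rho>(1) by (intro exI[of _ \<rho>]) auto
        show "set_integrable lborel K' (\<lambda>w. real_of_ereal (u w))" if "compact K'" "K' \<subseteq> \<Omega>" for K'
          using visc_locally_integrable(1)[OF \<Gamma> f \<Omega> visc0 that] .
      qed
      have vcont: "continuous_on (cball z0 \<rho>) v"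
      proof -
        have "continuous_on UNIV (convolve (\<lambda>y. indicator ?K y * real_of_ereal (u y)) ?h)"
          by (rule convolve_continuous[OF ccu smooth_kernelD(4)[OF h(1)]])
        then have "continuous_on (cball z0 \<rho>) (convolve (\<lambda>y. indicator ?K y * real_of_ereal (u y)) ?h)"
          by (rule continuous_on_subset) simp
        then show ?thesis by (rule continuous_on_eq) (simp add: v_convolve)
      qed
      have pcont: "continuous_on (cball z0 \<rho>) p" by (rule continuous_on_subset[OF Ck_on_continuous[OF pC2] c1])
      have "cball z0 \<rho> \<noteq> {}" using \<rho>(1) by simp
      from continuous_attains_sup[OF compact_cball this continuous_on_diff[OF vcont pcont]]
      obtain m where m: "m \<in> cball z0 \<rho>" "\<And>y. y \<in> cball z0 \<rho> \<Longrightarrow> v y - p y \<le> v m - p m" by blast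
      \<comment> \<open>a maximum inside the ball would give \<open>L v \<le> L p\<close> there, while \<open>L v \<ge> \<psi> * \<chi>\<^sub>\<epsilon> - b > L p\<close>\<close>
      have "v m - p m \<le> - \<nu>"
      proof (cases "dist z0 m = \<rho>")
        case True
        have "p m = q m + \<gamma> * \<rho>\<^sup>2" using True by (simp add: p_def dist_norm norm_minus_commute)
        then show ?thesis using vq[OF m(1)] by (simp add: \<nu>_def)
      next
        case False
        then have mb: "m \<in> ball z0 \<rho>" using m(1) by simp
        have mU: "m \<in> U0" using c1 m(1) by blast
        have pC2b: "Ck_on 2 p (ball z0 \<rho>)" by (rule Ck_on_subset[OF pC2]) (use c1 in auto)
        have npC2: "Ck_on 2 (\<lambda>y. (-1) * p y) (ball z0 \<rho>)"
          by (rule Ck_on_bounded_linear[OF bounded_linear_mult_right open_ball pC2b])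
        have dC2: "Ck_on 2 (\<lambda>y. v y + (-1) * p y) (ball z0 \<rho>)" by (rule Ck_on_add[OF open_ball vC2 npC2])
        have "second_deriv v m c c - second_deriv p m c c \<le> 0" for c
        proof -
          have "second_deriv (\<lambda>y. v y + (-1) * p y) m c c \<le> 0"
            by (rule second_deriv_local_max[OF dC2 open_ball mb]) (use m(2) in auto)
          moreover have "second_deriv (\<lambda>y. v y + (-1) * p y) m c c = second_deriv v m c c + second_deriv (\<lambda>y. (-1) * p y) m c c"
            by (rule second_deriv_add[OF vC2 npC2 open_ball mb])
          moreover have "second_deriv (\<lambda>y. (-1) * p y) m c c = (-1) * second_deriv p m c c"
            by (rule second_deriv_scale[OF pC2b open_ball mb])
          ultimately show ?thesis by simp
        qed
        then have "elliptic v m \<le> elliptic p m"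
          unfolding elliptic_def using a_pos by (intro sum_mono mult_left_mono) (auto simp: less_imp_le)
        moreover have "conv \<Omega> \<psi> ?h m \<le> elliptic v m + b"
        proof -
          have "cball m (2 * \<epsilon>) \<subseteq> \<Omega>"
          proof -
            have "cball m (2 * \<epsilon>) \<subseteq> cball m (\<epsilon> + \<rho>)" using \<epsilon>(4) by (intro subset_cball) simp
            then show ?thesis using sub[OF m(1)] K\<Omega> by blast
          qed
          then have "m \<in> inner_domain \<Omega> \<epsilon>" by (rule in_inner_domain[OF \<Omega>(1) bdd _ \<epsilon>(1)])
          from cl[OF \<epsilon>(1) this] have "ereal (conv \<Omega> \<psi> ?h m) \<le> F_op \<Gamma> f (cHess v m)" by (simp add: v_def)
          then have "conv \<Omega> \<psi> ?h m \<le> frame_trace a \<xi> (cHess v m) + b"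
            using F_op_ge_iff[OF \<Gamma> f cHess_hermitian[OF vC2 open_ball mb]] ab \<xi> by blast
          then show ?thesis using L[OF vC2 open_ball mb] by simp
        qed
        moreover have "\<psi> m - \<kappa> / 2 \<le> conv \<Omega> \<psi> ?h m"
        proof -
          have \<psi>i: "integrable lborel (\<lambda>y. indicator ?K y * \<psi> y)"
            using borel_integrable_compact[OF compact_cball continuous_on_subset[OF \<psi> K\<Omega>]] by simp
          have cc: "convolvable (\<lambda>y. indicator ?K y * \<psi> y) ?h"
            using \<psi>i smooth_kernelD(5)[OF h(1)] by (simp add: convolvable_def)
          have hd: "w \<in> ?K \<and> dist m w \<le> d1" if "?h (m - w) \<noteq> 0" for w
          proof -
            have dw: "dist m w \<le> \<epsilon>" using smooth_kernelD(3)[OF h(1) that] by (simp add: dist_norm)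
            then have "w \<in> cball m (\<epsilon> + \<rho>)" using \<rho>(1) by simp
            then show ?thesis using sub[OF m(1)] dw \<epsilon>(2) by auto
          qed
          have "(\<psi> m - \<kappa> / 2) * (\<integral>x. ?h x \<partial>lborel) \<le> convolve (\<lambda>y. indicator ?K y * \<psi> y) ?h m"
          proof (rule convolve_ge_const[OF convolve_integrand_integrable[OF cc smooth_kernelD(4)[OF h(1)]] smooth_kernel_integrable[OF h(1)] smooth_kernelD(2)[OF h(1)]])
            show "AE w in lborel. ?h (m - w) \<noteq> 0 \<longrightarrow> \<psi> m - \<kappa> / 2 \<le> indicator ?K w * \<psi> w"
            proof (intro AE_I2 impI)
              fix w assume "?h (m - w) \<noteq> 0"
              note w = hd[OF this]
              then have "\<bar>\<psi> w - \<psi> m\<bar> < \<kappa> / 2" using d1(2)[OF m(1), of w] by (simp add: dist_real_def)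
              then have "\<psi> m - \<kappa> / 2 \<le> \<psi> w" unfolding abs_less_iff by linarith
              then show "\<psi> m - \<kappa> / 2 \<le> indicator ?K w * \<psi> w" using w by simp
            qed
          qed
          also have "convolve (\<lambda>y. indicator ?K y * \<psi> y) ?h m = conv \<Omega> \<psi> ?h m"
            by (rule conv_eq_convolve[OF _ K\<Omega>, symmetric]) (use hd in blast)
          finally show ?thesis using h(2) by simp
        qed
        ultimately show ?thesis using Lpb[OF m(1)] \<kappa> by linarith
      qed
      then show ?thesis using m(2)[OF x] by (simp add: v_def)
    qed
    \<comment> \<open>The submean inequality bounds \<open>u z0\<close> by the Gaussian average \<open>V z0\<close>. Mollifying \<open>V\<close> amounts to averaging
      \<open>u\<^sub>\<epsilon> \<le> p - \<nu>\<close>; the errors \<open>\<nu> / 8\<close>, \<open>\<nu> / 4\<close>, \<open>\<nu> / 4\<close> and \<open>\<nu> / 4\<close> leave part of the gap \<open>\<nu>\<close>.\<close>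
    obtain R0 where R0: "R0 > 0" "\<And>w. dist z0 w \<le> R0 \<Longrightarrow> w \<in> U0 \<and> dist (p w) (p z0) < \<nu> / 4"
      using compact_uniform_nbhd[OF compact_sing[of z0] U0(1) _ Ck_on_continuous[OF pC2], of "\<nu>/4"] U0(2) \<nu>
      by (metis divide_pos_pos empty_subsetI insert_subset singletonI zero_less_numeral)
    define R where "R = min R0 \<rho>"
    have R: "R > 0" "R \<le> R0" "R \<le> \<rho>" using R0(1) \<rho>(1) by (auto simp: R_def)
    note rp = inner_radius_props[OF R(1)]
    obtain M where M: "\<And>z. z \<in> ?K \<Longrightarrow> u z \<le> ereal M"
      using usc_bounded_above_compact[OF us(1,2) compact_cball K\<Omega>] by blast
    define M0 where "M0 = M + 1"
    \<comment> \<open>an upper bound for \<open>u\<^sub>\<epsilon> - M0\<close> on the ball of radius \<open>R\<close>\<close>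
    define A where "A = p z0 - \<nu> + \<nu> / 4 - M0"
    have Ap: "\<bar>A\<bar> + 1 > 0" by simp
    have e4: "\<nu> / 4 / (\<bar>A\<bar> + 1) > 0" using \<nu> by simp
    obtain t0 where t0: "t0 > 0" "\<And>t. 0 < t \<Longrightarrow> t < t0 \<Longrightarrow> (\<integral>x. heat_trunc (inner_level R) t x \<partial>lborel) \<ge> 1 - \<nu> / 4 / (\<bar>A\<bar> + 1)"
      using heat_trunc_mass[OF rp(5) e4] by blast
    define t where "t = min (t0 / 2) (min (outer_level R / (2 * DIM(complex^'n))) (min 1 (\<nu> / 8) / (b + 1)))"
    have t: "t > 0" "t < t0" "t \<le> outer_level R / (2 * DIM(complex^'n))" "t \<le> min 1 (\<nu> / 8) / (b + 1)"
    proof -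
      have p: "outer_level R / (2 * DIM(complex^'n)) > 0" using rp(6) by simp
      have p2: "min 1 (\<nu> / 8) / (b + 1) > 0" using \<nu> b by simp
      show "t > 0" unfolding t_def using p p2 t0 by (simp only: min_less_iff_conj) simp
      show "t < t0" "t \<le> outer_level R / (2 * DIM(complex^'n))" "t \<le> min 1 (\<nu> / 8) / (b + 1)" using t0 unfolding t_def by linarith+
    qed
    have T1: "2 * real DIM(complex^'n) * t \<le> outer_level R" using t(3) by (subst (asm) pos_le_divide_eq) (auto simp: mult.commute)
    have bt: "b * t \<le> 1" "b * t \<le> \<nu> / 8"
    proof -
      have "t * (b + 1) \<le> min 1 (\<nu> / 8)" using t(4) b by (subst (asm) pos_le_divide_eq) auto
      then show "b * t \<le> 1" "b * t \<le> \<nu> / 8" using t(1) by (auto simp: algebra_simps)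
    qed
    let ?kt = "heat_trunc (inner_level R) t"
    define U' where "U' y = indicator ?K y * real_of_ereal (u y - ereal M0)" for y
    have U'i: "integrable lborel U'" unfolding U'_def by (rule shifted_integrable(2)[OF us(1,2) compact_cball K\<Omega> li])
    note kts = heat_trunc_inner_support[OF t(1) R(1)]
    note ktb = heat_trunc_inner_bounded_support[OF t(1) R(1)]
    have kti: "integrable lborel ?kt" by (rule heat_trunc_integrable[OF t(1)])
    note kk = heat_trunc_bounded[OF t(1), of "inner_level R"]
    define V where "V = convolve U' ?kt"
    have ccV: "convolvable U' ?kt" using U'i ktb by (simp add: convolvable_def)
    have Vc: "continuous_on UNIV V" unfolding V_def by (rule convolve_continuous[OF ccV heat_trunc_continuous])
    have lower: "q z0 - M0 \<le> V z0 + \<nu> / 8"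
    proof -
      have RK: "cball z0 R \<subseteq> ?K" using R(3) \<rho>(1) by (intro subset_cball) simp
      have "u z0 - ereal (M + 1) \<le> ereal (convolve U' ?kt z0 - (0 - b) * t)"
      proof (rule submean_domain[OF us(1) vs R(1)])
        show "cball z0 R \<subseteq> \<Omega>" using RK K\<Omega> by blast
        show "u z \<le> ereal M" if "z \<in> cball z0 R" for z using M RK that by blast
        show "\<bar>0 - b\<bar> * t \<le> 1" using bt(1) b by simp
        show "U' y = real_of_ereal (u y - ereal (M + 1))" if "y \<in> ball z0 (inner_radius R)" for y
        proof -
          have "y \<in> cball z0 R" using that rp(2) by auto
          then show ?thesis using RK by (auto simp: U'_def M0_def)
        qed
      qed (use T1 t(1) U'i in auto)
      then have "q z0 - (M + 1) \<le> V z0 + b * t" by (simp add: U0(5) V_def)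
      then show ?thesis using bt(2) unfolding M0_def by linarith
    qed
    have n4: "\<nu> / 4 > 0" using \<nu> by simp
    obtain d3 where d3: "d3 > 0" "\<And>y. dist z0 y \<le> d3 \<Longrightarrow> y \<in> UNIV \<and> dist (V y) (V z0) < \<nu> / 4"
      using compact_uniform_nbhd[OF compact_sing[of z0] open_UNIV subset_UNIV Vc n4] by (metis singletonI)
    define \<epsilon> where "\<epsilon> = min (min d1 d2) (min \<rho> d3) / 2"
    have \<epsilon>: "0 < \<epsilon>" "\<epsilon> < d1" "\<epsilon> < d2" "\<epsilon> < \<rho>" "\<epsilon> < d3"
      using d1(1) d2(1) d3(1) \<rho>(1) by (auto simp: \<epsilon>_def)
    let ?h = "rescaled \<eta> \<epsilon>"
    note h = mollifier_kernel[OF \<eta> \<epsilon>(1)]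
    have hi: "integrable lborel ?h" by (rule smooth_kernel_integrable[OF h(1)])
    obtain Ch where Ch: "\<And>x. \<bar>?h x\<bar> \<le> Ch"
      using continuous_compact_support_bounded[OF smooth_kernelD(4,5)[OF h(1)]] by metis
    have "\<bar>convolve V ?h z0 - V z0\<bar> \<le> \<nu> / 4"
    proof (rule convolve_continuous_close[OF Vc h])
      show "\<bar>V y - V z0\<bar> \<le> \<nu> / 4" if "dist z0 y \<le> \<epsilon>" for y
        using d3(2)[of y] that \<epsilon>(5) by (simp add: dist_real_def)
    qed
    moreover have "convolve V ?h z0 \<le> A + \<nu> / 4"
    proof -
      have "convolve V ?h z0 = convolve U' (convolve ?kt ?h) z0"
        unfolding V_def by (rule convolve_assoc[OF U'i hi heat_trunc_continuous kk])
      also have "convolve ?kt ?h = convolve ?h ?kt"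
        using convolve_commute[of ?kt ?h] kti hi by auto
      also have "convolve U' (convolve ?h ?kt) z0 = convolve (convolve U' ?h) ?kt z0"
        by (rule convolve_assoc[OF U'i kti smooth_kernelD(4)[OF h(1)] Ch, symmetric])
      also have "\<dots> \<le> A * (\<integral>x. ?kt x \<partial>lborel)"
      proof (rule convolve_le_const[OF _ kti heat_trunc_nonneg])
        have "convolvable U' ?h" using U'i smooth_kernelD(5)[OF h(1)] by (simp add: convolvable_def)
        then have cUh: "continuous_on UNIV (convolve U' ?h)" by (rule convolve_continuous[OF _ smooth_kernelD(4)[OF h(1)]])
        show "integrable lborel (\<lambda>y. convolve U' ?h y * ?kt (z0 - y))"
        proof (rule continuous_compact_support_integrable)
          show "continuous_on UNIV (\<lambda>y. convolve U' ?h y * ?kt (z0 - y))"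
            by (intro continuous_on_mult cUh continuous_on_compose2[OF heat_trunc_continuous] continuous_intros) auto
          have "y \<in> ball z0 (inner_radius R)" if "convolve U' ?h y * ?kt (z0 - y) \<noteq> 0" for y
            using kts[of "z0 - y"] that by (auto simp: dist_norm)
          then show "bounded {y. convolve U' ?h y * ?kt (z0 - y) \<noteq> 0}" by (intro bounded_subset[OF bounded_ball]) blast
        qed
        show "AE y in lborel. ?kt (z0 - y) \<noteq> 0 \<longrightarrow> convolve U' ?h y \<le> A"
        proof (intro AE_I2 impI)
          fix y assume "?kt (z0 - y) \<noteq> 0"
          then have dy: "dist z0 y < R" using kts[of "z0 - y"] rp(2) by (simp add: dist_norm)
          then have yr: "y \<in> cball z0 \<rho>" using R(3) by simp
          have "cball z0 (\<epsilon> + 2 * \<rho>) \<subseteq> ?K" using \<epsilon>(4) by (intro subset_cball) simp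
          then have "convolve U' ?h y = conv_ereal \<Omega> u ?h y - M0 * (\<integral>x. ?h x \<partial>lborel)"
            unfolding U'_def by (rule convolve_shifted_eq_conv[OF h(1) compact_cball K\<Omega>]) (use yr \<rho>(1) in auto)
          also have "\<dots> \<le> p y - \<nu> - M0" using claim[OF \<epsilon>(1-4) yr] h(2) by simp
          also have "\<dots> \<le> A"
          proof -
            have "\<bar>p y - p z0\<bar> < \<nu> / 4" using R0(2)[of y] dy R(2) by (simp add: dist_real_def)
            then show ?thesis unfolding A_def abs_less_iff by linarith
          qed
          finally show "convolve U' ?h y \<le> A" .
        qed
      qed
      also have "\<dots> \<le> A + \<nu> / 4"
      proof -
        let ?m = "\<integral>x. ?kt x \<partial>lborel"
        have m1: "1 - ?m \<le> \<nu> / 4 / (\<bar>A\<bar> + 1)" "0 \<le> 1 - ?m"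
          using t0(2)[OF t(1,2)] heat_trunc_integral_le_1[OF t(1), of "inner_level R"] by auto
        have "(- A) * (1 - ?m) \<le> (\<bar>A\<bar> + 1) * (\<nu> / 4 / (\<bar>A\<bar> + 1))"
          by (rule mult_mono[OF _ m1(1)]) (use m1(2) in auto)
        also have "\<dots> = \<nu> / 4" using Ap by (intro nonzero_mult_div_cancel_left[of "\<bar>A\<bar> + 1", unfolded times_divide_eq_right[symmetric]]) simp
        finally show ?thesis by (simp add: algebra_simps)
      qed
      finally show ?thesis .
    qed
    moreover have "p z0 = q z0" by (simp add: p_def)
    ultimately show False using lower \<nu> unfolding A_def by linarith
  qed
  then show "ereal (\<psi> z0) \<le> F_op \<Gamma> f (cHess q z0)"
    using F_op_ge_iff[OF \<Gamma> f cHess_hermitian[OF U0(4,1,2)]] by blast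
qed

end

lemma viscosity_subsolution_mono:
  assumes "viscosity_subsolution \<Gamma> f \<Omega> \<psi> u" "\<And>z. z \<in> \<Omega> \<Longrightarrow> \<phi> z \<le> \<psi> z"
  shows "viscosity_subsolution \<Gamma> f \<Omega> \<phi> u"
  using assms unfolding viscosity_subsolution_def by (meson ereal_less_eq(3) order_trans)

theorem theorem1p1:
  fixes \<Omega> :: "(complex ^ 'n::finite) set"
    and \<Gamma> :: "(real ^ 'n) set"
    and f :: "real ^ 'n \<Rightarrow> real"
    and \<psi> \<eta> :: "complex ^ 'n \<Rightarrow> real"
    and u :: "complex ^ 'n \<Rightarrow> ereal"
  assumes "admissible_cone \<Gamma>"
    and "admissible_fun \<Gamma> f"
    and "mollifier \<eta>"
    and "open \<Omega>" and "connected \<Omega>" and "\<Omega> \<noteq> {}" and "bounded \<Omega>"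
    and "continuous_on (closure \<Omega>) \<psi>"
    and "\<forall>z\<in>closure \<Omega>. \<psi> z \<ge> 0"
    and "u \<in> USC \<Omega>"
  shows "viscosity_subsolution \<Gamma> f \<Omega> \<psi> u \<longleftrightarrow>
           Gamma_subharmonic \<Gamma> f \<Omega> u \<and>
           (\<forall>\<epsilon>>0. classical_subsolution \<Gamma> f (inner_domain \<Omega> \<epsilon>)
                    (conv \<Omega> \<psi> (rescaled \<eta> \<epsilon>)) (conv_ereal \<Omega> u (rescaled \<eta> \<epsilon>)))"
proof
  note \<Gamma> = assms(1) and f = assms(2) and \<eta> = assms(3) and \<Omega> = assms(4,5)
  have \<psi>: "continuous_on \<Omega> \<psi>" using assms(8) closure_subset continuous_on_subset by blast
  assume visc: "viscosity_subsolution \<Gamma> f \<Omega> \<psi> u"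
  have visc0: "viscosity_subsolution \<Gamma> f \<Omega> (\<lambda>_. 0) u"
    by (rule viscosity_subsolution_mono[OF visc]) (use assms(9) closure_subset in blast)
  have "Gamma_subharmonic \<Gamma> f \<Omega> u"
    unfolding Gamma_subharmonic_def
    using assms(10) visc0 visc_Gamma_approximable[OF \<Gamma> f \<Omega> visc0 \<eta>] by blast
  moreover have "classical_subsolution \<Gamma> f (inner_domain \<Omega> \<epsilon>)
      (conv \<Omega> \<psi> (rescaled \<eta> \<epsilon>)) (conv_ereal \<Omega> u (rescaled \<eta> \<epsilon>))" if \<epsilon>: "\<epsilon> > 0" for \<epsilon>
    unfolding classical_subsolution_def
  proof (intro conjI ballI)
    note h = mollifier_kernel[OF \<eta> \<epsilon>]
    show "Ck_on 2 (conv_ereal \<Omega> u (rescaled \<eta> \<epsilon>)) (inner_domain \<Omega> \<epsilon>)"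
      unfolding conv_ereal_def
    proof (rule conv_smooth[OF h(1) open_inner_domain[OF \<Omega>(1)]])
      show "\<exists>d>0. cball z (\<epsilon> + d) \<subseteq> \<Omega>" if "z \<in> inner_domain \<Omega> \<epsilon>" for z
        using inner_domain_cball[OF \<Omega>(1) that \<epsilon>] by blast
      show "set_integrable lborel K (\<lambda>w. real_of_ereal (u w))" if "compact K" "K \<subseteq> \<Omega>" for K
        by (rule visc_locally_integrable(1)[OF \<Gamma> f \<Omega> visc0 that])
    qed
    fix z assume "z \<in> inner_domain \<Omega> \<epsilon>"
    then obtain d where d: "d > 0" "cball z (\<epsilon> + d) \<subseteq> \<Omega>" using inner_domain_cball[OF \<Omega>(1) _ \<epsilon>] by blast
    show "ereal (conv \<Omega> \<psi> (rescaled \<eta> \<epsilon>) z) \<le> F_op \<Gamma> f (cHess (conv_ereal \<Omega> u (rescaled \<eta> \<epsilon>)) z)"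
      by (rule mollified_F_op_ge[OF \<Gamma> f \<Omega> visc0 visc \<psi> h(1) _ _ d]) (use h(2) \<epsilon> in auto)
  qed
  ultimately show "Gamma_subharmonic \<Gamma> f \<Omega> u \<and>
      (\<forall>\<epsilon>>0. classical_subsolution \<Gamma> f (inner_domain \<Omega> \<epsilon>)
        (conv \<Omega> \<psi> (rescaled \<eta> \<epsilon>)) (conv_ereal \<Omega> u (rescaled \<eta> \<epsilon>)))" by blast
next
  have \<psi>: "continuous_on \<Omega> \<psi>" using assms(8) closure_subset continuous_on_subset by blast
  assume R: "Gamma_subharmonic \<Gamma> f \<Omega> u \<and>
      (\<forall>\<epsilon>>0. classical_subsolution \<Gamma> f (inner_domain \<Omega> \<epsilon>)
        (conv \<Omega> \<psi> (rescaled \<eta> \<epsilon>)) (conv_ereal \<Omega> u (rescaled \<eta> \<epsilon>)))"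
  then have visc0: "viscosity_subsolution \<Gamma> f \<Omega> (\<lambda>_. 0) u" by (simp add: Gamma_subharmonic_def)
  show "viscosity_subsolution \<Gamma> f \<Omega> \<psi> u"
    by (rule mollified_subsolution_imp_viscosity[OF assms(1,2,4,5) visc0 assms(3,7) \<psi>])
      (use R in \<open>auto simp: classical_subsolution_def\<close>)
qed

end
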